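(* For the Walk on Spheres process (WoS) on a bounded domain $\Omega\subset\mathbb{R}^d$, started at any $x\in\Omega$ and run until termination at distance $<\varepsilon$ to $\partial\Omega$, the following bounds hold for the expected number of steps. 1. Since any planar domain is $2$-thick, the WoS on it converges in $O(\log^2 1/\varepsilon)$ steps. 2. Since any planar domain with connected exterior is $1$-thick, the WoS on it converges in $O(\log 1/\varepsilon)$ steps. 3. Since any domain in $\mathbb{R}^d$ is $d$-thick, for $d\ge 3$ the WoS on it converges in $O\big((1/\varepsilon)^{2-4/d}\big)$ steps. 4. Since any $3$-dimensional domain with connected exterior is $2$-thick, the WoS on it converges in $O(\log^2 1/\varepsilon)$ steps. 5. Since for any $d\ge 4$ any $d$-dimensional domain with connected exterior is $(d-1)$-thick, the WoS on it converges in $O\big((1/\varepsilon)^{2-4/(d-1)}\big)$ steps. 6. Since any domain bounded by a smooth hypersurface is $0$-thick, the WoS on it converges in $O(\log 1/\varepsilon)$ steps.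
   Context: Hausdorff content: for $s\ge 0$ and $K\subset\mathbb{R}^d$, $H^{s}(K)=\inf\sum_j r_j^{s}$, where the infimum is over all covers $K\subset\bigcup_j B(x_j,r_j)$ by balls. $\alpha$-thickness: a domain $\Omega\subset\mathbb{R}^d$ is $\alpha$-thick, $0\le\alpha\le d$, if there exists a constant $C>0$ (the thickness of $\Omega$) such that for every $x\in\partial\Omega$ and every $r<1$, $H^{d-\alpha}(B(x,r)\setminus\Omega)\ge C r^{d-\alpha}$. "Connected exterior" means that the complement $\mathbb{R}^d\setminus\Omega$ is connected. Walk on Spheres (WoS): let $d(y)=\operatorname{dist}(y,\partial\Omega)$ and fix $0<\beta<1$. Let $\gamma_0,\gamma_1,\dots$ be i.i.d. random vectors uniformly distributed on the unit sphere of $\mathbb{R}^d$. Starting from $X_0=x\in\Omega$, at each step $t$ one computes a multiplicative estimate $r_t$ of $d(X_t)$ with $\beta\, d(X_t)<r_t<d(X_t)$, and sets $X_{t+1}=X_t+(r_t/2)\gamma_t$. The process stops once it is within distance $\varepsilon$ of $\partial\Omega$, and the number of steps is the time $t$ at which it stops. The $O(\cdot)$ depends on the dimension $d$, on the indicated thickness exponent $\alpha$, on the thickness constant $C$ of $\Omega$ for that exponent, and on $\beta$; it does not depend directly on $\Omega$.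
   Formalization: The O-constant may also depend on an upper bound for the diameter of Ω (without this the claim fails: from the centre of a ball of radius N at least about log2(N/ε) steps are needed); formally it is chosen after the sample space's type, which is harmless by passing to the canonical space. *)

theory Defs
  imports "HOL-Probability.Probability"
begin

section \<open>Hausdorff content and thickness\<close>

text \<open>Covers are indexed by arbitrary sets of natural numbers, so finite covers are allowed.
  All radii are positive; in particular a ball contributes \<open>1\<close> when \<open>s = 0\<close>
  (whereas \<open>0 powr 0 = 0\<close>).\<close>

definition hausdorff_content :: "real \<Rightarrow> (real^'n::finite) set \<Rightarrow> ennreal" where
  "hausdorff_content s K =
     Inf {\<Sum>\<^sub>\<infinity>j\<in>J. ennreal (r j powr s) | (J :: nat set) (c :: nat \<Rightarrow> real^'n) r.
            (\<forall>j\<in>J. 0 < r j) \<and> K \<subseteq> (\<Union>j\<in>J. ball (c j) (r j))}"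

definition thick_with :: "real \<Rightarrow> real \<Rightarrow> (real^'n::finite) set \<Rightarrow> bool" where
  "thick_with \<alpha> C \<Omega> \<longleftrightarrow>
     0 \<le> \<alpha> \<and> \<alpha> \<le> real CARD('n) \<and> 0 < C \<and>
     (\<forall>x\<in>frontier \<Omega>. \<forall>r. 0 < r \<and> r < 1 \<longrightarrow>
        ennreal (C * r powr (real CARD('n) - \<alpha>))
          \<le> hausdorff_content (real CARD('n) - \<alpha>) (ball x r - \<Omega>))"

definition thick :: "real \<Rightarrow> (real^'n::finite) set \<Rightarrow> bool" where
  "thick \<alpha> \<Omega> \<longleftrightarrow> (\<exists>C. thick_with \<alpha> C \<Omega>)"

section \<open>Domains\<close>

definition bounded_domain :: "(real^'n::finite) set \<Rightarrow> bool" where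
  "bounded_domain \<Omega> \<longleftrightarrow> open \<Omega> \<and> connected \<Omega> \<and> \<Omega> \<noteq> {} \<and> bounded \<Omega>"

text \<open>\<open>Ck_on k f U\<close> is intended for open \<open>U\<close>.\<close>

primrec Ck_on :: "nat \<Rightarrow> (real^'n::finite \<Rightarrow> real) \<Rightarrow> (real^'n) set \<Rightarrow> bool" where
  "Ck_on 0 f U \<longleftrightarrow> continuous_on U f"
| "Ck_on (Suc k) f U \<longleftrightarrow>
     f differentiable_on U \<and>
     (\<forall>i. Ck_on k (\<lambda>x. frechet_derivative f (at x) (axis i 1)) U)"

definition smooth_hypersurface :: "(real^'n::finite) set \<Rightarrow> bool" where
  "smooth_hypersurface S \<longleftrightarrow>
     (\<forall>p\<in>S. \<exists>U \<phi>. open U \<and> p \<in> U \<and> (\<forall>k. Ck_on k \<phi> U) \<and>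
        (\<forall>y\<in>U. frechet_derivative \<phi> (at y) \<noteq> (\<lambda>v. 0)) \<and>
        S \<inter> U = {y \<in> U. \<phi> y = 0})"

section \<open>Walk on Spheres\<close>

text \<open>The uniform distribution on the unit sphere, as the law of the direction of a uniform
  point of the unit ball (\<open>sgn x\<close> is \<open>x /\<^sub>R norm x\<close> for \<open>x \<noteq> 0\<close>).\<close>

definition uniform_sphere :: "(real^'n::finite) measure" where
  "uniform_sphere = distr (uniform_measure lborel (cball 0 1)) borel sgn"

primrec wos_path ::
  "real^'n::finite \<Rightarrow> (nat \<Rightarrow> 'w \<Rightarrow> real) \<Rightarrow> (nat \<Rightarrow> 'w \<Rightarrow> real^'n) \<Rightarrow> nat \<Rightarrow> 'w \<Rightarrow> real^'n"
where
  "wos_path x r \<gamma> 0 \<omega> = x"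
| "wos_path x r \<gamma> (Suc t) \<omega> = wos_path x r \<gamma> t \<omega> + (r t \<omega> / 2) *\<^sub>R \<gamma> t \<omega>"

text \<open>The estimates \<open>r t\<close> may depend on the past and on additional randomness, but not on the
  present or future directions: \<open>F t\<close> is the information available when \<open>r t\<close> is computed.
  They are constrained only as long as the process has not stopped.\<close>

locale walk_on_spheres = prob_space M + filtration "space M" F
  for M :: "'w measure" and F :: "nat \<Rightarrow> 'w measure" +
  fixes \<Omega> :: "(real^'n::finite) set" and \<beta> \<epsilon> :: real and x :: "real^'n"
    and r :: "nat \<Rightarrow> 'w \<Rightarrow> real" and \<gamma> :: "nat \<Rightarrow> 'w \<Rightarrow> real^'n"
  assumes subalgebra_F: "subalgebra M (F t)"
    and start: "x \<in> \<Omega>"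
    and indep_directions: "indep_vars (\<lambda>_. borel) \<gamma> UNIV"
    and distr_direction: "distr M borel (\<gamma> t) = uniform_sphere"
    and measurable_direction: "\<gamma> t \<in> measurable (F (Suc t)) borel"
    and direction_indep_past:
      "indep_set (sets (F t)) {\<gamma> t -` A \<inter> space M | A. A \<in> sets borel}"
    and measurable_estimate: "r t \<in> measurable (F t) borel"
    and estimate:
      "AE \<omega> in M. \<forall>t. (\<forall>s\<le>t. \<epsilon> \<le> infdist (wos_path x r \<gamma> s \<omega>) (frontier \<Omega>)) \<longrightarrow>
         \<beta> * infdist (wos_path x r \<gamma> t \<omega>) (frontier \<Omega>) < r t \<omega> \<and>
         r t \<omega> < infdist (wos_path x r \<gamma> t \<omega>) (frontier \<Omega>)"

text \<open>Equals \<open>\<top>\<close> if the process never stops.\<close>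

definition wos_steps ::
  "(real^'n::finite) set \<Rightarrow> real \<Rightarrow> real^'n \<Rightarrow> (nat \<Rightarrow> 'w \<Rightarrow> real) \<Rightarrow> (nat \<Rightarrow> 'w \<Rightarrow> real^'n) \<Rightarrow>
   'w \<Rightarrow> ennreal"
where
  "wos_steps \<Omega> \<epsilon> x r \<gamma> \<omega> =
     (INF t\<in>{t. infdist (wos_path x r \<gamma> t \<omega>) (frontier \<Omega>) < \<epsilon>}. of_nat t)"

text \<open>\<open>wos_converges_in TYPE('w) P \<alpha> g\<close>: on the bounded \<open>\<alpha>\<close>-thick domains satisfying \<open>P\<close>, the
  expected number of steps is \<open>O(g \<epsilon>)\<close> as \<open>\<epsilon> \<rightarrow> 0\<close>, with a constant depending only on the
  dimension, \<open>\<alpha>\<close>, the thickness constant \<open>C\<close>, \<open>\<beta>\<close>, and a bound \<open>R\<close> on the diameter. The last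
  dependence cannot be avoided: thickness concerns scales below 1 only, and from the centre of
  a ball of radius \<open>R\<close> at least about \<open>log 2 (R / \<epsilon>)\<close> steps are needed. The restriction
  \<open>\<epsilon> \<le> 1/2\<close> keeps \<open>ln (1 / \<epsilon>)\<close> away from \<open>0\<close>. The type \<open>'w\<close> is the sample space.\<close>

definition wos_converges_in ::
  "'w itself \<Rightarrow> ((real^'n::finite) set \<Rightarrow> bool) \<Rightarrow> real \<Rightarrow> (real \<Rightarrow> real) \<Rightarrow> bool"
where
  "wos_converges_in _ P \<alpha> g \<longleftrightarrow>
     (\<forall>C \<beta> R. 0 < C \<and> 0 < \<beta> \<and> \<beta> < 1 \<longrightarrow>
       (\<exists>K>0. \<forall>\<Omega>. bounded_domain \<Omega> \<and> P \<Omega> \<and> thick_with \<alpha> C \<Omega> \<and> diameter \<Omega> \<le> R \<longrightarrow>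
         (\<forall>x\<in>\<Omega>. \<forall>\<epsilon>. 0 < \<epsilon> \<and> \<epsilon> \<le> 1/2 \<longrightarrow>
           (\<forall>(M :: 'w measure) F r \<gamma>. walk_on_spheres M F \<Omega> \<beta> \<epsilon> x r \<gamma> \<longrightarrow>
             (\<integral>\<^sup>+\<omega>. wos_steps \<Omega> \<epsilon> x r \<gamma> \<omega> \<partial>M) \<le> ennreal (K * g \<epsilon>)))))"

end

theory Submission
  imports Defs
begin

text \<open>Let \<open>K\<close> be a decreasing radial kernel for which \<open>K (|x - a|)\<close> is subharmonic in \<open>x\<close> up to a cut-off
  near \<open>a\<close>. The energy of a point \<open>y\<close> is the supremum of the discrete potentials
  \<open>\<Sum>a\<in>I. K (|y - a|)\<close> over the finite \<open>I \<subseteq> - \<Omega>\<close> obeying dyadic Frostman bounds. As a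
  supremum of submeans it is a submean, and it is bounded in terms of \<open>d (y)\<close>. Such sets form a
  matroid, so in a maximizer the points near \<open>X\<^sub>t\<close> can be exchanged for those of a Frostman set around
  a boundary point closest to \<open>X\<^sub>t\<close>; if the complement is thick there, this makes the energy increase
  by a definite amount in each step. The bound on the energy then bounds the expected number of
  steps. Power kernels give the logarithmic rates (the squared one with an exponent
  depending on \<open>\<epsilon>\<close>), a truncated harmonic kernel gives the power rate.

  For smooth boundaries, thickness needs the exterior to be present near every boundary point. The
  defining functions patch to a global sign function of the part of the boundary having \<open>\<Omega>\<close> on both
  sides, and it would have to change its sign inside the connected set \<open>\<Omega>\<close>.\<close>

section \<open>Lebesgue measure and the uniform measure on the sphere\<close>

text \<open>No single measure on the complement serves the whole walk: a definite gain is needed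
  wherever the walk stands, hence charge near every boundary point and at every scale. The supremum
  lets the charge depend on the position, and counting measures turn the comparison of a
  near-optimal charge with a Frostman set into a count of points.

  The exponents come from the Laplacian p (p + 2 - d) |x|^(-p-2) of |x|^(-p). A step of length
  comparable to the distance \<delta> raises the kernel of a point about \<delta> away by order
  \<delta>^(-p), and an s-dimensional set has mass \<delta>^s there, so p = s gives the same gain at
  all scales. The complement supplies s = 0 for general domains, s = 1 for connected exterior, s = d
  for thickness exponent 0. If s > d - 2, then p = s works. If s = d - 2, that kernel is harmonic
  and p has to exceed s slightly. If s < d - 2, the gain is confined to distances below a scale a,
  beyond which only the squared displacement helps, and a is optimized at the end.\<close>

lemma nn_integral_lborel_translate:
  fixes f :: "'a::euclidean_space \<Rightarrow> ennreal"
  assumes [measurable]: "f \<in> borel_measurable borel"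
  shows "(\<integral>\<^sup>+x. f (c + x) \<partial>lborel) = (\<integral>\<^sup>+x. f x \<partial>lborel)"
proof -
  have "(\<integral>\<^sup>+x. f x \<partial>distr lborel borel ((+) c)) = (\<integral>\<^sup>+x. f (c + x) \<partial>lborel)"
    by (rule nn_integral_distr) auto
  then show ?thesis by (simp add: lborel_distr_plus)
qed

lemma emeasure_lborel_unit_cball:
  "emeasure lborel (cball (0::real^'n::finite) 1) \<noteq> 0"
  "emeasure lborel (cball (0::real^'n::finite) 1) \<noteq> \<infinity>"
proof -
  have "measure lebesgue (cball (0::real^'n) 1) > 0"
    by (simp add: content_cball_pos)
  then have "measure lborel (cball (0::real^'n) 1) > 0" by simp
  then show "emeasure lborel (cball (0::real^'n) 1) \<noteq> 0"
    by (metis measure_def enn2real_0 less_irrefl)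
  show "emeasure lborel (cball (0::real^'n::finite) 1) \<noteq> \<infinity>"
    using emeasure_lborel_cball_finite by (simp add: less_top)
qed

text \<open>The library has this only for well-ordered index types. Here it is the uniqueness argument for
  Haar measure: the two translation-invariant measures are compared by Fubini, and both give the
  unit ball the same mass.\<close>

lemma distr_lborel_orthogonal:
  fixes T :: "real^'n::finite \<Rightarrow> real^'n"
  assumes T: "orthogonal_transformation T"
  shows "distr lborel borel T = lborel"
proof -
  have lin: "linear T" using T by (rule orthogonal_transformation_linear)
  have meas [measurable]: "T \<in> borel_measurable borel"
    by (intro borel_measurable_continuous_onI linear_continuous_on linear_linear[THEN iffD2] lin)
  have nT: "norm (T x) = norm x" for x
    using T by (simp add: orthogonal_transformation)
  let ?S = "inv T"
  have invT: "orthogonal_transformation ?S" using T by (rule orthogonal_transformation_inv)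
  have [measurable]: "?S \<in> borel_measurable borel"
    by (intro borel_measurable_continuous_onI linear_continuous_on linear_linear[THEN iffD2]
        orthogonal_transformation_linear invT)
  have TS: "T (?S y) = y" for y
    using orthogonal_transformation_surj[OF T] by (simp add: surj_f_inv_f)
  have Tadd: "T (?S y + x) = y + T x" for x y
    using lin by (simp add: linear_add TS)
  let ?B = "cball (0::real^'n) 1"
  have [measurable]: "?B \<in> sets borel" by simp
  have B0: "emeasure lborel ?B \<noteq> 0" "emeasure lborel ?B \<noteq> \<top>"
    using emeasure_lborel_unit_cball[where 'n = 'n] by simp_all
  have key: "(\<integral>\<^sup>+x. f (T x) \<partial>lborel) = (\<integral>\<^sup>+x. f x \<partial>lborel)"
    if [measurable]: "f \<in> borel_measurable borel" for f :: "real^'n \<Rightarrow> ennreal"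
  proof -
    have "(\<integral>\<^sup>+x. f (T x) \<partial>lborel) * emeasure lborel ?B
      = (\<integral>\<^sup>+y. (\<integral>\<^sup>+x. f (T x) \<partial>lborel) * indicator ?B y \<partial>lborel)"
      by (subst nn_integral_cmult) (auto intro!: borel_measurable_indicator)
    also have "\<dots> = (\<integral>\<^sup>+y. \<integral>\<^sup>+x. f (T x) * indicator ?B y \<partial>lborel \<partial>lborel)"
      by (subst nn_integral_multc) auto
    also have "\<dots> = (\<integral>\<^sup>+y. \<integral>\<^sup>+x. f (y + T x) * indicator ?B y \<partial>lborel \<partial>lborel)"
    proof (rule nn_integral_cong)
      fix y
      show "(\<integral>\<^sup>+x. f (T x) * indicator ?B y \<partial>lborel) = (\<integral>\<^sup>+x. f (y + T x) * indicator ?B y \<partial>lborel)"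
        \<comment> \<open>A shift of \<open>x\<close> by the preimage \<open>?S y\<close> becomes a
          shift of \<open>T x\<close> by \<open>y\<close>.\<close>
        using nn_integral_lborel_translate[of "\<lambda>x. f (T x) * indicator ?B y" "?S y"]
        by (simp add: Tadd)
    qed
    also have "\<dots> = (\<integral>\<^sup>+x. \<integral>\<^sup>+y. f (y + T x) * indicator ?B y \<partial>lborel \<partial>lborel)"
      by (rule lborel_pair.Fubini'[symmetric]) measurable
    also have "\<dots> = (\<integral>\<^sup>+x. \<integral>\<^sup>+y. f y * indicator ?B (y - T x) \<partial>lborel \<partial>lborel)"
    proof (rule nn_integral_cong)
      fix x
      show "(\<integral>\<^sup>+y. f (y + T x) * indicator ?B y \<partial>lborel) = (\<integral>\<^sup>+y. f y * indicator ?B (y - T x) \<partial>lborel)"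
        using nn_integral_lborel_translate[of "\<lambda>y. f (y + T x) * indicator ?B y" "- T x"] by simp
    qed
    also have "\<dots> = (\<integral>\<^sup>+y. \<integral>\<^sup>+x. f y * indicator ?B (y - T x) \<partial>lborel \<partial>lborel)"
      by (rule lborel_pair.Fubini') measurable
    also have "\<dots> = (\<integral>\<^sup>+y. f y * emeasure lborel ?B \<partial>lborel)"
    proof (rule nn_integral_cong)
      fix y
      have "(\<integral>\<^sup>+x. indicator ?B (y - T x) \<partial>lborel) = (\<integral>\<^sup>+x. indicator ?B (- T x) \<partial>lborel)"
        using nn_integral_lborel_translate[of "\<lambda>x. indicator ?B (y - T x)" "?S y"]
        by (simp add: Tadd)
      also have "\<dots> = (\<integral>\<^sup>+x. indicator ?B x \<partial>lborel)"
        by (intro nn_integral_cong) (simp add: indicator_def nT)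
      finally show "(\<integral>\<^sup>+x. f y * indicator ?B (y - T x) \<partial>lborel) = f y * emeasure lborel ?B"
        by (subst nn_integral_cmult) (auto intro!: borel_measurable_indicator)
    qed
    also have "\<dots> = (\<integral>\<^sup>+x. f x \<partial>lborel) * emeasure lborel ?B"
      by (rule nn_integral_multc) auto
    finally show ?thesis using B0
      by (simp add: ennreal_mult_cancel_left mult.commute[of _ "emeasure lborel ?B"])
  qed
  show ?thesis
  proof (rule measure_eqI)
    fix A assume "A \<in> sets (distr lborel borel T)"
    then have [measurable]: "A \<in> sets borel" by simp
    have "emeasure (distr lborel borel T) A = (\<integral>\<^sup>+x. indicator A x \<partial>distr lborel borel T)" by simp
    also have "\<dots> = (\<integral>\<^sup>+x. indicator A (T x) \<partial>lborel)" by (rule nn_integral_distr) auto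
    also have "\<dots> = emeasure lborel A" using key[of "indicator A"] by simp
    finally show "emeasure (distr lborel borel T) A = emeasure lborel A" .
  qed simp
qed

lemma prob_space_uniform_sphere: "prob_space (uniform_sphere :: (real^'n::finite) measure)"
proof -
  interpret P: prob_space "uniform_measure lborel (cball (0::real^'n) 1)"
    using emeasure_lborel_unit_cball by (rule prob_space_uniform_measure)
  show ?thesis unfolding uniform_sphere_def
    by (rule P.prob_space_distr) simp
qed

lemma sets_uniform_sphere [measurable_cong]: "sets uniform_sphere = sets borel"
  by (simp add: uniform_sphere_def)

lemma AE_uniform_sphere_norm: "AE \<gamma> in (uniform_sphere :: (real^'n::finite) measure). norm \<gamma> = 1"
proof -
  have "AE x in lborel. x \<noteq> (0::real^'n)"
    by (rule AE_lborel_singleton)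
  then have "AE x in uniform_measure lborel (cball (0::real^'n) 1). x \<noteq> 0"
    by (intro AE_uniform_measureI) auto
  then have "AE x in uniform_measure lborel (cball (0::real^'n) 1). norm (sgn x) = 1"
    by eventually_elim (simp add: norm_sgn)
  then show ?thesis
    unfolding uniform_sphere_def by (subst AE_distr_iff) auto
qed

text \<open>Both ingredients of \<open>uniform_sphere\<close> are compatible with \<open>T\<close>:
  the uniform law on the ball is invariant, and \<open>sgn\<close> commutes with linear
  isometries.\<close>

lemma distr_uniform_sphere_orthogonal:
  fixes T :: "real^'n::finite \<Rightarrow> real^'n"
  assumes T: "orthogonal_transformation T"
  shows "distr uniform_sphere borel T = uniform_sphere"
proof -
  have lin: "linear T" using T by (rule orthogonal_transformation_linear)
  have meas [measurable]: "T \<in> borel_measurable borel"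
    by (intro borel_measurable_continuous_onI linear_continuous_on linear_linear[THEN iffD2] lin)
  have nT: "norm (T x) = norm x" for x
    using T by (simp add: orthogonal_transformation)
  have sgnT: "T (sgn x) = sgn (T x)" for x
    unfolding sgn_div_norm using lin by (simp add: linear_cmul nT)
  let ?U = "uniform_measure lborel (cball (0::real^'n) 1)"
  have inv: "distr ?U borel T = ?U"
  proof (rule measure_eqI)
    fix A assume "A \<in> sets (distr ?U borel T)"
    then have A [measurable]: "A \<in> sets borel" by simp
    have vim: "T -` A \<in> sets borel" using measurable_sets[OF meas A] by simp
    have "cball (0::real^'n) 1 \<inter> T -` A = T -` (cball 0 1 \<inter> A)" using nT by auto
    then have "emeasure lborel (cball 0 1 \<inter> T -` A) = emeasure (distr lborel borel T) (cball 0 1 \<inter> A)"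
      by (simp add: emeasure_distr)
    then show "emeasure (distr ?U borel T) A = emeasure ?U A"
      using vim by (simp add: emeasure_distr distr_lborel_orthogonal[OF T])
  qed simp
  have "distr uniform_sphere borel T = distr ?U borel (\<lambda>x. T (sgn x))"
    unfolding uniform_sphere_def by (subst distr_distr) (auto simp: comp_def)
  also have "\<dots> = distr (distr ?U borel T) borel sgn"
    by (subst distr_distr) (auto simp: comp_def sgnT)
  finally show ?thesis by (simp add: inv uniform_sphere_def)
qed

lemma integral_uniform_sphere_orthogonal:
  fixes T :: "real^'n::finite \<Rightarrow> real^'n" and f :: "real^'n \<Rightarrow> real"
  assumes T: "orthogonal_transformation T" and f: "f \<in> borel_measurable borel"
  shows "(\<integral>\<gamma>. f (T \<gamma>) \<partial>uniform_sphere) = (\<integral>\<gamma>. f \<gamma> \<partial>uniform_sphere)"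
proof -
  have [measurable]: "T \<in> borel_measurable borel"
    by (intro borel_measurable_continuous_onI linear_continuous_on linear_linear[THEN iffD2]
        orthogonal_transformation_linear T)
  have "(\<integral>\<gamma>. f \<gamma> \<partial>distr uniform_sphere borel T) = (\<integral>\<gamma>. f (T \<gamma>) \<partial>uniform_sphere)"
    using f by (intro integral_distr) (auto simp: sets_uniform_sphere)
  then show ?thesis by (simp add: distr_uniform_sphere_orthogonal[OF T])
qed

section \<open>Differentiation under the integral and Stein's identity on the sphere\<close>

lemma has_real_derivative_integral:
  fixes f :: "real \<Rightarrow> 'a \<Rightarrow> real"
  assumes M: "finite_measure M" and e: "e > 0"
    and meas: "\<And>x. x \<in> ball a e \<Longrightarrow> f x \<in> borel_measurable M"
    and meas': "f' a \<in> borel_measurable M"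
    and int: "integrable M (f a)"
    and der: "AE \<omega> in M. \<forall>x\<in>ball a e. ((\<lambda>x. f x \<omega>) has_real_derivative f' x \<omega>) (at x) \<and> \<bar>f' x \<omega>\<bar> \<le> B"
  shows "((\<lambda>x. \<integral>\<omega>. f x \<omega> \<partial>M) has_real_derivative (\<integral>\<omega>. f' a \<omega> \<partial>M)) (at a)"
proof -
  interpret finite_measure M by fact
  \<comment> \<open>By the mean value theorem the bound on the derivative also dominates the
    difference quotients.\<close>
  have lip: "AE \<omega> in M. \<forall>x\<in>ball a e. \<bar>f x \<omega> - f a \<omega>\<bar> \<le> B * \<bar>x - a\<bar>"
    using der
  proof eventually_elim
    case (elim \<omega>)
    show ?case
    proof
      fix x assume x: "x \<in> ball a e"
      have "norm (f x \<omega> - f a \<omega>) \<le> B * norm (x - a)"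
      proof (rule field_differentiable_bound[where S = "ball a e"])
        show "convex (ball a e)" by (rule convex_ball)
        show "((\<lambda>x. f x \<omega>) has_field_derivative f' z \<omega>) (at z within ball a e)" if "z \<in> ball a e" for z
          using elim that by (auto intro: has_field_derivative_at_within)
        show "norm (f' z \<omega>) \<le> B" if "z \<in> ball a e" for z
          using elim that by auto
      qed (use x e in auto)
      then show "\<bar>f x \<omega> - f a \<omega>\<bar> \<le> B * \<bar>x - a\<bar>" by simp
    qed
  qed
  have intx: "integrable M (f x)" if "x \<in> ball a e" for x
  proof -
    have "integrable M (\<lambda>\<omega>. f x \<omega> - f a \<omega>)"
      by (rule integrable_const_bound[where B = "B * \<bar>x - a\<bar>"])
        (use lip that meas int in \<open>auto elim!: eventually_mono\<close>)
    from Bochner_Integration.integrable_add[OF this int] show ?thesis by simp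
  qed
  have "((\<lambda>x. ((\<integral>\<omega>. f x \<omega> \<partial>M) - (\<integral>\<omega>. f a \<omega> \<partial>M)) / (x - a)) \<longlongrightarrow> (\<integral>\<omega>. f' a \<omega> \<partial>M)) (at a)"
    unfolding tendsto_at_iff_sequentially
  proof (intro allI impI)
    fix X :: "nat \<Rightarrow> real" assume X: "\<forall>i. X i \<in> UNIV - {a}" "X \<longlonglongrightarrow> a"
    have "eventually (\<lambda>i. X i \<in> ball a e) sequentially"
      using X(2) e by (auto dest!: tendstoD[where e = e] simp: dist_commute)
    then obtain N where N: "\<And>i. i \<ge> N \<Longrightarrow> X i \<in> ball a e"
      by (auto simp: eventually_sequentially)
    let ?q = "\<lambda>i \<omega>. (f (X (i + N)) \<omega> - f a \<omega>) / (X (i + N) - a)"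
    have XN: "(\<lambda>i. X (i + N)) \<longlonglongrightarrow> a" using X(2) by (rule LIMSEQ_ignore_initial_segment)
    have lim: "(\<lambda>i. \<integral>\<omega>. ?q i \<omega> \<partial>M) \<longlonglongrightarrow> (\<integral>\<omega>. f' a \<omega> \<partial>M)"
    proof (rule integral_dominated_convergence[where w = "\<lambda>_. B"])
      show "?q i \<in> borel_measurable M" for i
        using meas[OF N[of "i + N"]] int by auto
      show "AE \<omega> in M. (\<lambda>i. ?q i \<omega>) \<longlonglongrightarrow> f' a \<omega>"
        using der
      proof eventually_elim
        case (elim \<omega>)
        then have "((\<lambda>x. (f x \<omega> - f a \<omega>) / (x - a)) \<longlongrightarrow> f' a \<omega>) (at a)"
          using e by (simp add: has_field_derivative_iff)
        from this[unfolded tendsto_at_iff_sequentially, rule_format, of "\<lambda>i. X (i + N)"]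
        show ?case using X XN by (simp add: comp_def)
      qed
      show "AE \<omega> in M. norm (?q i \<omega>) \<le> B" for i
        using lip
      proof eventually_elim
        case (elim \<omega>)
        then have "\<bar>f (X (i + N)) \<omega> - f a \<omega>\<bar> \<le> B * \<bar>X (i + N) - a\<bar>" using N[of "i + N"] by simp
        then show ?case using X(1) by (simp add: abs_divide divide_le_eq)
      qed
    qed (use meas' in auto)
    have eq: "(\<integral>\<omega>. ?q i \<omega> \<partial>M) = ((\<integral>\<omega>. f (X (i + N)) \<omega> \<partial>M) - (\<integral>\<omega>. f a \<omega> \<partial>M)) / (X (i + N) - a)" for i
      using Bochner_Integration.integral_diff[OF intx[OF N[of "i + N"]] int] by simp
    have "(\<lambda>i. ((\<integral>\<omega>. f (X (i + N)) \<omega> \<partial>M) - (\<integral>\<omega>. f a \<omega> \<partial>M)) / (X (i + N) - a)) \<longlonglongrightarrow> (\<integral>\<omega>. f' a \<omega> \<partial>M)"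
      using lim unfolding eq .
    then show "((\<lambda>x. ((\<integral>\<omega>. f x \<omega> \<partial>M) - (\<integral>\<omega>. f a \<omega> \<partial>M)) / (x - a)) \<circ> X) \<longlonglongrightarrow> (\<integral>\<omega>. f' a \<omega> \<partial>M)"
      unfolding comp_def by (rule LIMSEQ_offset)
  qed
  then show ?thesis by (simp add: has_field_derivative_iff)
qed

definition plane_rotation :: "'n::finite \<Rightarrow> 'n \<Rightarrow> real \<Rightarrow> real^'n \<Rightarrow> real^'n" where
  "plane_rotation i j \<theta> v =
     (\<chi> k. if k = i then cos \<theta> * v $ i - sin \<theta> * v $ j
           else if k = j then sin \<theta> * v $ i + cos \<theta> * v $ j else v $ k)"

lemma orthogonal_plane_rotation:
  assumes ij: "i \<noteq> j"
  shows "orthogonal_transformation (plane_rotation i j \<theta>)"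
proof -
  have "linear (plane_rotation i j \<theta>)"
    by (rule linearI) (auto simp: plane_rotation_def vec_eq_iff algebra_simps)
  moreover have "plane_rotation i j \<theta> v \<bullet> plane_rotation i j \<theta> v = v \<bullet> v" for v
  proof -
    let ?w = "plane_rotation i j \<theta> v"
    have split: "(\<Sum>k\<in>UNIV. u $ k * u $ k)
        = u $ i * u $ i + (u $ j * u $ j + (\<Sum>k\<in>UNIV - {i} - {j}. u $ k * u $ k))" for u :: "real^'a"
      using ij by (simp add: sum.remove[of UNIV i] sum.remove[of "UNIV - {i}" j])
    have "(\<Sum>k\<in>UNIV - {i} - {j}. ?w $ k * ?w $ k) = (\<Sum>k\<in>UNIV - {i} - {j}. v $ k * v $ k)"
      by (rule sum.cong) (auto simp: plane_rotation_def)
    moreover have "?w $ i * ?w $ i + ?w $ j * ?w $ j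
        = (v $ i * v $ i + v $ j * v $ j) * ((cos \<theta>)\<^sup>2 + (sin \<theta>)\<^sup>2)"
    proof -
      have "(c * x - s * y) * (c * x - s * y) + (s * x + c * y) * (s * x + c * y)
          = (x * x + y * y) * (c\<^sup>2 + s\<^sup>2)" for c s x y :: real
        by (simp add: algebra_simps power2_eq_square)
      then show ?thesis using ij by (simp add: plane_rotation_def del: sin_cos_squared_add sin_cos_squared_add2)
    qed
    ultimately show ?thesis by (simp add: inner_vec_def split)
  qed
  ultimately show ?thesis
    by (simp add: orthogonal_transformation norm_eq_sqrt_inner)
qed

lemma abs_mult_le_bound: "\<bar>a\<bar> \<le> 1 \<Longrightarrow> \<bar>b\<bar> \<le> B \<Longrightarrow> \<bar>a * b\<bar> \<le> (B::real)"
  using mult_mono[of "\<bar>a\<bar>" 1 "\<bar>b\<bar>" B] by (simp add: abs_mult)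

lemma component_abs_le_1: "norm (\<gamma>::real^'n::finite) = 1 \<Longrightarrow> \<bar>\<gamma> $ i\<bar> \<le> 1"
  using component_le_norm_cart[of \<gamma> i] by simp

lemma integrable_uniform_sphere_bounded:
  fixes f :: "real^'n::finite \<Rightarrow> real"
  assumes "f \<in> borel_measurable borel" "\<And>\<gamma>. norm \<gamma> = 1 \<Longrightarrow> \<bar>f \<gamma>\<bar> \<le> B"
  shows "integrable uniform_sphere f"
proof -
  interpret prob_space "uniform_sphere :: (real^'n) measure" by (rule prob_space_uniform_sphere)
  show ?thesis
    by (rule integrable_const_bound[where B = B])
      (use assms AE_uniform_sphere_norm in
        \<open>auto elim!: eventually_mono simp: measurable_cong_sets[OF sets_uniform_sphere refl]\<close>)
qed

text \<open>Stein's identity for the sphere: the derivative at \<open>\<theta> = 0\<close> of the constant function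
  \<open>\<theta> \<mapsto> E[(R\<^sub>\<theta> \<gamma>)\<^sub>j g((R\<^sub>\<theta> \<gamma>)\<^sub>i)]\<close>.\<close>

lemma sphere_stein_coordinate:
  fixes g g' :: "real \<Rightarrow> real" and i j :: "'n::finite"
  assumes ij: "i \<noteq> j"
    and [measurable]: "g \<in> borel_measurable borel" "g' \<in> borel_measurable borel"
    and der: "\<And>s. \<bar>s\<bar> \<le> 1 \<Longrightarrow> (g has_real_derivative g' s) (at s)"
    and bd: "\<And>s. \<bar>s\<bar> \<le> 1 \<Longrightarrow> \<bar>g s\<bar> \<le> B" "\<And>s. \<bar>s\<bar> \<le> 1 \<Longrightarrow> \<bar>g' s\<bar> \<le> B"
  shows "(\<integral>\<gamma>. \<gamma> $ i * g (\<gamma> $ i) \<partial>(uniform_sphere :: (real^'n) measure))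
       = (\<integral>\<gamma>. (\<gamma> $ j)\<^sup>2 * g' (\<gamma> $ i) \<partial>uniform_sphere)"
proof -
  let ?S = "uniform_sphere :: (real^'n) measure"
  interpret S: prob_space ?S by (rule prob_space_uniform_sphere)
  define F where "F \<theta> \<gamma> = plane_rotation i j \<theta> \<gamma> $ j * g (plane_rotation i j \<theta> \<gamma> $ i)"
    for \<theta> and \<gamma> :: "real^'n"
  define F' where "F' \<theta> \<gamma> = plane_rotation i j \<theta> \<gamma> $ i * g (plane_rotation i j \<theta> \<gamma> $ i)
     - (plane_rotation i j \<theta> \<gamma> $ j)\<^sup>2 * g' (plane_rotation i j \<theta> \<gamma> $ i)" for \<theta> and \<gamma> :: "real^'n"
  have R: "plane_rotation i j \<theta> \<gamma> $ i = cos \<theta> * \<gamma> $ i - sin \<theta> * \<gamma> $ j"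
    "plane_rotation i j \<theta> \<gamma> $ j = sin \<theta> * \<gamma> $ i + cos \<theta> * \<gamma> $ j" for \<theta> \<gamma>
    using ij by (auto simp: plane_rotation_def)
  have [measurable]: "(\<lambda>\<gamma>::real^'n. \<gamma> $ k) \<in> borel_measurable borel" for k
    by (intro borel_measurable_continuous_onI continuous_intros)
  have F_meas: "F \<theta> \<in> borel_measurable ?S" "F' \<theta> \<in> borel_measurable ?S" for \<theta>
    unfolding F_def F'_def R by measurable
  have le1: "\<bar>plane_rotation i j \<theta> \<gamma> $ k\<bar> \<le> 1" if "norm \<gamma> = 1" for \<theta> \<gamma> k
    using orthogonal_plane_rotation[OF ij, of \<theta>] that
    by (intro component_abs_le_1) (simp add: orthogonal_transformation)
  have "((\<lambda>\<theta>. \<integral>\<gamma>. F \<theta> \<gamma> \<partial>?S) has_real_derivative (\<integral>\<gamma>. F' 0 \<gamma> \<partial>?S)) (at 0)"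
  proof (rule has_real_derivative_integral[where e = 1 and B = "2 * B"])
    show "finite_measure ?S" by unfold_locales
    show "integrable ?S (F 0)"
      using F_meas(1)[of 0] unfolding F_def
      by (intro integrable_uniform_sphere_bounded[where B = B])
        (auto simp: measurable_cong_sets[OF sets_uniform_sphere refl] R intro!: abs_mult_le_bound bd(1) component_abs_le_1)
    show "AE \<gamma> in ?S. \<forall>\<theta>\<in>ball 0 1. ((\<lambda>\<theta>. F \<theta> \<gamma>) has_real_derivative F' \<theta> \<gamma>) (at \<theta>) \<and> \<bar>F' \<theta> \<gamma>\<bar> \<le> 2 * B"
      using AE_uniform_sphere_norm
    proof eventually_elim
      case (elim \<gamma>)
      show ?case
      proof (intro ballI conjI)
        fix \<theta> :: real
        have arg: "((\<lambda>\<theta>. cos \<theta> * \<gamma> $ i - sin \<theta> * \<gamma> $ j) has_real_derivative - sin \<theta> * \<gamma> $ i - cos \<theta> * \<gamma> $ j) (at \<theta>)"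
          by (auto intro!: derivative_eq_intros)
        have dg: "((\<lambda>\<theta>. g (cos \<theta> * \<gamma> $ i - sin \<theta> * \<gamma> $ j)) has_real_derivative
            g' (cos \<theta> * \<gamma> $ i - sin \<theta> * \<gamma> $ j) * (- sin \<theta> * \<gamma> $ i - cos \<theta> * \<gamma> $ j)) (at \<theta>)"
          using DERIV_chain2[OF _ arg, of g] der[OF le1[OF elim, of \<theta> i]] unfolding R(1) by blast
        have "((\<lambda>\<theta>. sin \<theta> * \<gamma> $ i + cos \<theta> * \<gamma> $ j) has_real_derivative cos \<theta> * \<gamma> $ i - sin \<theta> * \<gamma> $ j) (at \<theta>)"
          by (auto intro!: derivative_eq_intros)
        from DERIV_mult[OF this dg]
        show "((\<lambda>\<theta>. F \<theta> \<gamma>) has_real_derivative F' \<theta> \<gamma>) (at \<theta>)"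
          unfolding F_def F'_def R by (rule DERIV_cong) (simp add: algebra_simps power2_eq_square)
        have "\<bar>plane_rotation i j \<theta> \<gamma> $ i * g (plane_rotation i j \<theta> \<gamma> $ i)\<bar> \<le> B"
          using le1[OF elim] bd(1) by (intro abs_mult_le_bound) auto
        moreover have "\<bar>(plane_rotation i j \<theta> \<gamma> $ j)\<^sup>2 * g' (plane_rotation i j \<theta> \<gamma> $ i)\<bar> \<le> B"
          using le1[OF elim] bd(2) by (intro abs_mult_le_bound) (auto simp: abs_square_le_1)
        ultimately show "\<bar>F' \<theta> \<gamma>\<bar> \<le> 2 * B" unfolding F'_def by linarith
      qed
    qed
  qed (use F_meas in auto)
  moreover have "(\<integral>\<gamma>. F \<theta> \<gamma> \<partial>?S) = (\<integral>\<gamma>. \<gamma> $ j * g (\<gamma> $ i) \<partial>?S)" for \<theta>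
    unfolding F_def
    using integral_uniform_sphere_orthogonal[OF orthogonal_plane_rotation[OF ij, of \<theta>], of "\<lambda>\<gamma>. \<gamma> $ j * g (\<gamma> $ i)"]
    by simp
  ultimately have "((\<lambda>\<theta>::real. (\<integral>\<gamma>. \<gamma> $ j * g (\<gamma> $ i) \<partial>?S)) has_real_derivative (\<integral>\<gamma>. F' 0 \<gamma> \<partial>?S)) (at 0)"
    by simp
  then have "(\<integral>\<gamma>. F' 0 \<gamma> \<partial>?S) = 0" using DERIV_unique DERIV_const by blast
  moreover have "(\<integral>\<gamma>. F' 0 \<gamma> \<partial>?S)
     = (\<integral>\<gamma>. \<gamma> $ i * g (\<gamma> $ i) \<partial>?S) - (\<integral>\<gamma>. (\<gamma> $ j)\<^sup>2 * g' (\<gamma> $ i) \<partial>?S)"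
  proof -
    have "integrable ?S (\<lambda>\<gamma>. \<gamma> $ i * g (\<gamma> $ i))"
      by (rule integrable_uniform_sphere_bounded[where B = B])
        (auto intro!: abs_mult_le_bound bd(1) component_abs_le_1)
    moreover have "integrable ?S (\<lambda>\<gamma>. (\<gamma> $ j)\<^sup>2 * g' (\<gamma> $ i))"
      by (rule integrable_uniform_sphere_bounded[where B = B])
        (auto simp: abs_square_le_1 intro!: abs_mult_le_bound bd(2) component_abs_le_1)
    ultimately show ?thesis by (simp add: F'_def R)
  qed
  ultimately show ?thesis by simp
qed

text \<open>Sum of the coordinate identities over all \<open>j\<close> other than \<open>i\<close>;
  on the sphere the squares of these coordinates add up to 1 minus the square of coordinate
  \<open>i\<close>.\<close>

lemma sphere_stein:
  fixes g g' :: "real \<Rightarrow> real" and i :: "'n::finite"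
  assumes [measurable]: "g \<in> borel_measurable borel" "g' \<in> borel_measurable borel"
    and der: "\<And>s. \<bar>s\<bar> \<le> 1 \<Longrightarrow> (g has_real_derivative g' s) (at s)"
    and bd: "\<And>s. \<bar>s\<bar> \<le> 1 \<Longrightarrow> \<bar>g s\<bar> \<le> B" "\<And>s. \<bar>s\<bar> \<le> 1 \<Longrightarrow> \<bar>g' s\<bar> \<le> B"
  shows "(real CARD('n) - 1) * (\<integral>\<gamma>. \<gamma> $ i * g (\<gamma> $ i) \<partial>(uniform_sphere :: (real^'n) measure))
       = (\<integral>\<gamma>. (1 - (\<gamma> $ i)\<^sup>2) * g' (\<gamma> $ i) \<partial>uniform_sphere)"
proof -
  let ?S = "uniform_sphere :: (real^'n) measure"
  have [measurable]: "(\<lambda>\<gamma>::real^'n. \<gamma> $ k) \<in> borel_measurable borel" for k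
    by (intro borel_measurable_continuous_onI continuous_intros)
  have "(real CARD('n) - 1) * (\<integral>\<gamma>. \<gamma> $ i * g (\<gamma> $ i) \<partial>?S)
      = (\<Sum>j\<in>UNIV - {i}. \<integral>\<gamma>. \<gamma> $ i * g (\<gamma> $ i) \<partial>?S)"
    by (simp add: of_nat_diff Suc_leI)
  also have "\<dots> = (\<Sum>j\<in>UNIV - {i}. \<integral>\<gamma>. (\<gamma> $ j)\<^sup>2 * g' (\<gamma> $ i) \<partial>?S)"
    by (rule sum.cong) (auto intro!: sphere_stein_coordinate[where B = B] der bd)
  also have "\<dots> = (\<integral>\<gamma>. (\<Sum>j\<in>UNIV - {i}. (\<gamma> $ j)\<^sup>2 * g' (\<gamma> $ i)) \<partial>?S)"
  proof (rule Bochner_Integration.integral_sum[symmetric])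
    fix j
    show "integrable ?S (\<lambda>\<gamma>. (\<gamma> $ j)\<^sup>2 * g' (\<gamma> $ i))"
      by (rule integrable_uniform_sphere_bounded[where B = B])
        (auto simp: abs_square_le_1 intro!: abs_mult_le_bound bd(2) component_abs_le_1)
  qed
  also have "\<dots> = (\<integral>\<gamma>. (1 - (\<gamma> $ i)\<^sup>2) * g' (\<gamma> $ i) \<partial>?S)"
  proof (rule integral_cong_AE)
    show "AE \<gamma> in ?S. (\<Sum>j\<in>UNIV - {i}. (\<gamma> $ j)\<^sup>2 * g' (\<gamma> $ i)) = (1 - (\<gamma> $ i)\<^sup>2) * g' (\<gamma> $ i)"
      using AE_uniform_sphere_norm
    proof eventually_elim
      case (elim \<gamma>)
      then have "\<gamma> \<bullet> \<gamma> = 1" by (simp add: norm_eq_1)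
      then have "(\<Sum>j\<in>UNIV. (\<gamma> $ j)\<^sup>2) = 1" by (simp add: inner_vec_def power2_eq_square)
      then have "(\<Sum>j\<in>UNIV - {i}. (\<gamma> $ j)\<^sup>2) = 1 - (\<gamma> $ i)\<^sup>2"
        by (simp add: sum_diff1)
      then show ?case by (simp add: sum_distrib_right[symmetric])
    qed
  qed (unfold measurable_cong_sets[OF sets_uniform_sphere refl], measurable)
  finally show ?thesis .
qed

section \<open>Spherical means of powers of the distance\<close>

text \<open>\<open>f \<tau> s = (1 + 2 \<tau> s + \<tau>\<^sup>2) powr (- p / 2)\<close> is \<open>|e + \<tau> \<gamma>|\<^sup>-\<^sup>p\<close> for unit vectors with \<open>e \<bullet> \<gamma> = s\<close>. In polar
  coordinates its Laplacian is \<open>f\<^sub>\<tau>\<^sub>\<tau> + (d - 1) f\<^sub>\<tau> / \<tau>\<close> plus an angular part, whose spherical mean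
  vanishes by Stein's identity.\<close>

lemma sphere_mean_power_axis:
  fixes p \<sigma> \<tau> :: real and i :: "'n::finite"
  defines "d \<equiv> real CARD('n)"
  assumes p: "p \<ge> 0" and sg: "\<sigma> * (p * (p + 2 - d)) \<ge> 0" and \<tau>: "0 \<le> \<tau>" "\<tau> \<le> 1/2"
  shows "\<sigma> + \<sigma> * (p * (p + 2 - d)) * (2/3) powr (p + 2) / (2 * d) * \<tau>\<^sup>2
      \<le> \<sigma> * (\<integral>\<gamma>. (1 + 2 * \<tau> * (\<gamma> $ i) + \<tau>\<^sup>2) powr (- p / 2) \<partial>(uniform_sphere :: (real^'n) measure))"
proof -
  let ?S = "uniform_sphere :: (real^'n) measure"
  interpret S: prob_space ?S by (rule prob_space_uniform_sphere)
  have [measurable]: "(\<lambda>\<gamma>::real^'n. \<gamma> $ k) \<in> borel_measurable borel" for k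
    by (intro borel_measurable_continuous_onI continuous_intros)
  have [measurable]: "(\<lambda>\<gamma>::real^'n. \<gamma> $ k) \<in> borel_measurable ?S" for k
    by (subst measurable_cong_sets[OF sets_uniform_sphere refl]) measurable
  have d1: "d \<ge> 1" unfolding d_def by (simp add: Suc_leI)
  define q where "q \<tau> s = 1 + 2 * \<tau> * s + \<tau>\<^sup>2" for \<tau> s :: real
  define f where "f \<tau> s = q \<tau> s powr (- p / 2)" for \<tau> s
  define f1 where "f1 \<tau> s = - p * (\<tau> + s) * q \<tau> s powr (- p / 2 - 1)" for \<tau> s
  define f2 where "f2 \<tau> s = - p * q \<tau> s powr (- p / 2 - 1)
      + p * (p + 2) * (\<tau> + s)\<^sup>2 * q \<tau> s powr (- p / 2 - 2)" for \<tau> s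
  \<comment> \<open>\<open>g\<close> and \<open>g'\<close> are the first two derivatives of
    \<open>f\<close> in \<open>s\<close>. Stein's identity for \<open>g\<close> says that (1 - s^2)
    g' - (d - 1) s g, the angular Laplacian of \<open>f\<close>, has mean zero.\<close>
  define g where "g \<tau> s = - p * \<tau> * q \<tau> s powr (- p / 2 - 1)" for \<tau> s
  define g' where "g' \<tau> s = p * (p + 2) * \<tau>\<^sup>2 * q \<tau> s powr (- p / 2 - 2)" for \<tau> s
  note defs = f_def f1_def f2_def g_def g'_def q_def
  have meas [measurable]: "(\<lambda>s. q \<tau> s) \<in> borel_measurable borel" "f \<tau> \<in> borel_measurable borel"
     "f1 \<tau> \<in> borel_measurable borel"
     "f2 \<tau> \<in> borel_measurable borel" "g \<tau> \<in> borel_measurable borel" "g' \<tau> \<in> borel_measurable borel" for \<tau>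
    unfolding defs by measurable
  \<comment> \<open>The range up to 3/4 leaves a neighbourhood of radius 1/4 about each \<tau> \<le>
    1/2 for differentiating under the integral.\<close>
  have ql: "1/16 \<le> q \<tau> s" if "\<bar>\<tau>\<bar> \<le> 3/4" "\<bar>s\<bar> \<le> 1" for \<tau> s
  proof -
    have ts: "\<bar>\<tau> * s\<bar> \<le> \<bar>\<tau>\<bar>" using that by (simp add: abs_mult mult_left_le)
    then have "(1 - \<bar>\<tau>\<bar>)\<^sup>2 \<le> q \<tau> s"
      unfolding q_def power2_eq_square by (auto simp: algebra_simps abs_le_iff)
    moreover have "(1/4)\<^sup>2 \<le> (1 - \<bar>\<tau>\<bar>)\<^sup>2" using that by (intro power_mono) auto
    ultimately show "1/16 \<le> q \<tau> s" by (auto simp: power2_eq_square)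
  qed
  have qpos: "q \<tau> s > 0" if "\<bar>\<tau>\<bar> \<le> 3/4" "\<bar>s\<bar> \<le> 1" for \<tau> s
    using ql[OF that] by linarith
  have powr_bd: "0 \<le> q \<tau> s powr (- a)" "q \<tau> s powr (- a) \<le> 16 powr a"
    if "\<bar>\<tau>\<bar> \<le> 3/4" "\<bar>s\<bar> \<le> 1" "a \<ge> 0" for \<tau> s a
  proof -
    have "(1/16) powr a \<le> q \<tau> s powr a" using ql[OF that(1,2)] that by (intro powr_mono2) auto
    then have "inverse (q \<tau> s powr a) \<le> inverse ((1/16) powr a)"
      by (intro le_imp_inverse_le) auto
    then show "q \<tau> s powr (- a) \<le> 16 powr a" by (simp add: powr_minus powr_divide inverse_eq_divide)
  qed simp
  define B where "B = 2 * p * 16 powr (p/2 + 1) + p * (p + 2) * 4 * 16 powr (p/2 + 2) + 16 powr (p/2)"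
  have bnds: "\<bar>f \<tau> s\<bar> \<le> B" "\<bar>f1 \<tau> s\<bar> \<le> B" "\<bar>f2 \<tau> s\<bar> \<le> B" "\<bar>g \<tau> s\<bar> \<le> B" "\<bar>g' \<tau> s\<bar> \<le> B"
    if \<tau>s: "\<bar>\<tau>\<bar> \<le> 3/4" "\<bar>s\<bar> \<le> 1" for \<tau> s
  proof -
    have b0: "\<bar>q \<tau> s powr (- p / 2)\<bar> \<le> 16 powr (p / 2)" using powr_bd[OF \<tau>s, of "p/2"] p by simp
    have e1: "- p / 2 - 1 = - (p / 2 + 1)" "- p / 2 - 2 = - (p / 2 + 2)" by simp_all
    have b1: "\<bar>q \<tau> s powr (- p / 2 - 1)\<bar> \<le> 16 powr (p / 2 + 1)"
      using powr_bd[OF \<tau>s, of "p/2 + 1"] p unfolding e1 by simp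
    have b2: "\<bar>q \<tau> s powr (- p / 2 - 2)\<bar> \<le> 16 powr (p / 2 + 2)"
      using powr_bd[OF \<tau>s, of "p/2 + 2"] p unfolding e1 by simp
    have ts: "\<bar>\<tau> + s\<bar> \<le> 2" using \<tau>s by linarith
    then have ts2: "\<bar>(\<tau> + s)\<^sup>2\<bar> \<le> 4" using abs_le_square_iff[of "\<tau> + s" 2] by simp
    have t1: "\<bar>\<tau>\<bar> \<le> 2" "\<bar>\<tau>\<^sup>2\<bar> \<le> 4" using \<tau>s abs_le_square_iff[of \<tau> 2] by auto
    have m1: "\<bar>- p * x * y\<bar> \<le> 2 * p * 16 powr (p/2 + 1)" if "\<bar>x\<bar> \<le> 2" "\<bar>y\<bar> \<le> 16 powr (p/2 + 1)" for x y
    proof -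
      have "\<bar>- p * x * y\<bar> = p * (\<bar>x\<bar> * \<bar>y\<bar>)" using p by (simp add: abs_mult)
      also have "\<dots> \<le> p * (2 * 16 powr (p/2 + 1))" using that p by (intro mult_left_mono mult_mono) auto
      finally show ?thesis by simp
    qed
    have m2: "\<bar>p * (p + 2) * x * y\<bar> \<le> p * (p + 2) * 4 * 16 powr (p/2 + 2)"
      if "\<bar>x\<bar> \<le> 4" "\<bar>y\<bar> \<le> 16 powr (p/2 + 2)" for x y
    proof -
      have "\<bar>p * (p + 2) * x * y\<bar> = p * (p + 2) * (\<bar>x\<bar> * \<bar>y\<bar>)" using p by (simp add: abs_mult)
      also have "\<dots> \<le> p * (p + 2) * (4 * 16 powr (p/2 + 2))" using that p by (intro mult_left_mono mult_mono) auto
      finally show ?thesis by simp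
    qed
    have nn: "0 \<le> 2 * p * 16 powr (p/2 + 1)" "0 \<le> p * (p + 2) * 4 * 16 powr (p/2 + 2)" "0 \<le> 16 powr (p/2)"
      using p by auto
    show "\<bar>f \<tau> s\<bar> \<le> B" using b0 nn unfolding f_def B_def by linarith
    show "\<bar>f1 \<tau> s\<bar> \<le> B" using m1[OF ts b1] nn unfolding f1_def B_def by linarith
    show "\<bar>g \<tau> s\<bar> \<le> B" using m1[OF t1(1) b1] nn unfolding g_def B_def by linarith
    show "\<bar>g' \<tau> s\<bar> \<le> B" using m2[OF t1(2) b2] nn unfolding g'_def B_def by linarith
    show "\<bar>f2 \<tau> s\<bar> \<le> B" using m1[of 1, OF _ b1] m2[OF ts2 b2] nn unfolding f2_def B_def
      by (simp only: mult_1_right) linarith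
  qed
  have df: "((\<lambda>\<tau>. f \<tau> s) has_real_derivative f1 \<tau> s) (at \<tau>)"
    and df1: "((\<lambda>\<tau>. f1 \<tau> s) has_real_derivative f2 \<tau> s) (at \<tau>)"
    and dg: "((\<lambda>s. g \<tau> s) has_real_derivative g' \<tau> s) (at s)" if "\<bar>\<tau>\<bar> \<le> 3/4" "\<bar>s\<bar> \<le> 1" for \<tau> s
  proof -
    note q0 = qpos[OF that]
    have dq: "((\<lambda>\<tau>. q \<tau> s) has_real_derivative 2 * (\<tau> + s)) (at \<tau>)"
      unfolding q_def by (auto intro!: derivative_eq_intros)
    have dqs: "((\<lambda>s. q \<tau> s) has_real_derivative 2 * \<tau>) (at s)"
      unfolding q_def by (auto intro!: derivative_eq_intros)
    have pw: "((\<lambda>\<tau>. q \<tau> s powr a) has_real_derivative a * q \<tau> s powr (a - 1) * (2 * (\<tau> + s))) (at \<tau>)" for a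
      using DERIV_fun_powr[OF dq q0, of a] by simp
    have pws: "((\<lambda>s. q \<tau> s powr a) has_real_derivative a * q \<tau> s powr (a - 1) * (2 * \<tau>)) (at s)" for a
      using DERIV_fun_powr[OF dqs q0, of a] by simp
    show "((\<lambda>\<tau>. f \<tau> s) has_real_derivative f1 \<tau> s) (at \<tau>)"
      unfolding f_def f1_def using pw[of "- p / 2"] by (rule DERIV_cong) (simp add: algebra_simps)
    have lin: "((\<lambda>\<tau>. - p * (\<tau> + s)) has_real_derivative - p) (at \<tau>)"
      by (auto intro!: derivative_eq_intros)
    show "((\<lambda>\<tau>. f1 \<tau> s) has_real_derivative f2 \<tau> s) (at \<tau>)"
      unfolding f1_def f2_def using DERIV_mult[OF lin pw[of "- p / 2 - 1"]]
      by (rule DERIV_cong) (simp add: field_simps power2_eq_square)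
    show "((\<lambda>s. g \<tau> s) has_real_derivative g' \<tau> s) (at s)"
      unfolding g_def g'_def using DERIV_cmult[OF pws[of "- p / 2 - 1"], of "- p * \<tau>"]
      by (rule DERIV_cong) (simp add: field_simps power2_eq_square)
  qed
  define m where "m \<tau> = (\<integral>\<gamma>. f \<tau> (\<gamma> $ i) \<partial>?S)" for \<tau>
  define m1 where "m1 \<tau> = (\<integral>\<gamma>. f1 \<tau> (\<gamma> $ i) \<partial>?S)" for \<tau>
  define m2 where "m2 \<tau> = (\<integral>\<gamma>. f2 \<tau> (\<gamma> $ i) \<partial>?S)" for \<tau>
  have intS: "integrable ?S (\<lambda>\<gamma>. h (\<gamma> $ i))" if "h \<in> borel_measurable borel" "\<And>s. \<bar>s\<bar> \<le> 1 \<Longrightarrow> \<bar>h s\<bar> \<le> C" for h :: "real \<Rightarrow> real" and C :: real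
    by (rule integrable_uniform_sphere_bounded[where B = C])
      (use that(1) in \<open>auto intro!: that(2) component_abs_le_1\<close>)
  have dm: "(m has_real_derivative m1 \<tau>) (at \<tau>)" and dm1: "(m1 has_real_derivative m2 \<tau>) (at \<tau>)"
    if "\<bar>\<tau>\<bar> \<le> 1/2" for \<tau>
  proof -
    have b: "\<bar>u\<bar> \<le> 3/4" if "u \<in> ball \<tau> (1/4)" for u
    proof -
      have "\<bar>\<tau> - u\<bar> < 1/4" using that by (simp add: dist_real_def)
      then show ?thesis using \<open>\<bar>\<tau>\<bar> \<le> 1/2\<close> by linarith
    qed
    show "(m has_real_derivative m1 \<tau>) (at \<tau>)"
      unfolding m_def m1_def
    proof (rule has_real_derivative_integral[where e = "1/4" and B = B])
      show "AE \<gamma> in ?S. \<forall>u\<in>ball \<tau> (1/4). ((\<lambda>u. f u (\<gamma> $ i)) has_real_derivative f1 u (\<gamma> $ i)) (at u) \<and> \<bar>f1 u (\<gamma> $ i)\<bar> \<le> B"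
        using AE_uniform_sphere_norm
        proof eventually_elim
          case (elim \<gamma>)
          note s = component_abs_le_1[OF elim, of i]
          show ?case by (intro ballI conjI df bnds(2) s b)
        qed
      show "integrable ?S (\<lambda>\<gamma>. f \<tau> (\<gamma> $ i))"
        using that by (intro intS[of _ B] bnds) auto
    qed (auto intro: S.finite_measure_axioms)
    show "(m1 has_real_derivative m2 \<tau>) (at \<tau>)"
      unfolding m1_def m2_def
    proof (rule has_real_derivative_integral[where e = "1/4" and B = B])
      show "AE \<gamma> in ?S. \<forall>u\<in>ball \<tau> (1/4). ((\<lambda>u. f1 u (\<gamma> $ i)) has_real_derivative f2 u (\<gamma> $ i)) (at u) \<and> \<bar>f2 u (\<gamma> $ i)\<bar> \<le> B"
        using AE_uniform_sphere_norm
        proof eventually_elim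
          case (elim \<gamma>)
          note s = component_abs_le_1[OF elim, of i]
          show ?case by (intro ballI conjI df1 bnds(3) s b)
        qed
      show "integrable ?S (\<lambda>\<gamma>. f1 \<tau> (\<gamma> $ i))"
        using that by (intro intS[of _ B] bnds) auto
    qed (auto intro: S.finite_measure_axioms)
  qed
  have cont_m: "continuous_on {0..1/2} m" "continuous_on {0..1/2} m1"
    by (rule DERIV_continuous_on, rule has_field_derivative_at_within, rule dm dm1, simp)+
  define c where "c = p * (p + 2 - d)"
  \<comment> \<open>For 0 < \<tau> \<le> 1/2 the factor \<open>q\<close> is at most (3/2)^2 on the
    sphere, so \<open>L\<close> bounds \<open>q powr (- p / 2 - 1)\<close> from below.\<close>
  define L where "L = (2/3 :: real) powr (p + 2)"
  define bb where "bb = \<sigma> * c * L"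
  have radial: "\<sigma> * ((d - 1) * m1 \<tau> + \<tau> * m2 \<tau>) \<ge> bb * \<tau>" if "0 < \<tau>" "\<tau> \<le> 1/2" for \<tau>
  proof -
    have t: "\<bar>\<tau>\<bar> \<le> 3/4" using that by simp
    have stein: "(d - 1) * (\<integral>\<gamma>. \<gamma> $ i * g \<tau> (\<gamma> $ i) \<partial>?S) = (\<integral>\<gamma>. (1 - (\<gamma> $ i)\<^sup>2) * g' \<tau> (\<gamma> $ i) \<partial>?S)"
      unfolding d_def by (rule sphere_stein[where B = B]) (use t bnds dg in auto)
    have i1: "integrable ?S (\<lambda>\<gamma>. f1 \<tau> (\<gamma> $ i))" "integrable ?S (\<lambda>\<gamma>. f2 \<tau> (\<gamma> $ i))"
      using t by (auto intro!: intS[of _ B] bnds)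
    have i2: "integrable ?S (\<lambda>\<gamma>. \<gamma> $ i * g \<tau> (\<gamma> $ i))"
      by (rule intS[of "\<lambda>s. s * g \<tau> s" B]) (use t in \<open>auto intro!: abs_mult_le_bound bnds\<close>)
    have i3: "integrable ?S (\<lambda>\<gamma>. (1 - (\<gamma> $ i)\<^sup>2) * g' \<tau> (\<gamma> $ i))"
    proof (rule intS[of "\<lambda>s. (1 - s\<^sup>2) * g' \<tau> s" B])
      fix s :: real assume s: "\<bar>s\<bar> \<le> 1"
      then have "s\<^sup>2 \<le> 1" by (simp add: abs_square_le_1)
      then have "\<bar>1 - s\<^sup>2\<bar> \<le> 1" by (simp add: abs_le_iff)
      then show "\<bar>(1 - s\<^sup>2) * g' \<tau> s\<bar> \<le> B" using bnds(5)[OF t s] by (rule abs_mult_le_bound)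
    qed measurable
    have i4: "integrable ?S (\<lambda>\<gamma>. q \<tau> (\<gamma> $ i) powr (- p / 2 - 1))"
    proof (rule intS[of "\<lambda>s. q \<tau> s powr (- p / 2 - 1)" "16 powr (p/2 + 1)"])
      fix s :: real assume s: "\<bar>s\<bar> \<le> 1"
      have e: "- p / 2 - 1 = - (p / 2 + 1)" by simp
      show "\<bar>q \<tau> s powr (- p / 2 - 1)\<bar> \<le> 16 powr (p/2 + 1)"
        using powr_bd[OF t s, of "p/2 + 1"] p unfolding e by simp
    qed measurable
    \<comment> \<open>This is \<tau>^2 times the polar form of the Laplacian of |x|^(-p), with
      \<open>c\<close> = p (p + 2 - d).\<close>
    have alg: "\<tau>\<^sup>2 * f2 \<tau> s + (d - 1) * \<tau> * f1 \<tau> s + (1 - s\<^sup>2) * g' \<tau> s - (d - 1) * (s * g \<tau> s)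
        = \<tau>\<^sup>2 * c * q \<tau> s powr (- p / 2 - 1)" if "\<bar>s\<bar> \<le> 1" for s
    proof -
      have e: "q \<tau> s powr (- p / 2 - 1) = q \<tau> s * q \<tau> s powr (- p / 2 - 2)"
      proof -
        have x: "1 + (- p / 2 - 2) = - p / 2 - 1" by simp
        show ?thesis using powr_mult_base[of "q \<tau> s" "- p / 2 - 2"] qpos[OF t that] unfolding x by simp
      qed
      have k: "(\<tau> + s)\<^sup>2 = q \<tau> s - (1 - s\<^sup>2)"
        by (simp add: q_def power2_eq_square algebra_simps)
      define Q where "Q = q \<tau> s powr (- p / 2 - 2)"
      show ?thesis
        unfolding f2_def f1_def g_def g'_def e c_def Q_def[symmetric] k
        by (simp add: algebra_simps power2_eq_square)
    qed
    have "\<tau>\<^sup>2 * m2 \<tau> + (d - 1) * \<tau> * m1 \<tau>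
      = (\<integral>\<gamma>. \<tau>\<^sup>2 * f2 \<tau> (\<gamma> $ i) + (d - 1) * \<tau> * f1 \<tau> (\<gamma> $ i) + (1 - (\<gamma> $ i)\<^sup>2) * g' \<tau> (\<gamma> $ i)
           - (d - 1) * (\<gamma> $ i * g \<tau> (\<gamma> $ i)) \<partial>?S)"
      using i1 i2 i3 stein by (simp add: m1_def m2_def)
    also have "\<dots> = (\<integral>\<gamma>. \<tau>\<^sup>2 * c * q \<tau> (\<gamma> $ i) powr (- p / 2 - 1) \<partial>?S)"
    proof (rule integral_cong_AE)
      show "AE \<gamma> in ?S. \<tau>\<^sup>2 * f2 \<tau> (\<gamma> $ i) + (d - 1) * \<tau> * f1 \<tau> (\<gamma> $ i) + (1 - (\<gamma> $ i)\<^sup>2) * g' \<tau> (\<gamma> $ i)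
           - (d - 1) * (\<gamma> $ i * g \<tau> (\<gamma> $ i)) = \<tau>\<^sup>2 * c * q \<tau> (\<gamma> $ i) powr (- p / 2 - 1)"
        using AE_uniform_sphere_norm by eventually_elim (intro alg component_abs_le_1)
    qed measurable
    also have "\<dots> = \<tau>\<^sup>2 * c * (\<integral>\<gamma>. q \<tau> (\<gamma> $ i) powr (- p / 2 - 1) \<partial>?S)" by simp
    finally have eq: "\<tau>\<^sup>2 * m2 \<tau> + (d - 1) * \<tau> * m1 \<tau> = \<tau>\<^sup>2 * c * (\<integral>\<gamma>. q \<tau> (\<gamma> $ i) powr (- p / 2 - 1) \<partial>?S)" .
    have "L \<le> (\<integral>\<gamma>. q \<tau> (\<gamma> $ i) powr (- p / 2 - 1) \<partial>?S)"
    proof (rule S.integral_ge_const[OF i4])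
      show "AE \<gamma> in ?S. L \<le> q \<tau> (\<gamma> $ i) powr (- p / 2 - 1)"
        using AE_uniform_sphere_norm
      proof eventually_elim
        case (elim \<gamma>)
        then have s: "\<bar>\<gamma> $ i\<bar> \<le> 1" by (rule component_abs_le_1)
        have "\<tau> * (\<gamma> $ i) \<le> \<tau>" using that s by (intro mult_left_le) auto
        then have "\<tau> * (\<gamma> $ i) \<le> 1/2" using that by linarith
        moreover have "\<tau>\<^sup>2 \<le> (1/2)\<^sup>2" using that by (intro power_mono) auto
        then have "\<tau>\<^sup>2 \<le> 1/4" by (simp add: power2_eq_square)
        ultimately have "q \<tau> (\<gamma> $ i) \<le> 9/4" unfolding q_def by linarith
        then have "(9/4) powr (- (p / 2 + 1)) \<le> q \<tau> (\<gamma> $ i) powr (- (p / 2 + 1))"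
          using qpos[OF t s] p by (intro powr_mono2') auto
        moreover have "(9/4 :: real) powr (- (p / 2 + 1)) = L"
        proof -
          have "(9/4 :: real) = (2/3) powr (-2)" by (simp add: powr_minus power2_eq_square)
          then have "(9/4 :: real) powr (- (p / 2 + 1)) = (2/3) powr ((-2) * (- (p / 2 + 1)))"
            by (simp only: powr_powr)
          also have "(-2) * (- (p / 2 + 1)) = p + 2" by simp
          finally show ?thesis by (simp only: L_def)
        qed
        ultimately show ?case by simp
      qed
    qed
    moreover have "\<sigma> * c \<ge> 0" using sg by (simp add: c_def)
    ultimately have le: "\<sigma> * c * L \<le> \<sigma> * c * (\<integral>\<gamma>. q \<tau> (\<gamma> $ i) powr (- p / 2 - 1) \<partial>?S)"
      by (rule mult_left_mono)
    have "\<tau>\<^sup>2 * bb \<le> \<tau>\<^sup>2 * (\<sigma> * c * (\<integral>\<gamma>. q \<tau> (\<gamma> $ i) powr (- p / 2 - 1) \<partial>?S))"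
      unfolding bb_def by (rule mult_left_mono[OF le]) simp
    also have "\<dots> = \<tau> * (\<sigma> * ((d - 1) * m1 \<tau> + \<tau> * m2 \<tau>))"
      using arg_cong[OF eq, of "\<lambda>x. \<sigma> * x"] by (simp add: algebra_simps power2_eq_square)
    finally have "\<tau> * (bb * \<tau>) \<le> \<tau> * (\<sigma> * ((d - 1) * m1 \<tau> + \<tau> * m2 \<tau>))"
      by (simp add: power2_eq_square mult_ac)
    then show ?thesis using that by (simp add: mult_le_cancel_left_pos)
  qed
  obtain k where k: "CARD('n) = Suc k" by (cases "CARD('n)") auto
  have dk: "d = real k + 1" by (simp add: d_def k)
  \<comment> \<open>In dimension one \<open>0 ^ k\<close> is 1, so \<open>m1 0\<close> itself has to
    vanish; there it does so by the symmetry of the sphere.\<close>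
  have m1_0: "0 ^ k * m1 0 = 0"
  proof (cases "k = 0")
    case True
    have "orthogonal_transformation (\<lambda>x::real^'n. - x)"
      using orthogonal_transformation_neg[of "\<lambda>x::real^'n. x"] orthogonal_transformation_id by blast
    then have "(\<integral>\<gamma>. (- \<gamma>) $ i \<partial>?S) = (\<integral>\<gamma>. \<gamma> $ i \<partial>?S)"
      by (rule integral_uniform_sphere_orthogonal[where f = "\<lambda>\<gamma>. \<gamma> $ i"])
        (intro borel_measurable_continuous_onI continuous_intros)
    then have "(\<integral>\<gamma>. \<gamma> $ i \<partial>?S) = 0" by simp
    then show ?thesis by (simp add: m1_def f1_def q_def)
  qed (simp add: power_0_left)
  have m1_ge: "\<sigma> * m1 \<tau> \<ge> bb * \<tau> / d" if "0 < \<tau>" "\<tau> \<le> 1/2" for \<tau>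
  proof -
    \<comment> \<open>The weight \<open>u ^ k\<close> with k = d - 1 turns the radial Laplacian into
      the derivative of \<open>u ^ k * m1 u\<close>, so that the inequality can be integrated from
      0.\<close>
    define \<psi> where "\<psi> u = \<sigma> * (u ^ k * m1 u) - bb * u ^ Suc k / d" for u
    have "\<psi> 0 \<le> \<psi> \<tau>"
    proof (rule DERIV_nonneg_imp_increasing_open[where f = \<psi> and a = 0 and b = \<tau>])
      show "continuous_on {0..\<tau>} \<psi>"
        unfolding \<psi>_def
        using that d1 by (intro continuous_intros continuous_on_subset[OF cont_m(2)]) auto
      fix u assume u: "0 < u" "u < \<tau>"
      have "(\<psi> has_real_derivative \<sigma> * (real k * u ^ (k - 1) * m1 u + u ^ k * m2 u) - bb * u ^ k) (at u)"
      proof -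
        have d1: "(m1 has_real_derivative m2 u) (at u)" using u that by (intro dm1) auto
        have "((\<lambda>u. \<sigma> * (u ^ k * m1 u)) has_real_derivative \<sigma> * (real k * u ^ (k - 1) * m1 u + m2 u * u ^ k)) (at u)"
          using DERIV_cmult[OF DERIV_mult[OF DERIV_pow[of k u] d1], of \<sigma>] by simp
        from DERIV_diff[OF this DERIV_cdivide[OF DERIV_cmult[OF DERIV_pow[of "Suc k" u], of bb], of d]]
        show ?thesis unfolding \<psi>_def
          by (rule DERIV_cong) (simp add: dk mult.commute add_ac)
      qed
      moreover have "\<sigma> * (real k * u ^ (k - 1) * m1 u + u ^ k * m2 u) - bb * u ^ k \<ge> 0"
      proof -
        have r: "\<sigma> * (real k * m1 u + u * m2 u) - bb * u \<ge> 0"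
          using radial[of u] u that by (simp add: dk)
        have "u * (\<sigma> * (real k * u ^ (k - 1) * m1 u + u ^ k * m2 u) - bb * u ^ k)
            = u ^ k * (\<sigma> * (real k * m1 u + u * m2 u) - bb * u)"
          by (cases k) (simp_all add: algebra_simps)
        also have "\<dots> \<ge> 0" using r u by simp
        finally show ?thesis using u by (simp add: zero_le_mult_iff)
      qed
      ultimately show "\<exists>y. (\<psi> has_real_derivative y) (at u) \<and> y \<ge> 0" by blast
    qed (use that in auto)
    moreover have "\<psi> 0 = 0" using m1_0 by (simp add: \<psi>_def)
    ultimately have "0 \<le> \<psi> \<tau>" by simp
    then have "\<tau> ^ k * (bb * \<tau> / d) \<le> \<tau> ^ k * (\<sigma> * m1 \<tau>)"
      by (simp add: \<psi>_def algebra_simps)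
    then show ?thesis using that by (simp only: mult_le_cancel_left_pos zero_less_power)
  qed
  define \<phi> where "\<phi> u = \<sigma> * m u - bb / (2 * d) * u\<^sup>2" for u
  have "\<phi> 0 \<le> \<phi> \<tau>"
  proof (rule DERIV_nonneg_imp_increasing_open[where f = \<phi> and a = 0 and b = \<tau>])
    show "continuous_on {0..\<tau>} \<phi>"
      unfolding \<phi>_def
      using \<tau> by (intro continuous_intros continuous_on_subset[OF cont_m(1)]) auto
    fix u assume u: "0 < u" "u < \<tau>"
    have "(\<phi> has_real_derivative \<sigma> * m1 u - bb * u / d) (at u)"
    proof -
      have dmu: "(m has_real_derivative m1 u) (at u)" using u \<tau> by (intro dm) auto
      from DERIV_diff[OF DERIV_cmult[OF dmu, of \<sigma>] DERIV_cmult[OF DERIV_pow[of 2 u], of "bb / (2 * d)"]]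
      show ?thesis unfolding \<phi>_def by (rule DERIV_cong) (simp add: mult.commute)
    qed
    moreover have "\<sigma> * m1 u - bb * u / d \<ge> 0" using m1_ge[of u] u \<tau> by simp
    ultimately show "\<exists>y. (\<phi> has_real_derivative y) (at u) \<and> y \<ge> 0" by blast
  qed (use \<tau> in auto)
  moreover have "m 0 = 1"
    using S.prob_space by (simp add: m_def f_def q_def)
  ultimately show ?thesis
    by (simp add: \<phi>_def bb_def L_def c_def m_def f_def q_def algebra_simps)
qed

text \<open>A rotation taking an axis to the direction of \<open>w\<close> and a scaling by
  \<open>norm w\<close> reduce this to \<open>sphere_mean_power_axis\<close>. The sign \<sigma> is 1
  for subharmonic powers and -1 for superharmonic ones, where p (p + 2 - d) is negative.\<close>

lemma sphere_mean_power:
  fixes w :: "real^'n::finite" and p \<sigma> \<rho> :: real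
  defines "d \<equiv> real CARD('n)"
  assumes p: "p \<ge> 0" and sg: "\<sigma> * (p * (p + 2 - d)) \<ge> 0" and w: "w \<noteq> 0" and \<rho>: "0 \<le> \<rho>" "\<rho> \<le> norm w / 2"
  shows "norm w powr (- p) * (\<sigma> + \<sigma> * (p * (p + 2 - d)) * (2/3) powr (p + 2) / (2 * d) * (\<rho> / norm w)\<^sup>2)
      \<le> \<sigma> * (\<integral>\<gamma>. norm (w + \<rho> *\<^sub>R \<gamma>) powr (- p) \<partial>uniform_sphere)"
proof -
  let ?S = "uniform_sphere :: (real^'n) measure"
  define i :: 'n where "i = undefined"
  define \<tau> where "\<tau> = \<rho> / norm w"
  have \<tau>: "0 \<le> \<tau>" "\<tau> \<le> 1/2"
  proof -
    show "0 \<le> \<tau>" using \<rho> by (simp add: \<tau>_def)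
    have "\<rho> / norm w \<le> (norm w / 2) / norm w" by (rule divide_right_mono) (use \<rho> in auto)
    then show "\<tau> \<le> 1/2" using w by (simp add: \<tau>_def)
  qed
  have \<rho>_eq: "\<rho> = norm w * \<tau>" using w by (simp add: \<tau>_def)
  obtain T :: "real^'n \<Rightarrow> real^'n"
    where T: "orthogonal_transformation T" "T (norm w *\<^sub>R axis i 1) = w"
    using orthogonal_transformation_exists[of "norm w *\<^sub>R axis i 1" w] by auto
  have lin: "linear T" using T(1) by (rule orthogonal_transformation_linear)
  have nT: "norm (T x) = norm x" for x using T(1) by (simp add: orthogonal_transformation)
  have [measurable]: "(\<lambda>\<gamma>::real^'n. \<gamma> $ k) \<in> borel_measurable borel" for k
    by (intro borel_measurable_continuous_onI continuous_intros)
  have [measurable]: "(\<lambda>\<gamma>::real^'n. \<gamma> $ k) \<in> borel_measurable ?S" for k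
    by (subst measurable_cong_sets[OF sets_uniform_sphere refl]) measurable
  have "(\<integral>\<gamma>. norm (w + \<rho> *\<^sub>R \<gamma>) powr (- p) \<partial>?S) = (\<integral>\<gamma>. norm (w + \<rho> *\<^sub>R T \<gamma>) powr (- p) \<partial>?S)"
    by (rule integral_uniform_sphere_orthogonal[OF T(1), of "\<lambda>\<gamma>. norm (w + \<rho> *\<^sub>R \<gamma>) powr (- p)", symmetric]) measurable
  also have "\<dots> = (\<integral>\<gamma>. norm w powr (- p) * (1 + 2 * \<tau> * (\<gamma> $ i) + \<tau>\<^sup>2) powr (- p / 2) \<partial>?S)"
  proof (rule integral_cong_AE)
    have [measurable]: "T \<in> borel_measurable borel"
      by (intro borel_measurable_continuous_onI linear_continuous_on linear_linear[THEN iffD2] lin)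
    show "(\<lambda>\<gamma>. norm (w + \<rho> *\<^sub>R T \<gamma>) powr (- p)) \<in> borel_measurable ?S"
      by (subst measurable_cong_sets[OF sets_uniform_sphere refl]) measurable
    show "AE \<gamma> in ?S. norm (w + \<rho> *\<^sub>R T \<gamma>) powr (- p) = norm w powr (- p) * (1 + 2 * \<tau> * (\<gamma> $ i) + \<tau>\<^sup>2) powr (- p / 2)"
      using AE_uniform_sphere_norm
    proof eventually_elim
      case (elim \<gamma>)
      have "w + \<rho> *\<^sub>R T \<gamma> = T (norm w *\<^sub>R axis i 1 + \<rho> *\<^sub>R \<gamma>)"
        using lin T(2) by (simp add: linear_add linear_cmul)
      also have "norm w *\<^sub>R axis i 1 + \<rho> *\<^sub>R \<gamma> = norm w *\<^sub>R (axis i 1 + \<tau> *\<^sub>R \<gamma>)"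
        by (simp add: \<rho>_eq algebra_simps)
      finally have n: "norm (w + \<rho> *\<^sub>R T \<gamma>) = norm w * norm (axis i 1 + \<tau> *\<^sub>R \<gamma>)" by (simp add: nT)
      have "\<gamma> \<bullet> \<gamma> = 1" using elim by (simp add: norm_eq_1)
      then have "(axis i 1 + \<tau> *\<^sub>R \<gamma>) \<bullet> (axis i 1 + \<tau> *\<^sub>R \<gamma>) = 1 + 2 * \<tau> * (\<gamma> $ i) + \<tau>\<^sup>2"
        by (simp add: inner_add_left inner_add_right inner_axis inner_axis' power2_eq_square distrib_left)
      moreover have "norm v powr (- p) = (v \<bullet> v) powr (- p / 2)" for v :: "real^'n"
      proof -
        have "norm v = (v \<bullet> v) powr (1/2)" by (simp add: norm_eq_sqrt_inner powr_half_sqrt)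
        then show ?thesis by (simp add: powr_powr)
      qed
      ultimately show ?case by (simp add: n powr_mult)
    qed
  qed measurable
  also have "\<dots> = norm w powr (- p) * (\<integral>\<gamma>. (1 + 2 * \<tau> * (\<gamma> $ i) + \<tau>\<^sup>2) powr (- p / 2) \<partial>?S)" by simp
  finally have "\<sigma> * (\<integral>\<gamma>. norm (w + \<rho> *\<^sub>R \<gamma>) powr (- p) \<partial>?S)
    = norm w powr (- p) * (\<sigma> * (\<integral>\<gamma>. (1 + 2 * \<tau> * (\<gamma> $ i) + \<tau>\<^sup>2) powr (- p / 2) \<partial>?S))" by simp
  also have "\<dots> \<ge> norm w powr (- p) * (\<sigma> + \<sigma> * (p * (p + 2 - d)) * (2/3) powr (p + 2) / (2 * d) * \<tau>\<^sup>2)"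
    unfolding d_def using sphere_mean_power_axis[OF p sg[unfolded d_def] \<tau>, of i]
    by (intro mult_left_mono) auto
  finally show ?thesis by (simp add: \<tau>_def)
qed

section \<open>Laminar sparsity\<close>

text \<open>The sets satisfying such bounds are the independent sets of a laminar matroid; this is its
  exchange property.\<close>

lemma laminar_exchange:
  fixes cell :: "nat \<Rightarrow> 'a \<Rightarrow> 'b" and cap :: "nat \<Rightarrow> nat"
  assumes refine: "\<And>k k' a b. k \<le> k' \<Longrightarrow> cell k' a = cell k' b \<Longrightarrow> cell k a = cell k b"
    and I: "finite I" "\<And>k c. k \<le> n \<Longrightarrow> card {z\<in>I. cell k z = c} \<le> cap k"
    and J: "finite J" "\<And>k c. k \<le> n \<Longrightarrow> card {z\<in>J. cell k z = c} \<le> cap k"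
  obtains L where "J \<subseteq> L" "L \<subseteq> I \<union> J" "\<And>k c. k \<le> n \<Longrightarrow> card {z\<in>L. cell k z = c} \<le> cap k"
    "card (I - L) \<le> card J"
proof -
  \<comment> \<open>A maximal member refills \<open>J\<close> with points of \<open>I\<close> as far
    as the caps permit.\<close>
  define Fam where "Fam = {L. J \<subseteq> L \<and> L \<subseteq> I \<union> J \<and> (\<forall>k\<le>n. \<forall>c. card {z\<in>L. cell k z = c} \<le> cap k)}"
  have "finite Fam"
    by (rule finite_subset[of _ "Pow (I \<union> J)"]) (use I J in \<open>auto simp: Fam_def\<close>)
  moreover have "J \<in> Fam" using J by (auto simp: Fam_def)
  ultimately obtain L where L: "L \<in> Fam" and max: "\<And>L'. L' \<in> Fam \<Longrightarrow> L \<subseteq> L' \<Longrightarrow> L' = L"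
    using finite_has_maximal[of Fam] by auto
  have JL: "J \<subseteq> L" "L \<subseteq> I \<union> J" and capL: "\<And>k c. k \<le> n \<Longrightarrow> card {z\<in>L. cell k z = c} \<le> cap k"
    using L by (auto simp: Fam_def)
  have finL: "finite L" using JL(2) I(1) J(1) finite_subset by blast
  \<comment> \<open>Only a cell that is already full can keep a point of \<open>I\<close> out of the
    maximal set.\<close>
  define tight where "tight k e \<longleftrightarrow> k \<le> n \<and> cap k \<le> card {z\<in>L. cell k z = cell k e}" for k e
  have ex_tight: "\<exists>k. tight k e" if e: "e \<in> I - L" for e
  proof (rule ccontr)
    assume no: "\<nexists>k. tight k e"
    have "insert e L \<in> Fam"
      unfolding Fam_def
    proof (intro CollectI conjI allI impI)
      fix k c assume k: "k \<le> n"
      show "card {z \<in> insert e L. cell k z = c} \<le> cap k"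
      proof (cases "cell k e = c")
        case True
        then have "{z \<in> insert e L. cell k z = c} = insert e {z\<in>L. cell k z = c}" by auto
        then have "card {z \<in> insert e L. cell k z = c} \<le> Suc (card {z\<in>L. cell k z = c})"
          using finL by (simp add: card_insert_if)
        moreover have "card {z\<in>L. cell k z = c} < cap k"
        proof -
          have "\<not> tight k e" using no by blast
          then show ?thesis using k True by (simp add: tight_def)
        qed
        ultimately show ?thesis by simp
      next
        case False
        then have "{z \<in> insert e L. cell k z = c} = {z\<in>L. cell k z = c}" by auto
        then show ?thesis using capL[OF k] by simp
      qed
    qed (use JL e in auto)
    then have "insert e L = L" by (rule max) auto
    then show False using e by auto
  qed
  \<comment> \<open>The coarsest full cell around \<open>e\<close>. Because cells are nested, two
    such cells coincide or are disjoint.\<close>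
  define lev where "lev e = (LEAST k. tight k e)" for e
  have lev: "tight (lev e) e" if "e \<in> I - L" for e
    unfolding lev_def using ex_tight[OF that] by (rule LeastI_ex)
  define blk where "blk e = {z. cell (lev e) z = cell (lev e) e}" for e
  have same: "blk e = blk e'"
    if e: "e \<in> I - L" "e' \<in> I - L" and z: "z \<in> blk e" "z \<in> blk e'" and le: "lev e \<le> lev e'" for e e' z
  proof -
    have c: "cell (lev e) e' = cell (lev e) e"
      using z refine[OF le, of z e'] by (simp add: blk_def)
    have "tight (lev e) e'" using lev[OF e(1)] by (simp add: tight_def c)
    then have "lev e' \<le> lev e" unfolding lev_def[of e'] by (rule Least_le)
    then have "lev e' = lev e" using le by simp
    then show ?thesis by (simp add: blk_def c)
  qed
  have disj: "disjoint (blk ` (I - L))"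
  proof (rule disjointI, clarify)
    fix e e' assume e: "e \<in> I" "e \<notin> L" "e' \<in> I" "e' \<notin> L" and ne: "blk e \<noteq> blk e'"
    show "blk e \<inter> blk e' = {}"
    proof (rule ccontr)
      assume "blk e \<inter> blk e' \<noteq> {}"
      then obtain z where "z \<in> blk e" "z \<in> blk e'" by auto
      then show False using same[of e e' z] same[of e' e z] e ne by (cases "lev e \<le> lev e'") auto
    qed
  qed
  define Bs where "Bs = blk ` (I - L)"
  have finB: "finite Bs" using I(1) by (simp add: Bs_def)
  \<comment> \<open>In a full cell \<open>L\<close> has all the points the cap allows, so
    \<open>I\<close> has no more than \<open>L\<close> there. What \<open>I\<close> loses is made up
    by points of \<open>L - I\<close>, hence of \<open>J\<close>.\<close>
  have local: "card ((I - L) \<inter> b) \<le> card ((L - I) \<inter> b)" if "b \<in> Bs" for b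
  proof -
    obtain e where e: "e \<in> I - L" and b: "b = blk e" using \<open>b \<in> Bs\<close> unfolding Bs_def by blast
    have t: "lev e \<le> n" "cap (lev e) \<le> card {z\<in>L. cell (lev e) z = cell (lev e) e}"
      using lev[OF e] by (auto simp: tight_def)
    have "card (I \<inter> b) \<le> card (L \<inter> b)"
    proof -
      have "I \<inter> b = {z\<in>I. cell (lev e) z = cell (lev e) e}" "L \<inter> b = {z\<in>L. cell (lev e) z = cell (lev e) e}"
        by (auto simp: b blk_def)
      then show ?thesis using order_trans[OF I(2)[OF t(1), of "cell (lev e) e"] t(2)] by simp
    qed
    moreover have "card (I \<inter> b) = card (I \<inter> L \<inter> b) + card ((I - L) \<inter> b)"
    proof -
      have "I \<inter> b = (I \<inter> L \<inter> b) \<union> ((I - L) \<inter> b)" by auto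
      moreover have "card ((I \<inter> L \<inter> b) \<union> ((I - L) \<inter> b)) = card (I \<inter> L \<inter> b) + card ((I - L) \<inter> b)"
        using I(1) by (intro card_Un_disjoint) auto
      ultimately show ?thesis by simp
    qed
    moreover have "card (L \<inter> b) = card (I \<inter> L \<inter> b) + card ((L - I) \<inter> b)"
    proof -
      have "L \<inter> b = (I \<inter> L \<inter> b) \<union> ((L - I) \<inter> b)" by auto
      moreover have "card ((I \<inter> L \<inter> b) \<union> ((L - I) \<inter> b)) = card (I \<inter> L \<inter> b) + card ((L - I) \<inter> b)"
        using finL by (intro card_Un_disjoint) auto
      ultimately show ?thesis by simp
    qed
    ultimately show ?thesis by simp
  qed
  have "card (I - L) = card (\<Union>b\<in>Bs. (I - L) \<inter> b)"
    by (rule arg_cong[where f = card]) (auto simp: Bs_def blk_def)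
  also have "\<dots> = (\<Sum>b\<in>Bs. card ((I - L) \<inter> b))"
    using disj finB I(1) by (intro card_UN_disjoint) (auto simp: Bs_def disjoint_def)
  also have "\<dots> \<le> (\<Sum>b\<in>Bs. card ((L - I) \<inter> b))"
    by (rule sum_mono) (rule local)
  also have "\<dots> = card (\<Union>b\<in>Bs. (L - I) \<inter> b)"
    using disj finB finL by (intro card_UN_disjoint[symmetric]) (auto simp: Bs_def disjoint_def)
  also have "\<dots> \<le> card J"
    using JL J(1) by (intro card_mono) auto
  finally have "card (I - L) \<le> card J" .
  with JL capL show ?thesis using that by blast
qed

section \<open>Dyadic cubes and discrete Frostman sets\<close>

definition cell :: "nat \<Rightarrow> real^'n::finite \<Rightarrow> 'n \<Rightarrow> int" where
  "cell k z = (\<lambda>i. \<lfloor>2 ^ k * z $ i\<rfloor>)"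

text \<open>The floor of a quotient by a positive integer is the integer quotient of the floor, so
  the coarse index is determined by the fine one.\<close>

lemma cell_refine:
  fixes a b :: "real^'n::finite"
  assumes "k \<le> k'" "cell k' a = cell k' b"
  shows "cell k a = cell k b"
proof -
  have "cell k z i = cell k' z i div 2 ^ (k' - k)" for z :: "real^'n" and i
  proof -
    have "(2::real) ^ k' = 2 ^ k * 2 ^ (k' - k)" using assms(1) by (simp add: power_add[symmetric])
    then have "2 ^ k * z $ i = (2 ^ k' * z $ i) / real_of_int (2 ^ (k' - k))" by simp
    then show ?thesis unfolding cell_def by (simp only: floor_divide_real_eq_div zero_le_power zero_le_numeral)
  qed
  then show ?thesis using assms(2) by (simp add: fun_eq_iff)
qed

text \<open>Discrete Frostman condition: \<open>I\<close> puts a multiple \<open>2\<^sup>-\<^sup>n\<^sup>s\<close> of counting measure on at most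
  \<open>\<ell>(Q)\<^sup>s\<close> in each dyadic cube \<open>Q\<close> of side \<open>\<ell>(Q) = 2\<^sup>-\<^sup>k \<ge> 2\<^sup>-\<^sup>n\<close>.\<close>

definition dyadic_sparse :: "nat \<Rightarrow> nat \<Rightarrow> (real^'n::finite) set \<Rightarrow> bool" where
  "dyadic_sparse n s I \<longleftrightarrow>
     finite I \<and> (\<forall>k\<le>n. \<forall>c. card {z\<in>I. cell k z = c} \<le> 2 ^ ((n - k) * s))"

lemma dyadic_sparse_exchange:
  assumes I: "dyadic_sparse n s I" and J: "dyadic_sparse n s J"
  obtains L where "J \<subseteq> L" "L \<subseteq> I \<union> J" "dyadic_sparse n s L" "card (I - L) \<le> card J"
proof (rule laminar_exchange[of cell I n "\<lambda>k. 2 ^ ((n - k) * s)" J])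
  show "\<And>k k' (a :: real^'a) b. k \<le> k' \<Longrightarrow> cell k' a = cell k' b \<Longrightarrow> cell k a = cell k b"
    by (rule cell_refine)
next
  fix L assume L: "J \<subseteq> L" "L \<subseteq> I \<union> J"
    "\<And>k c. k \<le> n \<Longrightarrow> card {z\<in>L. cell k z = c} \<le> 2 ^ ((n - k) * s)" "card (I - L) \<le> card J"
  have "finite L" using L(2) I J finite_subset[of L "I \<union> J"] by (auto simp: dyadic_sparse_def)
  then show thesis using L that by (simp add: dyadic_sparse_def)
qed (use I J in \<open>auto simp: dyadic_sparse_def\<close>)

text \<open>An open ball of radius 2^(-k) meets only the level \<open>k\<close> cube of its centre
  and the adjacent ones, at most 3^d cubes.\<close>

lemma dyadic_sparse_ball:
  fixes I :: "(real^'n::finite) set"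
  assumes I: "dyadic_sparse n s I" and k: "k \<le> n"
  shows "card {z\<in>I. dist y z < 1 / 2 ^ k} \<le> 3 ^ CARD('n) * 2 ^ ((n - k) * s)"
proof -
  define P where "P = PiE (UNIV :: 'n set) (\<lambda>i. {cell k y i - 1 .. cell k y i + 1})"
  have cP: "card P = 3 ^ CARD('n)" by (simp add: P_def card_PiE)
  have fP: "finite P" by (simp add: P_def finite_PiE)
  have "cell k z \<in> P" if "dist y z < 1 / 2 ^ k" for z
    unfolding P_def
  proof (rule PiE_I)
    fix i
    have "\<bar>y $ i - z $ i\<bar> < 1 / 2 ^ k"
      using that component_le_norm_cart[of "y - z" i] by (simp add: dist_norm)
    moreover have "\<bar>2 ^ k * y $ i - 2 ^ k * z $ i\<bar> = 2 ^ k * \<bar>y $ i - z $ i\<bar>"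
      by (simp add: abs_mult flip: right_diff_distrib)
    ultimately have "\<bar>2 ^ k * y $ i - 2 ^ k * z $ i\<bar> < 1"
      by (simp add: pos_less_divide_eq mult.commute)
    then have "2 ^ k * z $ i \<le> 2 ^ k * y $ i + 1" "2 ^ k * y $ i - 1 \<le> 2 ^ k * z $ i" by linarith+
    then have "\<lfloor>2 ^ k * z $ i\<rfloor> \<le> \<lfloor>2 ^ k * y $ i + 1\<rfloor>" "\<lfloor>2 ^ k * y $ i - 1\<rfloor> \<le> \<lfloor>2 ^ k * z $ i\<rfloor>"
      by - (rule floor_mono; assumption)+
    then show "cell k z i \<in> {cell k y i - 1 .. cell k y i + 1}" by (simp add: cell_def)
  qed auto
  then have sub: "{z\<in>I. dist y z < 1 / 2 ^ k} \<subseteq> (\<Union>c\<in>P. {z\<in>I. cell k z = c})" by auto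
  have fin: "finite I" using I by (simp add: dyadic_sparse_def)
  have "card {z\<in>I. dist y z < 1 / 2 ^ k} \<le> card (\<Union>c\<in>P. {z\<in>I. cell k z = c})"
    using fin sub by (intro card_mono finite_subset[OF _ fin]) auto
  also have "\<dots> \<le> (\<Sum>c\<in>P. card {z\<in>I. cell k z = c})" using fP by (rule card_UN_le)
  also have "\<dots> \<le> (\<Sum>c\<in>P. 2 ^ ((n - k) * s))"
    using I k by (intro sum_mono) (auto simp: dyadic_sparse_def)
  finally show ?thesis by (simp add: cP)
qed

section \<open>Energy of sparse subsets\<close>

text \<open>A kernel vanishing from distance 1 on sees a bounded amount of any sparse set, so
  potentials stay bounded although the complement of \<Omega> is unbounded. Continuity makes
  superlevel sets of potentials open; monotonicity lets the exchange argument compare points by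
  their distance alone.\<close>

locale energy_kernel =
  fixes K :: "real \<Rightarrow> real"
  assumes antimono_K: "antimono K"
    and cont_K: "continuous_on UNIV K"
    and nonneg_K: "0 \<le> K t"
    and zero_K: "1 \<le> t \<Longrightarrow> K t = 0"
begin

definition pot :: "nat \<Rightarrow> nat \<Rightarrow> (real^'n::finite) set \<Rightarrow> real^'n \<Rightarrow> real" where
  "pot n s I y = (\<Sum>z\<in>I. K (dist y z)) / 2 ^ (n * s)"

definition energy :: "nat \<Rightarrow> nat \<Rightarrow> (real^'n::finite) set \<Rightarrow> real^'n \<Rightarrow> real" where
  "energy n s E y = (SUP I\<in>{I. dyadic_sparse n s I \<and> I \<subseteq> E}. pot n s I y)"

lemma K_le: "t \<le> t' \<Longrightarrow> K t' \<le> K t"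
  using antimono_K by (rule antimonoD)

lemma pot_nonneg: "0 \<le> pot n s I y"
  by (simp add: pot_def sum_nonneg nonneg_K)

lemma pot_bound_crude:
  fixes I :: "(real^'n::finite) set"
  assumes I: "dyadic_sparse n s I"
  shows "pot n s I y \<le> 3 ^ CARD('n) * K 0"
proof -
  have fin: "finite I" using I by (simp add: dyadic_sparse_def)
  have "(\<Sum>z\<in>I. K (dist y z)) \<le> (\<Sum>z\<in>I. if dist y z < 1 / 2 ^ 0 then K 0 else 0)"
    by (rule sum_mono) (auto intro: K_le simp: zero_K)
  also have "\<dots> = real (card {z\<in>I. dist y z < 1 / 2 ^ 0}) * K 0"
    by (simp add: sum.inter_filter[OF fin, symmetric])
  also have "\<dots> \<le> real (3 ^ CARD('n) * 2 ^ ((n - 0) * s)) * K 0"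
    using dyadic_sparse_ball[OF I, of 0 y] nonneg_K by (intro mult_right_mono of_nat_mono) auto
  finally show ?thesis by (simp add: pot_def pos_divide_le_eq mult_ac)
qed

text \<open>Split by dyadic shells around \<open>y\<close>: a point at distance between 2^(-k-1) and
  2^(-k) contributes at most the kernel at the inner radius, and sparsity bounds the number of
  points within the outer one. Below the finest scale the value \<open>K 0\<close> is used.\<close>

lemma pot_bound_shells:
  fixes I :: "(real^'n::finite) set"
  assumes I: "dyadic_sparse n s I"
  shows "pot n s I y \<le> 3 ^ CARD('n) * ((\<Sum>k<n. K (1 / 2 ^ Suc k) / 2 ^ (k * s)) + K 0 / 2 ^ (n * s))"
proof -
  have fin: "finite I" using I by (simp add: dyadic_sparse_def)
  define N where "N k = real (card {z\<in>I. dist y z < 1 / 2 ^ k})" for k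
  have pw: "K (dist y z) \<le> (\<Sum>k<n. if dist y z < 1 / 2 ^ k then K (1 / 2 ^ Suc k) else 0)
      + (if dist y z < 1 / 2 ^ n then K 0 else 0)" for z
  proof (cases "dist y z < 1 / 2 ^ n")
    case True
    have "0 \<le> (\<Sum>k<n. if dist y z < 1 / 2 ^ k then K (1 / 2 ^ Suc k) else 0)"
      by (intro sum_nonneg) (simp add: nonneg_K)
    then show ?thesis using True K_le[of 0 "dist y z"] by simp
  next
    case False
    show ?thesis
    proof (cases "dist y z < 1")
      case lt1: True
      \<comment> \<open>The first scale that separates \<open>z\<close> from \<open>y\<close>
        identifies the shell of \<open>z\<close>.\<close>
      define j where "j = (LEAST k. \<not> dist y z < 1 / 2 ^ k)"
      have j: "\<not> dist y z < 1 / 2 ^ j" unfolding j_def using False by (rule LeastI)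
      have "j \<noteq> 0" using j lt1 by (cases j) auto
      then obtain k where k: "j = Suc k" by (cases j) auto
      have lt: "dist y z < 1 / 2 ^ k"
        using not_less_Least[of k "\<lambda>k. \<not> dist y z < 1 / 2 ^ k"] k j_def by auto
      have "j \<le> n" unfolding j_def using False by (rule Least_le)
      then have kn: "k < n" using k by simp
      have "K (dist y z) \<le> (if dist y z < 1 / 2 ^ k then K (1 / 2 ^ Suc k) else 0)"
        using j lt k by (auto intro: K_le)
      also have "\<dots> \<le> (\<Sum>k<n. if dist y z < 1 / 2 ^ k then K (1 / 2 ^ Suc k) else 0)"
        using kn by (intro member_le_sum) (auto simp: nonneg_K)
      finally show ?thesis using False by simp
    next
      case False
      then have "K (dist y z) = 0" by (simp add: zero_K)
      moreover have "0 \<le> (\<Sum>k<n. if dist y z < 1 / 2 ^ k then K (1 / 2 ^ Suc k) else 0)"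
        by (intro sum_nonneg) (simp add: nonneg_K)
      ultimately show ?thesis by (simp add: nonneg_K)
    qed
  qed
  have cnt: "(\<Sum>z\<in>I. if dist y z < 1 / 2 ^ k then c else 0) = N k * c" for k and c :: real
    by (simp add: sum.inter_filter[OF fin, symmetric] N_def)
  have Nle: "N k \<le> 3 ^ CARD('n) * 2 ^ ((n - k) * s)" if "k \<le> n" for k
    using of_nat_mono[OF dyadic_sparse_ball[OF I that, of y], where 'a = real] by (simp add: N_def)
  have "(\<Sum>z\<in>I. K (dist y z)) \<le> (\<Sum>z\<in>I. (\<Sum>k<n. if dist y z < 1 / 2 ^ k then K (1 / 2 ^ Suc k) else 0)
      + (if dist y z < 1 / 2 ^ n then K 0 else 0))"
    by (rule sum_mono) (rule pw)
  also have "\<dots> = (\<Sum>k<n. N k * K (1 / 2 ^ Suc k)) + N n * K 0"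
    by (simp only: sum.distrib sum.swap[of _ "{..<n}"] cnt)
  also have "\<dots> \<le> (\<Sum>k<n. 3 ^ CARD('n) * 2 ^ ((n - k) * s) * K (1 / 2 ^ Suc k)) + 3 ^ CARD('n) * 2 ^ ((n - n) * s) * K 0"
    by (intro add_mono sum_mono mult_right_mono Nle nonneg_K) auto
  also have "\<dots> = 2 ^ (n * s) * (3 ^ CARD('n) * ((\<Sum>k<n. K (1 / 2 ^ Suc k) / 2 ^ (k * s)) + K 0 / 2 ^ (n * s)))"
  proof -
    have "(2::real) ^ ((n - k) * s) = 2 ^ (n * s) / 2 ^ (k * s)" if "k < n" for k
      using that by (simp add: power_diff diff_mult_distrib)
    then have "(\<Sum>k<n. 3 ^ CARD('n) * 2 ^ ((n - k) * s) * K (1 / 2 ^ Suc k))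
        = 2 ^ (n * s) * (3 ^ CARD('n) * (\<Sum>k<n. K (1 / 2 ^ Suc k) / 2 ^ (k * s)))"
      by (simp add: sum_distrib_left mult_ac)
    then show ?thesis by (simp add: distrib_left mult_ac)
  qed
  finally show ?thesis by (simp add: pot_def pos_divide_le_eq mult.commute)
qed

lemma sparse_empty: "dyadic_sparse n s {}"
  by (simp add: dyadic_sparse_def)

lemma bdd_above_pot:
  "bdd_above ((\<lambda>I. pot n s I y) ` {I. dyadic_sparse n s I \<and> I \<subseteq> (E :: (real^'n::finite) set)})"
  by (rule bdd_aboveI2[where M = "3 ^ CARD('n) * K 0"]) (auto intro: pot_bound_crude)

lemma pot_le_energy: "dyadic_sparse n s I \<Longrightarrow> I \<subseteq> E \<Longrightarrow> pot n s I y \<le> energy n s E y"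
  unfolding energy_def by (rule cSUP_upper[OF _ bdd_above_pot]) auto

lemma energy_nonneg: "0 \<le> energy n s E y"
  using order_trans[OF pot_nonneg pot_le_energy[OF sparse_empty]] by simp

lemma energy_le:
  assumes "\<And>I. dyadic_sparse n s I \<Longrightarrow> pot n s I y \<le> B"
  shows "energy n s E y \<le> B"
  unfolding energy_def by (rule cSUP_least) (use sparse_empty assms in auto)

lemma energy_attained:
  assumes "0 < e"
  obtains I where "dyadic_sparse n s I" "I \<subseteq> E" "energy n s E y - e < pot n s I y"
proof -
  have "energy n s E y - e < (SUP I\<in>{I. dyadic_sparse n s I \<and> I \<subseteq> E}. pot n s I y)"
    using assms by (simp add: energy_def)
  then show ?thesis using that
    by (subst (asm) less_cSUP_iff[OF _ bdd_above_pot]) (use sparse_empty in auto)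
qed

lemma less_energy_iff:
  "a < energy n s E y \<longleftrightarrow> (\<exists>I. dyadic_sparse n s I \<and> I \<subseteq> E \<and> a < pot n s I y)"
proof
  assume "a < energy n s E y"
  then have "0 < energy n s E y - a" by simp
  then obtain I where "dyadic_sparse n s I" "I \<subseteq> E" "energy n s E y - (energy n s E y - a) < pot n s I y"
    by (rule energy_attained)
  then show "\<exists>I. dyadic_sparse n s I \<and> I \<subseteq> E \<and> a < pot n s I y" by auto
qed (use pot_le_energy less_le_trans in blast)

lemma continuous_pot: "continuous_on UNIV (pot n s I)"
proof -
  have "continuous_on UNIV (\<lambda>y. K (dist y z))" for z :: "real^'a"
    by (rule continuous_on_compose2[OF cont_K]) (auto intro!: continuous_intros)
  then show ?thesis unfolding pot_def by (intro continuous_intros) auto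
qed

text \<open>The supremum is over uncountably many sets, but it is lower semicontinuous: superlevel
  sets are unions of open sets.\<close>

lemma energy_measurable [measurable]: "energy n s E \<in> borel_measurable borel"
proof (rule borel_measurableI_greater)
  fix a
  have "{y \<in> space borel. a < energy n s E y} = (\<Union>I\<in>{I. dyadic_sparse n s I \<and> I \<subseteq> E}. {y. a < pot n s I y})"
    by (auto simp: less_energy_iff)
  moreover have "open {y. a < pot n s I y}" for I :: "(real^'a) set"
    by (intro open_Collect_less continuous_intros continuous_pot)
  ultimately show "{y \<in> space borel. a < energy n s E y} \<in> sets borel"
    by (auto intro!: borel_open)
qed

lemma integrable_energy:
  "integrable uniform_sphere (\<lambda>\<gamma>. energy n s E (y + \<rho> *\<^sub>R \<gamma>))"
proof (rule integrable_uniform_sphere_bounded[where B = "3 ^ CARD('a) * K 0"])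
  show "\<bar>energy n s E (y + \<rho> *\<^sub>R \<gamma>)\<bar> \<le> 3 ^ CARD('a) * K 0" for \<gamma> :: "real^'a"
    using energy_nonneg[of n s E "y + \<rho> *\<^sub>R \<gamma>"] energy_le[OF pot_bound_crude, of n s E "y + \<rho> *\<^sub>R \<gamma>"] by simp
qed measurable

lemma integrable_K:
  "integrable uniform_sphere (\<lambda>\<gamma>. K (norm (w + \<rho> *\<^sub>R \<gamma>)))" (is ?int)
proof (rule integrable_uniform_sphere_bounded[where B = "K 0"])
  have "K \<in> borel_measurable borel" by (rule borel_measurable_continuous_onI[OF cont_K])
  then show "(\<lambda>\<gamma>::real^'a. K (norm (w + \<rho> *\<^sub>R \<gamma>))) \<in> borel_measurable borel" by measurable
qed (auto simp: nonneg_K intro: K_le)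

text \<open>The set \<open>I\<close> stays fixed while the point moves over the sphere; at each
  position its potential is a lower bound for the energy.\<close>

lemma energy_mean_ge:
  assumes I: "dyadic_sparse n s I" "I \<subseteq> E"
  shows "(\<Sum>z\<in>I. \<integral>\<gamma>. K (norm ((y - z) + \<rho> *\<^sub>R \<gamma>)) \<partial>uniform_sphere) / 2 ^ (n * s)
    \<le> (\<integral>\<gamma>. energy n s E (y + \<rho> *\<^sub>R \<gamma>) \<partial>uniform_sphere)"
proof -
  have eq: "K (norm ((y - z) + \<rho> *\<^sub>R \<gamma>)) = K (dist (y + \<rho> *\<^sub>R \<gamma>) z)" for z \<gamma>
    by (simp add: dist_norm algebra_simps)
  have ints: "integrable uniform_sphere (\<lambda>\<gamma>. pot n s I (y + \<rho> *\<^sub>R \<gamma>))"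
    unfolding pot_def eq[symmetric] by (intro integrable_divide Bochner_Integration.integrable_sum integrable_K)
  have "(\<Sum>z\<in>I. \<integral>\<gamma>. K (norm ((y - z) + \<rho> *\<^sub>R \<gamma>)) \<partial>uniform_sphere) / 2 ^ (n * s)
      = (\<integral>\<gamma>. pot n s I (y + \<rho> *\<^sub>R \<gamma>) \<partial>uniform_sphere)"
    unfolding pot_def eq[symmetric]
    by (subst integral_divide_zero, subst Bochner_Integration.integral_sum) (rule integrable_K refl)+
  also have "\<dots> \<le> (\<integral>\<gamma>. energy n s E (y + \<rho> *\<^sub>R \<gamma>) \<partial>uniform_sphere)"
    by (rule integral_mono[OF ints integrable_energy]) (rule pot_le_energy[OF I])
  finally show ?thesis .
qed

lemma energy_submean:
  assumes mean: "\<And>z. z \<in> E \<Longrightarrow> K (norm (y - z)) \<le> (\<integral>\<gamma>. K (norm ((y - z) + \<rho> *\<^sub>R \<gamma>)) \<partial>uniform_sphere)"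
  shows "energy n s E y \<le> (\<integral>\<gamma>. energy n s E (y + \<rho> *\<^sub>R \<gamma>) \<partial>uniform_sphere)"
proof (rule field_le_epsilon)
  fix e :: real assume "0 < e"
  then obtain I where I: "dyadic_sparse n s I" "I \<subseteq> E" "energy n s E y - e < pot n s I y"
    by (rule energy_attained)
  have "pot n s I y \<le> (\<Sum>z\<in>I. \<integral>\<gamma>. K (norm ((y - z) + \<rho> *\<^sub>R \<gamma>)) \<partial>uniform_sphere) / 2 ^ (n * s)"
    unfolding pot_def using mean I(2) by (intro divide_right_mono sum_mono) (auto simp: dist_norm)
  with energy_mean_ge[OF I(1,2), of y \<rho>] I(3)
  show "energy n s E y \<le> (\<integral>\<gamma>. energy n s E (y + \<rho> *\<^sub>R \<gamma>) \<partial>uniform_sphere) + e" by linarith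
qed

text \<open>A nearly optimal \<open>I\<close> carries more than \<open>\<theta> * card J\<close> points within \<open>8 * \<delta>\<close> of \<open>y\<close>: otherwise
  exchanging in \<open>J\<close> would raise the potential at \<open>y\<close>. Only these points are used for the gain.\<close>

lemma energy_drift:
  fixes E :: "(real^'n::finite) set"
  assumes \<delta>: "0 < \<delta>" "\<And>z. z \<in> E \<Longrightarrow> \<delta> \<le> dist y z"
    and mean: "\<And>w. \<delta> \<le> norm w \<Longrightarrow> K (norm w) \<le> (\<integral>\<gamma>. K (norm (w + \<rho> *\<^sub>R \<gamma>)) \<partial>(uniform_sphere :: (real^'n) measure))"
    and gain: "\<And>w. \<delta> \<le> norm w \<Longrightarrow> norm w \<le> 8 * \<delta> \<Longrightarrow>
        K (norm w) + G \<le> (\<integral>\<gamma>. K (norm (w + \<rho> *\<^sub>R \<gamma>)) \<partial>(uniform_sphere :: (real^'n) measure))"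
    and G: "0 \<le> G"
    and J: "dyadic_sparse n s J" "J \<subseteq> E" "\<And>z. z \<in> J \<Longrightarrow> dist y z \<le> 2 * \<delta>" "J \<noteq> {}"
    and \<theta>: "0 \<le> \<theta>" "\<theta> * K \<delta> + K (8 * \<delta>) < (1 - \<theta>) * K (2 * \<delta>)"
    and b: "b \<le> max 1 (\<theta> * card J)"
  shows "energy n s E y + b * G / 2 ^ (n * s) \<le> (\<integral>\<gamma>. energy n s E (y + \<rho> *\<^sub>R \<gamma>) \<partial>uniform_sphere)"
proof -
  define c where "c = real (card J)"
  have finJ: "finite J" using J(1) by (simp add: dyadic_sparse_def)
  have c: "c > 0" using J(4) finJ by (simp add: c_def card_gt_0_iff)
  \<comment> \<open>What the exchange would gain if at most \<theta> \<open>card J\<close> points of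
    \<open>I\<close> were near: at least (1 - \<theta>) \<open>card J\<close> new points bring
    \<open>K (2 * \<delta>)\<close> each, at most \<theta> \<open>card J\<close> removed near points
    cost \<open>K \<delta>\<close> each, and at most \<open>card J\<close> removed distant ones cost
    \<open>K (8 * \<delta>)\<close> each.\<close>
  define \<mu> where "\<mu> = c * ((1 - \<theta>) * K (2 * \<delta>) - \<theta> * K \<delta> - K (8 * \<delta>)) / 2 ^ (n * s)"
  have \<mu>: "\<mu> > 0" using c \<theta>(2) by (simp add: \<mu>_def)
  show ?thesis
  proof (rule field_le_epsilon)
    fix e :: real assume e: "0 < e"
    obtain I where I: "dyadic_sparse n s I" "I \<subseteq> E" "energy n s E y - min e (\<mu> / 2) < pot n s I y"
    proof -
      have "0 < min e (\<mu> / 2)" using e \<mu> by simp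
      then show ?thesis using that by (rule energy_attained)
    qed
    have finI: "finite I" using I(1) by (simp add: dyadic_sparse_def)
    define near where "near = {z\<in>I. dist y z \<le> 8 * \<delta>}"
    have fin_near: "finite near" using finI by (simp add: near_def)
    have many: "\<theta> * c < card near"
    proof (rule ccontr)
      assume "\<not> ?thesis"
      then have few: "card near \<le> \<theta> * c" by simp
      obtain L where L: "J \<subseteq> L" "L \<subseteq> I \<union> J" "dyadic_sparse n s L" "card (I - L) \<le> card J"
        using dyadic_sparse_exchange[OF I(1) J(1)] by blast
      let ?S = "\<lambda>A. \<Sum>z\<in>A. K (dist y z)"
      have LI: "L = (I \<inter> L) \<union> (J - I)" "I = (I \<inter> L) \<union> (I - L)" using L by auto
      have SL: "?S L = ?S (I \<inter> L) + ?S (J - I)"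
        by (subst LI(1), rule sum.union_disjoint) (use finI finJ in auto)
      have SI: "?S I = ?S (I \<inter> L) + ?S (I - L)"
        by (subst LI(2), rule sum.union_disjoint) (use finI in auto)
      \<comment> \<open>Points of \<open>J\<close> already in \<open>I\<close> bring nothing new,
        but they lie within 2 \<delta> and so are counted as near; hence there are few of them
        too.\<close>
      have sub_near: "J \<inter> I \<subseteq> near" using J(3) \<delta>(1) by (fastforce simp: near_def)
      have "card J \<le> card (J - I) + card near"
      proof -
        have "card J \<le> card ((J - I) \<union> (J \<inter> I))" by (intro card_mono) (use finJ in auto)
        also have "\<dots> \<le> card (J - I) + card (J \<inter> I)" by (rule card_Un_le)
        also have "card (J \<inter> I) \<le> card near" by (rule card_mono[OF fin_near sub_near])
        finally show ?thesis by simp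
      qed
      then have "c - \<theta> * c \<le> card (J - I)" using few by (simp add: c_def)
      then have "(1 - \<theta>) * c * K (2 * \<delta>) \<le> card (J - I) * K (2 * \<delta>)"
        using nonneg_K by (intro mult_right_mono) (auto simp: algebra_simps)
      also have "\<dots> = (\<Sum>z\<in>J - I. K (2 * \<delta>))" by simp
      also have "\<dots> \<le> ?S (J - I)" by (rule sum_mono) (use J(3) in \<open>auto intro: K_le\<close>)
      finally have added: "(1 - \<theta>) * c * K (2 * \<delta>) \<le> ?S (J - I)" .
      have "?S (I - L) \<le> (\<Sum>z\<in>I - L. (if z \<in> near then K \<delta> else 0) + K (8 * \<delta>))"
      proof (rule sum_mono)
        fix z assume z: "z \<in> I - L"
        show "K (dist y z) \<le> (if z \<in> near then K \<delta> else 0) + K (8 * \<delta>)"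
        proof (cases "z \<in> near")
          case True
          then show ?thesis using K_le[OF \<delta>(2), of z] I(2) z nonneg_K[of "8 * \<delta>"] by auto
        next
          case False
          then show ?thesis using z K_le[of "8 * \<delta>" "dist y z"] by (auto simp: near_def)
        qed
      qed
      also have "\<dots> = real (card ((I - L) \<inter> near)) * K \<delta> + real (card (I - L)) * K (8 * \<delta>)"
        using finI by (simp add: sum.distrib sum.If_cases)
      also have "\<dots> \<le> \<theta> * c * K \<delta> + c * K (8 * \<delta>)"
      proof (intro add_mono mult_right_mono nonneg_K)
        have "card ((I - L) \<inter> near) \<le> card near" using fin_near by (intro card_mono) auto
        then show "real (card ((I - L) \<inter> near)) \<le> \<theta> * c" using few by linarith
        show "real (card (I - L)) \<le> c" using L(4) by (simp add: c_def)
      qed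
      finally have removed: "?S (I - L) \<le> \<theta> * c * K \<delta> + c * K (8 * \<delta>)" .
      have "?S I + c * ((1 - \<theta>) * K (2 * \<delta>) - \<theta> * K \<delta> - K (8 * \<delta>)) \<le> ?S L"
        using added removed SL SI by (simp add: algebra_simps)
      then have "pot n s I y + \<mu> \<le> pot n s L y"
        by (simp add: pot_def \<mu>_def add_divide_distrib[symmetric] divide_right_mono)
      also have "\<dots> \<le> energy n s E y"
        by (rule pot_le_energy[OF L(3)]) (use L(2) I(2) J(2) in auto)
      finally show False using I(3) \<mu> by linarith
    qed
    have "0 \<le> \<theta> * c" using \<theta>(1) c by simp
    then have "0 < card near" using many by linarith
    \<comment> \<open>Being more than \<theta> \<open>card J\<close> \<ge> 0, the number of near
      points is at least 1; this is the only content of the bound for \<theta> = 0.\<close>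
    then have bn: "b \<le> card near" using many b by (auto simp: c_def)
    have "(\<Sum>z\<in>I. K (dist y z)) + card near * G = (\<Sum>z\<in>I. K (dist y z) + (if z \<in> near then G else 0))"
    proof -
      have "I \<inter> near = near" by (auto simp: near_def)
      then show ?thesis using finI by (simp add: sum.distrib sum.If_cases)
    qed
    also have "\<dots> \<le> (\<Sum>z\<in>I. \<integral>\<gamma>. K (norm ((y - z) + \<rho> *\<^sub>R \<gamma>)) \<partial>uniform_sphere)"
    proof (rule sum_mono)
      fix z assume z: "z \<in> I"
      then have "\<delta> \<le> norm (y - z)" using \<delta>(2) I(2) by (auto simp: dist_norm)
      then show "K (dist y z) + (if z \<in> near then G else 0) \<le> (\<integral>\<gamma>. K (norm ((y - z) + \<rho> *\<^sub>R \<gamma>)) \<partial>uniform_sphere)"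
        using mean[of "y - z"] gain[of "y - z"] by (auto simp: near_def dist_norm)
    qed
    finally have "((\<Sum>z\<in>I. K (dist y z)) + card near * G) / 2 ^ (n * s)
        \<le> (\<integral>\<gamma>. energy n s E (y + \<rho> *\<^sub>R \<gamma>) \<partial>uniform_sphere)"
      using energy_mean_ge[OF I(1,2), of y \<rho>] by (meson divide_right_mono order_trans zero_le_numeral zero_le_power)
    then have "pot n s I y + card near * G / 2 ^ (n * s) \<le> (\<integral>\<gamma>. energy n s E (y + \<rho> *\<^sub>R \<gamma>) \<partial>uniform_sphere)"
      by (simp add: pot_def add_divide_distrib)
    moreover have "b * G / 2 ^ (n * s) \<le> card near * G / 2 ^ (n * s)"
      using bn G by (intro divide_right_mono mult_right_mono) auto
    ultimately show "energy n s E y + b * G / 2 ^ (n * s)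
        \<le> (\<integral>\<gamma>. energy n s E (y + \<rho> *\<^sub>R \<gamma>) \<partial>uniform_sphere) + e"
      using I(3) by linarith
  qed
qed

end

section \<open>The expected number of steps\<close>

text \<open>The ball reaching up to the frontier is connected and misses the frontier, so it cannot
  leave \<Omega>.\<close>

lemma add_mem_of_less_infdist_frontier:
  fixes y :: "'a::real_normed_vector"
  assumes y: "y \<in> \<Omega>" and v: "norm v < infdist y (frontier \<Omega>)"
  shows "y + v \<in> \<Omega>"
proof (rule ccontr)
  assume n: "y + v \<notin> \<Omega>"
  let ?B = "ball y (infdist y (frontier \<Omega>))"
  have pos: "0 < infdist y (frontier \<Omega>)" using v norm_ge_zero[of v] by linarith
  have "y \<in> ?B \<inter> \<Omega>" using y pos by simp
  then have "?B \<inter> \<Omega> \<noteq> {}" by blast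
  moreover have "y + v \<in> ?B" using v by (simp add: dist_norm)
  then have "?B - \<Omega> \<noteq> {}" using n by auto
  ultimately have "?B \<inter> frontier \<Omega> \<noteq> {}" by (intro connected_Int_frontier) auto
  then obtain p where "p \<in> frontier \<Omega>" "dist y p < infdist y (frontier \<Omega>)" by auto
  then show False using infdist_le[of p "frontier \<Omega>" y] by simp
qed

section \<open>Optional stopping for the walk\<close>

context walk_on_spheres
begin

abbreviation X :: "nat \<Rightarrow> 'w \<Rightarrow> real^'n" where "X t \<equiv> wos_path x r \<gamma> t"

definition running :: "nat \<Rightarrow> 'w set" where
  "running t = {\<omega> \<in> space M. \<forall>i\<le>t. \<epsilon> \<le> infdist (X i \<omega>) (frontier \<Omega>)}"

lemma subalgebra_F_mono: "i \<le> j \<Longrightarrow> subalgebra (F j) (F i)"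
  using sets_F_mono[of i j] by (simp add: subalgebra_def space_F)

lemma measurable_X_F: "X t \<in> measurable (F t) borel"
proof (induction t)
  case 0
  show ?case by (simp add: measurable_const)
next
  case (Suc t)
  have sub: "subalgebra (F (Suc t)) (F t)" by (rule subalgebra_F_mono) simp
  have [measurable]: "X t \<in> measurable (F (Suc t)) borel" "r t \<in> measurable (F (Suc t)) borel"
    using measurable_from_subalg[OF sub] Suc measurable_estimate by auto
  have [measurable]: "\<gamma> t \<in> measurable (F (Suc t)) borel" by (rule measurable_direction)
  show ?case by simp
qed

lemma running_sets_F: "running t \<in> sets (F t)"
proof -
  have "{\<omega> \<in> space (F t). \<epsilon> \<le> infdist (X i \<omega>) (frontier \<Omega>)} \<in> sets (F t)" if "i \<le> t" for i
  proof -
    have "X i \<in> measurable (F t) borel"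
      using measurable_from_subalg[OF subalgebra_F_mono[OF that] measurable_X_F] .
    moreover have "(\<lambda>y::real^'n. infdist y (frontier \<Omega>)) \<in> borel_measurable borel"
      by (intro borel_measurable_continuous_onI continuous_intros)
    ultimately have "(\<lambda>\<omega>. infdist (X i \<omega>) (frontier \<Omega>)) \<in> borel_measurable (F t)"
      by (rule measurable_compose)
    from this[unfolded borel_measurable_iff_ge] show ?thesis by blast
  qed
  then have "(\<Inter>i\<in>{..t}. {\<omega> \<in> space (F t). \<epsilon> \<le> infdist (X i \<omega>) (frontier \<Omega>)}) \<in> sets (F t)"
    by (intro sets.finite_INT) auto
  moreover have "(\<Inter>i\<in>{..t}. {\<omega> \<in> space (F t). \<epsilon> \<le> infdist (X i \<omega>) (frontier \<Omega>)}) = running t"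
    unfolding running_def space_F by blast
  ultimately show ?thesis by (simp only:)
qed

lemma measurable_from_F: "f \<in> measurable (F t) N \<Longrightarrow> f \<in> measurable M N"
  using measurable_from_subalg[OF subalgebra_F] .

lemma running_sets [measurable]: "running t \<in> sets M"
  using running_sets_F[of t] subalgebra_F[of t] by (auto simp: subalgebra_def)

lemma measurable_X [measurable]: "X t \<in> measurable M borel"
  by (rule measurable_from_F[OF measurable_X_F])

lemma measurable_r [measurable]: "r t \<in> measurable M borel"
  by (rule measurable_from_F[OF measurable_estimate])

lemma measurable_\<gamma> [measurable]: "\<gamma> t \<in> measurable M borel"
  by (rule measurable_from_F[OF measurable_direction])

text \<open>Independence is assumed for the past and the events of the direction. Both systems are
  closed under intersection, so it passes to the generated sigma-algebras, and from there to all
  variables measurable with respect to them.\<close>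

lemma indep_var_direction:
  assumes Z: "Z \<in> measurable (F t) N" and f: "f \<in> measurable borel N'"
  shows "indep_var N Z N' (\<lambda>\<omega>. f (\<gamma> t \<omega>))"
proof -
  have ZM: "Z \<in> measurable M N" by (rule measurable_from_F[OF Z])
  have fM: "(\<lambda>\<omega>. f (\<gamma> t \<omega>)) \<in> measurable M N'" by (rule measurable_compose[OF measurable_\<gamma> f])
  let ?G = "{\<gamma> t -` A \<inter> space M | A. A \<in> sets borel}"
  have "Int_stable ?G"
  proof (rule Int_stableI)
    fix a b assume "a \<in> ?G" "b \<in> ?G"
    then obtain A B where "A \<in> sets borel" "B \<in> sets borel" "a = \<gamma> t -` A \<inter> space M" "b = \<gamma> t -` B \<inter> space M"
      by auto
    then show "a \<inter> b \<in> ?G" by (intro CollectI exI[of _ "A \<inter> B"]) auto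
  qed
  then have i1: "indep_set (sigma_sets (space M) (sets (F t))) (sigma_sets (space M) ?G)"
    using direction_indep_past[of t] by (intro indep_set_sigma_sets) (auto intro: sets.Int_stable)
  have sub: "sigma_sets (space M) {Z -` A \<inter> space M | A. A \<in> sets N} \<subseteq> sigma_sets (space M) (sets (F t))"
  proof (rule sigma_sets_mono')
    show "{Z -` A \<inter> space M | A. A \<in> sets N} \<subseteq> sets (F t)"
      using measurable_sets[OF Z] by (auto simp: space_F)
  qed
  have sub': "sigma_sets (space M) {(\<lambda>\<omega>. f (\<gamma> t \<omega>)) -` A \<inter> space M | A. A \<in> sets N'} \<subseteq> sigma_sets (space M) ?G"
  proof (rule sigma_sets_mono', clarify)
    fix A assume "A \<in> sets N'"
    then have "f -` A \<in> sets borel" using measurable_sets[OF f, of A] by simp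
    then show "\<exists>B. (\<lambda>\<omega>. f (\<gamma> t \<omega>)) -` A \<inter> space M = \<gamma> t -` B \<inter> space M \<and> B \<in> sets borel"
      by (intro exI[of _ "f -` A"]) auto
  qed
  have "indep_set (sigma_sets (space M) {Z -` A \<inter> space M | A. A \<in> sets N})
     (sigma_sets (space M) {(\<lambda>\<omega>. f (\<gamma> t \<omega>)) -` A \<inter> space M | A. A \<in> sets N'})"
    using i1 unfolding indep_set_def
    by (rule indep_sets_mono_sets) (use sub sub' in \<open>auto split: bool.split\<close>)
  then show ?thesis using ZM fM by (simp add: indep_var_eq)
qed

lemma integrable_running: "integrable M (indicator (running t) :: 'w \<Rightarrow> real)"
  by (intro integrable_real_indicator running_sets) (simp add: less_top[symmetric])

lemma AE_norm_direction: "AE \<omega> in M. \<forall>t. norm (\<gamma> t \<omega>) = 1"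
proof -
  have "AE \<omega> in M. norm (\<gamma> t \<omega>) = 1" for t
  proof -
    have "AE v in distr M borel (\<gamma> t). norm v = 1"
      unfolding distr_direction by (rule AE_uniform_sphere_norm)
    then show ?thesis by (subst (asm) AE_distr_iff) auto
  qed
  then show ?thesis by (simp add: AE_all_countable)
qed

lemma AE_running_mem:
  assumes "0 < \<beta>"
  shows "AE \<omega> in M. \<forall>t. \<omega> \<in> running t \<longrightarrow> X t \<omega> \<in> \<Omega> \<and> \<epsilon> \<le> infdist (X t \<omega>) (frontier \<Omega>) \<and>
     \<beta> * infdist (X t \<omega>) (frontier \<Omega>) < r t \<omega> \<and> r t \<omega> < infdist (X t \<omega>) (frontier \<Omega>)"
  using AE_norm_direction estimate
proof eventually_elim
  case (elim \<omega>)
  have est: "\<beta> * infdist (X t \<omega>) (frontier \<Omega>) < r t \<omega> \<and> r t \<omega> < infdist (X t \<omega>) (frontier \<Omega>)"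
    if "\<omega> \<in> running t" for t
    using elim(2) that by (auto simp: running_def)
  have "X t \<omega> \<in> \<Omega>" if "\<omega> \<in> running t" for t
    using that
  proof (induction t)
    case 0
    show ?case using start by simp
  next
    case (Suc t)
    then have run: "\<omega> \<in> running t" by (auto simp: running_def)
    note e = est[OF run]
    have "0 \<le> \<beta> * infdist (X t \<omega>) (frontier \<Omega>)" using assms by (simp add: infdist_nonneg)
    then have "0 \<le> r t \<omega>" using e by linarith
    then have "norm ((r t \<omega> / 2) *\<^sub>R \<gamma> t \<omega>) < infdist (X t \<omega>) (frontier \<Omega>)"
      using e elim(1) by simp
    from add_mem_of_less_infdist_frontier[OF Suc.IH[OF run] this] show ?case by simp
  qed
  with est show ?case by (auto simp: running_def)
qed

text \<open>The number of steps counts the times at which the walk is still running; for a walk that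
  never stops the sum is infinite.\<close>

lemma wos_steps_le_suminf:
  assumes "\<omega> \<in> space M"
  shows "wos_steps \<Omega> \<epsilon> x r \<gamma> \<omega> \<le> (\<Sum>t. indicator (running t) \<omega>)"
proof (cases "\<exists>t. infdist (X t \<omega>) (frontier \<Omega>) < \<epsilon>")
  case True
  define T where "T = (LEAST t. infdist (X t \<omega>) (frontier \<Omega>) < \<epsilon>)"
  have T: "infdist (X T \<omega>) (frontier \<Omega>) < \<epsilon>" unfolding T_def using True by (rule LeastI_ex)
  have run: "\<omega> \<in> running t" if "t < T" for t
  proof -
    have "\<epsilon> \<le> infdist (X i \<omega>) (frontier \<Omega>)" if "i \<le> t" for i
      using not_less_Least[of i "\<lambda>t. infdist (X t \<omega>) (frontier \<Omega>) < \<epsilon>"] that \<open>t < T\<close>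
      by (auto simp: T_def)
    then show ?thesis using assms by (simp add: running_def)
  qed
  have "wos_steps \<Omega> \<epsilon> x r \<gamma> \<omega> \<le> of_nat T"
    unfolding wos_steps_def using T by (intro INF_lower) auto
  also have "\<dots> = (\<Sum>t<T. indicator (running t) \<omega> :: ennreal)" using run by simp
  also have "\<dots> \<le> (\<Sum>t. indicator (running t) \<omega>)" by (intro sum_le_suminf) auto
  finally show ?thesis .
next
  case False
  then have "indicator (running t) \<omega> = (1::ennreal)" for t
    using assms by (auto simp: running_def not_less)
  then have "(\<Sum>t. indicator (running t) \<omega> :: ennreal) = (SUP n. of_nat n)"
    by (simp add: suminf_eq_SUP)
  then show ?thesis by (simp add: ennreal_SUP_of_nat_eq_top)
qed

text \<open>Position, estimate and running indicator are known before the direction is drawn, so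
  their joint law with the direction is a product measure. Fubini takes the place of conditional
  expectation: the drift inequality is applied to the inner integral over the sphere.\<close>

lemma expected_step_drift:
  assumes \<beta>: "0 < \<beta>"
    and \<Phi>: "\<Phi> \<in> borel_measurable borel" "\<And>y. 0 \<le> \<Phi> y" "\<And>y. \<Phi> y \<le> B"
    and drift: "\<And>y \<rho>. y \<in> \<Omega> \<Longrightarrow> \<epsilon> \<le> infdist y (frontier \<Omega>) \<Longrightarrow> \<beta> * infdist y (frontier \<Omega>) < \<rho> \<Longrightarrow>
        \<rho> < infdist y (frontier \<Omega>) \<Longrightarrow> \<Phi> y + 1 \<le> (\<integral>v. \<Phi> (y + (\<rho> / 2) *\<^sub>R v) \<partial>uniform_sphere)"
  shows "(\<integral>\<omega>. indicator (running t) \<omega> * \<Phi> (X t \<omega>) \<partial>M) + prob (running t)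
     \<le> (\<integral>\<omega>. indicator (running t) \<omega> * \<Phi> (X (Suc t) \<omega>) \<partial>M)"
proof -
  note [measurable] = \<Phi>(1)
  interpret S: prob_space "uniform_sphere :: (real^'n) measure" by (rule prob_space_uniform_sphere)
  define ind where "ind \<omega> = (indicator (running t) \<omega> :: real)" for \<omega>
  let ?N = "borel \<Otimes>\<^sub>M borel \<Otimes>\<^sub>M (borel :: real measure) :: ((real^'n) \<times> real \<times> real) measure"
  define Z where "Z \<omega> = (X t \<omega>, r t \<omega>, ind \<omega>)" for \<omega>
  have [measurable]: "X t \<in> measurable (F t) borel" "r t \<in> measurable (F t) borel"
    "running t \<in> sets (F t)"
    using measurable_X_F measurable_estimate running_sets_F by auto
  have "ind \<in> measurable (F t) borel" unfolding ind_def by measurable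
  then have ZF: "Z \<in> measurable (F t) ?N" unfolding Z_def by measurable
  then have ZM [measurable]: "Z \<in> measurable M ?N" by (rule measurable_from_F)
  define h where "h p = ennreal (snd (snd (fst p)) * \<Phi> (fst (fst p) + (fst (snd (fst p)) / 2) *\<^sub>R fst (snd p)))"
    for p :: "((real^'n) \<times> real \<times> real) \<times> (real^'n) \<times> real \<times> real"
  have h [measurable]: "h \<in> borel_measurable (?N \<Otimes>\<^sub>M ?N)" unfolding h_def by measurable
  \<comment> \<open>The two variables of \<open>indep_var\<close> take values in one type, so the
    direction is padded with zeros to the type of \<open>Z\<close>.\<close>
  define emb :: "real^'n \<Rightarrow> (real^'n) \<times> real \<times> real" where "emb v = (v, 0, 0)" for v
  have emb [measurable]: "emb \<in> measurable borel ?N" unfolding emb_def by measurable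
  have "distr M ?N (\<lambda>\<omega>. emb (\<gamma> t \<omega>)) = distr (distr M borel (\<gamma> t)) ?N emb"
    by (subst distr_distr) (auto simp: comp_def)
  then have joint: "distr M (?N \<Otimes>\<^sub>M ?N) (\<lambda>\<omega>. (Z \<omega>, emb (\<gamma> t \<omega>))) = distr M ?N Z \<Otimes>\<^sub>M distr uniform_sphere ?N emb"
    using indep_var_direction[OF ZF emb] by (simp add: indep_var_distribution_eq distr_direction)
  have embS [measurable]: "emb \<in> measurable uniform_sphere ?N"
    using emb by (simp add: measurable_cong_sets[OF sets_uniform_sphere refl])
  interpret SE: prob_space "distr uniform_sphere ?N emb" by (rule S.prob_space_distr) measurable
  have B0: "0 \<le> B" using order_trans[OF \<Phi>(2,3)] .
  have int\<Phi>: "integrable uniform_sphere (\<lambda>v. \<Phi> (y + (\<rho> / 2) *\<^sub>R v))" for y \<rho>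
    by (rule integrable_uniform_sphere_bounded[where B = B]) (use \<Phi> in auto)
  have bd: "\<bar>ind \<omega> * \<Phi> y\<bar> \<le> B" for \<omega> y
    using \<Phi>(2,3)[of y] B0 by (auto simp: ind_def indicator_def)
  have [measurable]: "ind \<in> borel_measurable M" unfolding ind_def by measurable
  have int1: "integrable M (\<lambda>\<omega>. ind \<omega> * \<Phi> (X (Suc t) \<omega>))"
    by (rule integrable_const_bound[where B = B]) (use bd in auto)
  have int2: "integrable M (\<lambda>\<omega>. ind \<omega> * \<Phi> (X t \<omega>))"
    by (rule integrable_const_bound[where B = B]) (use bd in auto)
  have int3: "integrable M (\<lambda>\<omega>. ind \<omega> * \<Phi> (X t \<omega>) + ind \<omega>)"
    by (rule Bochner_Integration.integrable_add[OF int2]) (simp add: ind_def integrable_running)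
  have "ennreal (\<integral>\<omega>. ind \<omega> * \<Phi> (X t \<omega>) + ind \<omega> \<partial>M) = (\<integral>\<^sup>+\<omega>. ennreal (ind \<omega> * \<Phi> (X t \<omega>) + ind \<omega>) \<partial>M)"
    by (rule nn_integral_eq_integral[symmetric, OF int3]) (use \<Phi>(2) in \<open>auto simp: ind_def\<close>)
  also have "\<dots> \<le> (\<integral>\<^sup>+\<omega>. (\<integral>\<^sup>+v. h (Z \<omega>, emb v) \<partial>uniform_sphere) \<partial>M)"
  proof (rule nn_integral_mono_AE)
    show "AE \<omega> in M. ennreal (ind \<omega> * \<Phi> (X t \<omega>) + ind \<omega>) \<le> (\<integral>\<^sup>+v. h (Z \<omega>, emb v) \<partial>uniform_sphere)"
      using AE_running_mem[OF \<beta>]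
    proof eventually_elim
      case (elim \<omega>)
      show ?case
      proof (cases "\<omega> \<in> running t")
        case True
        then have "\<Phi> (X t \<omega>) + 1 \<le> (\<integral>v. \<Phi> (X t \<omega> + (r t \<omega> / 2) *\<^sub>R v) \<partial>uniform_sphere)"
          using elim by (intro drift) auto
        then have "ennreal (\<Phi> (X t \<omega>) + 1) \<le> ennreal (\<integral>v. \<Phi> (X t \<omega> + (r t \<omega> / 2) *\<^sub>R v) \<partial>uniform_sphere)"
          by (rule ennreal_leI)
        also have "\<dots> = (\<integral>\<^sup>+v. ennreal (\<Phi> (X t \<omega> + (r t \<omega> / 2) *\<^sub>R v)) \<partial>uniform_sphere)"
          by (rule nn_integral_eq_integral[symmetric, OF int\<Phi>]) (use \<Phi>(2) in auto)
        finally show ?thesis using True by (simp add: ind_def h_def Z_def emb_def)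
      qed (simp add: ind_def)
    qed
  qed
  also have "\<dots> = (\<integral>\<^sup>+\<omega>. (\<integral>\<^sup>+v. h (Z \<omega>, v) \<partial>distr uniform_sphere ?N emb) \<partial>M)"
  proof (rule nn_integral_cong)
    fix \<omega>
    have "(\<lambda>v. h (Z \<omega>, v)) \<in> borel_measurable ?N"
      by (rule measurable_compose[OF measurable_Pair1' h]) (simp add: space_pair_measure)
    then have "(\<lambda>v. h (Z \<omega>, v)) \<in> borel_measurable (distr uniform_sphere ?N emb)" by simp
    from nn_integral_distr[OF embS this]
    show "(\<integral>\<^sup>+v. h (Z \<omega>, emb v) \<partial>uniform_sphere) = (\<integral>\<^sup>+v. h (Z \<omega>, v) \<partial>distr uniform_sphere ?N emb)"
      by simp
  qed
  also have "\<dots> = (\<integral>\<^sup>+z. (\<integral>\<^sup>+v. h (z, v) \<partial>distr uniform_sphere ?N emb) \<partial>distr M ?N Z)"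
    by (rule nn_integral_distr[symmetric]) measurable
  also have "\<dots> = (\<integral>\<^sup>+p. h p \<partial>(distr M ?N Z \<Otimes>\<^sub>M distr uniform_sphere ?N emb))"
    by (rule SE.nn_integral_fst) measurable
  also have "\<dots> = (\<integral>\<^sup>+\<omega>. h (Z \<omega>, emb (\<gamma> t \<omega>)) \<partial>M)"
    unfolding joint[symmetric] by (rule nn_integral_distr) measurable
  also have "\<dots> = (\<integral>\<^sup>+\<omega>. ennreal (ind \<omega> * \<Phi> (X (Suc t) \<omega>)) \<partial>M)"
    by (simp add: h_def Z_def emb_def)
  also have "\<dots> = ennreal (\<integral>\<omega>. ind \<omega> * \<Phi> (X (Suc t) \<omega>) \<partial>M)"
    by (rule nn_integral_eq_integral[OF int1]) (use \<Phi>(2) in \<open>auto simp: ind_def\<close>)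
  finally have "(\<integral>\<omega>. ind \<omega> * \<Phi> (X t \<omega>) + ind \<omega> \<partial>M) \<le> (\<integral>\<omega>. ind \<omega> * \<Phi> (X (Suc t) \<omega>) \<partial>M)"
    by (subst (asm) ennreal_le_iff) (use \<Phi>(2) in \<open>auto simp: ind_def intro!: integral_nonneg_AE\<close>)
  moreover have "(\<integral>\<omega>. ind \<omega> * \<Phi> (X t \<omega>) + ind \<omega> \<partial>M) = (\<integral>\<omega>. ind \<omega> * \<Phi> (X t \<omega>) \<partial>M) + prob (running t)"
    proof -
    have "ind = indicator (running t)" by (simp add: ind_def fun_eq_iff)
    then show ?thesis
      by (subst Bochner_Integration.integral_add[OF int2]) (simp_all add: integrable_running)
  qed
  ultimately show ?thesis by (simp add: ind_def)
qed

text \<open>Each step of a running walk raises the expected value of \<Phi> by at least 1, while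
  \<Phi> never exceeds \<open>B\<close>. Hence the probabilities of still running, whose sum bounds
  the expected number of steps, add up to at most \<open>B\<close>.\<close>

theorem expected_steps_le:
  assumes \<beta>: "0 < \<beta>"
    and \<Phi>: "\<Phi> \<in> borel_measurable borel" "\<And>y. 0 \<le> \<Phi> y" "\<And>y. \<Phi> y \<le> B"
    and drift: "\<And>y \<rho>. y \<in> \<Omega> \<Longrightarrow> \<epsilon> \<le> infdist y (frontier \<Omega>) \<Longrightarrow> \<beta> * infdist y (frontier \<Omega>) < \<rho> \<Longrightarrow>
        \<rho> < infdist y (frontier \<Omega>) \<Longrightarrow> \<Phi> y + 1 \<le> (\<integral>v. \<Phi> (y + (\<rho> / 2) *\<^sub>R v) \<partial>uniform_sphere)"
  shows "(\<integral>\<^sup>+\<omega>. wos_steps \<Omega> \<epsilon> x r \<gamma> \<omega> \<partial>M) \<le> ennreal B"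
proof -
  note [measurable] = \<Phi>(1)
  have B0: "0 \<le> B" using order_trans[OF \<Phi>(2,3)] .
  define a where "a t = (\<integral>\<omega>. indicator (running t) \<omega> * \<Phi> (X t \<omega>) \<partial>M)" for t
  define p where "p t = prob (running t)" for t
  have dec: "running (Suc t) \<subseteq> running t" for t by (auto simp: running_def)
  have intg: "integrable M (\<lambda>\<omega>. indicator (running t) \<omega> * \<Phi> (X s \<omega>))" for t s
    by (rule integrable_const_bound[where B = B])
      (use \<Phi>(2,3) B0 in \<open>auto simp: indicator_def\<close>)
  have step: "a t + p t \<le> a (Suc t) + B * (p t - p (Suc t))" for t
  proof -
    have "a t + p t \<le> (\<integral>\<omega>. indicator (running t) \<omega> * \<Phi> (X (Suc t) \<omega>) \<partial>M)"
      unfolding a_def p_def by (rule expected_step_drift[OF \<beta> \<Phi> drift])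
    \<comment> \<open>A walk that stops at time t + 1 leaves the running sum; its value of \<Phi>,
      at most \<open>B\<close>, is booked in the second term.\<close>
    also have "\<dots> \<le> (\<integral>\<omega>. indicator (running (Suc t)) \<omega> * \<Phi> (X (Suc t) \<omega>)
        + B * (indicator (running t) \<omega> - indicator (running (Suc t)) \<omega>) \<partial>M)"
    proof (rule integral_mono)
      show "integrable M (\<lambda>\<omega>. indicator (running t) \<omega> * \<Phi> (X (Suc t) \<omega>))" by (rule intg)
      show "integrable M (\<lambda>\<omega>. indicator (running (Suc t)) \<omega> * \<Phi> (X (Suc t) \<omega>)
        + B * (indicator (running t) \<omega> - indicator (running (Suc t)) \<omega>))"
        by (intro Bochner_Integration.integrable_add intg integrable_mult_right
            Bochner_Integration.integrable_diff integrable_running)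
      show "indicator (running t) \<omega> * \<Phi> (X (Suc t) \<omega>) \<le> indicator (running (Suc t)) \<omega> * \<Phi> (X (Suc t) \<omega>)
        + B * (indicator (running t) \<omega> - indicator (running (Suc t)) \<omega>)" for \<omega>
        using dec[of t] \<Phi>(3)[of "X (Suc t) \<omega>"] by (auto simp: indicator_def simp del: wos_path.simps)
    qed
    also have "\<dots> = a (Suc t) + B * (p t - p (Suc t))"
      unfolding a_def p_def
      using Bochner_Integration.integral_diff[OF integrable_running[of t] integrable_running[of "Suc t"]]
      by (subst Bochner_Integration.integral_add) (auto simp del: wos_path.simps intro!: intg integrable_running)
    finally show ?thesis .
  qed
  have a_bd: "0 \<le> a t" "a t \<le> B * p t" for t
  proof -
    show "0 \<le> a t" unfolding a_def using \<Phi>(2) by (intro integral_nonneg_AE) auto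
    have "a t \<le> (\<integral>\<omega>. B * indicator (running t) \<omega> \<partial>M)"
      unfolding a_def using \<Phi>(3) by (intro integral_mono intg integrable_mult_right integrable_running) (auto simp: indicator_def)
    then show "a t \<le> B * p t" by (simp add: p_def)
  qed
  have "(\<Sum>t<n. p t) \<le> a n - a 0 + B * (p 0 - p n)" for n
  proof (induction n)
    case (Suc n)
    then show ?case using step[of n] by (simp add: algebra_simps)
  qed simp
  then have sum_le: "(\<Sum>t<n. p t) \<le> B" for n
  proof -
    \<comment> \<open>The remaining \<open>a n\<close> is at most \<open>B * p n\<close> and cancels
      against the telescoped loss.\<close>
    have "(\<Sum>t<n. p t) \<le> B * p n - 0 + B * (p 0 - p n)"
      using \<open>\<And>n. (\<Sum>t<n. p t) \<le> a n - a 0 + B * (p 0 - p n)\<close>[of n] a_bd(2)[of n] a_bd(1)[of 0] by linarith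
    also have "\<dots> = B * p 0" by (simp add: algebra_simps)
    also have "\<dots> \<le> B" using B0 by (simp add: p_def mult_left_le)
    finally show ?thesis .
  qed
  have "(\<integral>\<^sup>+\<omega>. wos_steps \<Omega> \<epsilon> x r \<gamma> \<omega> \<partial>M) \<le> (\<integral>\<^sup>+\<omega>. (\<Sum>t. indicator (running t) \<omega>) \<partial>M)"
    by (rule nn_integral_mono) (rule wos_steps_le_suminf)
  also have "\<dots> = (\<Sum>t. emeasure M (running t))"
    by (subst nn_integral_suminf) auto
  also have "\<dots> = (\<Sum>t. ennreal (p t))" by (simp add: p_def emeasure_eq_measure)
  also have "\<dots> = (SUP n. \<Sum>t<n. ennreal (p t))" by (rule suminf_eq_SUP)
  also have "\<dots> \<le> ennreal B"
  proof (rule SUP_least)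
    fix n
    have "(\<Sum>t<n. ennreal (p t)) = ennreal (\<Sum>t<n. p t)" by (rule sum_ennreal) (simp add: p_def)
    then show "(\<Sum>t<n. ennreal (p t)) \<le> ennreal B" using sum_le[of n] by (simp add: ennreal_leI)
  qed
  finally show ?thesis .
qed

end

section \<open>The two kernels and their spherical means\<close>

lemma sphere_mean_lower:
  fixes w :: "real^'n::finite" and f K :: "real \<Rightarrow> real"
  assumes "energy_kernel K" and w: "w \<noteq> 0" "0 \<le> \<rho>" "\<rho> \<le> norm w / 2"
    and f: "f \<in> borel_measurable borel" "continuous_on {norm w / 2 .. 3 * norm w / 2} f"
    and le: "\<And>t. norm w / 2 \<le> t \<Longrightarrow> f t \<le> K t"
  shows "(\<integral>\<gamma>. f (norm (w + \<rho> *\<^sub>R \<gamma>)) \<partial>uniform_sphere) \<le> (\<integral>\<gamma>. K (norm (w + \<rho> *\<^sub>R \<gamma>)) \<partial>uniform_sphere)"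
    and "integrable uniform_sphere (\<lambda>\<gamma>. f (norm (w + \<rho> *\<^sub>R \<gamma>)))"
proof -
  interpret energy_kernel K by fact
  \<comment> \<open>A step of at most half the distance keeps the norm between 1/2 and 3/2 of
    \<open>norm w\<close>, where the smooth minorant \<open>f\<close> is continuous and lies below
    the cut-off kernel \<open>K\<close>.\<close>
  have nb: "norm w / 2 \<le> norm (w + \<rho> *\<^sub>R \<gamma>)" "norm (w + \<rho> *\<^sub>R \<gamma>) \<le> 3 * norm w / 2"
    if "norm \<gamma> = 1" for \<gamma>
  proof -
    have "norm (\<rho> *\<^sub>R \<gamma>) = \<rho>" using that w by simp
    then show "norm w / 2 \<le> norm (w + \<rho> *\<^sub>R \<gamma>)" "norm (w + \<rho> *\<^sub>R \<gamma>) \<le> 3 * norm w / 2"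
      using norm_triangle_ineq[of w "\<rho> *\<^sub>R \<gamma>"] norm_diff_ineq[of w "\<rho> *\<^sub>R \<gamma>"] w by linarith+
  qed
  obtain C where C: "\<And>t. t \<in> {norm w / 2 .. 3 * norm w / 2} \<Longrightarrow> \<bar>f t\<bar> \<le> C"
  proof -
    obtain C where C: "\<And>u. u \<in> f ` {norm w / 2 .. 3 * norm w / 2} \<Longrightarrow> norm u \<le> C"
      using compact_imp_bounded[OF compact_continuous_image[OF f(2) compact_Icc]]
      unfolding bounded_iff by blast
    show ?thesis
    proof (rule that)
      show "\<bar>f t\<bar> \<le> C" if "t \<in> {norm w / 2 .. 3 * norm w / 2}" for t
        using C[of "f t"] imageI[OF that, of f] by simp
    qed
  qed
  note [measurable] = f(1)
  show int: "integrable uniform_sphere (\<lambda>\<gamma>. f (norm (w + \<rho> *\<^sub>R \<gamma>)))"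
  proof (rule integrable_uniform_sphere_bounded)
    show "(\<lambda>\<gamma>. f (norm (w + \<rho> *\<^sub>R \<gamma>))) \<in> borel_measurable borel" by measurable
    show "\<bar>f (norm (w + \<rho> *\<^sub>R \<gamma>))\<bar> \<le> C" if "norm \<gamma> = 1" for \<gamma>
      using nb[OF that] by (intro C) simp
  qed
  show "(\<integral>\<gamma>. f (norm (w + \<rho> *\<^sub>R \<gamma>)) \<partial>uniform_sphere) \<le> (\<integral>\<gamma>. K (norm (w + \<rho> *\<^sub>R \<gamma>)) \<partial>uniform_sphere)"
  proof (rule integral_mono_AE[OF int integrable_K])
    show "AE \<gamma> in uniform_sphere. f (norm (w + \<rho> *\<^sub>R \<gamma>)) \<le> K (norm (w + \<rho> *\<^sub>R \<gamma>))"
      using AE_uniform_sphere_norm by eventually_elim (intro le nb)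
  qed
qed

text \<open>Subtracting 1 makes the kernel vanish at distance 1. The cap at
  \<open>\<epsilon> / 2\<close> keeps it finite, and no single step gets below it: before stopping
  the complement is at distance at least \<epsilon>, and a step covers at most half of the
  distance.\<close>

definition power_kernel :: "real \<Rightarrow> real \<Rightarrow> real \<Rightarrow> real" where
  "power_kernel p \<epsilon> t = max 0 (max t (\<epsilon> / 2) powr (- p) - 1)"

lemma energy_kernel_power:
  assumes p: "0 < p" and \<epsilon>: "0 < \<epsilon>"
  shows "energy_kernel (power_kernel p \<epsilon>)"
proof
  show "antimono (power_kernel p \<epsilon>)"
    unfolding power_kernel_def using p \<epsilon>
    by (intro antimonoI max.mono order_refl diff_mono powr_mono2') auto
  show "continuous_on UNIV (power_kernel p \<epsilon>)"
    unfolding power_kernel_def using \<epsilon> by (intro continuous_intros) auto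
  show "power_kernel p \<epsilon> t = 0" if "1 \<le> t" for t
  proof -
    have "max t (\<epsilon> / 2) powr (- p) \<le> 1 powr (- p)" using p that by (intro powr_mono2') auto
    then show ?thesis by (simp add: power_kernel_def)
  qed
qed (simp add: power_kernel_def)

lemma power_kernel_eq:
  assumes "0 < p" "0 < \<epsilon>" "\<epsilon> / 2 \<le> t" "t \<le> 1"
  shows "power_kernel p \<epsilon> t = t powr (- p) - 1"
proof -
  have "1 powr (- p) \<le> t powr (- p)" using assms by (intro powr_mono2') auto
  then show ?thesis using assms by (simp add: power_kernel_def max_absorb1)
qed

text \<open>On the sphere of a step the kernel dominates t^(-p) - 1, with equality at the centre if
  \<open>norm w\<close> \<le> 1, so the gain of the power survives the cut-off. Further out the
  kernel is zero at the centre and nonnegative elsewhere.\<close>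

lemma power_kernel_mean:
  fixes w :: "real^'n::finite"
  assumes p: "0 < p" "real CARD('n) - 2 \<le> p" and \<epsilon>: "0 < \<epsilon>" "\<epsilon> \<le> norm w"
    and \<rho>: "0 \<le> \<rho>" "\<rho> \<le> norm w / 2"
  defines "I \<equiv> \<integral>\<gamma>. power_kernel p \<epsilon> (norm (w + \<rho> *\<^sub>R \<gamma>)) \<partial>uniform_sphere"
  shows "power_kernel p \<epsilon> (norm w) \<le> I"
    and "norm w \<le> 1 \<Longrightarrow> power_kernel p \<epsilon> (norm w) + p * (p + 2 - real CARD('n)) * (2/3) powr (p + 2)
        / (2 * real CARD('n)) * (\<rho> / norm w)\<^sup>2 * norm w powr (- p) \<le> I"
proof -
  interpret energy_kernel "power_kernel p \<epsilon>" using p(1) \<epsilon>(1) by (rule energy_kernel_power)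
  interpret S: prob_space "uniform_sphere :: (real^'n) measure" by (rule prob_space_uniform_sphere)
  have w: "w \<noteq> 0" using \<epsilon> by auto
  define c where "c = p * (p + 2 - real CARD('n)) * (2/3) powr (p + 2) / (2 * real CARD('n))"
  have c: "0 \<le> c" using p by (simp add: c_def)
  let ?t = "norm w"
  have cont: "continuous_on {?t / 2 .. 3 * ?t / 2} (\<lambda>t. t powr (- p) - 1)"
    using w by (intro continuous_intros) auto
  have le: "t powr (- p) - 1 \<le> power_kernel p \<epsilon> t" if "?t / 2 \<le> t" for t
    using that \<epsilon> by (simp add: power_kernel_def max_absorb1)
  have meas: "(\<lambda>t::real. t powr (- p) - 1) \<in> borel_measurable borel" by measurable
  note low = sphere_mean_lower[OF energy_kernel_power[OF p(1) \<epsilon>(1)] w \<rho> meas cont le]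
  have int: "integrable uniform_sphere (\<lambda>\<gamma>. norm (w + \<rho> *\<^sub>R \<gamma>) powr (- p))"
    using Bochner_Integration.integrable_add[OF low(2), of "\<lambda>_. 1"] by simp
  have "?t powr (- p) * (1 + c * (\<rho> / ?t)\<^sup>2) \<le> (\<integral>\<gamma>. norm (w + \<rho> *\<^sub>R \<gamma>) powr (- p) \<partial>uniform_sphere)"
    using sphere_mean_power[of p 1 w \<rho>] p w \<rho> by (simp add: c_def)
  also have "\<dots> - 1 = (\<integral>\<gamma>. norm (w + \<rho> *\<^sub>R \<gamma>) powr (- p) - 1 \<partial>uniform_sphere)"
    using int S.prob_space by simp
  also have "\<dots> \<le> I" unfolding I_def by (rule low(1))
  finally have main: "?t powr (- p) * (1 + c * (\<rho> / ?t)\<^sup>2) - 1 \<le> I" by linarith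
  have I0: "0 \<le> I" unfolding I_def by (intro integral_nonneg_AE) (simp add: nonneg_K)
  show g: "power_kernel p \<epsilon> ?t + p * (p + 2 - real CARD('n)) * (2/3) powr (p + 2)
        / (2 * real CARD('n)) * (\<rho> / ?t)\<^sup>2 * ?t powr (- p) \<le> I" if "?t \<le> 1"
    using main \<epsilon> that p unfolding c_def[symmetric] by (subst power_kernel_eq) (auto simp: algebra_simps)
  show "power_kernel p \<epsilon> ?t \<le> I"
  proof (cases "?t \<le> 1")
    case True
    have "0 \<le> c * (\<rho> / ?t)\<^sup>2 * ?t powr (- p)" using c by simp
    then show ?thesis using g[OF True] unfolding c_def[symmetric] by linarith
  next
    case False
    then show ?thesis using zero_K[of ?t] I0 by simp
  qed
qed

text \<open>The harmonic kernel \<open>t\<^sup>2\<^sup>-\<^sup>d\<close>, made strictly subharmonic below the scale \<open>a\<close> by a lower order term.\<close>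

definition truncated_kernel :: "real \<Rightarrow> real \<Rightarrow> real \<Rightarrow> real \<Rightarrow> real" where
  "truncated_kernel d a \<epsilon> t =
     max 0 (max t (\<epsilon> / 2) powr (2 - d) * (1 - (max t (\<epsilon> / 2) / a) powr (1/2) / 2))"

text \<open>The second factor reaches zero at 4 a, whence the bound on \<open>a\<close>; up to there
  both factors are nonnegative and decreasing.\<close>

lemma energy_kernel_truncated:
  assumes d: "3 \<le> d" and a: "0 < a" "a \<le> 1/4" and \<epsilon>: "0 < \<epsilon>"
  shows "energy_kernel (truncated_kernel d a \<epsilon>)"
proof
  show "antimono (truncated_kernel d a \<epsilon>)"
  proof (rule antimonoI)
    fix s t :: real assume st: "s \<le> t"
    define S T where "S = max s (\<epsilon> / 2)" and "T = max t (\<epsilon> / 2)"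
    have ST: "0 < S" "S \<le> T" using st \<epsilon> by (auto simp: S_def T_def)
    show "truncated_kernel d a \<epsilon> t \<le> truncated_kernel d a \<epsilon> s"
    proof (cases "1 - (T / a) powr (1/2) / 2 \<le> 0")
      case True
      then have "T powr (2 - d) * (1 - (T / a) powr (1/2) / 2) \<le> 0"
        by (intro mult_nonneg_nonpos) auto
      then show ?thesis by (simp add: truncated_kernel_def T_def[symmetric] S_def[symmetric])
    next
      case False
      have "(S / a) powr (1/2) \<le> (T / a) powr (1/2)"
        using ST a by (intro powr_mono2 divide_right_mono) auto
      then have "1 - (T / a) powr (1/2) / 2 \<le> 1 - (S / a) powr (1/2) / 2" by linarith
      moreover have "T powr (2 - d) \<le> S powr (2 - d)" using ST d by (intro powr_mono2') auto
      ultimately have "T powr (2 - d) * (1 - (T / a) powr (1/2) / 2) \<le> S powr (2 - d) * (1 - (S / a) powr (1/2) / 2)"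
        using False by (intro mult_mono) auto
      then show ?thesis unfolding truncated_kernel_def T_def[symmetric] S_def[symmetric] by (rule max.mono[OF order_refl])
    qed
  qed
  show "continuous_on UNIV (truncated_kernel d a \<epsilon>)"
    unfolding truncated_kernel_def using \<epsilon> a by (intro continuous_intros) auto
  show "truncated_kernel d a \<epsilon> t = 0" if "1 \<le> t" for t
  proof -
    define T where "T = max t (\<epsilon> / 2)"
    have "4 \<le> T / a" using that a by (simp add: T_def pos_le_divide_eq)
    then have "4 powr (1/2) \<le> (T / a) powr (1/2)" by (intro powr_mono2) auto
    then have "1 - (T / a) powr (1/2) / 2 \<le> 0" by (simp add: powr_half_sqrt)
    then have "T powr (2 - d) * (1 - (T / a) powr (1/2) / 2) \<le> 0" by (intro mult_nonneg_nonpos) auto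
    then show ?thesis by (simp add: truncated_kernel_def T_def[symmetric])
  qed
qed (simp add: truncated_kernel_def)

text \<open>For p = d - 2 the power is harmonic; for p = d - 5/2 it is strictly superharmonic, so
  subtracting a multiple of it leaves a strictly subharmonic function. The gain is that of the
  subtracted term, and the cut at zero only raises the mean.\<close>

lemma truncated_kernel_mean:
  fixes w :: "real^'n::finite"
  defines "d \<equiv> real CARD('n)"
  assumes d: "3 \<le> d" and a: "0 < a" "a \<le> 1/4" and \<epsilon>: "0 < \<epsilon>" "\<epsilon> \<le> norm w"
    and \<rho>: "0 \<le> \<rho>" "\<rho> \<le> norm w / 2"
  defines "I \<equiv> \<integral>\<gamma>. truncated_kernel d a \<epsilon> (norm (w + \<rho> *\<^sub>R \<gamma>)) \<partial>uniform_sphere"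
  shows "truncated_kernel d a \<epsilon> (norm w) \<le> I"
    and "norm w \<le> 4 * a \<Longrightarrow> truncated_kernel d a \<epsilon> (norm w) + a powr (- (1/2)) / 2 *
        ((d - 5/2) / 2 * (2/3) powr (d - 1/2) / (2 * d)) * (\<rho> / norm w)\<^sup>2 * norm w powr (5/2 - d) \<le> I"
proof -
  note ek = energy_kernel_truncated[OF d a \<epsilon>(1)]
  interpret energy_kernel "truncated_kernel d a \<epsilon>" by (rule ek)
  have w: "w \<noteq> 0" using \<epsilon> by auto
  define b where "b = a powr (- (1/2)) / 2"
  have b: "0 < b" using a by (simp add: b_def)
  define c where "c = (d - 5/2) / 2 * (2/3) powr (d - 1/2) / (2 * d)"
  have c: "0 \<le> c" using d by (simp add: c_def)
  let ?t = "norm w"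
  let ?f = "\<lambda>t::real. t powr (2 - d) - b * t powr (5/2 - d)"
  have f_eq: "?f t = t powr (2 - d) * (1 - (t / a) powr (1/2) / 2)" if "0 < t" for t
  proof -
    have "(t / a) powr (1/2) = t powr (1/2) * a powr (- (1/2))"
      using that a powr_divide[of t a "1/2"] powr_minus[of a "1/2"] by (simp only: divide_inverse)
    then have "t powr (2 - d) * (t / a) powr (1/2) = (t powr (2 - d) * t powr (1/2)) * a powr (- (1/2))"
      by (simp only: mult.assoc)
    also have "t powr (2 - d) * t powr (1/2) = t powr (2 - d + 1/2)" by (rule powr_add[symmetric])
    also have "2 - d + 1/2 = 5/2 - d" by simp
    finally have "t powr (2 - d) * (t / a) powr (1/2) = t powr (5/2 - d) * a powr (- (1/2))" .
    then show ?thesis by (simp add: b_def right_diff_distrib mult.commute)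
  qed
  have cont: "continuous_on {?t / 2 .. 3 * ?t / 2} ?f"
    using w by (intro continuous_intros) auto
  have le: "?f t \<le> truncated_kernel d a \<epsilon> t" if "?t / 2 \<le> t" for t
  proof -
    have "0 < t" "max t (\<epsilon> / 2) = t" using that \<epsilon> w by (auto simp: max_absorb1)
    then show ?thesis unfolding truncated_kernel_def by (simp only: f_eq max.cobounded2)
  qed
  have meas: "?f \<in> borel_measurable borel" by measurable
  note low = sphere_mean_lower[OF ek w \<rho> meas cont le]
  have pw: "integrable uniform_sphere (\<lambda>\<gamma>. norm (w + \<rho> *\<^sub>R \<gamma>) powr e)" if "e \<le> 0" for e
  proof (rule integrable_uniform_sphere_bounded[where B = "(?t / 2) powr e"])
    fix \<gamma> :: "real^'n" assume "norm \<gamma> = 1"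
    then have "norm (\<rho> *\<^sub>R \<gamma>) = \<rho>" using \<rho> by simp
    then have "?t / 2 \<le> norm (w + \<rho> *\<^sub>R \<gamma>)"
      using norm_diff_ineq[of w "\<rho> *\<^sub>R \<gamma>"] \<rho> by linarith
    then have "norm (w + \<rho> *\<^sub>R \<gamma>) powr e \<le> (?t / 2) powr e"
      using w that by (intro powr_mono2') auto
    then show "\<bar>norm (w + \<rho> *\<^sub>R \<gamma>) powr e\<bar> \<le> (?t / 2) powr e" by simp
  qed measurable
  have m1: "?t powr (2 - d) \<le> (\<integral>\<gamma>. norm (w + \<rho> *\<^sub>R \<gamma>) powr (2 - d) \<partial>uniform_sphere)"
    using sphere_mean_power[of "d - 2" 1 w \<rho>] d w \<rho> by (simp add: d_def)
  have m2: "?t powr (5/2 - d) * (- 1 + c * (\<rho> / ?t)\<^sup>2) \<le> - (\<integral>\<gamma>. norm (w + \<rho> *\<^sub>R \<gamma>) powr (5/2 - d) \<partial>uniform_sphere)"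
  proof -
    have e: "(- 1) * ((d - 5/2) * ((d - 5/2) + 2 - d)) = (d - 5/2) / 2" by (simp add: field_simps)
    have nn: "0 \<le> (- 1) * ((d - 5/2) * ((d - 5/2) + 2 - d))" unfolding e using d by simp
    have "?t powr (- (d - 5/2)) * (- 1 + (- 1) * ((d - 5/2) * ((d - 5/2) + 2 - d)) * (2/3) powr ((d - 5/2) + 2) / (2 * d) * (\<rho> / ?t)\<^sup>2)
        \<le> (- 1) * (\<integral>\<gamma>. norm (w + \<rho> *\<^sub>R \<gamma>) powr (- (d - 5/2)) \<partial>uniform_sphere)"
      using sphere_mean_power[of "d - 5/2" "-1" w \<rho>] nn d w \<rho> unfolding d_def by simp
    then show ?thesis unfolding e c_def by simp
  qed
  have "?t powr (2 - d) + b * (?t powr (5/2 - d) * (- 1 + c * (\<rho> / ?t)\<^sup>2))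
      \<le> (\<integral>\<gamma>. norm (w + \<rho> *\<^sub>R \<gamma>) powr (2 - d) \<partial>uniform_sphere)
        + b * (- (\<integral>\<gamma>. norm (w + \<rho> *\<^sub>R \<gamma>) powr (5/2 - d) \<partial>uniform_sphere))"
    using m1 m2 b by (intro add_mono mult_left_mono) auto
  also have "\<dots> = (\<integral>\<gamma>. ?f (norm (w + \<rho> *\<^sub>R \<gamma>)) \<partial>uniform_sphere)"
    using pw[of "2 - d"] pw[of "5/2 - d"] d by simp
  also have "\<dots> \<le> I" unfolding I_def by (rule low(1))
  finally have main: "?f ?t + b * c * (\<rho> / ?t)\<^sup>2 * ?t powr (5/2 - d) \<le> I"
    by (simp add: algebra_simps)
  have I0: "0 \<le> I" unfolding I_def by (intro integral_nonneg_AE) (simp add: nonneg_K)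
  have gain0: "0 \<le> b * c * (\<rho> / ?t)\<^sup>2 * ?t powr (5/2 - d)" using b c by simp
  have keq: "truncated_kernel d a \<epsilon> ?t = max 0 (?f ?t)"
    using \<epsilon> w unfolding truncated_kernel_def by (subst f_eq) (auto simp: max_absorb1)
  show "truncated_kernel d a \<epsilon> ?t \<le> I" using main I0 gain0 unfolding keq by linarith
  show "truncated_kernel d a \<epsilon> ?t + a powr (- (1/2)) / 2 *
        ((d - 5/2) / 2 * (2/3) powr (d - 1/2) / (2 * d)) * (\<rho> / ?t)\<^sup>2 * ?t powr (5/2 - d) \<le> I" if "?t \<le> 4 * a"
  proof -
    have "(?t / a) powr (1/2) \<le> 4 powr (1/2)" using that a by (intro powr_mono2) (auto simp: pos_divide_le_eq)
    then have "0 \<le> 1 - (?t / a) powr (1/2) / 2" by (simp add: powr_half_sqrt)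
    then have "0 \<le> ?f ?t" using w by (subst f_eq) auto
    then show ?thesis using main unfolding keq b_def[symmetric] c_def[symmetric] by simp
  qed
qed

section \<open>Step bound from energy and squared displacement\<close>

lemma infdist_frontier_le_dist:
  fixes y :: "'a::real_normed_vector"
  assumes "y \<in> \<Omega>" "z \<notin> \<Omega>"
  shows "infdist y (frontier \<Omega>) \<le> dist y z"
  using add_mem_of_less_infdist_frontier[of y \<Omega> "z - y"] assms
  by (force simp: dist_norm norm_minus_commute not_le)

text \<open>The cross term averages to zero by the antipodal symmetry of the sphere.\<close>

lemma sphere_mean_norm_square:
  fixes u :: "real^'n::finite"
  shows "integrable uniform_sphere (\<lambda>v. (norm (u + \<tau> *\<^sub>R v))\<^sup>2)"
    and "(\<integral>v. (norm (u + \<tau> *\<^sub>R v))\<^sup>2 \<partial>uniform_sphere) = (norm u)\<^sup>2 + \<tau>\<^sup>2"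
proof -
  let ?S = "uniform_sphere :: (real^'n) measure"
  interpret prob_space ?S by (rule prob_space_uniform_sphere)
  have [measurable]: "(\<lambda>v::real^'n. u \<bullet> v) \<in> borel_measurable borel"
    by (intro borel_measurable_continuous_onI continuous_intros)
  have int: "integrable ?S (\<lambda>v. u \<bullet> v)"
  proof (rule integrable_uniform_sphere_bounded)
    show "\<bar>u \<bullet> v\<bar> \<le> norm u" if "norm v = 1" for v
      using Cauchy_Schwarz_ineq2[of u v] that by simp
  qed measurable
  have "orthogonal_transformation (\<lambda>x::real^'n. - x)"
    using orthogonal_transformation_neg[of "\<lambda>x::real^'n. x"] orthogonal_transformation_id by blast
  then have "(\<integral>v. u \<bullet> (- v) \<partial>?S) = (\<integral>v. u \<bullet> v \<partial>?S)"
    by (rule integral_uniform_sphere_orthogonal[where f = "\<lambda>v. u \<bullet> v"]) measurable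
  then have zero: "(\<integral>v. u \<bullet> v \<partial>?S) = 0" by simp
  have [measurable]: "(\<lambda>v::real^'n. u \<bullet> v) \<in> borel_measurable ?S"
    by (subst measurable_cong_sets[OF sets_uniform_sphere refl]) measurable
  have eq: "AE v in ?S. (norm (u + \<tau> *\<^sub>R v))\<^sup>2 = (norm u)\<^sup>2 + \<tau>\<^sup>2 + 2 * \<tau> * (u \<bullet> v)"
    using AE_uniform_sphere_norm
  proof eventually_elim
    case (elim v)
    then have "v \<bullet> v = 1" by (simp add: norm_eq_1)
    then show ?case
      unfolding power2_norm_eq_inner
      by (simp add: inner_add_left inner_add_right inner_commute power2_eq_square algebra_simps)
  qed
  have int': "integrable ?S (\<lambda>v. (norm u)\<^sup>2 + \<tau>\<^sup>2 + 2 * \<tau> * (u \<bullet> v))"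
    using int by (intro Bochner_Integration.integrable_add integrable_mult_right) auto
  have m1: "(\<lambda>v. (norm (u + \<tau> *\<^sub>R v))\<^sup>2) \<in> borel_measurable ?S"
    by (subst measurable_cong_sets[OF sets_uniform_sphere refl]) measurable
  have m2: "(\<lambda>v. (norm u)\<^sup>2 + \<tau>\<^sup>2 + 2 * \<tau> * (u \<bullet> v)) \<in> borel_measurable ?S" by measurable
  show "integrable ?S (\<lambda>v. (norm (u + \<tau> *\<^sub>R v))\<^sup>2)"
    using integrable_cong_AE[OF m1 m2 eq] int' by simp
  have "(\<integral>v. (norm (u + \<tau> *\<^sub>R v))\<^sup>2 \<partial>?S) = (\<integral>v. (norm u)\<^sup>2 + \<tau>\<^sup>2 + 2 * \<tau> * (u \<bullet> v) \<partial>?S)"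
    by (rule integral_cong_AE[OF m1 m2 eq])
  also have "\<dots> = (norm u)\<^sup>2 + \<tau>\<^sup>2"
    using int zero prob_space by simp
  finally show "(\<integral>v. (norm (u + \<tau> *\<^sub>R v))\<^sup>2 \<partial>uniform_sphere) = (norm u)\<^sup>2 + \<tau>\<^sup>2" .
qed

text \<open>The energy makes the walk progress at distances up to \<open>\<delta>\<^sub>s\<close> from the boundary; at larger distances
  the squared distance to the starting point does.\<close>

theorem expected_steps_energy:
  fixes \<Omega> :: "(real^'n::finite) set" and M :: "'w measure"
  assumes walk: "walk_on_spheres M F \<Omega> \<beta> \<epsilon> x r \<gamma>"
    and dom: "bounded_domain \<Omega>" and diam: "diameter \<Omega> \<le> R"
    and \<epsilon>: "0 < \<epsilon>" and \<beta>: "0 < \<beta>" "\<beta> < 1"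
    and ek: "energy_kernel K"
    and UB: "\<And>I y. dyadic_sparse n s (I :: (real^'n) set) \<Longrightarrow> energy_kernel.pot K n s I y \<le> UB"
    and mean: "\<And>(w :: real^'n) \<rho>. \<epsilon> \<le> norm w \<Longrightarrow> 0 \<le> \<rho> \<Longrightarrow> \<rho> \<le> norm w / 2 \<Longrightarrow>
        K (norm w) \<le> (\<integral>v. K (norm (w + \<rho> *\<^sub>R v)) \<partial>uniform_sphere)"
    and \<delta>s: "0 < \<delta>\<^sub>s" and Gt: "0 < Gt"
    and gain: "\<And>\<delta>. \<epsilon> \<le> \<delta> \<Longrightarrow> \<delta> \<le> \<delta>\<^sub>s \<Longrightarrow> \<exists>G\<ge>0. \<exists>\<theta>\<ge>0. \<theta> * K \<delta> + K (8 * \<delta>) < (1 - \<theta>) * K (2 * \<delta>) \<and>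
        (\<forall>(w :: real^'n) \<rho>. \<delta> \<le> norm w \<longrightarrow> norm w \<le> 8 * \<delta> \<longrightarrow> \<beta> * \<delta> / 2 \<le> \<rho> \<longrightarrow> \<rho> \<le> \<delta> / 2 \<longrightarrow>
            K (norm w) + G \<le> (\<integral>v. K (norm (w + \<rho> *\<^sub>R v)) \<partial>uniform_sphere)) \<and>
        (\<forall>z\<in>frontier \<Omega>. \<exists>J. dyadic_sparse n s J \<and> J \<subseteq> - \<Omega> \<and> J \<noteq> {} \<and> (\<forall>a\<in>J. dist z a \<le> \<delta>) \<and>
            Gt \<le> max 1 (\<theta> * card J) * G / 2 ^ (n * s))"
  shows "(\<integral>\<^sup>+\<omega>. wos_steps \<Omega> \<epsilon> x r \<gamma> \<omega> \<partial>M) \<le> ennreal (UB / Gt + 4 * R\<^sup>2 / (\<beta>\<^sup>2 * \<delta>\<^sub>s\<^sup>2))"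
proof -
  interpret walk_on_spheres M F \<Omega> \<beta> \<epsilon> x r \<gamma> by fact
  interpret K: energy_kernel K by fact
  interpret S: prob_space "uniform_sphere :: (real^'n) measure" by (rule prob_space_uniform_sphere)
  have op: "open \<Omega>" and ne: "\<Omega> \<noteq> {}" and bd: "bounded \<Omega>"
    using dom by (auto simp: bounded_domain_def)
  have [measurable]: "\<Omega> \<in> sets borel" using op by simp
  define U where "U = K.energy n s (- \<Omega>)"
  have [measurable]: "U \<in> borel_measurable borel" unfolding U_def by (rule K.energy_measurable)
  \<comment> \<open>At distance above \<open>\<delta>\<^sub>s\<close> a step has \<rho> \<ge>
    \<open>\<beta> * \<delta>\<^sub>s\<close>, and the squared displacement rises by (\<rho> / 2)^2
    in the mean; \<open>c\<close> scales this rise to at least 1.\<close>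
  define c where "c = 4 / (\<beta>\<^sup>2 * \<delta>\<^sub>s\<^sup>2)"
  have c: "0 < c" using \<beta> \<delta>s by (simp add: c_def)
  define \<Psi> where "\<Psi> y = U y / Gt + c * (norm (y - x))\<^sup>2" for y
  \<comment> \<open>Cutting off outside \<Omega> makes the function bounded; a step never leaves
    \<Omega>, so the spherical means do not see the cut.\<close>
  define \<Phi> where "\<Phi> y = indicator \<Omega> y * \<Psi> y" for y
  have U_bd: "0 \<le> U y" "U y \<le> UB" for y
  proof -
    show "0 \<le> U y" unfolding U_def by (rule K.energy_nonneg)
    show "U y \<le> UB" unfolding U_def by (rule K.energy_le) (rule UB)
  qed
  have \<Psi>0: "0 \<le> \<Psi> y" for y using U_bd(1)[of y] Gt c by (simp add: \<Psi>_def)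
  have "(\<integral>\<^sup>+\<omega>. wos_steps \<Omega> \<epsilon> x r \<gamma> \<omega> \<partial>M) \<le> ennreal (UB / Gt + c * R\<^sup>2)"
  proof (rule expected_steps_le[OF \<beta>(1), of \<Phi>])
    show "\<Phi> \<in> borel_measurable borel" unfolding \<Phi>_def \<Psi>_def by measurable
    show "0 \<le> \<Phi> y" for y unfolding \<Phi>_def using \<Psi>0 by simp
    have UBc: "0 \<le> UB / Gt + c * R\<^sup>2" using order_trans[OF U_bd(1,2)] Gt c by simp
    show "\<Phi> y \<le> UB / Gt + c * R\<^sup>2" for y
    proof (cases "y \<in> \<Omega>")
      case True
      have "norm (y - x) \<le> R"
        using diameter_bounded_bound[OF bd True start] diam by (simp add: dist_norm)
      then have "(norm (y - x))\<^sup>2 \<le> R\<^sup>2" by (intro power_mono) auto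
      then have "\<Psi> y \<le> UB / Gt + c * R\<^sup>2"
        unfolding \<Psi>_def using U_bd(2) Gt c by (intro add_mono divide_right_mono mult_left_mono) auto
      then show ?thesis using True by (simp add: \<Phi>_def)
    next
      case False
      then show ?thesis using UBc by (simp add: \<Phi>_def)
    qed
    fix y \<rho>
    assume y: "y \<in> \<Omega>" and D\<epsilon>: "\<epsilon> \<le> infdist y (frontier \<Omega>)"
      and \<rho>: "\<beta> * infdist y (frontier \<Omega>) < \<rho>" "\<rho> < infdist y (frontier \<Omega>)"
    define D where "D = infdist y (frontier \<Omega>)"
    have D: "0 < D" "\<epsilon> \<le> D" using D\<epsilon> \<epsilon> by (auto simp: D_def)
    have \<rho>D: "\<beta> * D < \<rho>" "\<rho> < D" using \<rho> by (auto simp: D_def)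
    have \<rho>0: "0 < \<rho>" using \<rho>D(1) \<beta> D by (meson less_trans mult_pos_pos)
    have far: "D \<le> dist y z" if "z \<in> - \<Omega>" for z
      unfolding D_def using y that by (intro infdist_frontier_le_dist) auto
    have intU: "integrable uniform_sphere (\<lambda>v. U (y + (\<rho> / 2) *\<^sub>R v))"
      unfolding U_def by (rule K.integrable_energy)
    have sq: "(\<lambda>v. (norm ((y - x) + (\<rho> / 2) *\<^sub>R v))\<^sup>2) = (\<lambda>v. (norm (y + (\<rho> / 2) *\<^sub>R v - x))\<^sup>2)"
      by (simp add: algebra_simps)
    have \<Psi>_mean: "(\<integral>v. \<Psi> (y + (\<rho> / 2) *\<^sub>R v) \<partial>uniform_sphere)
        = (\<integral>v. U (y + (\<rho> / 2) *\<^sub>R v) \<partial>uniform_sphere) / Gt + c * ((norm (y - x))\<^sup>2 + (\<rho> / 2)\<^sup>2)"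
      using intU sphere_mean_norm_square[of "y - x" "\<rho> / 2"] unfolding \<Psi>_def sq by simp
    have \<Phi>_mean: "(\<integral>v. \<Phi> (y + (\<rho> / 2) *\<^sub>R v) \<partial>uniform_sphere) = (\<integral>v. \<Psi> (y + (\<rho> / 2) *\<^sub>R v) \<partial>uniform_sphere)"
    proof (rule integral_cong_AE)
      show "AE v in uniform_sphere. \<Phi> (y + (\<rho> / 2) *\<^sub>R v) = \<Psi> (y + (\<rho> / 2) *\<^sub>R v)"
        using AE_uniform_sphere_norm
      proof eventually_elim
        case (elim v)
        have "norm ((\<rho> / 2) *\<^sub>R v) < infdist y (frontier \<Omega>)"
          using elim \<rho>0 \<rho>(2) by simp
        then have "y + (\<rho> / 2) *\<^sub>R v \<in> \<Omega>" by (rule add_mem_of_less_infdist_frontier[OF y])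
        then show ?case by (simp add: \<Phi>_def)
      qed
      have "(\<lambda>v. \<Phi> (y + (\<rho> / 2) *\<^sub>R v)) \<in> borel_measurable borel" unfolding \<Phi>_def \<Psi>_def by measurable
      then show "(\<lambda>v. \<Phi> (y + (\<rho> / 2) *\<^sub>R v)) \<in> borel_measurable uniform_sphere"
        by (simp add: measurable_cong_sets[OF sets_uniform_sphere refl])
      have "(\<lambda>v. \<Psi> (y + (\<rho> / 2) *\<^sub>R v)) \<in> borel_measurable borel" unfolding \<Psi>_def by measurable
      then show "(\<lambda>v. \<Psi> (y + (\<rho> / 2) *\<^sub>R v)) \<in> borel_measurable uniform_sphere"
        by (simp add: measurable_cong_sets[OF sets_uniform_sphere refl])
    qed
    have "\<Psi> y + 1 \<le> (\<integral>v. \<Psi> (y + (\<rho> / 2) *\<^sub>R v) \<partial>uniform_sphere)"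
    proof (cases "D \<le> \<delta>\<^sub>s")
      case True
      obtain G \<theta> where G: "0 \<le> G" and \<theta>: "0 \<le> \<theta>" "\<theta> * K D + K (8 * D) < (1 - \<theta>) * K (2 * D)"
        and gK: "\<And>(w :: real^'n) \<rho>. D \<le> norm w \<Longrightarrow> norm w \<le> 8 * D \<Longrightarrow> \<beta> * D / 2 \<le> \<rho> \<Longrightarrow> \<rho> \<le> D / 2 \<Longrightarrow>
            K (norm w) + G \<le> (\<integral>v. K (norm (w + \<rho> *\<^sub>R v)) \<partial>uniform_sphere)"
        and J: "\<And>z. z \<in> frontier \<Omega> \<Longrightarrow> \<exists>J. dyadic_sparse n s J \<and> J \<subseteq> - \<Omega> \<and> J \<noteq> {} \<and> (\<forall>a\<in>J. dist z a \<le> D) \<and>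
            Gt \<le> max 1 (\<theta> * card J) * G / 2 ^ (n * s)"
        using gain[OF D(2) True] by blast
      have "frontier \<Omega> \<noteq> {}"
        using ne bd not_bounded_UNIV[where 'a = "real^'n"] by (auto simp: frontier_eq_empty)
      then obtain z where z: "z \<in> frontier \<Omega>" "D = dist y z"
        unfolding D_def using infdist_attains_inf[OF frontier_closed] by metis
      obtain J where J: "dyadic_sparse n s J" "J \<subseteq> - \<Omega>" "J \<noteq> {}" "\<And>a. a \<in> J \<Longrightarrow> dist z a \<le> D"
          and GJ: "Gt \<le> max 1 (\<theta> * card J) * G / 2 ^ (n * s)"
        using J[OF z(1)] by blast
      have "U y + max 1 (\<theta> * card J) * G / 2 ^ (n * s) \<le> (\<integral>v. U (y + (\<rho> / 2) *\<^sub>R v) \<partial>uniform_sphere)"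
        unfolding U_def
      proof (rule K.energy_drift[OF D(1) far])
        show "dist y a \<le> 2 * D" if "a \<in> J" for a
          using dist_triangle[of y a z] J(4)[OF that] z(2) by simp
        show "K (norm w) \<le> (\<integral>v. K (norm (w + (\<rho> / 2) *\<^sub>R v)) \<partial>uniform_sphere)" if "D \<le> norm w" for w :: "real^'n"
          using that D \<rho>D \<rho>0 by (intro mean) auto
        show "K (norm w) + G \<le> (\<integral>v. K (norm (w + (\<rho> / 2) *\<^sub>R v)) \<partial>uniform_sphere)"
          if "D \<le> norm w" "norm w \<le> 8 * D" for w :: "real^'n"
          using that \<rho>D by (intro gK) auto
      qed (use G J \<theta> in auto)
      then have "U y + Gt \<le> (\<integral>v. U (y + (\<rho> / 2) *\<^sub>R v) \<partial>uniform_sphere)" using GJ by linarith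
      then have "(U y + Gt) / Gt \<le> (\<integral>v. U (y + (\<rho> / 2) *\<^sub>R v) \<partial>uniform_sphere) / Gt"
        using Gt by (intro divide_right_mono) auto
      then have "U y / Gt + 1 \<le> (\<integral>v. U (y + (\<rho> / 2) *\<^sub>R v) \<partial>uniform_sphere) / Gt"
        using Gt by (simp add: add_divide_distrib)
      moreover have "c * (norm (y - x))\<^sup>2 \<le> c * ((norm (y - x))\<^sup>2 + (\<rho> / 2)\<^sup>2)"
        using c by (intro mult_left_mono) auto
      ultimately show ?thesis unfolding \<Psi>_mean by (simp add: \<Psi>_def)
    next
      case False
      have "U y \<le> (\<integral>v. U (y + (\<rho> / 2) *\<^sub>R v) \<partial>uniform_sphere)"
        unfolding U_def
      proof (rule K.energy_submean)
        fix z assume "z \<in> - \<Omega>"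
        then have "D \<le> norm (y - z)" using far by (simp add: dist_norm)
        then show "K (norm (y - z)) \<le> (\<integral>v. K (norm (y - z + (\<rho> / 2) *\<^sub>R v)) \<partial>uniform_sphere)"
          using D \<rho>D \<rho>0 by (intro mean) auto
      qed
      then have "U y / Gt \<le> (\<integral>v. U (y + (\<rho> / 2) *\<^sub>R v) \<partial>uniform_sphere) / Gt"
        using Gt by (intro divide_right_mono) auto
      moreover have "1 \<le> c * (\<rho> / 2)\<^sup>2"
      proof -
        have "\<beta> * \<delta>\<^sub>s \<le> \<beta> * D" using False \<beta> by (intro mult_left_mono) auto
        then have "\<beta> * \<delta>\<^sub>s \<le> \<rho>" using \<rho>D(1) by linarith
        then have "(\<beta> * \<delta>\<^sub>s)\<^sup>2 \<le> \<rho>\<^sup>2" using \<beta> \<delta>s by (intro power_mono) auto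
        then have "\<beta>\<^sup>2 * \<delta>\<^sub>s\<^sup>2 \<le> \<rho>\<^sup>2" by (simp add: power_mult_distrib)
        moreover have "c * (\<rho> / 2)\<^sup>2 = \<rho>\<^sup>2 / (\<beta>\<^sup>2 * \<delta>\<^sub>s\<^sup>2)" by (simp add: c_def power_divide)
        ultimately show ?thesis using \<beta> \<delta>s by simp
      qed
      ultimately show ?thesis unfolding \<Psi>_mean by (simp add: \<Psi>_def distrib_left)
    qed
    then show "\<Phi> y + 1 \<le> (\<integral>v. \<Phi> (y + (\<rho> / 2) *\<^sub>R v) \<partial>uniform_sphere)"
      using y unfolding \<Phi>_mean by (simp add: \<Phi>_def)
  qed
  then show ?thesis by (simp add: c_def)
qed

section \<open>Sparse subsets of large complements\<close>

lemma same_cell_dist: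
  fixes a b :: "real^'n::finite"
  assumes "cell k a = cell k b"
  shows "dist a b < real CARD('n) / 2 ^ k"
proof -
  have c: "\<bar>a $ i - b $ i\<bar> < 1 / 2 ^ k" for i
  proof -
    have "\<lfloor>2 ^ k * a $ i\<rfloor> = \<lfloor>2 ^ k * b $ i\<rfloor>" using assms by (simp add: cell_def fun_eq_iff)
    then have "\<bar>2 ^ k * a $ i - 2 ^ k * b $ i\<bar> < 1" by linarith
    moreover have "\<bar>2 ^ k * a $ i - 2 ^ k * b $ i\<bar> = 2 ^ k * \<bar>a $ i - b $ i\<bar>"
      by (simp add: abs_mult flip: right_diff_distrib)
    ultimately show ?thesis by (simp add: pos_less_divide_eq mult.commute)
  qed
  have "dist a b \<le> (\<Sum>i\<in>UNIV. \<bar>(a - b) $ i\<bar>)" unfolding dist_norm by (rule norm_le_l1_cart)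
  also have "\<dots> < (\<Sum>i\<in>(UNIV :: 'n set). 1 / 2 ^ k)" using c by (intro sum_strict_mono) auto
  finally show ?thesis by simp
qed

lemma sparse_singleton: "dyadic_sparse n s {a}"
proof -
  have "card {z \<in> {a}. cell k z = c} \<le> 2 ^ ((n - k) * s)" for k c
    using card_mono[of "{a}" "{z \<in> {a}. cell k z = c}"] order_trans[OF _ one_le_power[of "2::nat"]] by fastforce
  then show ?thesis by (simp add: dyadic_sparse_def)
qed

text \<open>The distances from \<open>x\<close> to points of \<open>E\<close> form a connected
  unbounded set of reals containing 0.\<close>

lemma connected_unbounded_meets_sphere:
  fixes E :: "'a::metric_space set"
  assumes E: "connected E" "x \<in> E" "\<not> bounded E" and \<rho>: "0 \<le> \<rho>"
  shows "\<exists>z\<in>E. dist x z = \<rho>"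
proof -
  have "connected (dist x ` E)"
    by (intro connected_continuous_image continuous_intros E)
  moreover have "0 \<in> dist x ` E" using E(2) by (auto intro!: image_eqI[of _ _ x])
  moreover obtain z where z: "z \<in> E" "\<rho> \<le> dist x z"
  proof (rule ccontr)
    assume "\<not> thesis"
    then have "E \<subseteq> cball x \<rho>" using that by force
    then show False using E(3) bounded_subset[OF bounded_cball] by blast
  qed
  ultimately have "\<rho> \<in> dist x ` E" using \<rho> connectedD_interval[of "dist x ` E" 0 "dist x z" \<rho>] by auto
  then show ?thesis by auto
qed

text \<open>One point on each of the concentric spheres of radii \<open>i * d / 2\<^sup>n\<close>. Points in a common cube of
  level \<open>k\<close> have radii differing by less than \<open>d / 2\<^sup>k\<close>.\<close>

lemma sparse_connected:
  fixes E :: "(real^'n::finite) set"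
  assumes E: "connected E" "x \<in> E" "\<not> bounded E" and k: "k \<le> n"
  obtains J where "dyadic_sparse n 1 J" "J \<subseteq> E" "\<And>z. z \<in> J \<Longrightarrow> dist x z \<le> real CARD('n) / 2 ^ k"
    "card J = 2 ^ (n - k)"
proof -
  define d where "d = real CARD('n)"
  have d: "0 < d" by (simp add: d_def)
  define z where "z i = (SOME z. z \<in> E \<and> dist x z = real i * d / 2 ^ n)" for i :: nat
  have z: "z i \<in> E \<and> dist x (z i) = real i * d / 2 ^ n" for i
    unfolding z_def by (rule someI_ex) (use connected_unbounded_meets_sphere[OF E, of "real i * d / 2 ^ n"] d in auto)
  have inj: "inj z"
  proof (rule injI)
    fix i j assume "z i = z j"
    then have "real i * d / 2 ^ n = real j * d / 2 ^ n" using z by metis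
    then show "i = j" using d by simp
  qed
  let ?J = "z ` {1..2 ^ (n - k)}"
  have "dyadic_sparse n 1 ?J"
    unfolding dyadic_sparse_def
  proof (intro conjI allI impI)
    fix l c assume l: "l \<le> n"
    let ?I = "{i\<in>{1..2 ^ (n - k)}. cell l (z i) = c}"
    have "{a \<in> ?J. cell l a = c} = z ` ?I" by auto
    then have card_eq: "card {a \<in> ?J. cell l a = c} = card ?I"
      using inj by (simp add: card_image inj_on_subset)
    have "card ?I \<le> 2 ^ (n - l)"
    proof (cases "?I = {}")
      case False
      define m where "m = Min ?I"
      have m: "m \<in> ?I" unfolding m_def using False by (intro Min_in) auto
      have "i < m + 2 ^ (n - l)" if i: "i \<in> ?I" for i
      proof -
        have "real i * d / 2 ^ n - real m * d / 2 ^ n \<le> dist (z i) (z m)"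
          using z dist_triangle[of x "z i" "z m"] by (simp add: dist_commute)
        also have "\<dots> < d / 2 ^ l" unfolding d_def using i m by (intro same_cell_dist) auto
        finally have "(real i - real m) * d / 2 ^ n < d / 2 ^ l"
          by (simp add: diff_divide_distrib left_diff_distrib)
        then have "(real i - real m) * d < d / 2 ^ l * 2 ^ n" by (simp add: pos_divide_less_eq)
        also have "d / 2 ^ l * 2 ^ n = 2 ^ (n - l) * d"
          using l by (simp add: power_diff)
        finally have "real i - real m < 2 ^ (n - l)" using d by simp
        then have "real i < real (m + 2 ^ (n - l))" by simp
        then show ?thesis by (simp only: of_nat_less_iff)
      qed
      moreover have "m \<le> i" if "i \<in> ?I" for i unfolding m_def using that by (intro Min_le) auto
      ultimately have "?I \<subseteq> {m..<m + 2 ^ (n - l)}" by auto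
      then have "card ?I \<le> card {m..<m + 2 ^ (n - l)}" by (intro card_mono) auto
      then show ?thesis by simp
    qed (simp only: card.empty zero_le)
    then show "card {a \<in> ?J. cell l a = c} \<le> 2 ^ ((n - l) * 1)" by (simp only: card_eq mult_1_right)
  qed simp
  moreover have "?J \<subseteq> E" using z by auto
  moreover have "dist x a \<le> real CARD('n) / 2 ^ k" if "a \<in> ?J" for a
  proof -
    obtain i where i: "i \<le> 2 ^ (n - k)" "a = z i" using \<open>a \<in> ?J\<close> by auto
    have "real i \<le> 2 ^ (n - k)" using i(1) by (metis of_nat_le_iff of_nat_numeral of_nat_power)
    then have "real i * d / 2 ^ n \<le> 2 ^ (n - k) * d / 2 ^ n"
      using d by (intro divide_right_mono mult_right_mono) auto
    also have "\<dots> = d / 2 ^ k" using k by (simp add: power_diff)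
    finally show ?thesis using z i(2) by (simp add: d_def)
  qed
  moreover have "card ?J = 2 ^ (n - k)" using inj by (simp add: card_image inj_on_subset)
  ultimately show thesis by (rule that)
qed

lemma card_subcells:
  fixes c :: "'n::finite \<Rightarrow> int"
  assumes k: "k \<le> n"
  shows "finite {cell n z | z. cell k z = c}" "card {cell n z | z. cell k z = c} \<le> 2 ^ ((n - k) * CARD('n))"
proof -
  let ?m = "2 ^ (n - k) :: int"
  let ?P = "PiE (UNIV :: 'n set) (\<lambda>i. {c i * ?m ..< c i * ?m + ?m})"
  have sub: "{cell n z | z. cell k z = c} \<subseteq> ?P"
  proof (clarify, rule PiE_I)
    fix z :: "real^'n" and i
    assume "c = cell k z"
    have "(2::real) ^ n = 2 ^ k * 2 ^ (n - k)" using k by (simp add: power_add[symmetric])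
    then have "2 ^ k * z $ i = (2 ^ n * z $ i) / real_of_int ?m" by simp
    then have "cell k z i = cell n z i div ?m"
      unfolding cell_def by (simp only: floor_divide_real_eq_div zero_le_power zero_le_numeral)
    moreover have "0 \<le> cell n z i mod ?m" "cell n z i mod ?m < ?m" by simp_all
    ultimately show "cell n z i \<in> {cell k z i * ?m ..< cell k z i * ?m + ?m}"
      using div_mult_mod_eq[of "cell n z i" ?m] by (simp only: atLeastLessThan_iff) linarith
  qed auto
  have fin: "finite ?P" by (simp add: finite_PiE)
  show "finite {cell n z | z. cell k z = c}" using sub fin by (rule finite_subset)
  have "card {cell n z | z. cell k z = c} \<le> card ?P" using fin sub by (rule card_mono)
  also have "\<dots> = (\<Prod>i\<in>(UNIV :: 'n set). nat ?m)" by (simp add: card_PiE)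
  also have "\<dots> = 2 ^ ((n - k) * CARD('n))" by (simp add: nat_power_eq power_mult)
  finally show "card {cell n z | z. cell k z = c} \<le> 2 ^ ((n - k) * CARD('n))" .
qed

lemma hausdorff_content_finite_cover:
  fixes K :: "(real^'n::finite) set"
  assumes "finite J" "0 < \<rho>" "K \<subseteq> (\<Union>z\<in>J. ball z \<rho>)"
  shows "hausdorff_content s K \<le> ennreal (card J * \<rho> powr s)"
proof -
  obtain f where f: "bij_betw f {..<card J} J" using \<open>finite J\<close> by (metis atLeast0LessThan ex_bij_betw_nat_finite)
  have "K \<subseteq> (\<Union>j\<in>{..<card J}. ball (f j) \<rho>)"
  proof -
    have "(\<Union>j\<in>{..<card J}. ball (f j) \<rho>) = (\<Union>z\<in>f ` {..<card J}. ball z \<rho>)" by blast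
    also have "f ` {..<card J} = J" by (rule bij_betw_imp_surj_on[OF f])
    finally show ?thesis using assms(3) by simp
  qed
  then have "hausdorff_content s K \<le> (\<Sum>\<^sub>\<infinity>j\<in>{..<card J}. ennreal (\<rho> powr s))"
    unfolding hausdorff_content_def using assms(2)
    by (intro Inf_lower CollectI exI[of _ "{..<card J}"] exI[of _ f] exI[of _ "\<lambda>_. \<rho>"]) auto
  also have "\<dots> = ennreal (card J * \<rho> powr s)"
    by (simp add: ennreal_mult ennreal_of_nat_eq_real_of_nat)
  finally show ?thesis .
qed

text \<open>One point is taken from each level \<open>n\<close> cube that meets the complement
  inside the ball. Having at most one point per cube makes the set sparse for s = d, and balls of
  radius d / 2^n about its points cover, so the content bounds their number from below.\<close>

lemma sparse_content:
  fixes \<Omega> :: "(real^'n::finite) set"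
  assumes thick: "thick_with 0 C \<Omega>" and x: "x \<in> frontier \<Omega>" and k: "k \<le> n"
  obtains J where "dyadic_sparse n CARD('n) J" "J \<subseteq> - \<Omega>" "\<And>z. z \<in> J \<Longrightarrow> dist x z \<le> 1 / 2 ^ k"
    "C / (2 * real CARD('n)) ^ CARD('n) * 2 ^ ((n - k) * CARD('n)) \<le> card J"
proof -
  define d where "d = CARD('n)"
  have d: "0 < d" by (simp add: d_def)
  \<comment> \<open>The extra factor 1/2 keeps the radius below 1, where thickness applies, also at
    level 0.\<close>
  define r :: real where "r = 1 / 2 ^ k / 2"
  have r: "0 < r" "r < 1" "r \<le> 1 / 2 ^ k"
  proof -
    define q :: real where "q = 1 / 2 ^ k"
    have "0 < q" "q \<le> 1" by (simp_all add: q_def)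
    then show "0 < r" "r < 1" "r \<le> 1 / 2 ^ k" unfolding r_def q_def[symmetric] by simp_all
  qed
  let ?A = "ball x r - \<Omega>"
  have fin: "finite (cell n ` ?A)"
  proof -
    let ?P = "PiE (UNIV :: 'n set) (\<lambda>i. {\<lfloor>2 ^ n * (x $ i - 1)\<rfloor> .. \<lfloor>2 ^ n * (x $ i + 1)\<rfloor>})"
    have "cell n ` ?A \<subseteq> ?P"
    proof (clarify, rule PiE_I)
      fix z i assume "z \<in> ball x r"
      then have "\<bar>(x - z) $ i\<bar> \<le> 1" using component_le_norm_cart[of "x - z" i] r by (simp add: dist_norm)
      then show "cell n z i \<in> {\<lfloor>2 ^ n * (x $ i - 1)\<rfloor> .. \<lfloor>2 ^ n * (x $ i + 1)\<rfloor>}"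
        unfolding cell_def by (auto intro!: floor_mono mult_left_mono)
    qed auto
    then show ?thesis by (rule finite_subset) (simp add: finite_PiE)
  qed
  define rep where "rep c = (SOME z. z \<in> ?A \<and> cell n z = c)" for c
  have rep: "rep c \<in> ?A \<and> cell n (rep c) = c" if "c \<in> cell n ` ?A" for c
    unfolding rep_def by (rule someI_ex) (use that in auto)
  let ?J = "rep ` cell n ` ?A"
  have injc: "inj_on (cell n) ?J"
  proof (rule inj_onI)
    fix a b assume ab: "a \<in> ?J" "b \<in> ?J" and eq: "cell n a = cell n b"
    obtain c where c: "c \<in> cell n ` ?A" "a = rep c" using ab(1) by blast
    obtain c' where c': "c' \<in> cell n ` ?A" "b = rep c'" using ab(2) by blast
    show "a = b" using rep[OF c(1)] rep[OF c'(1)] c(2) c'(2) eq by simp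
  qed
  have finJ: "finite ?J" using fin by simp
  have sparse: "dyadic_sparse n d ?J"
    unfolding dyadic_sparse_def
  proof (intro conjI allI impI)
    show "finite ?J" by (rule finJ)
    fix l c assume l: "l \<le> n"
    have "card {z \<in> ?J. cell l z = c} = card (cell n ` {z \<in> ?J. cell l z = c})"
      by (rule card_image[symmetric]) (rule inj_on_subset[OF injc], auto)
    also have "\<dots> \<le> card {cell n z | z. cell l z = c}"
      by (rule card_mono[OF card_subcells(1)[OF l]]) auto
    also have "\<dots> \<le> 2 ^ ((n - l) * d)" unfolding d_def by (rule card_subcells(2)[OF l])
    finally show "card {z \<in> ?J. cell l z = c} \<le> 2 ^ ((n - l) * d)" .
  qed
  have "?A \<subseteq> (\<Union>z\<in>?J. ball z (real d / 2 ^ n))"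
  proof
    fix z assume z: "z \<in> ?A"
    then have "cell n z \<in> cell n ` ?A" by (rule imageI)
    note R = rep[OF this]
    have "dist (rep (cell n z)) z < real d / 2 ^ n"
      unfolding d_def by (rule same_cell_dist) (use R in auto)
    then show "z \<in> (\<Union>z\<in>?J. ball z (real d / 2 ^ n))" using z by auto
  qed
  then have "hausdorff_content (real d) ?A \<le> ennreal (card ?J * (real d / 2 ^ n) powr real d)"
    using d by (intro hausdorff_content_finite_cover finJ) auto
  moreover have "ennreal (C * r powr (real d)) \<le> hausdorff_content (real d) ?A"
    using thick x r(1,2) by (auto simp: thick_with_def d_def)
  ultimately have "ennreal (C * r powr (real d)) \<le> ennreal (card ?J * (real d / 2 ^ n) powr real d)"
    by (rule order_trans[rotated])
  then have "C * r powr real d \<le> card ?J * (real d / 2 ^ n) powr real d"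
    by (subst (asm) ennreal_le_iff) auto
  then have main: "C * r ^ d \<le> card ?J * (real d / 2 ^ n) ^ d"
    using r d by (simp add: powr_realpow)
  have "C / (2 * real d) ^ d * 2 ^ ((n - k) * d) \<le> card ?J"
  proof -
    have "C / (2 * real d) ^ d * 2 ^ ((n - k) * d) * (real d / 2 ^ n) ^ d = C * r ^ d"
    proof -
      have "(2::real) ^ ((n - k) * d) = (2 ^ n / 2 ^ k) ^ d" using k by (simp add: power_mult power_diff)
      then have "C / (2 * real d) ^ d * 2 ^ ((n - k) * d) * (real d / 2 ^ n) ^ d
          = C * (1 / (2 * real d) * (2 ^ n / 2 ^ k) * (real d / 2 ^ n)) ^ d"
        by (simp only: power_mult_distrib power_one_over divide_inverse power_inverse mult_1_left mult_ac)
      also have "1 / (2 * real d) * (2 ^ n / 2 ^ k) * (real d / 2 ^ n) = r"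
        using d by (simp add: r_def)
      finally show ?thesis .
    qed
    then have "C / (2 * real d) ^ d * 2 ^ ((n - k) * d) * (real d / 2 ^ n) ^ d \<le> card ?J * (real d / 2 ^ n) ^ d"
      using main by simp
    then show ?thesis by (rule mult_right_le_imp_le) (use d in simp)
  qed
  moreover have "?J \<subseteq> - \<Omega>" using rep by blast
  moreover have "dist x z \<le> 1 / 2 ^ k" if "z \<in> ?J" for z
    using that rep r(3) by fastforce
  ultimately show thesis using that sparse unfolding d_def by blast
qed

text \<open>\<open>\<Omega>\<close> has complement of dimension \<open>s\<close> around each boundary point, at all scales \<open>2\<^sup>-\<^sup>k \<ge> 2\<^sup>-\<^sup>n\<close>.\<close>

definition local_mass :: "(real^'n::finite) set \<Rightarrow> nat \<Rightarrow> real \<Rightarrow> nat \<Rightarrow> bool" where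
  "local_mass \<Omega> s c n \<longleftrightarrow>
     (\<forall>z\<in>frontier \<Omega>. \<forall>k\<le>n. \<exists>J. dyadic_sparse n s J \<and> J \<subseteq> - \<Omega> \<and> J \<noteq> {} \<and>
        (\<forall>a\<in>J. dist z a \<le> real CARD('n) / 2 ^ k) \<and> c * 2 ^ ((n - k) * s) \<le> card J)"

lemma frontier_open_notin: "open \<Omega> \<Longrightarrow> z \<in> frontier \<Omega> \<Longrightarrow> z \<notin> \<Omega>"
  by (simp add: frontier_def interior_open)

text \<open>Dimension 0 asks for one point at every scale, and the boundary point itself
  serves.\<close>

lemma local_mass_point:
  assumes "open \<Omega>"
  shows "local_mass \<Omega> 0 1 n"
  unfolding local_mass_def
proof (intro ballI allI impI)
  fix z k assume "z \<in> frontier \<Omega>"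
  then have "z \<notin> \<Omega>" by (rule frontier_open_notin[OF assms])
  then show "\<exists>J. dyadic_sparse n 0 J \<and> J \<subseteq> - \<Omega> \<and> J \<noteq> {} \<and> (\<forall>a\<in>J. dist z a \<le> real CARD('a) / 2 ^ k) \<and>
      1 * 2 ^ ((n - k) * 0) \<le> real (card J)"
    by (intro exI[of _ "{z}"]) (simp add: sparse_singleton)
qed

lemma unbounded_complement:
  fixes \<Omega> :: "(real^'n::finite) set"
  assumes "bounded \<Omega>"
  shows "\<not> bounded (- \<Omega>)"
  using bounded_Un[of \<Omega> "- \<Omega>"] assms not_bounded_UNIV[where 'a = "real^'n"] by (auto simp: Compl_partition)

lemma local_mass_connected:
  fixes \<Omega> :: "(real^'n::finite) set"
  assumes \<Omega>: "open \<Omega>" "bounded \<Omega>" "connected (- \<Omega>)"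
  shows "local_mass \<Omega> 1 1 n"
  unfolding local_mass_def
proof (intro ballI allI impI)
  fix z k assume z: "z \<in> frontier \<Omega>" and k: "k \<le> n"
  have "z \<in> - \<Omega>" using frontier_open_notin[OF \<Omega>(1) z] by simp
  obtain J where J: "dyadic_sparse n 1 J" "J \<subseteq> - \<Omega>" "\<And>a. a \<in> J \<Longrightarrow> dist z a \<le> real CARD('n) / 2 ^ k"
      "card J = 2 ^ (n - k)"
    using sparse_connected[OF \<Omega>(3) \<open>z \<in> - \<Omega>\<close> unbounded_complement[OF \<Omega>(2)] k] by blast
  have "J \<noteq> {}" using J(4) by (intro notI) simp
  then show "\<exists>J. dyadic_sparse n 1 J \<and> J \<subseteq> - \<Omega> \<and> J \<noteq> {} \<and> (\<forall>a\<in>J. dist z a \<le> real CARD('n) / 2 ^ k) \<and>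
      1 * 2 ^ ((n - k) * 1) \<le> real (card J)"
    using J by (intro exI[of _ J]) simp
qed

lemma local_mass_content:
  fixes \<Omega> :: "(real^'n::finite) set"
  assumes thick: "thick_with 0 C \<Omega>"
  shows "local_mass \<Omega> CARD('n) (C / (2 * real CARD('n)) ^ CARD('n)) n"
  unfolding local_mass_def
proof (intro ballI allI impI)
  fix z k assume z: "z \<in> frontier \<Omega>" and k: "k \<le> n"
  obtain J where J: "dyadic_sparse n CARD('n) J" "J \<subseteq> - \<Omega>" "\<And>a. a \<in> J \<Longrightarrow> dist z a \<le> 1 / 2 ^ k"
    "C / (2 * real CARD('n)) ^ CARD('n) * 2 ^ ((n - k) * CARD('n)) \<le> card J"
    using sparse_content[OF thick z k] by metis
  have "0 < C" using thick by (simp add: thick_with_def)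
  then have "0 < C / (2 * real CARD('n)) ^ CARD('n) * 2 ^ ((n - k) * CARD('n))" by simp
  then have "J \<noteq> {}" using J(4) by (intro notI) simp
  moreover have "dist z a \<le> real CARD('n) / 2 ^ k" if "a \<in> J" for a
  proof -
    have "1 / 2 ^ k \<le> real CARD('n) / 2 ^ k" by (intro divide_right_mono) (simp_all add: Suc_leI)
    then show ?thesis using J(3)[OF that] by linarith
  qed
  ultimately show "\<exists>J. dyadic_sparse n CARD('n) J \<and> J \<subseteq> - \<Omega> \<and> J \<noteq> {} \<and> (\<forall>a\<in>J. dist z a \<le> real CARD('n) / 2 ^ k) \<and>
      C / (2 * real CARD('n)) ^ CARD('n) * 2 ^ ((n - k) * CARD('n)) \<le> real (card J)"
    using J(1,2,4) by (intro exI[of _ J]) simp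
qed

text \<open>Passage from dyadic scales to arbitrary \<delta>: \<open>k\<close> is the coarsest level
  whose radius A / 2^k fits into \<delta>. Rounding loses at most the factor 2 A, and \<delta> \<ge>
  \<epsilon> keeps the level within \<open>n\<close>.\<close>

lemma local_mass_scale:
  fixes \<Omega> :: "(real^'n::finite) set"
  defines "A \<equiv> real CARD('n)"
  assumes lm: "local_mass \<Omega> s c n" and c: "0 < c"
    and n: "1 / 2 ^ n \<le> \<epsilon> / (2 * A)"
    and \<delta>: "0 < \<epsilon>" "\<epsilon> \<le> \<delta>" "\<delta> \<le> 1" and z: "z \<in> frontier \<Omega>"
  obtains J where "dyadic_sparse n s J" "J \<subseteq> - \<Omega>" "J \<noteq> {}" "\<And>a. a \<in> J \<Longrightarrow> dist z a \<le> \<delta>"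
    "c * (\<delta> / (2 * A)) ^ s \<le> card J / 2 ^ (n * s)"
proof -
  have A: "1 \<le> A" by (simp add: A_def Suc_leI)
  define k where "k = (LEAST k. A / 2 ^ k \<le> \<delta>)"
  have "A / 2 ^ n \<le> A * (\<epsilon> / (2 * A))" using n A mult_left_mono[OF n, of A] by simp
  also have "\<dots> \<le> \<delta>" using \<delta> A by simp
  finally have nn: "A / 2 ^ n \<le> \<delta>" .
  have k1: "A / 2 ^ k \<le> \<delta>" unfolding k_def using nn by (rule LeastI)
  have kn: "k \<le> n" unfolding k_def using nn by (rule Least_le)
  have k2: "\<delta> / (2 * A) \<le> 1 / 2 ^ k"
  proof (cases k)
    case 0
    have "\<delta> \<le> 2 * A" using \<delta> A by linarith
    then show ?thesis using 0 A by simp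
  next
    case (Suc j)
    have "\<not> A / 2 ^ j \<le> \<delta>" using not_less_Least[of j "\<lambda>k. A / 2 ^ k \<le> \<delta>"] Suc k_def by simp
    then have "\<delta> < A / 2 ^ j" by simp
    then have "\<delta> / (2 * A) < (A / 2 ^ j) / (2 * A)" using A by (intro divide_strict_right_mono) auto
    then show ?thesis using Suc A by simp
  qed
  obtain J where J: "dyadic_sparse n s J" "J \<subseteq> - \<Omega>" "J \<noteq> {}" "\<And>a. a \<in> J \<Longrightarrow> dist z a \<le> A / 2 ^ k"
      "c * 2 ^ ((n - k) * s) \<le> card J"
  proof -
    from lm[unfolded local_mass_def, rule_format, OF z kn]
    show ?thesis using that unfolding A_def by blast
  qed
  have "c * (\<delta> / (2 * A)) ^ s \<le> c * (1 / 2 ^ k) ^ s"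
    using k2 \<delta> A c by (intro mult_left_mono power_mono) auto
  also have "\<dots> = c * 2 ^ ((n - k) * s) / 2 ^ (n * s)"
    using kn by (simp add: power_diff diff_mult_distrib power_one_over power_mult[symmetric])
  also have "\<dots> \<le> card J / 2 ^ (n * s)" using J(5) by (intro divide_right_mono) auto
  finally have "c * (\<delta> / (2 * A)) ^ s \<le> card J / 2 ^ (n * s)" .
  moreover have "dist z a \<le> \<delta>" if "a \<in> J" for a using J(4)[OF that] k1 by linarith
  ultimately show thesis using that[OF J(1-3)] by blast
qed

section \<open>Step bounds for the two kernels\<close>

lemma power_kernel_le:
  assumes "0 < p" "0 < \<epsilon>" "0 < t"
  shows "power_kernel p \<epsilon> t \<le> t powr (- p)"
proof -
  have "max t (\<epsilon> / 2) powr (- p) \<le> t powr (- p)" using assms by (intro powr_mono2') auto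
  then show ?thesis by (auto simp: power_kernel_def)
qed

text \<open>The shell at scale 2^(-k) contributes order 2^(k(p-s)), which is largest at the finest
  level as p \<ge> s; there are n + 1 terms. The bound is linear in \<open>n\<close> for p = s, and
  also for p above s as long as 2^(n(p-s)) stays bounded.\<close>

lemma power_kernel_pot_le:
  fixes I :: "(real^'n::finite) set"
  assumes p: "0 < p" "real s \<le> p" and \<epsilon>: "0 < \<epsilon>" and n: "1 / 2 ^ n \<le> \<epsilon> / 2" and I: "dyadic_sparse n s I"
  shows "energy_kernel.pot (power_kernel p \<epsilon>) n s I y
    \<le> 3 ^ CARD('n) * 2 powr p * 2 powr (real n * (p - real s)) * (real n + 1)"
proof -
  interpret energy_kernel "power_kernel p \<epsilon>" using p(1) \<epsilon> by (rule energy_kernel_power)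
  define b where "b = 2 powr p * 2 powr (real n * (p - real s))"
  have e: "(1 / 2 ^ k) powr (- p) = 2 powr (real k * p)" for k :: nat
    by (simp add: powr_minus powr_divide powr_realpow[symmetric] powr_powr)
  have e': "(2::real) ^ (k * s) = 2 powr (real k * real s)" for k
    by (simp add: powr_realpow[symmetric])
  have t1: "power_kernel p \<epsilon> (1 / 2 ^ Suc k) / 2 ^ (k * s) \<le> b" if k: "k < n" for k
  proof -
    have "power_kernel p \<epsilon> (1 / 2 ^ Suc k) / 2 ^ (k * s) \<le> (1 / 2 ^ Suc k) powr (- p) / 2 ^ (k * s)"
      using p \<epsilon> by (intro divide_right_mono power_kernel_le) auto
    also have "\<dots> = 2 powr (p + real k * (p - real s))"
      unfolding e e' powr_diff[symmetric] by (simp add: algebra_simps)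
    also have "\<dots> \<le> 2 powr (p + real n * (p - real s))"
      using p k by (intro powr_mono add_left_mono mult_right_mono) auto
    also have "\<dots> = b" by (simp add: b_def powr_add)
    finally show ?thesis .
  qed
  have t2: "power_kernel p \<epsilon> 0 / 2 ^ (n * s) \<le> b"
  proof -
    have "power_kernel p \<epsilon> 0 \<le> (\<epsilon> / 2) powr (- p)" using \<epsilon> by (simp add: power_kernel_def)
    also have "\<dots> \<le> (1 / 2 ^ n) powr (- p)" using n p by (intro powr_mono2') auto
    finally have "power_kernel p \<epsilon> 0 / 2 ^ (n * s) \<le> (1 / 2 ^ n) powr (- p) / 2 ^ (n * s)"
      by (intro divide_right_mono) auto
    also have "\<dots> = 2 powr (real n * (p - real s))"
      unfolding e e' powr_diff[symmetric] by (simp add: algebra_simps)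
    also have "\<dots> \<le> 2 powr (p + real n * (p - real s))" using p by (intro powr_mono) auto
    also have "\<dots> = b" by (simp add: b_def powr_add)
    finally show ?thesis .
  qed
  have "pot n s I y \<le> 3 ^ CARD('n) * ((\<Sum>k<n. power_kernel p \<epsilon> (1 / 2 ^ Suc k) / 2 ^ (k * s)) + power_kernel p \<epsilon> 0 / 2 ^ (n * s))"
    by (rule pot_bound_shells[OF I])
  also have "\<dots> \<le> 3 ^ CARD('n) * ((\<Sum>k<n. b) + b)"
    using t1 t2 by (intro mult_left_mono add_mono sum_mono) auto
  also have "\<dots> = 3 ^ CARD('n) * 2 powr p * 2 powr (real n * (p - real s)) * (real n + 1)"
    by (simp add: b_def algebra_simps)
  finally show ?thesis .
qed

text \<open>A near point gains order \<delta>^(-p) and the exchanged set has mass of order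
  \<delta>^s, so p \<ge> s makes the gain at least a constant \<open>Gt\<close> at every scale. For
  s = 0 the alternative m = 1 counts a single near point instead.\<close>

theorem expected_steps_power:
  fixes \<Omega> :: "(real^'n::finite) set" and M :: "'w measure"
  defines "A \<equiv> real CARD('n)"
  assumes walk: "walk_on_spheres M F \<Omega> \<beta> \<epsilon> x r \<gamma>"
    and dom: "bounded_domain \<Omega>" and diam: "diameter \<Omega> \<le> R"
    and \<epsilon>: "0 < \<epsilon>" and \<beta>: "0 < \<beta>" "\<beta> < 1"
    and p: "0 < p" "A - 2 < p" "real s \<le> p"
    and lm: "local_mass \<Omega> s c n" "0 < c"
    and n: "1 / 2 ^ n \<le> \<epsilon> / (2 * A)"
    and UB: "\<And>I y. dyadic_sparse n s (I :: (real^'n) set) \<Longrightarrow> energy_kernel.pot (power_kernel p \<epsilon>) n s I y \<le> UB"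
    and \<theta>: "0 \<le> \<theta>" "\<theta> * (1 + 2 powr p) + 4 powr (- p) < 1"
    and m: "m = \<theta> * c \<or> (s = 0 \<and> m = 1)"
    and Gt: "0 < Gt" "Gt \<le> m / (16 * A) ^ s * (p * (p + 2 - A) * (2/3) powr (p + 2) / (2 * A)) * (\<beta> / 16)\<^sup>2"
  shows "(\<integral>\<^sup>+\<omega>. wos_steps \<Omega> \<epsilon> x r \<gamma> \<omega> \<partial>M) \<le> ennreal (UB / Gt + 256 * R\<^sup>2 / \<beta>\<^sup>2)"
proof -
  let ?K = "power_kernel p \<epsilon>"
  define B where "B = p * (p + 2 - A) * (2/3) powr (p + 2) / (2 * A)"
  have A: "1 \<le> A" by (simp add: A_def Suc_leI)
  have B: "0 < B" using p A by (simp add: B_def)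
  have "(\<integral>\<^sup>+\<omega>. wos_steps \<Omega> \<epsilon> x r \<gamma> \<omega> \<partial>M) \<le> ennreal (UB / Gt + 4 * R\<^sup>2 / (\<beta>\<^sup>2 * (1/8)\<^sup>2))"
  proof (rule expected_steps_energy[OF walk dom diam \<epsilon> \<beta> energy_kernel_power[OF p(1) \<epsilon>] UB _ _ Gt(1)])
    show "?K (norm w) \<le> (\<integral>v. ?K (norm (w + \<rho> *\<^sub>R v)) \<partial>uniform_sphere)"
      if "\<epsilon> \<le> norm w" "0 \<le> \<rho>" "\<rho> \<le> norm w / 2" for w :: "real^'n" and \<rho>
      using p that \<epsilon> by (intro power_kernel_mean(1)) (auto simp: A_def)
    \<comment> \<open>The threshold 1/8 keeps \<delta>, 2 \<delta> and 8 \<delta> in the unit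
      interval, where the kernel is t^(-p) - 1.\<close>
    fix \<delta> :: real assume \<delta>: "\<epsilon> \<le> \<delta>" "\<delta> \<le> 1/8"
    have \<delta>0: "0 < \<delta>" using \<delta> \<epsilon> by linarith
    define G where "G = B * (\<beta> / 16)\<^sup>2 * (8 * \<delta>) powr (- p)"
    have G: "0 \<le> G" using B by (simp add: G_def)
    have th: "\<theta> * ?K \<delta> + ?K (8 * \<delta>) < (1 - \<theta>) * ?K (2 * \<delta>)"
    proof -
      define X where "X = (2 * \<delta>) powr (- p)"
      have X: "0 < X" using \<delta>0 by (simp add: X_def)
      have k1: "?K \<delta> = 2 powr p * X - 1"
      proof -
        have "\<delta> powr (- p) = (1/2 * (2 * \<delta>)) powr (- p)" by simp
        also have "\<dots> = (1/2) powr (- p) * X" unfolding X_def by (rule powr_mult)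
        also have "(1/2 :: real) powr (- p) = 2 powr p" by (simp add: powr_minus powr_divide)
        finally show ?thesis using p \<epsilon> \<delta> by (subst power_kernel_eq) auto
      qed
      have k8: "?K (8 * \<delta>) = 4 powr (- p) * X - 1"
      proof -
        have "(8 * \<delta>) powr (- p) = (4 * (2 * \<delta>)) powr (- p)" by simp
        also have "\<dots> = 4 powr (- p) * X" unfolding X_def by (rule powr_mult)
        finally show ?thesis using p \<epsilon> \<delta> by (subst power_kernel_eq) auto
      qed
      have k2: "?K (2 * \<delta>) = X - 1" unfolding X_def using p \<epsilon> \<delta> by (intro power_kernel_eq) auto
      \<comment> \<open>The constants -1 leave a nonnegative surplus 2 \<theta>, so it suffices to
        compare the coefficients of \<open>X\<close>.\<close>
      have "0 < X * (1 - (\<theta> * (1 + 2 powr p) + 4 powr (- p)))" using X \<theta>(2) by simp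
      then show ?thesis using \<theta>(1) unfolding k1 k8 k2 by (simp add: algebra_simps)
    qed
    have gain: "?K (norm w) + G \<le> (\<integral>v. ?K (norm (w + \<rho> *\<^sub>R v)) \<partial>uniform_sphere)"
      if w: "\<delta> \<le> norm w" "norm w \<le> 8 * \<delta>" "\<beta> * \<delta> / 2 \<le> \<rho>" "\<rho> \<le> \<delta> / 2" for w :: "real^'n" and \<rho>
    proof -
      have w0: "0 < norm w" using w \<delta>0 by linarith
      have bd: "0 \<le> \<beta> * \<delta>" using \<beta> \<delta>0 by simp
      have "\<beta> / 16 \<le> \<rho> / norm w"
      proof -
        have "\<beta> / 16 * norm w \<le> \<beta> / 16 * (8 * \<delta>)" using w \<beta> by (intro mult_left_mono) auto
        also have "\<dots> \<le> \<rho>" using w by simp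
        finally show ?thesis using w0 by (simp add: pos_le_divide_eq)
      qed
      then have "(\<beta> / 16)\<^sup>2 \<le> (\<rho> / norm w)\<^sup>2" using \<beta> by (intro power_mono) auto
      moreover have "(8 * \<delta>) powr (- p) \<le> norm w powr (- p)" using w w0 p by (intro powr_mono2') auto
      ultimately have "G \<le> B * (\<rho> / norm w)\<^sup>2 * norm w powr (- p)"
        unfolding G_def using B by (intro mult_mono mult_left_mono) auto
      moreover have "?K (norm w) + B * (\<rho> / norm w)\<^sup>2 * norm w powr (- p) \<le> (\<integral>v. ?K (norm (w + \<rho> *\<^sub>R v)) \<partial>uniform_sphere)"
        unfolding B_def A_def using p w w0 \<epsilon> \<delta> bd by (intro power_kernel_mean(2)) (auto simp: A_def)
      ultimately show ?thesis by linarith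
    qed
    have J: "\<exists>J. dyadic_sparse n s J \<and> J \<subseteq> - \<Omega> \<and> J \<noteq> {} \<and> (\<forall>a\<in>J. dist z a \<le> \<delta>) \<and>
            Gt \<le> max 1 (\<theta> * card J) * G / 2 ^ (n * s)" if z: "z \<in> frontier \<Omega>" for z
    proof -
      obtain J where J: "dyadic_sparse n s J" "J \<subseteq> - \<Omega>" "J \<noteq> {}" "\<And>a. a \<in> J \<Longrightarrow> dist z a \<le> \<delta>"
        "c * (\<delta> / (2 * A)) ^ s \<le> card J / 2 ^ (n * s)"
        using local_mass_scale[OF lm n[unfolded A_def] \<epsilon> \<delta>(1) _ z] \<delta> unfolding A_def by auto
      have "m * (\<delta> / (2 * A)) ^ s \<le> max 1 (\<theta> * card J) / 2 ^ (n * s)"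
        using m
      proof
        assume "m = \<theta> * c"
        then have "m * (\<delta> / (2 * A)) ^ s \<le> \<theta> * (card J / 2 ^ (n * s))"
          using mult_left_mono[OF J(5) \<theta>(1)] by (simp only: mult.assoc)
        also have "\<dots> \<le> max 1 (\<theta> * card J) / 2 ^ (n * s)" by (simp add: divide_right_mono)
        finally show ?thesis .
      qed simp
      then have le: "m * (\<delta> / (2 * A)) ^ s * G \<le> max 1 (\<theta> * card J) / 2 ^ (n * s) * G"
        using G by (rule mult_right_mono)
      have "m / (16 * A) ^ s * B * (\<beta> / 16)\<^sup>2 \<le> m * (\<delta> / (2 * A)) ^ s * G"
      proof -
        have m0: "0 \<le> m" using m \<theta>(1) lm(2) by auto
        \<comment> \<open>The product of mass and gain carries \<delta>^(s-p), which is smallest at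
          the top scale 8 \<delta> = 1.\<close>
        have "1 \<le> (8 * \<delta>) powr (real s - p)"
        proof -
          have "1 powr (real s - p) \<le> (8 * \<delta>) powr (real s - p)"
            using p \<delta>0 \<delta> by (intro powr_mono2') auto
          then show ?thesis by simp
        qed
        also have "\<dots> = (8 * \<delta>) ^ s * (8 * \<delta>) powr (- p)"
          using \<delta>0 by (simp add: powr_diff powr_minus powr_realpow divide_inverse)
        finally have one: "1 \<le> (8 * \<delta>) ^ s * (8 * \<delta>) powr (- p)" .
        have "m * (\<delta> / (2 * A)) ^ s * G = m / (16 * A) ^ s * B * (\<beta> / 16)\<^sup>2 * ((8 * \<delta>) ^ s * (8 * \<delta>) powr (- p))"
        proof -
          have "\<delta> / (2 * A) = 1 / (16 * A) * (8 * \<delta>)" by simp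
          then have "(\<delta> / (2 * A)) ^ s = 1 / (16 * A) ^ s * (8 * \<delta>) ^ s"
            by (simp only: power_mult_distrib power_one_over)
          then show ?thesis by (simp add: G_def)
        qed
        also have "\<dots> \<ge> m / (16 * A) ^ s * B * (\<beta> / 16)\<^sup>2"
          using mult_left_mono[OF one, of "m / (16 * A) ^ s * B * (\<beta> / 16)\<^sup>2"] m0 A B by simp
        finally show ?thesis .
      qed
      then have "Gt \<le> max 1 (\<theta> * card J) * G / 2 ^ (n * s)"
        using Gt(2) le unfolding B_def by simp
      then show ?thesis using J by blast
    qed
    show "\<exists>G\<ge>0. \<exists>\<theta>\<ge>0. \<theta> * ?K \<delta> + ?K (8 * \<delta>) < (1 - \<theta>) * ?K (2 * \<delta>) \<and>
        (\<forall>(w :: real^'n) \<rho>. \<delta> \<le> norm w \<longrightarrow> norm w \<le> 8 * \<delta> \<longrightarrow> \<beta> * \<delta> / 2 \<le> \<rho> \<longrightarrow> \<rho> \<le> \<delta> / 2 \<longrightarrow>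
            ?K (norm w) + G \<le> (\<integral>v. ?K (norm (w + \<rho> *\<^sub>R v)) \<partial>uniform_sphere)) \<and>
        (\<forall>z\<in>frontier \<Omega>. \<exists>J. dyadic_sparse n s J \<and> J \<subseteq> - \<Omega> \<and> J \<noteq> {} \<and> (\<forall>a\<in>J. dist z a \<le> \<delta>) \<and>
            Gt \<le> max 1 (\<theta> * card J) * G / 2 ^ (n * s))"
      using G \<theta>(1) th gain J by blast
  qed auto
  then show ?thesis by (simp add: power2_eq_square)
qed

lemma truncated_kernel_le:
  assumes "3 \<le> d" "0 < \<epsilon>" "0 < t"
  shows "truncated_kernel d a \<epsilon> t \<le> t powr (2 - d)"
proof -
  define T where "T = max t (\<epsilon> / 2)"
  have "T powr (2 - d) * (1 - (T / a) powr (1/2) / 2) \<le> T powr (2 - d) * 1"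
    by (intro mult_left_mono) auto
  also have "\<dots> \<le> t powr (2 - d)" using assms by (simp add: T_def, intro powr_mono2') auto
  finally show ?thesis by (simp add: truncated_kernel_def T_def[symmetric])
qed

lemma sum_powers_le:
  assumes "2 \<le> (x::real)"
  shows "(\<Sum>k<n. x ^ k) \<le> x ^ n"
proof (induction n)
  case (Suc n)
  have "x ^ n + x ^ n \<le> x * x ^ n" using assms mult_right_mono[of 2 x "x ^ n"] by simp
  then show ?case using Suc by simp
qed simp

text \<open>The kernel exponent d - 2 exceeds \<open>s\<close> by j + 1, so the shell contributions
  grow geometrically and the finest scale dominates; no factor \<open>n\<close> appears.\<close>

lemma truncated_kernel_pot_le:
  fixes I :: "(real^'n::finite) set"
  assumes d: "CARD('n) = s + 3 + j" and a: "0 < a" "a \<le> 1/4" and \<epsilon>: "0 < \<epsilon>" and n: "1 / 2 ^ n \<le> \<epsilon> / 2"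
    and I: "dyadic_sparse n s I"
  shows "energy_kernel.pot (truncated_kernel (real CARD('n)) a \<epsilon>) n s I y
    \<le> 3 ^ CARD('n) * (2 ^ CARD('n) + 1) * (2 ^ n) ^ (j + 1)"
proof -
  let ?d = "real CARD('n)"
  have d3: "3 \<le> ?d" using d by simp
  let ?K = "truncated_kernel ?d a \<epsilon>"
  interpret energy_kernel ?K by (rule energy_kernel_truncated[OF d3 a \<epsilon>])
  have e: "(1 / 2 ^ k) powr (2 - ?d) = (2 ^ k) ^ (s + 1 + j)" for k :: nat
  proof -
    have e1: "2 - ?d = - real (s + 1 + j)" using d by simp
    have "(1 / 2 ^ k) powr (2 - ?d) = inverse ((1 / 2 ^ k) ^ (s + 1 + j))"
      unfolding e1 powr_minus by (subst powr_realpow) auto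
    then show ?thesis by (simp only: power_one_over inverse_eq_divide divide_divide_eq_right mult_1_left div_by_1 mult_1_right)
  qed
  have e2: "((2::real) ^ k) ^ (s + 1 + j) / 2 ^ (k * s) = (2 ^ (j + 1)) ^ k" for k
  proof -
    have "((2::real) ^ k) ^ (s + 1 + j) = (2 ^ k) ^ s * (2 ^ k) ^ (j + 1)"
      unfolding power_add[symmetric] by (rule arg_cong[where f = "(^) (2 ^ k)"]) simp
    moreover have "((2::real) ^ k) ^ (j + 1) = (2 ^ (j + 1)) ^ k"
      unfolding power_mult[symmetric] by (simp only: mult.commute)
    ultimately show ?thesis by (simp only: power_mult nonzero_mult_div_cancel_left power_not_zero zero_neq_numeral[symmetric] not_False_eq_True)
  qed
  have t1: "?K (1 / 2 ^ Suc k) / 2 ^ (k * s) \<le> 2 ^ CARD('n) * (2 ^ (j + 1)) ^ k" for k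
  proof -
    have "?K (1 / 2 ^ Suc k) / 2 ^ (k * s) \<le> (1 / 2 ^ Suc k) powr (2 - ?d) / 2 ^ (k * s)"
      using d3 \<epsilon> by (intro divide_right_mono truncated_kernel_le) auto
    also have "\<dots> = 2 ^ (s + 1 + j) * (2 ^ (j + 1)) ^ k"
    proof -
      have "((2::real) ^ Suc k) ^ (s + 1 + j) = 2 ^ (s + 1 + j) * (2 ^ k) ^ (s + 1 + j)"
        by (simp only: power_Suc power_mult_distrib)
      then show ?thesis unfolding e e2[symmetric] by (simp only: times_divide_eq_right)
    qed
    also have "\<dots> \<le> 2 ^ CARD('n) * (2 ^ (j + 1)) ^ k"
      using d by (intro mult_right_mono power_increasing) auto
    finally show ?thesis .
  qed
  have t2: "?K 0 / 2 ^ (n * s) \<le> (2 ^ (j + 1)) ^ n"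
  proof -
    have "?K 0 = ?K (\<epsilon> / 2)" using \<epsilon> by (simp add: truncated_kernel_def)
    also have "\<dots> \<le> ?K (1 / 2 ^ n)" using n by (rule K_le)
    also have "\<dots> \<le> (1 / 2 ^ n) powr (2 - ?d)" using d3 \<epsilon> by (intro truncated_kernel_le) auto
    finally have "?K 0 / 2 ^ (n * s) \<le> (1 / 2 ^ n) powr (2 - ?d) / 2 ^ (n * s)" by (intro divide_right_mono) auto
    also have "\<dots> = (2 ^ (j + 1)) ^ n"
      unfolding e by (rule e2)
    finally show ?thesis .
  qed
  have "pot n s I y \<le> 3 ^ CARD('n) * ((\<Sum>k<n. ?K (1 / 2 ^ Suc k) / 2 ^ (k * s)) + ?K 0 / 2 ^ (n * s))"
    by (rule pot_bound_shells[OF I])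
  also have "\<dots> \<le> 3 ^ CARD('n) * ((\<Sum>k<n. 2 ^ CARD('n) * (2 ^ (j + 1)) ^ k) + (2 ^ (j + 1)) ^ n)"
    using t1 t2 by (intro mult_left_mono add_mono sum_mono) auto
  also have "\<dots> \<le> 3 ^ CARD('n) * (2 ^ CARD('n) * (2 ^ (j + 1)) ^ n + (2 ^ (j + 1)) ^ n)"
  proof -
    have "(2::real) \<le> 2 ^ (j + 1)" by simp
    then have "(\<Sum>k<n. (2 ^ (j + 1) :: real) ^ k) \<le> (2 ^ (j + 1)) ^ n" by (rule sum_powers_le)
    then show ?thesis unfolding sum_distrib_left[symmetric] by (intro mult_left_mono add_mono) auto
  qed
  also have "\<dots> = 3 ^ CARD('n) * (2 ^ CARD('n) + 1) * (2 ^ n) ^ (j + 1)"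
  proof -
    have "((2::real) ^ (j + 1)) ^ n = (2 ^ n) ^ (j + 1)"
      unfolding power_mult[symmetric] by (simp only: mult.commute)
    then show ?thesis by (simp only: distrib_right mult_1_left mult.assoc)
  qed
  finally show ?thesis .
qed

text \<open>Mass of order \<delta>^s times the gain a^(-1/2) \<delta>^(5/2-d) is least at the top
  scale \<delta> = a / 2, where it is of order a^(s+2-d) = a^(-(j+1)). Above that scale the squared
  displacement takes over at the price a^(-2).\<close>

theorem expected_steps_truncated:
  fixes \<Omega> :: "(real^'n::finite) set" and M :: "'w measure"
  defines "d \<equiv> real CARD('n)"
  assumes walk: "walk_on_spheres M F \<Omega> \<beta> \<epsilon> x r \<gamma>"
    and dom: "bounded_domain \<Omega>" and diam: "diameter \<Omega> \<le> R"
    and \<epsilon>: "0 < \<epsilon>" and \<beta>: "0 < \<beta>" "\<beta> < 1"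
    and dim: "CARD('n) = s + 3 + j"
    and a: "0 < a" "a \<le> 1/4"
    and lm: "local_mass \<Omega> s c n" "0 < c"
    and n: "1 / 2 ^ n \<le> \<epsilon> / (2 * d)"
    and g: "g = c / (2 * 2 ^ CARD('n)) / (16 * d) ^ s * ((d - 5/2) / 2 * (2/3) powr (d - 1/2) / (2 * d))
        * (\<beta> / 16)\<^sup>2 / 2 * 4 powr (real s + 5/2 - d)"
  shows "(\<integral>\<^sup>+\<omega>. wos_steps \<Omega> \<epsilon> x r \<gamma> \<omega> \<partial>M)
    \<le> ennreal (3 ^ CARD('n) * (2 ^ CARD('n) + 1) * (2 ^ n) ^ (j + 1) / (g * a powr (- real (j + 1))) + 16 * R\<^sup>2 / (\<beta>\<^sup>2 * a\<^sup>2))"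
proof -
  let ?K = "truncated_kernel d a \<epsilon>"
  have d3: "3 \<le> d" using dim by (simp add: d_def)
  have sd: "real s + 5/2 - d \<le> - (1/2)" "real s + 2 - d = - real (j + 1)" using dim by (simp_all add: d_def)
  define B where "B = (d - 5/2) / 2 * (2/3) powr (d - 1/2) / (2 * d)"
  have B: "0 < B" using d3 by (simp add: B_def)
  \<comment> \<open>The harmonic kernel at \<delta> is 2^(d-2) times that at 2 \<delta>; this
    \<theta> makes its share 1/8, so that 1/8 + 1/4 from the removed points stays below the nearly
    1/2 that the new points bring.\<close>
  define \<theta> :: real where "\<theta> = 1 / (2 * 2 ^ CARD('n))"
  have \<theta>: "0 < \<theta>" by (simp add: \<theta>_def)
  have g': "g = \<theta> * c / (16 * d) ^ s * B * (\<beta> / 16)\<^sup>2 / 2 * 4 powr (real s + 5/2 - d)"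
    by (simp add: g B_def \<theta>_def)
  have g0: "0 < g" unfolding g' using \<theta> lm(2) B \<beta> d3 by (intro mult_pos_pos divide_pos_pos zero_less_power) auto
  define Gt where "Gt = g * a powr (- real (j + 1))"
  have Gt: "0 < Gt" using g0 a by (simp add: Gt_def)
  have n2: "1 / 2 ^ n \<le> \<epsilon> / 2"
  proof -
    have "\<epsilon> / (2 * d) \<le> \<epsilon> / 2" using \<epsilon> d3 by (intro divide_left_mono) auto
    then show ?thesis using n by linarith
  qed
  have "(\<integral>\<^sup>+\<omega>. wos_steps \<Omega> \<epsilon> x r \<gamma> \<omega> \<partial>M)
    \<le> ennreal (3 ^ CARD('n) * (2 ^ CARD('n) + 1) * (2 ^ n) ^ (j + 1) / Gt + 4 * R\<^sup>2 / (\<beta>\<^sup>2 * (a/2)\<^sup>2))"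
  proof (rule expected_steps_energy[OF walk dom diam \<epsilon> \<beta> energy_kernel_truncated[OF d3 a \<epsilon>] _ _ _ Gt])
    show "energy_kernel.pot ?K n s I y \<le> 3 ^ CARD('n) * (2 ^ CARD('n) + 1) * (2 ^ n) ^ (j + 1)"
      if "dyadic_sparse n s I" for I :: "(real^'n) set" and y
      unfolding d_def by (rule truncated_kernel_pot_le[OF dim a \<epsilon> n2 that])
    show "?K (norm w) \<le> (\<integral>v. ?K (norm (w + \<rho> *\<^sub>R v)) \<partial>uniform_sphere)"
      if "\<epsilon> \<le> norm w" "0 \<le> \<rho>" "\<rho> \<le> norm w / 2" for w :: "real^'n" and \<rho>
      using truncated_kernel_mean(1)[OF d3[unfolded d_def] a \<epsilon> that] by (simp add: d_def)
    show "0 < a / 2" using a by simp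
    fix \<delta> :: real assume \<delta>: "\<epsilon> \<le> \<delta>" "\<delta> \<le> a / 2"
    have \<delta>0: "0 < \<delta>" using \<delta> \<epsilon> by linarith
    define G where "G = a powr (- (1/2)) / 2 * B * (\<beta> / 16)\<^sup>2 * (8 * \<delta>) powr (5/2 - d)"
    have G: "0 \<le> G" using B by (simp add: G_def)
    have mx: "max \<delta> (\<epsilon> / 2) = \<delta>" "max (2 * \<delta>) (\<epsilon> / 2) = 2 * \<delta>" using \<delta> \<epsilon> by auto
    have th: "\<theta> * ?K \<delta> + ?K (8 * \<delta>) < (1 - \<theta>) * ?K (2 * \<delta>)"
    proof -
      define Y where "Y = (2 * \<delta>) powr (2 - d)"
      have Y: "0 < Y" using \<delta>0 by (simp add: Y_def)
      have k1: "?K \<delta> \<le> 2 powr (d - 2) * Y"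
      proof -
        have "?K \<delta> \<le> \<delta> powr (2 - d)" using d3 \<epsilon> \<delta>0 by (intro truncated_kernel_le) auto
        also have "\<delta> powr (2 - d) = (1/2 * (2 * \<delta>)) powr (2 - d)" by simp
        also have "\<dots> = (1/2) powr (2 - d) * Y" unfolding Y_def by (rule powr_mult)
        also have "(1/2 :: real) powr (2 - d) = 2 powr (d - 2)"
        proof -
          have "(1/2 :: real) = 2 powr (- 1)" by simp
          then have "(1/2 :: real) powr (2 - d) = 2 powr ((- 1) * (2 - d))" by (simp only: powr_powr)
          then show ?thesis by simp
        qed
        finally show ?thesis .
      qed
      have k8: "?K (8 * \<delta>) \<le> Y / 4"
      proof -
        have "?K (8 * \<delta>) \<le> (8 * \<delta>) powr (2 - d)" using d3 \<epsilon> \<delta>0 by (intro truncated_kernel_le) auto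
        also have "\<dots> = (4 * (2 * \<delta>)) powr (2 - d)" by simp
        also have "\<dots> = 4 powr (2 - d) * Y" unfolding Y_def by (rule powr_mult)
        also have "\<dots> \<le> 4 powr (- 1) * Y" using d3 Y by (intro mult_right_mono powr_mono) auto
        also have "4 powr (- 1) * Y = Y / 4" by simp
        finally show ?thesis .
      qed
      have k2: "Y / 2 \<le> ?K (2 * \<delta>)"
      proof -
        have "(2 * \<delta> / a) powr (1/2) \<le> 1 powr (1/2)" using \<delta>0 \<delta> a by (intro powr_mono2) auto
        then have "1/2 \<le> 1 - (2 * \<delta> / a) powr (1/2) / 2" by simp
        then have "Y * (1/2) \<le> Y * (1 - (2 * \<delta> / a) powr (1/2) / 2)" using Y by (intro mult_left_mono) auto
        also have "\<dots> \<le> ?K (2 * \<delta>)" unfolding truncated_kernel_def mx Y_def by (rule max.cobounded2)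
        finally show ?thesis by simp
      qed
      have t2: "\<theta> * 2 powr (d - 2) = 1/8"
      proof -
        have "2 powr (d - 2) = 2 ^ CARD('n) / 4"
        proof -
          have "2 powr (d - 2) = 2 powr d / 2 powr 2" by (rule powr_diff)
          also have "2 powr d = 2 ^ CARD('n)" unfolding d_def by (rule powr_realpow) simp
          finally show ?thesis by simp
        qed
        then show ?thesis by (simp add: \<theta>_def)
      qed
      have t3: "\<theta> \<le> 1/16"
      proof -
        have "(2::real) ^ 3 \<le> 2 ^ CARD('n)" using dim by (intro power_increasing) auto
        then show ?thesis unfolding \<theta>_def by (simp add: pos_divide_le_eq)
      qed
      have "\<theta> * ?K \<delta> \<le> \<theta> * (2 powr (d - 2) * Y)" using k1 \<theta> by (intro mult_left_mono) auto
      also have "\<dots> = Y / 8" using t2 by (simp add: mult.assoc[symmetric])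
      finally have "\<theta> * ?K \<delta> + ?K (8 * \<delta>) \<le> Y / 8 + Y / 4" using k8 by linarith
      also have "\<dots> < (1 - 1/16) * (Y / 2)" using Y by simp
      also have "\<dots> \<le> (1 - \<theta>) * ?K (2 * \<delta>)" using t3 k2 Y by (intro mult_mono) auto
      finally show ?thesis .
    qed
    have gain: "?K (norm w) + G \<le> (\<integral>v. ?K (norm (w + \<rho> *\<^sub>R v)) \<partial>uniform_sphere)"
      if w: "\<delta> \<le> norm w" "norm w \<le> 8 * \<delta>" "\<beta> * \<delta> / 2 \<le> \<rho>" "\<rho> \<le> \<delta> / 2" for w :: "real^'n" and \<rho>
    proof -
      have w0: "0 < norm w" using w \<delta>0 by linarith
      have bd: "0 \<le> \<beta> * \<delta>" using \<beta> \<delta>0 by simp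
      have "\<beta> / 16 \<le> \<rho> / norm w"
      proof -
        have "\<beta> / 16 * norm w \<le> \<beta> / 16 * (8 * \<delta>)" using w \<beta> by (intro mult_left_mono) auto
        also have "\<dots> \<le> \<rho>" using w by simp
        finally show ?thesis using w0 by (simp add: pos_le_divide_eq)
      qed
      then have "(\<beta> / 16)\<^sup>2 \<le> (\<rho> / norm w)\<^sup>2" using \<beta> by (intro power_mono) auto
      moreover have "(8 * \<delta>) powr (5/2 - d) \<le> norm w powr (5/2 - d)" using w w0 d3 by (intro powr_mono2') auto
      ultimately have "G \<le> a powr (- (1/2)) / 2 * B * (\<rho> / norm w)\<^sup>2 * norm w powr (5/2 - d)"
        unfolding G_def using B by (intro mult_mono mult_left_mono) auto
      moreover have "?K (norm w) + a powr (- (1/2)) / 2 * B * (\<rho> / norm w)\<^sup>2 * norm w powr (5/2 - d)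
          \<le> (\<integral>v. ?K (norm (w + \<rho> *\<^sub>R v)) \<partial>uniform_sphere)"
      proof -
        have e1: "\<epsilon> \<le> norm w" "0 \<le> \<rho>" "\<rho> \<le> norm w / 2" "norm w \<le> 4 * a"
          using w \<delta> bd by linarith+
        show ?thesis
          using truncated_kernel_mean(2)[OF d3[unfolded d_def] a \<epsilon> e1] unfolding B_def d_def .
      qed
      ultimately show ?thesis by linarith
    qed
    have J: "\<exists>J. dyadic_sparse n s J \<and> J \<subseteq> - \<Omega> \<and> J \<noteq> {} \<and> (\<forall>a\<in>J. dist z a \<le> \<delta>) \<and>
            Gt \<le> max 1 (\<theta> * card J) * G / 2 ^ (n * s)" if z: "z \<in> frontier \<Omega>" for z
    proof -
      have "\<delta> \<le> 1" using \<delta> a by linarith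
      then obtain J where J: "dyadic_sparse n s J" "J \<subseteq> - \<Omega>" "J \<noteq> {}" "\<And>a. a \<in> J \<Longrightarrow> dist z a \<le> \<delta>"
        "c * (\<delta> / (2 * d)) ^ s \<le> card J / 2 ^ (n * s)"
        using local_mass_scale[OF lm n[unfolded d_def] \<epsilon> \<delta>(1) _ z] unfolding d_def by auto
      have "\<theta> * (c * (\<delta> / (2 * d)) ^ s) \<le> \<theta> * (card J / 2 ^ (n * s))"
        using J(5) \<theta> by (intro mult_left_mono) auto
      also have "\<dots> \<le> max 1 (\<theta> * card J) / 2 ^ (n * s)" by (simp add: divide_right_mono)
      finally have le: "\<theta> * (c * (\<delta> / (2 * d)) ^ s) * G \<le> max 1 (\<theta> * card J) / 2 ^ (n * s) * G"
        using G by (rule mult_right_mono)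
      have "Gt \<le> \<theta> * (c * (\<delta> / (2 * d)) ^ s) * G"
      proof -
        define H where "H = \<theta> * c / (16 * d) ^ s * B * (\<beta> / 16)\<^sup>2 / 2"
        have H: "0 \<le> H" using \<theta> lm(2) B d3 by (simp add: H_def)
        have "Gt = H * (4 powr (real s + 5/2 - d) * a powr (real s + 2 - d))"
          unfolding Gt_def g' H_def sd(2) by simp
        also have "\<dots> = H * (a powr (- (1/2)) * (4 * a) powr (real s + 5/2 - d))"
        proof -
          have "real s + 2 - d = - (1/2) + (real s + 5/2 - d)" by simp
          then have "a powr (real s + 2 - d) = a powr (- (1/2) + (real s + 5/2 - d))" by (simp only:)
          also have "\<dots> = a powr (- (1/2)) * a powr (real s + 5/2 - d)" by (rule powr_add)
          finally show ?thesis by (simp only: powr_mult mult_ac)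
        qed
        \<comment> \<open>The exponent is negative and 8 \<delta> \<le> 4 a, so the largest scale is
          the worst one.\<close>
        also have "\<dots> \<le> H * (a powr (- (1/2)) * (8 * \<delta>) powr (real s + 5/2 - d))"
          using H sd(1) \<delta>0 \<delta> by (intro mult_left_mono powr_mono2') auto
        also have "(8 * \<delta>) powr (real s + 5/2 - d) = (8 * \<delta>) ^ s * (8 * \<delta>) powr (5/2 - d)"
        proof -
          have "real s + 5/2 - d = real s + (5/2 - d)" by simp
          then show ?thesis using \<delta>0 by (simp only: powr_add) (simp add: powr_realpow)
        qed
        also have "H * (a powr (- (1/2)) * ((8 * \<delta>) ^ s * (8 * \<delta>) powr (5/2 - d))) = \<theta> * (c * (\<delta> / (2 * d)) ^ s) * G"
        proof -
          have "\<delta> / (2 * d) = 1 / (16 * d) * (8 * \<delta>)" by simp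
          then have "(\<delta> / (2 * d)) ^ s = 1 / (16 * d) ^ s * (8 * \<delta>) ^ s"
            by (simp only: power_mult_distrib power_one_over)
          then show ?thesis by (simp add: G_def H_def)
        qed
        finally show ?thesis .
      qed
      then have "Gt \<le> max 1 (\<theta> * card J) * G / 2 ^ (n * s)" using le by simp
      then show ?thesis using J(1-4) by blast
    qed
    show "\<exists>G\<ge>0. \<exists>\<theta>\<ge>0. \<theta> * ?K \<delta> + ?K (8 * \<delta>) < (1 - \<theta>) * ?K (2 * \<delta>) \<and>
        (\<forall>(w :: real^'n) \<rho>. \<delta> \<le> norm w \<longrightarrow> norm w \<le> 8 * \<delta> \<longrightarrow> \<beta> * \<delta> / 2 \<le> \<rho> \<longrightarrow> \<rho> \<le> \<delta> / 2 \<longrightarrow>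
            ?K (norm w) + G \<le> (\<integral>v. ?K (norm (w + \<rho> *\<^sub>R v)) \<partial>uniform_sphere)) \<and>
        (\<forall>z\<in>frontier \<Omega>. \<exists>J. dyadic_sparse n s J \<and> J \<subseteq> - \<Omega> \<and> J \<noteq> {} \<and> (\<forall>a\<in>J. dist z a \<le> \<delta>) \<and>
            Gt \<le> max 1 (\<theta> * card J) * G / 2 ^ (n * s))"
      using G less_imp_le[OF \<theta>] th gain J by blast
  qed
  then show ?thesis by (simp add: Gt_def power2_eq_square mult_ac)
qed

section \<open>Convergence rates\<close>

lemma dyadic_scale:
  fixes A \<epsilon> :: real
  assumes "1 \<le> A" "0 < \<epsilon>" "\<epsilon> \<le> 1/2"
  obtains n where "1 / 2 ^ n \<le> \<epsilon> / (2 * A)" "2 ^ n \<le> 4 * A / \<epsilon>"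
proof -
  have pos: "0 < \<epsilon> / (2 * A)" using assms by simp
  obtain N where "(1/2) ^ N < \<epsilon> / (2 * A)" using real_arch_pow_inv[OF pos, of "1/2"] by auto
  then have ex: "1 / 2 ^ N \<le> \<epsilon> / (2 * A)" by (simp add: power_one_over)
  define n where "n = (LEAST n. 1 / 2 ^ n \<le> \<epsilon> / (2 * A))"
  have n: "1 / 2 ^ n \<le> \<epsilon> / (2 * A)" unfolding n_def using ex by (rule LeastI)
  have "\<epsilon> / (2 * A) < 1"
  proof -
    have "\<epsilon> < 2 * A" using assms by linarith
    then show ?thesis using assms by simp
  qed
  then have "n \<noteq> 0" using n by (intro notI) simp
  then obtain j where j: "n = Suc j" by (cases n) auto
  have "\<not> 1 / 2 ^ j \<le> \<epsilon> / (2 * A)"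
    using not_less_Least[of j "\<lambda>n. 1 / 2 ^ n \<le> \<epsilon> / (2 * A)"] j n_def by simp
  then have "\<epsilon> / (2 * A) < 1 / 2 ^ j" by simp
  then have "\<epsilon> / (2 * A) * 2 ^ j < 1" by (simp add: pos_less_divide_eq)
  then have "\<epsilon> * 2 ^ j < 2 * A" using assms by (simp add: pos_divide_less_eq)
  then have "2 ^ n \<le> 4 * A / \<epsilon>" using assms j by (simp add: pos_le_divide_eq mult_ac)
  with n show ?thesis by (rule that)
qed

text \<open>The additive constants are absorbed because \<open>ln (1 / \<epsilon>)\<close> is at
  least \<open>ln 2\<close>.\<close>

lemma scale_count_le:
  fixes A \<epsilon> :: real
  assumes A: "1 \<le> A" and \<epsilon>: "0 < \<epsilon>" "\<epsilon> \<le> 1/2" and n: "2 ^ n \<le> 4 * A / \<epsilon>"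
  shows "real n + 1 \<le> ((ln (4 * A) / ln 2 + 2) / ln 2) * ln (1 / \<epsilon>)"
proof -
  define L where "L = ln (1 / \<epsilon>)"
  have l2: "0 < ln (2::real)" by simp
  have "2 \<le> 1 / \<epsilon>" using \<epsilon> by (simp add: pos_le_divide_eq)
  then have L: "ln 2 \<le> L" unfolding L_def using \<epsilon> by (subst ln_le_cancel_iff) auto
  have "ln (2 ^ n) \<le> ln (4 * A / \<epsilon>)" using n A \<epsilon> by (subst ln_le_cancel_iff) auto
  also have "4 * A / \<epsilon> = (4 * A) * (1 / \<epsilon>)" by simp
  also have "ln \<dots> = ln (4 * A) + L" unfolding L_def using A \<epsilon> by (intro ln_mult_pos) auto
  finally have "real n * ln 2 \<le> ln (4 * A) + L" by (simp add: ln_realpow)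
  then have "real n \<le> (ln (4 * A) + L) / ln 2" by (simp add: pos_le_divide_eq)
  moreover have "ln (4 * A) \<le> ln (4 * A) * (L / ln 2)"
  proof -
    have "1 \<le> L / ln 2" using L l2 by (simp add: pos_le_divide_eq)
    moreover have "0 \<le> ln (4 * A)" using A by simp
    ultimately show ?thesis using mult_left_mono[of 1 "L / ln 2" "ln (4 * A)"] by (simp only: mult_1_right)
  qed
  then have "(ln (4 * A) + L) / ln 2 \<le> (ln (4 * A) * (L / ln 2) + L) / ln 2"
    using l2 by (intro divide_right_mono) auto
  moreover have "1 \<le> L / ln 2" using L l2 by (simp add: pos_le_divide_eq)
  moreover have "(ln (4 * A) * (L / ln 2) + L) / ln 2 + L / ln 2 = ((ln (4 * A) / ln 2 + 2) / ln 2) * L"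
    by (simp add: add_divide_distrib distrib_right)
  ultimately show ?thesis unfolding L_def[symmetric] by linarith
qed

lemma ln_inverse_ge_ln2:
  fixes \<epsilon> :: real
  assumes "0 < \<epsilon>" "\<epsilon> \<le> 1/2"
  shows "ln 2 \<le> ln (1 / \<epsilon>)"
proof -
  have "2 \<le> 1 / \<epsilon>" using assms by (simp add: pos_le_divide_eq)
  then show ?thesis using assms by (subst ln_le_cancel_iff) auto
qed

text \<open>The exponent \<open>\<kappa>\<close> that makes \<open>\<epsilon>\<^sup>-\<^sup>\<kappa>\<close> a constant.\<close>

lemma critical_exponent:
  fixes \<epsilon> :: real
  assumes \<epsilon>: "0 < \<epsilon>" "\<epsilon> \<le> 1/2"
  defines "\<kappa> \<equiv> ln 2 / ln (1 / \<epsilon>)"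
  shows "0 < \<kappa>" "\<kappa> \<le> 1" "(1 / \<epsilon>) powr \<kappa> = 2"
proof -
  have L: "ln 2 \<le> ln (1 / \<epsilon>)" by (rule ln_inverse_ge_ln2[OF \<epsilon>])
  have L0: "0 < ln (1 / \<epsilon>)" using L ln_2_less_1 ln_gt_zero[of 2] by linarith
  show "0 < \<kappa>" unfolding \<kappa>_def using L0 by (intro divide_pos_pos) auto
  show "\<kappa> \<le> 1" unfolding \<kappa>_def using L L0 by (simp only: pos_divide_le_eq mult_1_left)
  have "(1 / \<epsilon>) powr \<kappa> = exp (\<kappa> * ln (1 / \<epsilon>))" using \<epsilon> by (simp add: powr_def)
  also have "\<kappa> * ln (1 / \<epsilon>) = ln 2"
  proof -
    have "a / b * b = a" if "0 < b" for a b :: real using that by simp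
    then show ?thesis unfolding \<kappa>_def using L0 by blast
  qed
  finally show "(1 / \<epsilon>) powr \<kappa> = 2" by simp
qed

lemma two_thirds_powr_ge:
  assumes "p \<le> (q::real)"
  shows "(2/3 :: real) powr q \<le> (2/3) powr p"
  using assms by (intro powr_mono') auto

text \<open>Here \<open>s\<close> exceeds the critical value d - 2, so p = s has a gain independent
  of \<epsilon>, while the energy is of the order of the number of scales.\<close>

lemma wos_converges_log:
  fixes P :: "(real^'n::finite) set \<Rightarrow> bool"
  assumes lm: "\<And>C \<Omega> n. 0 < C \<Longrightarrow> bounded_domain \<Omega> \<Longrightarrow> P \<Omega> \<Longrightarrow> thick_with \<alpha> C \<Omega> \<Longrightarrow> local_mass \<Omega> s (c C) n"
    and c: "\<And>C. 0 < C \<Longrightarrow> 0 < c C" and s: "1 \<le> s" "real CARD('n) - 2 < real s"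
  shows "wos_converges_in TYPE('w) P \<alpha> (\<lambda>\<epsilon>. ln (1 / \<epsilon>))"
  unfolding wos_converges_in_def
proof (intro allI impI, elim conjE)
  fix C \<beta> R :: real assume C: "0 < C" and \<beta>: "0 < \<beta>" "\<beta> < 1"
  define A where "A = real CARD('n)"
  have A: "1 \<le> A" by (simp add: A_def Suc_leI)
  define p where "p = real s"
  have p: "1 \<le> p" "A - 2 < p" using s by (auto simp: p_def A_def)
  \<comment> \<open>This makes the first term of the exchange condition 1/2; the second is at most
    1/4 because p \<ge> 1.\<close>
  define \<theta> where "\<theta> = 1 / (2 * (1 + 2 powr p))"
  have pw: "0 < 1 + 2 powr p" by (simp add: add_pos_pos)
  have \<theta>: "0 < \<theta>" "\<theta> * (1 + 2 powr p) = 1/2" using pw by (simp_all add: \<theta>_def)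
  have p4: "4 powr (- p) \<le> 1/4"
  proof -
    have "4 powr (- p) \<le> 4 powr (- 1 :: real)" using p by (intro powr_mono) auto
    then show ?thesis by simp
  qed
  define G where "G = \<theta> * c C / (16 * A) ^ s * (p * (p + 2 - A) * (2/3) powr (p + 2) / (2 * A)) * (\<beta> / 16)\<^sup>2"
  have G: "0 < G" unfolding G_def using \<theta>(1) c[OF C] A p \<beta>
    by (intro mult_pos_pos divide_pos_pos zero_less_power) auto
  define C1 where "C1 = (ln (4 * A) / ln 2 + 2) / ln 2"
  have C1: "0 < C1" unfolding C1_def using A by (intro divide_pos_pos add_nonneg_pos divide_nonneg_pos) auto
  define H where "H = 3 ^ CARD('n) * 2 powr p * C1 / G + 256 * R\<^sup>2 / \<beta>\<^sup>2 / ln 2"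
  have H: "0 < H" unfolding H_def using C1 G \<beta>
    by (intro add_pos_nonneg divide_pos_pos mult_pos_pos divide_nonneg_pos) auto
  show "\<exists>K>0. \<forall>\<Omega>. bounded_domain \<Omega> \<and> P \<Omega> \<and> thick_with \<alpha> C \<Omega> \<and> diameter \<Omega> \<le> R \<longrightarrow>
         (\<forall>x\<in>\<Omega>. \<forall>\<epsilon>. 0 < \<epsilon> \<and> \<epsilon> \<le> 1/2 \<longrightarrow>
           (\<forall>(M :: 'w measure) F r \<gamma>. walk_on_spheres M F \<Omega> \<beta> \<epsilon> x r \<gamma> \<longrightarrow>
             (\<integral>\<^sup>+\<omega>. wos_steps \<Omega> \<epsilon> x r \<gamma> \<omega> \<partial>M) \<le> ennreal (K * ln (1 / \<epsilon>))))"
  proof (intro exI[of _ H] conjI H allI impI ballI, elim conjE)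
    fix \<Omega> :: "(real^'n) set" and x \<epsilon> and M :: "'w measure" and F r \<gamma>
    assume \<Omega>: "bounded_domain \<Omega>" "P \<Omega>" "thick_with \<alpha> C \<Omega>" "diameter \<Omega> \<le> R"
      and \<epsilon>: "0 < \<epsilon>" "\<epsilon> \<le> 1/2" and walk: "walk_on_spheres M F \<Omega> \<beta> \<epsilon> x r \<gamma>"
    obtain n where n: "1 / 2 ^ n \<le> \<epsilon> / (2 * A)" "2 ^ n \<le> 4 * A / \<epsilon>"
      using dyadic_scale[OF A \<epsilon>] .
    have n2: "1 / 2 ^ n \<le> \<epsilon> / 2"
    proof -
      have "\<epsilon> / (2 * A) \<le> \<epsilon> / 2" using \<epsilon> A by (intro divide_left_mono) auto
      then show ?thesis using n(1) by linarith
    qed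
    have UB: "energy_kernel.pot (power_kernel p \<epsilon>) n s I y \<le> 3 ^ CARD('n) * 2 powr p * (real n + 1)"
      if "dyadic_sparse n s I" for I :: "(real^'n) set" and y
      using power_kernel_pot_le[OF _ _ \<epsilon>(1) n2 that, of p y] p by (simp add: p_def)
    have "(\<integral>\<^sup>+\<omega>. wos_steps \<Omega> \<epsilon> x r \<gamma> \<omega> \<partial>M)
        \<le> ennreal (3 ^ CARD('n) * 2 powr p * (real n + 1) / G + 256 * R\<^sup>2 / \<beta>\<^sup>2)"
    proof (rule expected_steps_power[where p = p and s = s and n = n and c = "c C" and \<theta> = \<theta> and m = "\<theta> * c C",
        OF walk \<Omega>(1) \<Omega>(4) \<epsilon>(1) \<beta>])
      show "local_mass \<Omega> s (c C) n" by (rule lm[OF C \<Omega>(1-3)])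
      show "\<theta> * (1 + 2 powr p) + 4 powr (- p) < 1" using \<theta>(2) p4 by linarith
      show "G \<le> \<theta> * c C / (16 * real CARD('n)) ^ s * (p * (p + 2 - real CARD('n)) * (2/3) powr (p + 2) / (2 * real CARD('n))) * (\<beta> / 16)\<^sup>2"
        by (simp add: G_def A_def)
    qed (use p \<theta> G c[OF C] n UB in \<open>auto simp: A_def p_def\<close>)
    also have "\<dots> \<le> ennreal (H * ln (1 / \<epsilon>))"
    proof (rule ennreal_leI)
      have "3 ^ CARD('n) * 2 powr p * (real n + 1) / G \<le> 3 ^ CARD('n) * 2 powr p * (C1 * ln (1 / \<epsilon>)) / G"
        unfolding C1_def using G scale_count_le[OF A \<epsilon> n(2)] by (intro divide_right_mono mult_left_mono) auto
      moreover have "256 * R\<^sup>2 / \<beta>\<^sup>2 \<le> 256 * R\<^sup>2 / \<beta>\<^sup>2 / ln 2 * ln (1 / \<epsilon>)"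
      proof -
        have "256 * R\<^sup>2 / \<beta>\<^sup>2 / ln 2 * ln 2 \<le> 256 * R\<^sup>2 / \<beta>\<^sup>2 / ln 2 * ln (1 / \<epsilon>)"
          using ln_inverse_ge_ln2[OF \<epsilon>] by (intro mult_left_mono) auto
        then show ?thesis by simp
      qed
      ultimately show "3 ^ CARD('n) * 2 powr p * (real n + 1) / G + 256 * R\<^sup>2 / \<beta>\<^sup>2 \<le> H * ln (1 / \<epsilon>)"
        by (simp add: H_def distrib_right)
    qed
    finally show "(\<integral>\<^sup>+\<omega>. wos_steps \<Omega> \<epsilon> x r \<gamma> \<omega> \<partial>M) \<le> ennreal (H * ln (1 / \<epsilon>))" .
  qed
qed

text \<open>At p = s = d - 2 the power is harmonic. The excess \<kappa> = ln 2 / ln (1/\<epsilon>)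
  restores a gain proportional to p \<kappa> and costs only a bounded factor in the energy. For s =
  0 the gain is of order \<kappa>^2 against a bounded energy, for s = 1 of order \<kappa> against an
  energy of order ln (1/\<epsilon>); both give the squared logarithm.\<close>

lemma wos_converges_log_squared:
  fixes P :: "(real^'n::finite) set \<Rightarrow> bool"
  assumes lm: "\<And>C \<Omega> n. 0 < C \<Longrightarrow> bounded_domain \<Omega> \<Longrightarrow> P \<Omega> \<Longrightarrow> thick_with \<alpha> C \<Omega> \<Longrightarrow> local_mass \<Omega> s 1 n"
    and s: "CARD('n) = s + 2" "s \<le> 1"
  shows "wos_converges_in TYPE('w) P \<alpha> (\<lambda>\<epsilon>. (ln (1 / \<epsilon>))\<^sup>2)"
  unfolding wos_converges_in_def
proof (intro allI impI, elim conjE)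
  fix C \<beta> R :: real assume C: "0 < C" and \<beta>: "0 < \<beta>" "\<beta> < 1"
  define A where "A = real CARD('n)"
  have A: "1 \<le> A" by (simp add: A_def Suc_leI)
  define C1 where "C1 = (ln (4 * A) / ln 2 + 2) / ln 2"
  have C1: "0 < C1" unfolding C1_def using A by (intro divide_pos_pos add_nonneg_pos divide_nonneg_pos) auto
  \<comment> \<open>Lower bounds uniform in \<epsilon>: 1/10 for the later \<theta>, as 2^p \<le> 4,
    and (2/3)^4 for the power of 2/3 in the spherical mean, as p \<le> 2.\<close>
  define g where "g = 1 / 10 / (16 * A) ^ s * ((2/3) ^ 4 / (2 * A)) * (\<beta> / 16)\<^sup>2"
  have g: "0 < g" unfolding g_def using A \<beta> by (intro mult_pos_pos divide_pos_pos zero_less_power) auto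
  define V where "V = 3 ^ CARD('n) * 4 * (8 * A) * (C1 + 1 / ln 2)"
  have V: "0 < V" unfolding V_def using A C1 by (intro mult_pos_pos add_pos_pos) auto
  define H where "H = V / (ln 2 * g) + V / ((ln 2)\<^sup>2 * g) + 256 * R\<^sup>2 / \<beta>\<^sup>2 / (ln 2)\<^sup>2"
  have H: "0 < H" unfolding H_def using V g \<beta>
    by (intro add_pos_nonneg add_pos_pos divide_pos_pos divide_nonneg_pos mult_pos_pos) auto
  show "\<exists>K>0. \<forall>\<Omega>. bounded_domain \<Omega> \<and> P \<Omega> \<and> thick_with \<alpha> C \<Omega> \<and> diameter \<Omega> \<le> R \<longrightarrow>
         (\<forall>x\<in>\<Omega>. \<forall>\<epsilon>. 0 < \<epsilon> \<and> \<epsilon> \<le> 1/2 \<longrightarrow>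
           (\<forall>(M :: 'w measure) F r \<gamma>. walk_on_spheres M F \<Omega> \<beta> \<epsilon> x r \<gamma> \<longrightarrow>
             (\<integral>\<^sup>+\<omega>. wos_steps \<Omega> \<epsilon> x r \<gamma> \<omega> \<partial>M) \<le> ennreal (K * (ln (1 / \<epsilon>))\<^sup>2)))"
  proof (intro exI[of _ H] conjI H allI impI ballI, elim conjE)
    fix \<Omega> :: "(real^'n) set" and x \<epsilon> and M :: "'w measure" and F r \<gamma>
    assume \<Omega>: "bounded_domain \<Omega>" "P \<Omega>" "thick_with \<alpha> C \<Omega>" "diameter \<Omega> \<le> R"
      and \<epsilon>: "0 < \<epsilon>" "\<epsilon> \<le> 1/2" and walk: "walk_on_spheres M F \<Omega> \<beta> \<epsilon> x r \<gamma>"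
    define L where "L = ln (1 / \<epsilon>)"
    have L: "ln 2 \<le> L" unfolding L_def by (rule ln_inverse_ge_ln2[OF \<epsilon>])
    have l2: "0 < ln (2::real)" by simp
    have L0: "0 < L" using L l2 by linarith
    define \<kappa> where "\<kappa> = ln 2 / L"
    have \<kappa>: "0 < \<kappa>" "\<kappa> \<le> 1" "(1 / \<epsilon>) powr \<kappa> = 2"
      unfolding \<kappa>_def L_def by (rule critical_exponent[OF \<epsilon>])+
    define p where "p = real s + \<kappa>"
    have p: "0 < p" "A - 2 < p" "real s \<le> p" "p \<le> 2" "p + 2 - A = \<kappa>" using s \<kappa> by (auto simp: p_def A_def)
    obtain n where n: "1 / 2 ^ n \<le> \<epsilon> / (2 * A)" "2 ^ n \<le> 4 * A / \<epsilon>"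
      using dyadic_scale[OF A \<epsilon>] .
    have n2: "1 / 2 ^ n \<le> \<epsilon> / 2"
    proof -
      have "\<epsilon> / (2 * A) \<le> \<epsilon> / 2" using \<epsilon> A by (intro divide_left_mono) auto
      then show ?thesis using n(1) by linarith
    qed
    have B: "(2/3) ^ 4 / (2 * A) * (p * \<kappa>) \<le> p * (p + 2 - A) * (2/3) powr (p + 2) / (2 * A)"
    proof -
      have "(2/3 :: real) powr 4 \<le> (2/3) powr (p + 2)" using p by (intro two_thirds_powr_ge) auto
      then have "(2/3 :: real) ^ 4 \<le> (2/3) powr (p + 2)" by simp
      then have "(p * \<kappa>) * (2/3) ^ 4 / (2 * A) \<le> (p * \<kappa>) * (2/3) powr (p + 2) / (2 * A)"
        using p \<kappa> A by (intro divide_right_mono mult_left_mono) auto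
      then show ?thesis unfolding p(5) by (simp add: mult_ac)
    qed
    \<comment> \<open>\<open>2 ^ n\<close> is of order 1/\<epsilon>, and the exponent \<kappa> turns
      1/\<epsilon> into 2.\<close>
    have nk: "2 powr (real n * \<kappa>) \<le> 8 * A"
    proof -
      have "2 powr (real n * \<kappa>) = (2 ^ n) powr \<kappa>" by (simp add: powr_powr[symmetric] powr_realpow)
      also have "\<dots> \<le> (4 * A * (1 / \<epsilon>)) powr \<kappa>" using n(2) \<kappa> by (intro powr_mono2) auto
      also have "\<dots> = (4 * A) powr \<kappa> * 2" by (simp only: powr_mult \<kappa>(3))
      also have "\<dots> \<le> (4 * A) powr 1 * 2" using A \<kappa> by (intro mult_right_mono powr_mono) auto
      finally show ?thesis using A by simp
    qed
    have p2: "2 powr p \<le> 4"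
    proof -
      have "2 powr p \<le> 2 powr 2" using p by (intro powr_mono) auto
      then show ?thesis by simp
    qed
    have "(\<integral>\<^sup>+\<omega>. wos_steps \<Omega> \<epsilon> x r \<gamma> \<omega> \<partial>M) \<le> ennreal (H * L\<^sup>2)"
    proof (cases "s = 0")
      case s0: True
      have UB: "energy_kernel.pot (power_kernel p \<epsilon>) n s I y \<le> V"
        if "dyadic_sparse n s I" for I :: "(real^'n) set" and y
      proof -
        interpret K: energy_kernel "power_kernel p \<epsilon>" by (rule energy_kernel_power[OF p(1) \<epsilon>(1)])
        have "K.pot n s I y \<le> 3 ^ CARD('n) * power_kernel p \<epsilon> 0" by (rule K.pot_bound_crude[OF that])
        also have "power_kernel p \<epsilon> 0 \<le> 4"
        proof -
          have "power_kernel p \<epsilon> 0 \<le> (\<epsilon> / 2) powr (- p)" using \<epsilon> by (simp add: power_kernel_def)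
          also have "\<dots> = (2 * (1 / \<epsilon>)) powr p"
          proof -
            have "\<epsilon> / 2 = inverse (2 * (1 / \<epsilon>))" using \<epsilon> by simp
            then show ?thesis using \<epsilon> by (simp only: inverse_powr powr_minus inverse_inverse_eq)
          qed
          also have "\<dots> = 2 powr p * 2" using s0 \<kappa>(3) by (simp only: powr_mult) (simp add: p_def)
          also have "\<dots> \<le> 2 powr 1 * 2" using s0 \<kappa>(2) by (intro mult_right_mono powr_mono) (auto simp: p_def)
          finally show ?thesis by simp
        qed
        also have "3 ^ CARD('n) * 4 * 1 \<le> V"
        proof -
          have "1 \<le> 1 / ln (2::real)" using ln_2_less_1 by (simp add: pos_le_divide_eq)
          then have "1 \<le> C1 + 1 / ln 2" using C1 by linarith
          then have "1 * 1 \<le> (8 * A) * (C1 + 1 / ln 2)" using A by (intro mult_mono) auto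
          then have "3 ^ CARD('n) * 4 * 1 \<le> 3 ^ CARD('n) * 4 * ((8 * A) * (C1 + 1 / ln 2))"
            by (intro mult_left_mono) auto
          then show ?thesis by (simp only: V_def mult.assoc)
        qed
        finally show ?thesis by simp
      qed
      have "(\<integral>\<^sup>+\<omega>. wos_steps \<Omega> \<epsilon> x r \<gamma> \<omega> \<partial>M) \<le> ennreal (V / (\<kappa>\<^sup>2 * g) + 256 * R\<^sup>2 / \<beta>\<^sup>2)"
      proof (rule expected_steps_power[where p = p and s = s and n = n and c = 1 and \<theta> = 0 and m = 1,
          OF walk \<Omega>(1) \<Omega>(4) \<epsilon>(1) \<beta>])
        show "local_mass \<Omega> s 1 n" by (rule lm[OF C \<Omega>(1-3)])
        \<comment> \<open>As p = \<kappa> tends to 0, the term \<open>4 powr (- p)\<close> tends to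
          1 and leaves no room for a fixed positive \<theta>; a single near point is counted
          instead.\<close>
        show "0 * (1 + 2 powr p) + 4 powr (- p) < 1"
        proof -
          have "4 powr (- p) < 4 powr (0::real)" using p by (intro powr_less_mono) auto
          then show ?thesis by simp
        qed
        show "0 < \<kappa>\<^sup>2 * g" using \<kappa> g by simp
        define W where "W = (2/3) ^ 4 / (2 * A) * (\<beta> / 16)\<^sup>2"
        have "0 \<le> W" using A by (simp add: W_def)
        moreover have "g = W / 10" using s0 by (simp add: g_def W_def)
        ultimately have "g \<le> W" by linarith
        then have "\<kappa>\<^sup>2 * g \<le> \<kappa>\<^sup>2 * ((2/3) ^ 4 / (2 * A) * (\<beta> / 16)\<^sup>2)"
          unfolding W_def by (rule mult_left_mono) simp
        also have "\<dots> = (2/3) ^ 4 / (2 * A) * (p * \<kappa>) * (\<beta> / 16)\<^sup>2"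
          using s0 by (simp add: p_def power2_eq_square)
        also have "\<dots> \<le> p * (p + 2 - A) * (2/3) powr (p + 2) / (2 * A) * (\<beta> / 16)\<^sup>2"
          using B by (rule mult_right_mono) simp
        finally show "\<kappa>\<^sup>2 * g \<le> 1 / (16 * real CARD('n)) ^ s * (p * (p + 2 - real CARD('n)) * (2/3) powr (p + 2) / (2 * real CARD('n))) * (\<beta> / 16)\<^sup>2"
          using s0 by (simp add: A_def)
      qed (use p n UB s0 in \<open>auto simp: A_def\<close>)
      also have "\<dots> \<le> ennreal (H * L\<^sup>2)"
      proof (rule ennreal_leI)
        have "V / (\<kappa>\<^sup>2 * g) = V / ((ln 2)\<^sup>2 * g) * L\<^sup>2"
          using L0 g l2 by (simp add: \<kappa>_def power_divide)
        moreover have "0 \<le> V / (ln 2 * g) * L\<^sup>2" using V g l2 by simp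
        moreover have "256 * R\<^sup>2 / \<beta>\<^sup>2 \<le> 256 * R\<^sup>2 / \<beta>\<^sup>2 / (ln 2)\<^sup>2 * L\<^sup>2"
        proof -
          have "(ln 2)\<^sup>2 \<le> L\<^sup>2" using L l2 by (intro power_mono) auto
          then have "256 * R\<^sup>2 / \<beta>\<^sup>2 / (ln 2)\<^sup>2 * (ln 2)\<^sup>2 \<le> 256 * R\<^sup>2 / \<beta>\<^sup>2 / (ln 2)\<^sup>2 * L\<^sup>2"
            by (intro mult_left_mono) auto
          then show ?thesis by simp
        qed
        ultimately show "V / (\<kappa>\<^sup>2 * g) + 256 * R\<^sup>2 / \<beta>\<^sup>2 \<le> H * L\<^sup>2"
          unfolding H_def distrib_right by linarith
      qed
      finally show ?thesis .
    next
      case False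
      then have s1: "s = 1" using s(2) by simp
      have p1: "1 \<le> p" using s1 \<kappa> by (simp add: p_def)
      define \<theta> where "\<theta> = 1 / (2 * (1 + 2 powr p))"
      have pw: "0 < 1 + 2 powr p" by (simp add: add_pos_pos)
      have \<theta>: "0 < \<theta>" "\<theta> * (1 + 2 powr p) = 1/2" using pw by (simp_all add: \<theta>_def)
      have \<theta>10: "1/10 \<le> \<theta>" unfolding \<theta>_def using p2 pw by (intro divide_left_mono) auto
      have p4: "4 powr (- p) \<le> 1/4"
      proof -
        have "4 powr (- p) \<le> 4 powr (- 1 :: real)" using p1 by (intro powr_mono) auto
        then show ?thesis by simp
      qed
      have UB: "energy_kernel.pot (power_kernel p \<epsilon>) n s I y \<le> V * L"
        if "dyadic_sparse n s I" for I :: "(real^'n) set" and y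
      proof -
        have "energy_kernel.pot (power_kernel p \<epsilon>) n s I y
            \<le> 3 ^ CARD('n) * 2 powr p * 2 powr (real n * (p - real s)) * (real n + 1)"
          by (rule power_kernel_pot_le[OF p(1,3) \<epsilon>(1) n2 that])
        also have "\<dots> \<le> 3 ^ CARD('n) * 4 * (8 * A) * (C1 * L)"
          using p2 nk scale_count_le[OF A \<epsilon> n(2)] A unfolding C1_def L_def
          by (intro mult_mono) (auto simp: p_def)
        also have "\<dots> \<le> 3 ^ CARD('n) * 4 * (8 * A) * ((C1 + 1 / ln 2) * L)"
          using A L0 l2 by (intro mult_left_mono mult_right_mono) auto
        also have "\<dots> = V * L" by (simp add: V_def mult_ac)
        finally show ?thesis .
      qed
      have "(\<integral>\<^sup>+\<omega>. wos_steps \<Omega> \<epsilon> x r \<gamma> \<omega> \<partial>M) \<le> ennreal (V * L / (\<kappa> * g) + 256 * R\<^sup>2 / \<beta>\<^sup>2)"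
      proof (rule expected_steps_power[where p = p and s = s and n = n and c = 1 and \<theta> = \<theta> and m = "\<theta> * 1",
          OF walk \<Omega>(1) \<Omega>(4) \<epsilon>(1) \<beta>])
        show "local_mass \<Omega> s 1 n" by (rule lm[OF C \<Omega>(1-3)])
        show "\<theta> * (1 + 2 powr p) + 4 powr (- p) < 1" using \<theta>(2) p4 by linarith
        show "0 < \<kappa> * g" using \<kappa> g by simp
        have "\<kappa> * g = 1 / 10 / (16 * A) ^ s * ((2/3) ^ 4 / (2 * A) * (1 * \<kappa>)) * (\<beta> / 16)\<^sup>2"
          by (simp add: g_def)
        also have "\<dots> \<le> \<theta> / (16 * A) ^ s * ((2/3) ^ 4 / (2 * A) * (p * \<kappa>)) * (\<beta> / 16)\<^sup>2"
          using \<theta>10 \<theta> p1 \<kappa> A by (intro mult_right_mono mult_mono mult_left_mono divide_right_mono) auto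
        also have "\<dots> \<le> \<theta> / (16 * A) ^ s * (p * (p + 2 - A) * (2/3) powr (p + 2) / (2 * A)) * (\<beta> / 16)\<^sup>2"
          using B \<theta> A by (intro mult_right_mono mult_left_mono) auto
        finally show "\<kappa> * g \<le> \<theta> * 1 / (16 * real CARD('n)) ^ s * (p * (p + 2 - real CARD('n)) * (2/3) powr (p + 2) / (2 * real CARD('n))) * (\<beta> / 16)\<^sup>2"
          by (simp add: A_def)
      qed (use p n UB \<theta> in \<open>auto simp: A_def\<close>)
      also have "\<dots> \<le> ennreal (H * L\<^sup>2)"
      proof (rule ennreal_leI)
        have "V * L / (\<kappa> * g) = V / (ln 2 * g) * L\<^sup>2"
          using L0 g l2 by (simp add: \<kappa>_def power2_eq_square)
        moreover have "0 \<le> V / ((ln 2)\<^sup>2 * g) * L\<^sup>2" using V g l2 by simp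
        moreover have "256 * R\<^sup>2 / \<beta>\<^sup>2 \<le> 256 * R\<^sup>2 / \<beta>\<^sup>2 / (ln 2)\<^sup>2 * L\<^sup>2"
        proof -
          have "(ln 2)\<^sup>2 \<le> L\<^sup>2" using L l2 by (intro power_mono) auto
          then have "256 * R\<^sup>2 / \<beta>\<^sup>2 / (ln 2)\<^sup>2 * (ln 2)\<^sup>2 \<le> 256 * R\<^sup>2 / \<beta>\<^sup>2 / (ln 2)\<^sup>2 * L\<^sup>2"
            by (intro mult_left_mono) auto
          then show ?thesis by simp
        qed
        ultimately show "V * L / (\<kappa> * g) + 256 * R\<^sup>2 / \<beta>\<^sup>2 \<le> H * L\<^sup>2"
          unfolding H_def distrib_right by linarith
      qed
      finally show ?thesis .
    qed
    then show "(\<integral>\<^sup>+\<omega>. wos_steps \<Omega> \<epsilon> x r \<gamma> \<omega> \<partial>M) \<le> ennreal (H * (ln (1 / \<epsilon>))\<^sup>2)" by (simp add: L_def)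
  qed
qed

text \<open>With \<mu> = d - 2 - s the energy costs order (a/\<epsilon>)^\<mu> and the squared
  displacement a^(-2). They balance at a of order \<epsilon>^(\<mu>/(\<mu>+2)), with common value
  (1/\<epsilon>)^(2 - 4/(\<mu>+2)), where \<mu> + 2 = j + 3 = d - s.\<close>

lemma wos_converges_power:
  fixes P :: "(real^'n::finite) set \<Rightarrow> bool"
  assumes lm: "\<And>C \<Omega> n. 0 < C \<Longrightarrow> bounded_domain \<Omega> \<Longrightarrow> P \<Omega> \<Longrightarrow> thick_with \<alpha> C \<Omega> \<Longrightarrow> local_mass \<Omega> s 1 n"
    and s: "CARD('n) = s + 3 + j"
  shows "wos_converges_in TYPE('w) P \<alpha> (\<lambda>\<epsilon>. (1 / \<epsilon>) powr (2 - 4 / real (j + 3)))"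
  unfolding wos_converges_in_def
proof (intro allI impI, elim conjE)
  fix C \<beta> R :: real assume C: "0 < C" and \<beta>: "0 < \<beta>" "\<beta> < 1"
  define d where "d = real CARD('n)"
  have d3: "3 \<le> d" using s by (simp add: d_def)
  define \<mu> where "\<mu> = real (j + 1)"
  have \<mu>: "1 \<le> \<mu>" "real (j + 3) = \<mu> + 2" by (simp_all add: \<mu>_def)
  define g where "g = 1 / (2 * 2 ^ CARD('n)) / (16 * d) ^ s * ((d - 5/2) / 2 * (2/3) powr (d - 1/2) / (2 * d))
        * (\<beta> / 16)\<^sup>2 / 2 * 4 powr (real s + 5/2 - d)"
  have g0: "0 < g" unfolding g_def using \<beta> d3 by (intro mult_pos_pos divide_pos_pos zero_less_power) auto
  define H where "H = 3 ^ CARD('n) * (2 ^ CARD('n) + 1) * (4 * d) ^ (j + 1) / g + 256 * R\<^sup>2 / \<beta>\<^sup>2"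
  have H: "0 < H" unfolding H_def using g0 \<beta> d3
    by (intro add_pos_nonneg divide_pos_pos mult_pos_pos divide_nonneg_pos zero_less_power add_pos_pos) auto
  show "\<exists>K>0. \<forall>\<Omega>. bounded_domain \<Omega> \<and> P \<Omega> \<and> thick_with \<alpha> C \<Omega> \<and> diameter \<Omega> \<le> R \<longrightarrow>
         (\<forall>x\<in>\<Omega>. \<forall>\<epsilon>. 0 < \<epsilon> \<and> \<epsilon> \<le> 1/2 \<longrightarrow>
           (\<forall>(M :: 'w measure) F r \<gamma>. walk_on_spheres M F \<Omega> \<beta> \<epsilon> x r \<gamma> \<longrightarrow>
             (\<integral>\<^sup>+\<omega>. wos_steps \<Omega> \<epsilon> x r \<gamma> \<omega> \<partial>M) \<le> ennreal (K * (1 / \<epsilon>) powr (2 - 4 / real (j + 3)))))"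
  proof (intro exI[of _ H] conjI H allI impI ballI, elim conjE)
    fix \<Omega> :: "(real^'n) set" and x \<epsilon> and M :: "'w measure" and F r \<gamma>
    assume \<Omega>: "bounded_domain \<Omega>" "P \<Omega>" "thick_with \<alpha> C \<Omega>" "diameter \<Omega> \<le> R"
      and \<epsilon>: "0 < \<epsilon>" "\<epsilon> \<le> 1/2" and walk: "walk_on_spheres M F \<Omega> \<beta> \<epsilon> x r \<gamma>"
    obtain n where n: "1 / 2 ^ n \<le> \<epsilon> / (2 * d)" "2 ^ n \<le> 4 * d / \<epsilon>"
      using dyadic_scale[OF _ \<epsilon>, of d] d3 by auto
    define q where "q = \<epsilon> powr (\<mu> / (\<mu> + 2))"
    have q: "0 < q" "q \<le> 1"
    proof -
      show "0 < q" using \<epsilon> by (simp add: q_def)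
      have "\<epsilon> powr (\<mu> / (\<mu> + 2)) \<le> 1 powr (\<mu> / (\<mu> + 2))" using \<epsilon> \<mu> by (intro powr_mono2) auto
      then show "q \<le> 1" by (simp add: q_def)
    qed
    define a where "a = q / 4"
    have a: "0 < a" "a \<le> 1/4" using q by (simp_all add: a_def)
    define T where "T = (1 / \<epsilon>) powr (2 - 4 / real (j + 3))"
    have expo: "2 - 4 / (\<mu> + 2) = 2 * (\<mu> / (\<mu> + 2))" using \<mu> by (simp add: field_simps)
    have inv: "(1 / \<epsilon>) powr e = \<epsilon> powr (- e)" for e
      by (simp only: powr_minus powr_divide powr_one_eq_one inverse_eq_divide)
    have T1: "1 / q\<^sup>2 = T"
    proof -
      have "1 / q\<^sup>2 = inverse (q powr 2)" using q by (simp add: inverse_eq_divide)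
      also have "\<dots> = q powr (- 2)" by (rule powr_minus[symmetric])
      also have "\<dots> = \<epsilon> powr (\<mu> / (\<mu> + 2) * - 2)" unfolding q_def by (rule powr_powr)
      also have "\<mu> / (\<mu> + 2) * - 2 = - (2 - 4 / (\<mu> + 2))" unfolding expo by simp
      finally show ?thesis unfolding T_def \<mu>(2) inv .
    qed
    have T2: "(1 / \<epsilon>) powr \<mu> * q powr \<mu> = T"
    proof -
      have "(1 / \<epsilon>) powr \<mu> * q powr \<mu> = \<epsilon> powr (- \<mu>) * \<epsilon> powr (\<mu> / (\<mu> + 2) * \<mu>)"
        unfolding inv q_def powr_powr ..
      also have "\<dots> = \<epsilon> powr (- \<mu> + \<mu> / (\<mu> + 2) * \<mu>)" by (rule powr_add[symmetric])
      also have "- \<mu> + \<mu> / (\<mu> + 2) * \<mu> = - (2 - 4 / (\<mu> + 2))"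
        unfolding expo using \<mu> by (simp add: field_simps)
      finally show ?thesis unfolding T_def \<mu>(2) inv .
    qed
    have "(\<integral>\<^sup>+\<omega>. wos_steps \<Omega> \<epsilon> x r \<gamma> \<omega> \<partial>M)
      \<le> ennreal (3 ^ CARD('n) * (2 ^ CARD('n) + 1) * (2 ^ n) ^ (j + 1) / (g * a powr (- real (j + 1))) + 16 * R\<^sup>2 / (\<beta>\<^sup>2 * a\<^sup>2))"
      by (rule expected_steps_truncated[OF walk \<Omega>(1) \<Omega>(4) \<epsilon>(1) \<beta> s a lm[OF C \<Omega>(1-3)] zero_less_one n(1)[unfolded d_def] g_def[unfolded d_def]])
    also have "\<dots> \<le> ennreal (H * T)"
    proof (rule ennreal_leI)
      have "(2 ^ n) ^ (j + 1) / (g * a powr (- real (j + 1))) \<le> (4 * d) ^ (j + 1) / g * T"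
      proof -
        have "(2 ^ n) ^ (j + 1) / (g * a powr (- real (j + 1))) = (2 ^ n) ^ (j + 1) / g * a powr \<mu>"
        proof -
          have "a powr (- real (j + 1)) = 1 / a powr \<mu>" unfolding \<mu>_def by (rule powr_minus_divide)
          then show ?thesis by simp
        qed
        also have "\<dots> \<le> (4 * d / \<epsilon>) ^ (j + 1) / g * q powr \<mu>"
        proof (rule mult_mono)
          have "(2 ^ n) ^ (j + 1) \<le> (4 * d / \<epsilon>) ^ (j + 1)" using n(2) by (rule power_mono) simp
          then show "(2 ^ n) ^ (j + 1) / g \<le> (4 * d / \<epsilon>) ^ (j + 1) / g" using g0 by (rule divide_right_mono[OF _ less_imp_le])
          have "a \<le> q" using q by (simp add: a_def)
          then show "a powr \<mu> \<le> q powr \<mu>" using a \<mu> by (intro powr_mono2) auto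
          show "0 \<le> (4 * d / \<epsilon>) ^ (j + 1) / g" using d3 \<epsilon> g0 by (intro divide_nonneg_pos zero_le_power) auto
        qed simp
        also have "(4 * d / \<epsilon>) ^ (j + 1) = (4 * d) ^ (j + 1) * (1 / \<epsilon>) powr \<mu>"
        proof -
          have "4 * d / \<epsilon> = 4 * d * (1 / \<epsilon>)" by simp
          moreover have "(1 / \<epsilon>) powr \<mu> = (1 / \<epsilon>) ^ (j + 1)" unfolding \<mu>_def using \<epsilon> by (intro powr_realpow) simp
          ultimately show ?thesis by (simp only: power_mult_distrib)
        qed
        also have "(4 * d) ^ (j + 1) * (1 / \<epsilon>) powr \<mu> / g * q powr \<mu> = (4 * d) ^ (j + 1) / g * T"
          unfolding T2[symmetric] by simp
        finally show ?thesis .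
      qed
      then have "3 ^ CARD('n) * (2 ^ CARD('n) + 1) * ((2 ^ n) ^ (j + 1) / (g * a powr (- real (j + 1))))
          \<le> 3 ^ CARD('n) * (2 ^ CARD('n) + 1) * ((4 * d) ^ (j + 1) / g * T)"
        by (intro mult_left_mono) auto
      moreover have "16 * R\<^sup>2 / (\<beta>\<^sup>2 * a\<^sup>2) = 256 * R\<^sup>2 / \<beta>\<^sup>2 * T"
        unfolding T1[symmetric] a_def by (simp add: power_divide)
      ultimately show "3 ^ CARD('n) * (2 ^ CARD('n) + 1) * (2 ^ n) ^ (j + 1) / (g * a powr (- real (j + 1))) + 16 * R\<^sup>2 / (\<beta>\<^sup>2 * a\<^sup>2) \<le> H * T"
        unfolding H_def distrib_right by simp
    qed
    finally show "(\<integral>\<^sup>+\<omega>. wos_steps \<Omega> \<epsilon> x r \<gamma> \<omega> \<partial>M) \<le> ennreal (H * (1 / \<epsilon>) powr (2 - 4 / real (j + 3)))"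
      by (simp only: T_def)
  qed
qed

section \<open>Thickness\<close>

lemma hausdorff_content_geI:
  assumes "\<And>J c r. (\<And>j. j \<in> J \<Longrightarrow> 0 < r j) \<Longrightarrow> K \<subseteq> (\<Union>j\<in>J. ball (c j) (r j)) \<Longrightarrow>
     v \<le> (\<Sum>\<^sub>\<infinity>j\<in>(J :: nat set). ennreal (r j powr s))"
  shows "v \<le> hausdorff_content s (K :: (real^'n::finite) set)"
  unfolding hausdorff_content_def by (rule Inf_greatest) (use assms in blast)

lemma infsum_ennreal_upper:
  fixes f :: "'a \<Rightarrow> ennreal"
  shows "finite A \<Longrightarrow> A \<subseteq> B \<Longrightarrow> sum f A \<le> infsum f B"
proof -
  assume A: "finite A" "A \<subseteq> B"
  have "sum f A = infsum f A" using A by simp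
  also have "\<dots> \<le> infsum f B"
    using A by (intro infsum_mono_neutral) (auto intro: nonneg_summable_on_complete)
  finally show ?thesis .
qed

lemma bounded_domain_frontier_outside:
  assumes "bounded_domain \<Omega>" "x \<in> frontier \<Omega>"
  shows "x \<in> - \<Omega>"
  using frontier_open_notin[of \<Omega> x] assms by (auto simp: bounded_domain_def)

text \<open>The content of exponent 0 counts balls, and a set containing the boundary point needs at
  least one.\<close>

lemma thick_full:
  fixes \<Omega> :: "(real^'n::finite) set"
  assumes dom: "bounded_domain \<Omega>"
  shows "thick (real CARD('n)) \<Omega>"
  unfolding thick_def thick_with_def
proof (intro exI[of _ 1] conjI ballI allI impI)
  fix x and r :: real assume x: "x \<in> frontier \<Omega>" and r: "0 < r \<and> r < 1"
  have xb: "x \<in> ball x r - \<Omega>" using bounded_domain_frontier_outside[OF dom x] r by simp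
  show "ennreal (1 * r powr (real CARD('n) - real CARD('n))) \<le> hausdorff_content (real CARD('n) - real CARD('n)) (ball x r - \<Omega>)"
  proof (rule hausdorff_content_geI)
    fix J :: "nat set" and c :: "nat \<Rightarrow> real^'n" and \<rho> :: "nat \<Rightarrow> real"
    assume pos: "\<And>j. j \<in> J \<Longrightarrow> 0 < \<rho> j" and cov: "ball x r - \<Omega> \<subseteq> (\<Union>j\<in>J. ball (c j) (\<rho> j))"
    obtain j where j: "j \<in> J" using cov xb by blast
    have "ennreal (1 * r powr (real CARD('n) - real CARD('n))) = ennreal (\<rho> j powr (real CARD('n) - real CARD('n)))"
      using r pos[OF j] by simp
    also have "\<dots> = (\<Sum>j\<in>{j}. ennreal (\<rho> j powr (real CARD('n) - real CARD('n))))" by simp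
    also have "\<dots> \<le> (\<Sum>\<^sub>\<infinity>j\<in>J. ennreal (\<rho> j powr (real CARD('n) - real CARD('n))))"
      by (rule infsum_ennreal_upper) (use j in auto)
    finally show "ennreal (1 * r powr (real CARD('n) - real CARD('n))) \<le> (\<Sum>\<^sub>\<infinity>j\<in>J. ennreal (\<rho> j powr (real CARD('n) - real CARD('n))))" .
  qed
qed auto

text \<open>The distances to \<open>x\<close> map the complement onto an interval of length \<open>r\<close>, and a ball of radius \<open>\<rho>\<close>
  into one of length \<open>2\<rho>\<close>.\<close>

lemma thick_connected:
  fixes \<Omega> :: "(real^'n::finite) set"
  assumes dom: "bounded_domain \<Omega>" and con: "connected (- \<Omega>)"
  shows "thick (real CARD('n) - 1) \<Omega>"
  unfolding thick_def thick_with_def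
proof (intro exI[of _ "1/2"] conjI ballI allI impI)
  show "0 \<le> real CARD('n) - 1" by (simp add: Suc_leI)
  fix x and r :: real assume x: "x \<in> frontier \<Omega>" and r: "0 < r \<and> r < 1"
  have xE: "x \<in> - \<Omega>" using bounded_domain_frontier_outside[OF dom x] .
  have unb: "\<not> bounded (- \<Omega>)" using dom by (intro unbounded_complement) (simp add: bounded_domain_def)
  have s: "real CARD('n) - (real CARD('n) - 1) = 1" by simp
  show "ennreal (1/2 * r powr (real CARD('n) - (real CARD('n) - 1))) \<le> hausdorff_content (real CARD('n) - (real CARD('n) - 1)) (ball x r - \<Omega>)"
    unfolding s
  proof (rule hausdorff_content_geI)
    fix J :: "nat set" and c :: "nat \<Rightarrow> real^'n" and \<rho> :: "nat \<Rightarrow> real"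
    assume pos: "\<And>j. j \<in> J \<Longrightarrow> 0 < \<rho> j" and cov: "ball x r - \<Omega> \<subseteq> (\<Union>j\<in>J. ball (c j) (\<rho> j))"
    define f where "f j = (if j \<in> J then {dist x (c j) - \<rho> j .. dist x (c j) + \<rho> j} else {})" for j
    have sub: "{0<..<r} \<subseteq> (\<Union>j. f j)"
    proof
      fix t assume t: "t \<in> {0<..<r}"
      obtain z where z: "z \<in> - \<Omega>" "dist x z = t"
        using connected_unbounded_meets_sphere[OF con xE unb, of t] t by auto
      then have "z \<in> ball x r - \<Omega>" using t by auto
      then obtain j where j: "j \<in> J" "dist (c j) z < \<rho> j" using cov by auto
      have "dist x z \<le> dist x (c j) + dist (c j) z" "dist x (c j) \<le> dist x z + dist (c j) z"
        using dist_triangle[of x z "c j"] dist_triangle[of x "c j" z] by (auto simp: dist_commute)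
      then have "t \<in> f j" using j z(2) by (auto simp: f_def)
      then show "t \<in> (\<Union>j. f j)" by blast
    qed
    have "ennreal r = emeasure lborel {0<..<r}" using r by simp
    also have "\<dots> \<le> emeasure lborel (\<Union>j. f j)" using sub by (intro emeasure_mono) (auto simp: f_def)
    also have "\<dots> \<le> (\<Sum>j. emeasure lborel (f j))" by (rule emeasure_subadditive_countably) (auto simp: f_def)
    also have "\<dots> = (SUP n. \<Sum>j<n. emeasure lborel (f j))" by (rule suminf_eq_SUP)
    also have "\<dots> \<le> 2 * (\<Sum>\<^sub>\<infinity>j\<in>J. ennreal (\<rho> j powr 1))"
    proof (rule SUP_least)
      fix n
      have "(\<Sum>j<n. emeasure lborel (f j)) = (\<Sum>j\<in>{..<n} \<inter> J. emeasure lborel (f j))"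
        by (rule sum.mono_neutral_right) (auto simp: f_def)
      also have "\<dots> = (\<Sum>j\<in>{..<n} \<inter> J. 2 * ennreal (\<rho> j powr 1))"
      proof (rule sum.cong)
        fix j assume "j \<in> {..<n} \<inter> J"
        then have j: "j \<in> J" by simp
        have "emeasure lborel (f j) = ennreal (2 * \<rho> j)" using j pos[OF j] by (simp add: f_def)
        also have "\<dots> = 2 * ennreal (\<rho> j powr 1)" using pos[OF j] by (simp add: ennreal_mult)
        finally show "emeasure lborel (f j) = 2 * ennreal (\<rho> j powr 1)" .
      qed simp
      also have "\<dots> = 2 * (\<Sum>j\<in>{..<n} \<inter> J. ennreal (\<rho> j powr 1))" by (rule sum_distrib_left[symmetric])
      also have "\<dots> \<le> 2 * (\<Sum>\<^sub>\<infinity>j\<in>J. ennreal (\<rho> j powr 1))"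
        by (intro mult_left_mono infsum_ennreal_upper) auto
      finally show "(\<Sum>j<n. emeasure lborel (f j)) \<le> 2 * (\<Sum>\<^sub>\<infinity>j\<in>J. ennreal (\<rho> j powr 1))" .
    qed
    finally have "ennreal (1/2) * ennreal r \<le> ennreal (1/2) * (2 * (\<Sum>\<^sub>\<infinity>j\<in>J. ennreal (\<rho> j powr 1)))"
      by (rule mult_left_mono) simp
    also have "\<dots> = (ennreal (1/2) * ennreal 2) * (\<Sum>\<^sub>\<infinity>j\<in>J. ennreal (\<rho> j powr 1))" by (simp add: mult.assoc)
    also have "ennreal (1/2) * ennreal 2 = 1" by (simp only: ennreal_mult'[symmetric]) simp
    finally have "ennreal (1/2) * ennreal r \<le> (\<Sum>\<^sub>\<infinity>j\<in>J. ennreal (\<rho> j powr 1))"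
      by (simp only: mult_1_left)
    moreover have "ennreal (1/2 * r powr 1) = ennreal (1/2) * ennreal r"
      using r by (subst ennreal_mult'[symmetric]) auto
    ultimately show "ennreal (1/2 * r powr 1) \<le> (\<Sum>\<^sub>\<infinity>j\<in>J. ennreal (\<rho> j powr 1))"
      by (simp only:)
  qed
qed auto

text \<open>Volume comparison, with \<open>(2\<rho>)\<^sup>d\<close> a crude bound for the volume of a ball of radius \<open>\<rho>\<close>.\<close>

lemma hausdorff_content_ball_ge:
  fixes K :: "(real^'n::finite) set"
  assumes sub: "ball a t \<subseteq> K" and t: "0 < t"
  shows "ennreal ((t / real CARD('n)) ^ CARD('n)) \<le> ennreal (2 ^ CARD('n)) * hausdorff_content (real CARD('n)) K"
proof -
  define d where "d = CARD('n)"
  have d: "0 < d" by (simp add: d_def)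
  have vol_le: "emeasure lborel (ball c \<rho>) \<le> ennreal (2 ^ d * \<rho> powr real d)" if "0 < \<rho>" for c :: "real^'n" and \<rho>
  proof -
    have "ball c \<rho> \<subseteq> cbox (c - (\<chi> i. \<rho>)) (c + (\<chi> i. \<rho>))"
    proof
      fix z assume z: "z \<in> ball c \<rho>"
      have "\<bar>(c - z) $ i\<bar> \<le> \<rho>" for i
        using component_le_norm_cart[of "c - z" i] z by (simp add: dist_norm)
      then show "z \<in> cbox (c - (\<chi> i. \<rho>)) (c + (\<chi> i. \<rho>))"
        by (auto simp: mem_box_cart abs_le_iff algebra_simps)
    qed
    then have "emeasure lborel (ball c \<rho>) \<le> emeasure lborel (cbox (c - (\<chi> i. \<rho>)) (c + (\<chi> i. \<rho>)))"
      by (rule emeasure_mono) simp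
    also have "\<dots> = ennreal (\<Prod>b\<in>Basis. ((c + (\<chi> i. \<rho>)) - (c - (\<chi> i. \<rho>))) \<bullet> b)"
      using that by (subst emeasure_lborel_cbox_eq) (auto simp: Basis_vec_def inner_axis)
    also have "(\<Prod>b\<in>(Basis :: (real^'n) set). ((c + (\<chi> i. \<rho>)) - (c - (\<chi> i. \<rho>))) \<bullet> b) = (\<Prod>b\<in>(Basis :: (real^'n) set). 2 * \<rho>)"
      by (rule prod.cong) (auto simp: Basis_vec_def inner_axis)
    also have "\<dots> = 2 ^ d * \<rho> powr real d" using that by (simp add: d_def powr_realpow power_mult_distrib)
    finally show ?thesis .
  qed
  have vol_ge: "ennreal ((t / real d) ^ d) \<le> emeasure lborel (ball a t)"
  proof -
    \<comment> \<open>A cube of half-side t / (2 d) fits into the ball because the coordinate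
      distances to its centre sum to at most t / 2.\<close>
    let ?h = "t / real d / 2"
    have h: "0 < ?h" using t d by simp
    have "box (a - (\<chi> i. ?h)) (a + (\<chi> i. ?h)) \<subseteq> ball a t"
    proof
      fix z assume z: "z \<in> box (a - (\<chi> i. ?h)) (a + (\<chi> i. ?h))"
      have "\<bar>(a - z) $ i\<bar> \<le> ?h" for i
        using z by (auto simp: mem_box_cart abs_le_iff algebra_simps dest!: spec[of _ i])
      then have "(\<Sum>i\<in>UNIV. \<bar>(a - z) $ i\<bar>) \<le> (\<Sum>i\<in>(UNIV :: 'n set). ?h)" by (intro sum_mono) auto
      also have "\<dots> = t / 2" using d by (simp add: d_def)
      finally have "norm (a - z) \<le> t / 2" using norm_le_l1_cart[of "a - z"] by linarith
      then show "z \<in> ball a t" using t by (simp add: dist_norm)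
    qed
    then have "emeasure lborel (box (a - (\<chi> i. ?h)) (a + (\<chi> i. ?h))) \<le> emeasure lborel (ball a t)"
      by (rule emeasure_mono) simp
    moreover have "emeasure lborel (box (a - (\<chi> i. ?h)) (a + (\<chi> i. ?h))) = ennreal (\<Prod>b\<in>Basis. ((a + (\<chi> i. ?h)) - (a - (\<chi> i. ?h))) \<bullet> b)"
      using h by (subst emeasure_lborel_box_eq) (auto simp: Basis_vec_def inner_axis)
    moreover have "(\<Prod>b\<in>(Basis :: (real^'n) set). ((a + (\<chi> i. ?h)) - (a - (\<chi> i. ?h))) \<bullet> b) = (\<Prod>b\<in>(Basis :: (real^'n) set). t / real d)"
      by (rule prod.cong) (auto simp: Basis_vec_def inner_axis)
    ultimately show ?thesis by (simp add: d_def)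
  qed
  have "ennreal ((t / real d) ^ d) / ennreal (2 ^ d) \<le> hausdorff_content (real d) K"
  proof (rule hausdorff_content_geI)
    fix J :: "nat set" and c :: "nat \<Rightarrow> real^'n" and \<rho> :: "nat \<Rightarrow> real"
    assume pos: "\<And>j. j \<in> J \<Longrightarrow> 0 < \<rho> j" and cov: "K \<subseteq> (\<Union>j\<in>J. ball (c j) (\<rho> j))"
    define f where "f j = (if j \<in> J then ball (c j) (\<rho> j) else {})" for j
    have "ball a t \<subseteq> (\<Union>j. f j)" using sub cov by (fastforce simp: f_def)
    then have "emeasure lborel (ball a t) \<le> emeasure lborel (\<Union>j. f j)" by (intro emeasure_mono) (auto simp: f_def)
    also have "\<dots> \<le> (\<Sum>j. emeasure lborel (f j))" by (rule emeasure_subadditive_countably) (auto simp: f_def)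
    also have "\<dots> = (SUP n. \<Sum>j<n. emeasure lborel (f j))" by (rule suminf_eq_SUP)
    also have "\<dots> \<le> ennreal (2 ^ d) * (\<Sum>\<^sub>\<infinity>j\<in>J. ennreal (\<rho> j powr real d))"
    proof (rule SUP_least)
      fix n
      have "(\<Sum>j<n. emeasure lborel (f j)) = (\<Sum>j\<in>{..<n} \<inter> J. emeasure lborel (f j))"
        by (rule sum.mono_neutral_right) (auto simp: f_def)
      also have "\<dots> \<le> (\<Sum>j\<in>{..<n} \<inter> J. ennreal (2 ^ d) * ennreal (\<rho> j powr real d))"
      proof (rule sum_mono)
        fix j assume "j \<in> {..<n} \<inter> J"
        then have j: "j \<in> J" by simp
        show "emeasure lborel (f j) \<le> ennreal (2 ^ d) * ennreal (\<rho> j powr real d)"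
          using vol_le[OF pos[OF j], of "c j"] j by (simp add: f_def ennreal_mult)
      qed
      also have "\<dots> = ennreal (2 ^ d) * (\<Sum>j\<in>{..<n} \<inter> J. ennreal (\<rho> j powr real d))" by (rule sum_distrib_left[symmetric])
      also have "\<dots> \<le> ennreal (2 ^ d) * (\<Sum>\<^sub>\<infinity>j\<in>J. ennreal (\<rho> j powr real d))"
        by (intro mult_left_mono infsum_ennreal_upper) auto
      finally show "(\<Sum>j<n. emeasure lborel (f j)) \<le> ennreal (2 ^ d) * (\<Sum>\<^sub>\<infinity>j\<in>J. ennreal (\<rho> j powr real d))" .
    qed
    finally have "ennreal ((t / real d) ^ d) \<le> (\<Sum>\<^sub>\<infinity>j\<in>J. ennreal (\<rho> j powr real d)) * ennreal (2 ^ d)"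
      using vol_ge by (simp add: mult.commute)
    then show "ennreal ((t / real d) ^ d) / ennreal (2 ^ d) \<le> (\<Sum>\<^sub>\<infinity>j\<in>J. ennreal (\<rho> j powr real d))"
      by (intro divide_le_posI_ennreal) (auto simp: mult.commute)
  qed
  then have "ennreal (2 ^ d) * (ennreal ((t / real d) ^ d) / ennreal (2 ^ d)) \<le> ennreal (2 ^ d) * hausdorff_content (real d) K"
    by (rule mult_left_mono) simp
  moreover have "ennreal (2 ^ d) * (ennreal ((t / real d) ^ d) / ennreal (2 ^ d)) = ennreal ((t / real d) ^ d)"
    using t by (simp add: divide_ennreal ennreal_mult'[symmetric])
  ultimately show ?thesis by (simp add: d_def)
qed

section \<open>Sign functions\<close>

text \<open>Models the side of a hypersurface \<open>A\<close> inside \<open>B\<close>: locally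
  constant off \<open>A\<close>, genuinely changing at each point of \<open>A\<close>. The last
  clause excludes constant functions near \<open>A\<close> and makes different sign functions
  comparable.\<close>

definition sign_on :: "'a::metric_space set \<Rightarrow> 'a set \<Rightarrow> ('a \<Rightarrow> real) \<Rightarrow> bool" where
  "sign_on A B s \<longleftrightarrow> (\<forall>x. s x = 1 \<or> s x = - 1) \<and>
     (\<forall>x\<in>B - A. \<exists>e>0. \<forall>y\<in>ball x e - A. s y = s x) \<and>
     (\<forall>q\<in>B \<inter> A. \<forall>e>0. \<exists>u\<in>ball q e - A. \<exists>w\<in>ball q e - A. s u \<noteq> s w)"

text \<open>At most two local sides: each of \<open>P\<close> and \<open>N\<close> is joined off
  \<open>A\<close> inside the larger ball. A sign function around \<open>q\<close> is then
  determined near \<open>q\<close> up to a factor -1.\<close>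

definition two_sided_at :: "'a::metric_space set \<Rightarrow> 'a \<Rightarrow> bool" where
  "two_sided_at A q \<longleftrightarrow> (\<forall>e>0. \<exists>e'>0. e' \<le> e \<and> (\<exists>P N. ball q e' - A \<subseteq> P \<union> N \<and>
     (\<forall>a\<in>P. \<forall>b\<in>P. connected_component (ball q e - A) a b) \<and>
     (\<forall>a\<in>N. \<forall>b\<in>N. connected_component (ball q e - A) a b)))"

lemma sign_on_subset: "sign_on A B s \<Longrightarrow> C \<subseteq> B \<Longrightarrow> sign_on A C s"
  unfolding sign_on_def by blast

lemma sign_on_square: "sign_on A B s \<Longrightarrow> s x * s x = 1"
  unfolding sign_on_def by (erule conjE, erule allE[of _ x]) auto

lemma sign_on_connected:
  assumes s: "sign_on A B s" and T: "connected T" "T \<subseteq> B - A" "a \<in> T" "b \<in> T"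
  shows "s a = s b"
proof (rule connected_local_const[OF T(1,3,4)])
  show "\<forall>a\<in>T. \<forall>\<^sub>F b in at a within T. s a = s b"
  proof
    fix a assume a: "a \<in> T"
    then have "a \<in> B - A" using T by blast
    then obtain e where e: "e > 0" "\<And>y. y \<in> ball a e - A \<Longrightarrow> s y = s a"
      using s unfolding sign_on_def by blast
    show "\<forall>\<^sub>F b in at a within T. s a = s b"
      unfolding eventually_at
    proof (intro exI[of _ e] conjI ballI impI)
      fix y assume y: "y \<in> T" "y \<noteq> a \<and> dist y a < e"
      then have "y \<in> ball a e - A" using T by (auto simp: dist_commute)
      then show "s a = s y" using e(2) by simp
    qed (rule e(1))
  qed
qed

lemma connected_component_sign:
  assumes s: "sign_on A B s" and ab: "connected_component (B - A) a b"
  shows "s a = s b"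
proof -
  obtain T where "connected T" "T \<subseteq> B - A" "a \<in> T" "b \<in> T"
    using ab unfolding connected_component_def by blast
  then show ?thesis by (rule sign_on_connected[OF s])
qed

text \<open>At a point of \<open>A\<close> every sign function takes opposite values on the two
  local sides, so the product of two of them is constant around the point, also across
  \<open>A\<close>.\<close>

lemma sign_product_locally_const:
  assumes two: "\<And>q. q \<in> A \<Longrightarrow> two_sided_at A q" and C: "open C"
    and s: "sign_on A C s" "sign_on A C s'" and q: "q \<in> C"
  shows "\<exists>e>0. \<exists>c. \<forall>x\<in>ball q e - A. s x * s' x = c"
proof (cases "q \<in> A")
  case False
  then have "q \<in> C - A" using q by blast
  then have "\<exists>e>0. \<forall>y\<in>ball q e - A. s y = s q" "\<exists>e>0. \<forall>y\<in>ball q e - A. s' y = s' q"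
    using s unfolding sign_on_def by blast+
  then obtain e e' where "e > 0" "\<forall>y\<in>ball q e - A. s y = s q" "e' > 0" "\<forall>y\<in>ball q e' - A. s' y = s' q"
    by blast
  then show ?thesis by (intro exI[of _ "min e e'"] conjI exI[of _ "s q * s' q"]) auto
next
  case True
  obtain e where e: "e > 0" "ball q e \<subseteq> C" using C q by (meson open_contains_ball)
  obtain e' P N where e': "e' > 0" "e' \<le> e" and cover: "ball q e' - A \<subseteq> P \<union> N"
    and P: "\<And>a b. a \<in> P \<Longrightarrow> b \<in> P \<Longrightarrow> connected_component (ball q e - A) a b"
    and N: "\<And>a b. a \<in> N \<Longrightarrow> b \<in> N \<Longrightarrow> connected_component (ball q e - A) a b"
  proof -
    from two[OF True, unfolded two_sided_at_def, rule_format, OF e(1)]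
    obtain e' P N where "e' > 0" "e' \<le> e" "ball q e' - A \<subseteq> P \<union> N"
      "\<forall>a\<in>P. \<forall>b\<in>P. connected_component (ball q e - A) a b"
      "\<forall>a\<in>N. \<forall>b\<in>N. connected_component (ball q e - A) a b" by blast
    then show ?thesis by (intro that) auto
  qed
  have sb: "sign_on A (ball q e) s" "sign_on A (ball q e) s'" using s e(2) sign_on_subset by blast+
  have flip: "\<exists>u\<in>ball q e' - A. \<exists>w\<in>ball q e' - A. t u \<noteq> t w" if "sign_on A (ball q e) t" for t
  proof -
    have "q \<in> ball q e \<inter> A" using True e(1) by simp
    then show ?thesis using that e'(1) unfolding sign_on_def by blast
  qed
  have rel: "\<exists>c. \<forall>x\<in>ball q e' - A. t x = (if x \<in> P then c else - c)" if t: "sign_on A (ball q e) t" for t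
  proof -
    have pm: "t x = 1 \<or> t x = - 1" for x using t unfolding sign_on_def by blast
    obtain u w where uw: "u \<in> ball q e' - A" "w \<in> ball q e' - A" "t u \<noteq> t w" using flip[OF t] by blast
    have PP: "t a = t b" if "a \<in> P" "b \<in> P" for a b using connected_component_sign[OF t P[OF that]] .
    have NN: "t a = t b" if "a \<in> N" "b \<in> N" for a b using connected_component_sign[OF t N[OF that]] .
    have "\<exists>a b. a \<in> P \<and> b \<in> N \<and> t a = - t b"
    proof -
      consider "u \<in> P" "w \<in> N" | "u \<in> N" "w \<in> P"
        using uw cover PP NN by blast
      then show ?thesis
      proof cases
        case 1
        moreover have "t u = - t w" using uw(3) pm[of u] pm[of w] by auto
        ultimately show ?thesis by blast
      next
        case 2
        moreover have "t w = - t u" using uw(3) pm[of u] pm[of w] by auto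
        ultimately show ?thesis by blast
      qed
    qed
    then obtain a b where ab: "a \<in> P" "b \<in> N" "t a = - t b" by blast
    have "t x = (if x \<in> P then t a else - t a)" if "x \<in> ball q e' - A" for x
    proof (cases "x \<in> P")
      case True
      then show ?thesis using PP[OF True ab(1)] by simp
    next
      case False
      then have "x \<in> N" using that cover by blast
      then show ?thesis using NN[OF _ ab(2), of x] ab(3) False by simp
    qed
    then show ?thesis by blast
  qed
  obtain c where c: "\<forall>x\<in>ball q e' - A. s x = (if x \<in> P then c else - c)" using rel[OF sb(1)] by blast
  obtain c' where c': "\<forall>x\<in>ball q e' - A. s' x = (if x \<in> P then c' else - c')" using rel[OF sb(2)] by blast
  have "\<forall>x\<in>ball q e' - A. s x * s' x = c * c'" using c c' by simp
  then show ?thesis using e'(1) by blast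
qed

text \<open>The product has a local constant at points of \<open>A\<close> too, so connectedness of
  \<open>C\<close> suffices even where \<open>C - A\<close> is disconnected.\<close>

lemma sign_product_const:
  assumes two: "\<And>q. q \<in> A \<Longrightarrow> two_sided_at A q" and C: "open C" "connected C"
    and s: "sign_on A C s" "sign_on A C s'" and xy: "x \<in> C - A" "y \<in> C - A"
  shows "s x * s' x = s y * s' y"
proof -
  have "\<forall>q\<in>C. \<exists>p. fst p > 0 \<and> (\<forall>x\<in>ball q (fst p) - A. s x * s' x = snd p)"
  proof
    fix q assume "q \<in> C"
    from sign_product_locally_const[OF two C(1) s this]
    obtain e c where "e > 0" "\<forall>x\<in>ball q e - A. s x * s' x = c" by blast
    then show "\<exists>p. fst p > 0 \<and> (\<forall>x\<in>ball q (fst p) - A. s x * s' x = snd p)"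
      by (intro exI[of _ "(e, c)"]) simp
  qed
  from bchoice[OF this] obtain f where
    f: "\<forall>q\<in>C. fst (f q) > 0 \<and> (\<forall>x\<in>ball q (fst (f q)) - A. s x * s' x = snd (f q))" by blast
  define e c where "e q = fst (f q)" and "c q = snd (f q)" for q
  have ec: "\<And>q. q \<in> C \<Longrightarrow> e q > 0" "\<And>q x. q \<in> C \<Longrightarrow> x \<in> ball q (e q) - A \<Longrightarrow> s x * s' x = c q"
    using f unfolding e_def c_def by blast+
  \<comment> \<open>Points off \<open>A\<close> are dense in \<open>C\<close>, so the constants of
    overlapping balls can be compared at a common point.\<close>
  have dense: "\<exists>u\<in>ball q r - A. True" if "q \<in> C" "r > 0" for q and r :: real
  proof (cases "q \<in> A")
    case True
    then have "q \<in> C \<inter> A" using that by blast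
    then show ?thesis using s(1) that(2) unfolding sign_on_def by blast
  next
    case False
    then have "q \<in> ball q r - A" using that(2) by simp
    then show ?thesis by blast
  qed
  have "c x = c y"
  proof (rule connected_local_const[OF C(2)])
    show "x \<in> C" "y \<in> C" using xy by auto
    show "\<forall>a\<in>C. \<forall>\<^sub>F b in at a within C. c a = c b"
    proof
      fix a assume a: "a \<in> C"
      show "\<forall>\<^sub>F b in at a within C. c a = c b"
        unfolding eventually_at
      proof (intro exI[of _ "e a"] conjI ballI impI)
        fix b assume b: "b \<in> C" "b \<noteq> a \<and> dist b a < e a"
        define r where "r = min (e b) (e a - dist b a)"
        have "r > 0" using b ec(1)[OF b(1)] by (simp add: r_def)
        then obtain u where u: "u \<in> ball b r" "u \<notin> A" using dense[OF b(1)] by blast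
        have "u \<in> ball b (e b)" using u by (simp add: r_def)
        moreover have "dist a u < e a"
          using dist_triangle[of a u b] u(1) by (simp add: r_def dist_commute)
        ultimately show "c a = c b" using ec(2)[OF a, of u] ec(2)[OF b(1), of u] u(2) by auto
      qed (rule ec(1)[OF a])
    qed
  qed
  moreover have "s z * s' z = c z" if "z \<in> C - A" for z
    using ec(2)[of z z] ec(1)[of z] that by auto
  ultimately show ?thesis using xy by simp
qed

text \<open>Local sign functions glue: the sign is transported along subdivided segments from the origin.\<close>

theorem global_sign:
  fixes A :: "'a::euclidean_space set"
  assumes A: "closed A" and two: "\<And>q. q \<in> A \<Longrightarrow> two_sided_at A q"
    and loc: "\<And>q. q \<in> A \<Longrightarrow> \<exists>B s. open B \<and> q \<in> B \<and> sign_on A B s"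
  shows "\<exists>\<sigma>. sign_on A (ball 0 R) \<sigma>"
proof -
  have cover: "\<exists>B s. open B \<and> q \<in> B \<and> sign_on A B s" for q
  proof (cases "q \<in> A")
    case False
    have "sign_on A (- A) (\<lambda>_. 1)" unfolding sign_on_def by (auto intro: exI[of _ 1])
    then show ?thesis using A False by (intro exI[of _ "- A"] exI[of _ "\<lambda>_. 1"]) auto
  qed (rule loc)
  define Cov where "Cov = {B. open B \<and> (\<exists>s. sign_on A B s)}"
  have "compact (cball (0::'a) (R + 1))" by simp
  moreover have "cball 0 (R + 1) \<subseteq> \<Union>Cov" using cover unfolding Cov_def by blast
  moreover have "\<And>B. B \<in> Cov \<Longrightarrow> open B" by (simp add: Cov_def)
  \<comment> \<open>A Lebesgue number: one radius that works at every point. The margin 1 in the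
    radius makes room for auxiliary points slightly outside the ball.\<close>
  ultimately obtain \<delta>0 where \<delta>0: "\<delta>0 > 0" "\<And>x. x \<in> cball 0 (R + 1) \<Longrightarrow> \<exists>B\<in>Cov. ball x \<delta>0 \<subseteq> B"
    using Heine_Borel_lemma[of "cball (0::'a) (R + 1)" Cov] by metis
  define \<delta> where "\<delta> = min \<delta>0 1"
  have \<delta>: "0 < \<delta>" "\<delta> \<le> 1" using \<delta>0 by (auto simp: \<delta>_def)
  have "\<exists>s. sign_on A (ball x \<delta>) s" if x: "x \<in> cball 0 (R + 1)" for x
  proof -
    obtain B s where "ball x \<delta>0 \<subseteq> B" "sign_on A B s" using \<delta>0(2)[OF x] by (auto simp: Cov_def)
    moreover have "ball x \<delta> \<subseteq> ball x \<delta>0" by (simp add: \<delta>_def subset_ball)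
    ultimately show ?thesis using sign_on_subset by blast
  qed
  then obtain s where s: "\<And>x. x \<in> cball 0 (R + 1) \<Longrightarrow> sign_on A (ball x \<delta>) (s x)" by metis
  have sq: "s x u * s x u = 1" if "x \<in> cball 0 (R + 1)" for x u
    using sign_on_square[OF s[OF that]] .
  \<comment> \<open>The sign of \<open>w\<close> relative to \<open>u\<close>. As a product of two
    values of one local function it does not change when that function is negated.\<close>
  define T where "T u w = s u u * s u w" for u w
  have indep: "T u w = s z u * s z w"
    if "z \<in> cball 0 (R + 1)" "u \<in> cball 0 (R + 1)" "u \<in> ball z \<delta> - A" "w \<in> ball z \<delta> - A" "dist u w < \<delta>" for z u w
  proof -
    let ?C = "ball u \<delta> \<inter> ball z \<delta>"
    have "s u u * s z u = s u w * s z w"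
    proof (rule sign_product_const[OF two])
      show "connected ?C" by (intro convex_connected convex_Int convex_ball)
      show "sign_on A ?C (s u)" "sign_on A ?C (s z)" using s that by (auto intro: sign_on_subset)
      show "u \<in> ?C - A" "w \<in> ?C - A" using that \<delta> by auto
    qed auto
    then have "s u u * s u w * (s z u * s z u) = (s u w * s u w) * (s z u * s z w)"
      by (metis mult.assoc mult.commute)
    then show ?thesis using sq[OF that(1), of u] sq[OF that(2), of w] by (simp only: T_def mult_1_left mult_1_right)
  qed
  \<comment> \<open>The cocycle relation: in a small ball all three relative signs can be computed
    from one sign function.\<close>
  have coc: "T u w * T w t = T u t"
    if z: "z \<in> cball 0 (R + 1)" and m: "u \<in> cball 0 (R + 1)" "w \<in> cball 0 (R + 1)"
      and b: "u \<in> ball z (\<delta>/2) - A" "w \<in> ball z (\<delta>/2) - A" "t \<in> ball z (\<delta>/2) - A" for z u w t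
  proof -
    have near: "dist p q < \<delta>" if "p \<in> ball z (\<delta>/2)" "q \<in> ball z (\<delta>/2)" for p q
      using dist_triangle[of p q z] that by (simp add: dist_commute)
    have bb: "u \<in> ball z \<delta> - A" "w \<in> ball z \<delta> - A" "t \<in> ball z \<delta> - A" using b \<delta> by auto
    have e1: "T u w = s z u * s z w" by (rule indep[OF z m(1) bb(1,2) near]) (use b in auto)
    have e2: "T w t = s z w * s z t" by (rule indep[OF z m(2) bb(2,3) near]) (use b in auto)
    have e3: "T u t = s z u * s z t" by (rule indep[OF z m(1) bb(1,3) near]) (use b in auto)
    have "T u w * T w t = s z u * (s z w * s z w) * s z t" unfolding e1 e2 by (simp only: mult_ac)
    then show ?thesis unfolding e3 using sq[OF z] by simp
  qed
  have "\<exists>a. a \<notin> A \<and> dist y a < \<delta> / 8" if y: "y \<in> cball 0 (R + 1)" for y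
  proof (cases "y \<in> A")
    case True
    then have "y \<in> ball y \<delta> \<inter> A" "\<delta> / 8 > 0" using \<delta> by auto
    then have "\<exists>u\<in>ball y (\<delta> / 8) - A. True" using s[OF y] unfolding sign_on_def by blast
    then show ?thesis by auto
  next
    case False
    then show ?thesis using \<delta> by (intro exI[of _ y]) simp
  qed
  then obtain a where a: "\<And>y. y \<in> cball 0 (R + 1) \<Longrightarrow> a y \<notin> A \<and> dist y (a y) < \<delta> / 8" by metis
  obtain n where "\<bar>R\<bar> / (\<delta> / 8) < real n" using reals_Archimedean2 by blast
  define m where "m = Suc n"
  have m: "\<bar>R\<bar> / real m < \<delta> / 8"
  proof -
    have "\<bar>R\<bar> < real n * (\<delta> / 8)" using \<open>\<bar>R\<bar> / (\<delta> / 8) < real n\<close> \<delta> by (simp only: pos_divide_less_eq)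
    also have "\<dots> \<le> real m * (\<delta> / 8)" using \<delta> by (intro mult_right_mono) (auto simp: m_def)
    finally show ?thesis by (simp add: pos_divide_less_eq m_def mult.commute)
  qed
  define y where "y i x = (real i / real m) *\<^sub>R x" for i and x :: 'a
  have y0: "y 0 x = 0" and ym: "y m x = x" for x by (simp_all add: y_def m_def)
  have y_norm: "norm (y i x) \<le> norm x" if "i \<le> m" for i x
  proof -
    have "real i / real m \<le> 1" using that by (simp add: m_def)
    then have "real i / real m * norm x \<le> 1 * norm x" by (intro mult_right_mono) auto
    then show ?thesis by (simp add: y_def)
  qed
  have y_step: "dist (y i x) (y (Suc i) x) < \<delta> / 8" if "x \<in> ball 0 R" for i x
  proof -
    have "y i x - y (Suc i) x = (- (1 / real m)) *\<^sub>R x"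
      by (simp add: y_def scaleR_diff_left[symmetric] diff_divide_distrib[symmetric])
    then have "dist (y i x) (y (Suc i) x) = norm x / real m" by (simp add: dist_norm)
    also have "\<dots> \<le> \<bar>R\<bar> / real m" using that by (intro divide_right_mono) auto
    finally show ?thesis using m by linarith
  qed
  have y_dist: "dist (y i x) (y i x') \<le> dist x x'" if "i \<le> m" for i x x'
  proof -
    have "y i x - y i x' = y i (x - x')" by (simp add: y_def scaleR_diff_right)
    then show ?thesis using y_norm[OF that, of "x - x'"] by (simp add: dist_norm)
  qed
  have in_ball: "y i x \<in> cball 0 (R + 1)" "a (y i x) \<in> cball 0 (R + 1)" "a (y i x) \<notin> A"
      "dist (y i x) (a (y i x)) < \<delta> / 8"
    if "i \<le> m" "x \<in> ball 0 R" for i x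
  proof -
    have n: "norm (y i x) < R" using y_norm[OF that(1), of x] that(2) by simp
    then show c: "y i x \<in> cball 0 (R + 1)" by simp
    show "a (y i x) \<notin> A" and d: "dist (y i x) (a (y i x)) < \<delta> / 8" using a[OF c] by auto
    have "norm (a (y i x)) \<le> norm (y i x) + dist (y i x) (a (y i x))"
      using norm_triangle_ineq[of "y i x" "a (y i x) - y i x"] by (simp add: dist_norm norm_minus_commute)
    then show "a (y i x) \<in> cball 0 (R + 1)" using n d \<delta> by simp
  qed
  define g where "g k x = (\<Prod>i<k. T (a (y i x)) (a (y (Suc i) x)))" for k x
  \<comment> \<open>The transports along two nearby segments are compared one quadrilateral of the
    subdivision at a time, by two cocycle relations each. This is what rules out monodromy.\<close>
  have transport: "g k x * T (a (y k x)) (a (y k x')) = g k x'"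
    if xx: "x \<in> ball 0 R" "x' \<in> ball 0 R" "dist x x' < \<delta> / 8" and "k \<le> m" for k x x'
    using \<open>k \<le> m\<close>
  proof (induction k)
    case 0
    have "T (a 0) (a 0) = 1" using in_ball(2)[of 0 x] xx sq by (simp add: T_def y0)
    then show ?case by (simp add: g_def y0)
  next
    case (Suc k)
    then have k: "k \<le> m" "Suc k \<le> m" by auto
    let ?z = "y k x"
    note nb = in_ball[OF k(1) xx(1)] in_ball[OF k(1) xx(2)] in_ball[OF k(2) xx(1)] in_ball[OF k(2) xx(2)]
    have d1: "dist ?z (y k x') < \<delta> / 8" using y_dist[OF k(1), of x x'] xx(3) by linarith
    have d2: "dist ?z (y (Suc k) x) < \<delta> / 8" by (rule y_step[OF xx(1)])
    have d3: "dist (y (Suc k) x) (y (Suc k) x') < \<delta> / 8" using y_dist[OF k(2), of x x'] xx(3) by linarith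
    have b0: "a ?z \<in> ball ?z (\<delta>/2) - A" using nb(3,4) \<delta> by simp
    have b1: "a (y k x') \<in> ball ?z (\<delta>/2) - A"
      using nb(7,8) d1 dist_triangle[of ?z "a (y k x')" "y k x'"] \<delta> by simp
    have b2: "a (y (Suc k) x) \<in> ball ?z (\<delta>/2) - A"
      using nb(11,12) d2 dist_triangle[of ?z "a (y (Suc k) x)" "y (Suc k) x"] \<delta> by simp
    have b3: "a (y (Suc k) x') \<in> ball ?z (\<delta>/2) - A"
      using nb(15,16) d2 d3 dist_triangle[of ?z "a (y (Suc k) x')" "y (Suc k) x'"]
        dist_triangle[of ?z "y (Suc k) x'" "y (Suc k) x"] \<delta> by simp
    have c1: "T (a ?z) (a (y (Suc k) x)) * T (a (y (Suc k) x)) (a (y (Suc k) x')) = T (a ?z) (a (y (Suc k) x'))"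
      by (rule coc[OF nb(1) nb(2) nb(10) b0 b2 b3])
    have c2: "T (a ?z) (a (y k x')) * T (a (y k x')) (a (y (Suc k) x')) = T (a ?z) (a (y (Suc k) x'))"
      by (rule coc[OF nb(1) nb(2) nb(6) b0 b1 b3])
    have "g (Suc k) x * T (a (y (Suc k) x)) (a (y (Suc k) x'))
        = g k x * (T (a ?z) (a (y (Suc k) x)) * T (a (y (Suc k) x)) (a (y (Suc k) x')))"
      by (simp add: g_def mult.assoc)
    also have "\<dots> = (g k x * T (a ?z) (a (y k x'))) * T (a (y k x')) (a (y (Suc k) x'))"
      unfolding c1 c2[symmetric] by (simp only: mult.assoc)
    also have "g k x * T (a ?z) (a (y k x')) = g k x'" by (rule Suc.IH[OF k(1)])
    finally show ?case by (simp add: g_def)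
  qed
  have T_pm: "T u w = 1 \<or> T u w = - 1" if "u \<in> cball 0 (R + 1)" for u w
  proof -
    have "s u u = 1 \<or> s u u = - 1" "s u w = 1 \<or> s u w = - 1" using s[OF that] unfolding sign_on_def by blast+
    then show ?thesis unfolding T_def by auto
  qed
  define \<sigma> where "\<sigma> x = (if x \<in> ball 0 R - A then g m x * T (a x) x else 1)" for x
  have step: "\<sigma> x' = \<sigma> x * T x x'" if x: "x \<in> ball 0 R - A" "x' \<in> ball 0 R - A" "dist x x' < \<delta> / 8" for x x'
  proof -
    have xb: "x \<in> ball 0 R" "x' \<in> ball 0 R" using x by auto
    note nb = in_ball[OF order_refl xb(1), unfolded ym] in_ball[OF order_refl xb(2), unfolded ym]
    have b0: "x \<in> ball x (\<delta>/2) - A" "x' \<in> ball x (\<delta>/2) - A" using x \<delta> by auto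
    have b1: "a x \<in> ball x (\<delta>/2) - A" using nb(3,4) \<delta> by simp
    have b2: "a x' \<in> ball x (\<delta>/2) - A" using nb(7,8) x(3) dist_triangle[of x "a x'" x'] \<delta> by simp
    have "\<sigma> x' = g m x' * T (a x') x'" using x by (simp add: \<sigma>_def)
    also have "g m x' = g m x * T (a x) (a x')" using transport[OF xb x(3) order_refl] by (simp add: ym)
    also have "g m x * T (a x) (a x') * T (a x') x' = g m x * (T (a x) (a x') * T (a x') x')" by (simp only: mult.assoc)
    also have "T (a x) (a x') * T (a x') x' = T (a x) x'"
      by (rule coc[OF nb(1) nb(2) nb(6) b1 b2 b0(2)])
    also have "T (a x) x' = T (a x) x * T x x'"
      by (rule coc[OF nb(1) nb(2) nb(1) b1 b0, symmetric])
    finally show ?thesis using x by (simp add: \<sigma>_def)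
  qed
  have pm: "\<sigma> x = 1 \<or> \<sigma> x = - 1" for x
  proof (cases "x \<in> ball 0 R - A")
    case True
    then have xb: "x \<in> ball 0 R" by blast
    have "g k x = 1 \<or> g k x = - 1" if "k \<le> m" for k
      using that
    proof (induction k)
      case (Suc k)
      have "T (a (y k x)) (a (y (Suc k) x)) = 1 \<or> T (a (y k x)) (a (y (Suc k) x)) = - 1"
        by (rule T_pm[OF in_ball(2)]) (use Suc xb in auto)
      then show ?case using Suc by (auto simp: g_def)
    qed (simp add: g_def)
    then have "g m x = 1 \<or> g m x = - 1" by simp
    then show ?thesis using True T_pm[OF in_ball(2)[OF order_refl xb, unfolded ym], of x]
      by (auto simp: \<sigma>_def)
  qed (auto simp: \<sigma>_def)
  \<comment> \<open>Around each point the transported sign is a constant multiple of the given local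
    sign, so it inherits the clauses of \<open>sign_on\<close>.\<close>
  have local: "\<exists>e>0. \<exists>c. (c = 1 \<or> c = - 1) \<and> (\<forall>x\<in>ball q e - A. \<sigma> x = c * s q x)" if q: "q \<in> ball 0 R" for q
  proof -
    define e where "e = min (\<delta> / 16) (R - norm q)"
    have e: "e > 0" using q \<delta> by (simp add: e_def)
    have sub: "x \<in> ball 0 R" "dist q x < \<delta> / 16" if "x \<in> ball q e" for x
    proof -
      show "dist q x < \<delta> / 16" using that by (simp add: e_def)
      have "norm x \<le> norm q + dist q x"
        using norm_triangle_ineq[of q "x - q"] by (simp add: dist_norm norm_minus_commute)
      then show "x \<in> ball 0 R" using that by (simp add: e_def)
    qed
    have qc: "q \<in> cball 0 (R + 1)" using q by simp
    obtain u where u: "u \<in> ball q e" "u \<notin> A"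
    proof (cases "q \<in> A")
      case True
      then have "q \<in> ball q \<delta> \<inter> A" using \<delta> by simp
      then have "\<exists>u\<in>ball q e - A. True" using s[OF qc] e unfolding sign_on_def by blast
      then show ?thesis using that by auto
    qed (use that[of q] e in auto)
    have "\<sigma> x = \<sigma> u * s q u * s q x" if x: "x \<in> ball q e - A" for x
    proof -
      have near: "dist u x < \<delta> / 8" using dist_triangle[of u x q] sub(2)[of u] sub(2)[of x] u x by (simp add: dist_commute)
      have "\<sigma> x = \<sigma> u * T u x" by (rule step) (use u x sub near in auto)
      also have "T u x = s q u * s q x"
      proof (rule indep[OF qc])
        show "u \<in> cball 0 (R + 1)" using sub(1)[OF u(1)] by simp
        show "u \<in> ball q \<delta> - A" "x \<in> ball q \<delta> - A" using sub(2)[of u] sub(2)[of x] u x \<delta>(1) by auto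
        show "dist u x < \<delta>" using near \<delta> by linarith
      qed
      finally show ?thesis by (simp only: mult.assoc)
    qed
    moreover have "s q u = 1 \<or> s q u = - 1" using s[OF qc] unfolding sign_on_def by blast
    then have "\<sigma> u * s q u = 1 \<or> \<sigma> u * s q u = - 1" using pm[of u] by (elim disjE) simp_all
    ultimately show ?thesis using e by blast
  qed
  have "sign_on A (ball 0 R) \<sigma>"
    unfolding sign_on_def
  proof (intro conjI ballI allI impI)
    show "\<sigma> x = 1 \<or> \<sigma> x = - 1" for x by (rule pm)
    fix x assume x: "x \<in> ball 0 R - A"
    obtain e c where e: "e > 0" "\<forall>y\<in>ball x e - A. \<sigma> y = c * s x y" using local[of x] x by blast
    have "x \<in> ball x \<delta> - A" "x \<in> cball 0 (R + 1)" using x \<delta> by auto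
    then obtain e' where e': "e' > 0" "\<forall>y\<in>ball x e' - A. s x y = s x x"
      using s[of x] unfolding sign_on_def by blast
    have "\<sigma> y = \<sigma> x" if y: "y \<in> ball x (min e e') - A" for y
    proof -
      have "\<sigma> y = c * s x y" "s x y = s x x" using e(2) e'(2) y by simp_all
      moreover have "\<sigma> x = c * s x x" using e x by simp
      ultimately show ?thesis by (simp only:)
    qed
    then show "\<exists>e>0. \<forall>y\<in>ball x e - A. \<sigma> y = \<sigma> x" using e(1) e'(1) by (intro exI[of _ "min e e'"]) auto
  next
    fix q and e :: real assume q: "q \<in> ball 0 R \<inter> A" and e: "e > 0"
    obtain e' c where e': "e' > 0" "c = 1 \<or> c = - 1" "\<forall>y\<in>ball q e' - A. \<sigma> y = c * s q y" using local[of q] q by blast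
    have "q \<in> ball q \<delta> \<inter> A" "q \<in> cball 0 (R + 1)" "min e e' > 0" using q \<delta> e e' by auto
    then obtain u w where "u \<in> ball q (min e e') - A" "w \<in> ball q (min e e') - A" "s q u \<noteq> s q w"
      using s[of q] unfolding sign_on_def by blast
    then show "\<exists>u\<in>ball q e - A. \<exists>w\<in>ball q e - A. \<sigma> u \<noteq> \<sigma> w" using e'(2,3) by (intro bexI[of _ u] bexI[of _ w]) auto
  qed
  then show ?thesis by blast
qed

section \<open>Smooth boundaries\<close>

text \<open>Local defining function with gradient \<open>g\<close> at \<open>p\<close>, which is almost constant on the ball.\<close>

definition chart :: "(real^'n::finite) set \<Rightarrow> real^'n \<Rightarrow> (real^'n \<Rightarrow> real) \<Rightarrow> real^'n \<Rightarrow> real \<Rightarrow> bool" where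
  "chart S p \<phi> g \<delta> \<longleftrightarrow> 0 < \<delta> \<and> g \<noteq> 0 \<and> S \<inter> ball p \<delta> = {y \<in> ball p \<delta>. \<phi> y = 0} \<and>
     (\<forall>a\<in>ball p \<delta>. \<forall>b\<in>ball p \<delta>. \<bar>\<phi> b - \<phi> a - g \<bullet> (b - a)\<bar> \<le> norm g / 2 * norm (b - a))"

lemma chart_uminus: "chart S p \<phi> g \<delta> \<Longrightarrow> chart S p (\<lambda>y. - \<phi> y) (- g) \<delta>"
proof -
  have "- \<phi> b - (- \<phi> a) - (- g) \<bullet> (b - a) = - (\<phi> b - \<phi> a - g \<bullet> (b - a))" for a b by simp
  then have "\<bar>- \<phi> b - (- \<phi> a) - (- g) \<bullet> (b - a)\<bar> = \<bar>\<phi> b - \<phi> a - g \<bullet> (b - a)\<bar>" for a b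
    by (simp only: abs_minus_cancel)
  note eq = this
  assume "chart S p \<phi> g \<delta>"
  then show "chart S p (\<lambda>y. - \<phi> y) (- g) \<delta>"
    unfolding chart_def eq norm_minus_cancel by simp
qed

lemma chart_mem_iff: "chart S p \<phi> g \<delta> \<Longrightarrow> y \<in> ball p \<delta> \<Longrightarrow> y \<in> S \<longleftrightarrow> \<phi> y = 0"
  unfolding chart_def by blast

lemma chart_approx:
  "chart S p \<phi> g \<delta> \<Longrightarrow> a \<in> ball p \<delta> \<Longrightarrow> b \<in> ball p \<delta> \<Longrightarrow>
    \<bar>\<phi> b - \<phi> a - g \<bullet> (b - a)\<bar> \<le> norm g / 2 * norm (b - a)"
  unfolding chart_def by blast

text \<open>Continuity of the gradient keeps it within half its norm of \<open>g\<close> on a small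
  ball; the mean value inequality, applied to \<phi> minus its linear part, gives the
  estimate.\<close>

lemma hypersurface_chart:
  fixes S :: "(real^'n::finite) set"
  assumes S: "smooth_hypersurface S" and p: "p \<in> S"
  obtains \<phi> g \<delta> where "chart S p \<phi> g \<delta>"
proof -
  obtain U \<phi> where U: "open U" "p \<in> U" and Ck: "\<And>k. Ck_on k \<phi> U"
    and nz: "\<And>y. y \<in> U \<Longrightarrow> frechet_derivative \<phi> (at y) \<noteq> (\<lambda>v. 0)"
    and SU: "S \<inter> U = {y \<in> U. \<phi> y = 0}"
    using S[unfolded smooth_hypersurface_def, rule_format, OF p] by blast
  have diff: "\<phi> differentiable_on U" and part: "continuous_on U (\<lambda>x. frechet_derivative \<phi> (at x) (axis i 1))" for i
    using Ck[of "Suc 0"] by auto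
  define D where "D y = frechet_derivative \<phi> (at y)" for y
  have D: "(\<phi> has_derivative D y) (at y)" if "y \<in> U" for y
    using diff U(1) that unfolding D_def
    by (simp add: differentiable_on_eq_differentiable_at frechet_derivative_works[symmetric])
  define G where "G y = (\<chi> i. D y (axis i 1))" for y
  have contG: "continuous_on U G"
    unfolding G_def D_def using part by (intro continuous_on_vec_lambda) auto
  have DG: "D y h = G y \<bullet> h" if "y \<in> U" for y h
  proof -
    have lin: "linear (D y)" using has_derivative_linear[OF D[OF that]] .
    have "D y h = D y (\<Sum>i\<in>UNIV. h $ i *\<^sub>R axis i 1)"
      using basis_expansion[of h] by (simp add: scalar_mult_eq_scaleR)
    also have "\<dots> = (\<Sum>i\<in>UNIV. h $ i * D y (axis i 1))"
      using lin by (simp add: linear_sum linear_cmul)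
    also have "\<dots> = G y \<bullet> h" by (simp add: G_def inner_vec_def mult.commute)
    finally show ?thesis .
  qed
  define g where "g = G p"
  have g: "g \<noteq> 0"
  proof
    assume "g = 0"
    then have "D p h = 0" for h using DG[OF U(2), of h] by (simp add: g_def)
    then show False using nz[OF U(2)] by (auto simp: D_def)
  qed
  have "norm g / 2 > 0" using g by simp
  then obtain e1 where e1: "e1 > 0" "\<And>y. y \<in> U \<Longrightarrow> dist y p < e1 \<Longrightarrow> dist (G y) g < norm g / 2"
    using contG[unfolded continuous_on_iff, rule_format, OF U(2), of "norm g / 2"] unfolding g_def by blast
  obtain e2 where e2: "e2 > 0" "ball p e2 \<subseteq> U" using U by (meson open_contains_ball)
  define \<delta> where "\<delta> = min e1 e2"
  have \<delta>: "\<delta> > 0" "ball p \<delta> \<subseteq> U" "ball p \<delta> \<subseteq> ball p e1" using e1 e2 by (auto simp: \<delta>_def)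
  have "\<bar>\<phi> b - \<phi> a - g \<bullet> (b - a)\<bar> \<le> norm g / 2 * norm (b - a)" if ab: "a \<in> ball p \<delta>" "b \<in> ball p \<delta>" for a b
  proof -
    have "norm ((\<phi> b - g \<bullet> b) - (\<phi> a - g \<bullet> a)) \<le> norm g / 2 * norm (b - a)"
    proof (rule differentiable_bound[where S = "ball p \<delta>" and f' = "\<lambda>y h. D y h - g \<bullet> h"])
      show "convex (ball p \<delta>)" by (rule convex_ball)
      fix y assume y: "y \<in> ball p \<delta>"
      then have yU: "y \<in> U" using \<delta> by blast
      show "((\<lambda>y. \<phi> y - g \<bullet> y) has_derivative (\<lambda>h. D y h - g \<bullet> h)) (at y within ball p \<delta>)"
        by (intro derivative_intros has_derivative_at_withinI[OF D[OF yU]])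
      show "onorm (\<lambda>h. D y h - g \<bullet> h) \<le> norm g / 2"
      proof (rule onorm_le)
        fix h
        have "norm (D y h - g \<bullet> h) = \<bar>(G y - g) \<bullet> h\<bar>" by (simp add: DG[OF yU] inner_diff_left)
        also have "\<dots> \<le> norm (G y - g) * norm h" by (rule Cauchy_Schwarz_ineq2)
        also have "\<dots> \<le> norm g / 2 * norm h"
          using e1(2)[OF yU] y \<delta>(3) by (intro mult_right_mono) (auto simp: dist_norm norm_minus_commute subset_iff)
        finally show "norm (D y h - g \<bullet> h) \<le> norm g / 2 * norm h" .
      qed
    qed (use ab in auto)
    then show ?thesis by (simp add: inner_diff_right algebra_simps)
  qed
  moreover have "S \<inter> ball p \<delta> = {y \<in> ball p \<delta>. \<phi> y = 0}" using SU \<delta>(2) by blast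
  ultimately have "chart S p \<phi> g \<delta>" using \<delta>(1) g by (auto simp: chart_def)
  then show thesis by (rule that)
qed

lemma chart_continuous:
  assumes "chart S p \<phi> g \<delta>"
  shows "continuous_on (ball p \<delta>) \<phi>"
proof -
  have "dist (\<phi> a) (\<phi> b) \<le> (3/2 * norm g) * dist a b" if "a \<in> ball p \<delta>" "b \<in> ball p \<delta>" for a b
  proof -
    have "\<bar>\<phi> a - \<phi> b - g \<bullet> (a - b)\<bar> \<le> norm g / 2 * norm (a - b)" by (rule chart_approx[OF assms that(2,1)])
    moreover have "\<bar>g \<bullet> (a - b)\<bar> \<le> norm g * norm (a - b)" by (rule Cauchy_Schwarz_ineq2)
    ultimately have "\<bar>\<phi> a - \<phi> b\<bar> \<le> norm g / 2 * norm (a - b) + norm g * norm (a - b)" by linarith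
    then show ?thesis by (simp add: dist_norm)
  qed
  then have "(3/2 * norm g)-lipschitz_on (ball p \<delta>) \<phi>" by (intro lipschitz_onI) auto
  then show ?thesis by (rule lipschitz_on_continuous_on)
qed

text \<open>Two points on the positive side near \<open>p\<close> are joined by moving both of them up along the gradient.\<close>

lemma chart_positive_connected:
  assumes ch: "chart S p \<phi> g \<delta>" and e: "0 < e" "e \<le> \<delta>"
    and ab: "a \<in> ball p (e / 8)" "b \<in> ball p (e / 8)" "0 < \<phi> a" "0 < \<phi> b"
  shows "connected_component (ball p e - S) a b"
proof -
  define v where "v = (1 / norm g) *\<^sub>R g"
  have g: "norm g > 0" using ch by (simp add: chart_def)
  have v: "norm v = 1" "g \<bullet> v = norm g"
    using g by (simp_all add: v_def power2_norm_eq_inner[symmetric] power2_eq_square)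
  \<comment> \<open>Lifting by 3/4 e stays in the ball, as 1/8 + 3/4 < 1. It raises \<phi> by at
    least 3/8 |g| e, which compensates the largest possible fall of \<phi> between \<open>a\<close>
    and a point of the segment to \<open>b\<close>; positivity of \<phi> at \<open>a\<close> does
    the rest.\<close>
  define \<eta> where "\<eta> = 3/4 * e"
  have star: "\<bar>\<phi> y - \<phi> x - g \<bullet> (y - x)\<bar> \<le> norm g / 2 * norm (y - x)" if "x \<in> ball p \<delta>" "y \<in> ball p \<delta>" for x y
    by (rule chart_approx[OF ch that])
  have inb: "c + t *\<^sub>R v \<in> ball p e" if "c \<in> ball p (e / 8)" "0 \<le> t" "t \<le> \<eta>" for c t
  proof -
    have "dist p (c + t *\<^sub>R v) \<le> dist p c + norm (t *\<^sub>R v)"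
      using dist_triangle[of p "c + t *\<^sub>R v" c] by (simp add: dist_norm)
    also have "norm (t *\<^sub>R v) = t" using that v by simp
    also have "dist p c + t < e" using that by (simp add: \<eta>_def)
    finally show ?thesis by simp
  qed
  have up: "\<phi> c + norm g / 2 * t \<le> \<phi> (c + t *\<^sub>R v)" if "c \<in> ball p (e / 8)" "0 \<le> t" "t \<le> \<eta>" for c t
  proof -
    have "c \<in> ball p \<delta>" "c + t *\<^sub>R v \<in> ball p \<delta>" using inb[OF that(1), of 0] inb[OF that] e \<open>0 \<le> t\<close> by (auto simp: \<eta>_def)
    from abs_le_D2[OF star[OF this]] have "- (\<phi> (c + t *\<^sub>R v) - \<phi> c - t * norm g) \<le> norm g / 2 * t"
      using that v by simp
    moreover have "norm g / 2 * t = t * norm g / 2" by simp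
    ultimately show ?thesis by linarith
  qed
  define P where "P = {y \<in> ball p e. 0 < \<phi> y}"
  have PS: "P \<subseteq> ball p e - S"
  proof
    fix y assume "y \<in> P"
    then have "y \<in> ball p e" "0 < \<phi> y" by (auto simp: P_def)
    moreover then have "y \<in> ball p \<delta>" using e by auto
    ultimately show "y \<in> ball p e - S" using chart_mem_iff[OF ch, of y] by auto
  qed
  have vert: "closed_segment c (c + \<eta> *\<^sub>R v) \<subseteq> P" if "c \<in> ball p (e / 8)" "0 < \<phi> c" for c
  proof
    fix y assume "y \<in> closed_segment c (c + \<eta> *\<^sub>R v)"
    then obtain u where u: "0 \<le> u" "u \<le> 1" "y = c + (u * \<eta>) *\<^sub>R v"
      by (auto simp: in_segment algebra_simps)
    have t: "0 \<le> u * \<eta>" "u * \<eta> \<le> \<eta>" using u e by (auto simp: \<eta>_def mult_left_le_one_le)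
    have "0 \<le> norm g / 2 * (u * \<eta>)" using t by simp
    then show "y \<in> P" unfolding u(3) P_def using up[OF that(1) t] inb[OF that(1) t] that(2) by auto
  qed
  have horiz: "closed_segment (a + \<eta> *\<^sub>R v) (b + \<eta> *\<^sub>R v) \<subseteq> P"
  proof
    fix y assume "y \<in> closed_segment (a + \<eta> *\<^sub>R v) (b + \<eta> *\<^sub>R v)"
    then obtain u where u: "0 \<le> u" "u \<le> 1" "y = (1 - u) *\<^sub>R (a + \<eta> *\<^sub>R v) + u *\<^sub>R (b + \<eta> *\<^sub>R v)"
      unfolding in_segment by blast
    define c where "c = (1 - u) *\<^sub>R a + u *\<^sub>R b"
    have c: "c \<in> closed_segment a b" "y = c + \<eta> *\<^sub>R v"
      using u by (auto simp: c_def in_segment algebra_simps)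
    have cb: "c \<in> ball p (e / 8)"
      using c(1) ab closed_segment_subset[OF ab(1,2) convex_ball] by blast
    have t: "0 \<le> \<eta>" "\<eta> \<le> \<eta>" using e by (auto simp: \<eta>_def)
    have "dist a c < e / 4" using dist_triangle[of a c p] ab(1) cb by (simp add: dist_commute)
    then have n: "norm (c - a) \<le> e / 4" by (simp add: dist_norm norm_minus_commute)
    have "a \<in> ball p \<delta>" "c \<in> ball p \<delta>" using ab(1) cb e by auto
    from abs_le_D2[OF star[OF this]] have "- (\<phi> c - \<phi> a - g \<bullet> (c - a)) \<le> norm g / 2 * norm (c - a)" .
    moreover have "- (g \<bullet> (c - a)) \<le> norm g * norm (c - a)" by (rule abs_le_D2[OF Cauchy_Schwarz_ineq2])
    moreover have "norm g * norm (c - a) \<le> norm g * (e / 4)" using n by (intro mult_left_mono) auto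
    moreover have "norm g / 2 * norm (c - a) = (norm g * norm (c - a)) / 2" by simp
    moreover have "norm g / 2 * \<eta> = 3/2 * (norm g * (e / 4))" by (simp add: \<eta>_def)
    ultimately have "0 < \<phi> c + norm g / 2 * \<eta>" using ab(3) by linarith
    then show "y \<in> P" unfolding c(2) P_def using up[OF cb t] inb[OF cb t] by auto
  qed
  let ?T = "closed_segment a (a + \<eta> *\<^sub>R v) \<union> closed_segment (a + \<eta> *\<^sub>R v) (b + \<eta> *\<^sub>R v) \<union> closed_segment b (b + \<eta> *\<^sub>R v)"
  have "connected ?T"
    by (intro connected_Un connected_segment) (auto intro: ends_in_segment)
  moreover have "?T \<subseteq> ball p e - S" using vert[OF ab(1,3)] vert[OF ab(2,4)] horiz PS by blast
  ultimately show ?thesis unfolding connected_component_def by (intro exI[of _ ?T]) auto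
qed

text \<open>The centre lies r / 2 from \<open>q\<close> along the gradient. On the small ball the
  linear part is at least (1/2 - 1/8) |g| r and the error at most 5/16 |g| r, so \<phi> stays
  positive.\<close>

lemma chart_cone:
  assumes ch: "chart S p \<phi> g \<delta>" and q: "q \<in> S" "q \<in> ball p (\<delta> / 2)" and r: "0 < r" "r \<le> \<delta> / 2"
  obtains u where "ball u (r / 8) \<subseteq> ball q r" "\<And>y. y \<in> ball u (r / 8) \<Longrightarrow> y \<in> ball p \<delta> \<and> 0 < \<phi> y"
proof -
  define v where "v = (1 / norm g) *\<^sub>R g"
  have g: "norm g > 0" using ch by (simp add: chart_def)
  have v: "norm v = 1" "g \<bullet> v = norm g"
    using g by (simp_all add: v_def power2_norm_eq_inner[symmetric] power2_eq_square)
  define u where "u = q + (r / 2) *\<^sub>R v"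
  have \<delta>: "0 < \<delta>" using ch by (simp add: chart_def)
  have q\<delta>: "q \<in> ball p \<delta>" using q \<delta> by simp
  have \<phi>q: "\<phi> q = 0" using chart_mem_iff[OF ch q\<delta>] q(1) by simp
  have D: "norm (y - q) \<le> 5/8 * r" if "y \<in> ball u (r / 8)" for y
  proof -
    have "norm (y - q) \<le> norm (y - u) + norm ((r / 2) *\<^sub>R v)"
      using norm_triangle_ineq[of "y - u" "u - q"] by (simp add: u_def)
    also have "norm ((r / 2) *\<^sub>R v) = r / 2" using v r by simp
    finally show ?thesis using that by (simp add: dist_norm norm_minus_commute)
  qed
  have sub: "ball u (r / 8) \<subseteq> ball q r"
    using D r by (force simp: dist_norm norm_minus_commute)
  have inp: "y \<in> ball p \<delta>" if "y \<in> ball u (r / 8)" for y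
    using dist_triangle[of p y q] q(2) r sub that by (auto simp: subset_iff)
  have pos: "0 < \<phi> y" if y: "y \<in> ball u (r / 8)" for y
  proof -
    have star: "\<bar>\<phi> y - \<phi> q - g \<bullet> (y - q)\<bar> \<le> norm g / 2 * norm (y - q)"
      by (rule chart_approx[OF ch q\<delta> inp[OF y]])
    define Z where "Z = norm g * r"
    have Z: "0 < Z" using g r by (simp add: Z_def)
    have a1: "g \<bullet> (y - q) = g \<bullet> (y - u) + Z / 2" using v by (simp add: u_def Z_def inner_diff_right inner_add_right)
    have a2: "- (g \<bullet> (y - u)) \<le> norm g * norm (y - u)" by (rule abs_le_D2[OF Cauchy_Schwarz_ineq2])
    have "norm g * norm (y - u) \<le> norm g * (r / 8)"
      using y g by (intro mult_left_mono) (auto simp: dist_norm norm_minus_commute)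
    then have a3: "norm g * norm (y - u) \<le> Z / 8" by (simp add: Z_def)
    have "norm g / 2 * norm (y - q) \<le> norm g / 2 * (5/8 * r)" using D[OF y] g by (intro mult_left_mono) auto
    then have a4: "norm g / 2 * norm (y - q) \<le> 5/16 * Z" by (simp add: Z_def)
    have a5: "- (\<phi> y - \<phi> q - g \<bullet> (y - q)) \<le> norm g / 2 * norm (y - q)" by (rule abs_le_D2[OF star])
    show ?thesis using a1 a2 a3 a4 a5 Z \<phi>q by linarith
  qed
  show thesis by (rule that[OF sub]) (use inp pos in auto)
qed

lemma chart_cone_negative:
  assumes ch: "chart S p \<phi> g \<delta>" and q: "q \<in> S" "q \<in> ball p (\<delta> / 2)" and r: "0 < r" "r \<le> \<delta> / 2"
  obtains u where "ball u (r / 8) \<subseteq> ball q r" "\<And>y. y \<in> ball u (r / 8) \<Longrightarrow> y \<in> ball p \<delta> \<and> \<phi> y < 0"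
  using chart_cone[OF chart_uminus[OF ch] q r] by auto

text \<open>The assumption on \<open>e0\<close> makes \<open>A\<close> open in \<open>S\<close> near
  \<open>p\<close>, so in a small ball the two sides of \<open>S\<close> are the sides of
  \<open>A\<close>.\<close>

lemma chart_two_sided:
  assumes ch: "chart S p \<phi> g \<delta>" and AS: "A \<subseteq> S" and e0: "0 < e0" "S \<inter> ball p e0 \<subseteq> A"
  shows "two_sided_at A p"
  unfolding two_sided_at_def
proof (intro allI impI)
  fix e :: real assume e: "0 < e"
  have \<delta>: "0 < \<delta>" using ch by (simp add: chart_def)
  define f where "f = min e (min e0 \<delta>)"
  have f: "0 < f" "f \<le> e" "f \<le> e0" "f \<le> \<delta>" using e e0 \<delta> by (auto simp: f_def)
  have sub: "ball p f - S \<subseteq> ball p e - A" using f AS by auto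
  let ?P = "{y \<in> ball p (f / 8). 0 < \<phi> y}" and ?N = "{y \<in> ball p (f / 8). 0 < - \<phi> y}"
  have P: "connected_component (ball p e - A) a b" if "a \<in> ?P" "b \<in> ?P" for a b
    using chart_positive_connected[OF ch f(1,4), of a b] that connected_component_of_subset[OF _ sub] by blast
  have N: "connected_component (ball p e - A) a b" if "a \<in> ?N" "b \<in> ?N" for a b
    using chart_positive_connected[OF chart_uminus[OF ch] f(1,4), of a b] that connected_component_of_subset[OF _ sub] by blast
  have "ball p (f / 8) - A \<subseteq> ?P \<union> ?N"
  proof
    fix y assume y: "y \<in> ball p (f / 8) - A"
    then have "dist p y < f / 8" by simp
    then have "dist p y < f" using f(1) by linarith
    then have "y \<in> ball p e0" "y \<in> ball p \<delta>" using f by auto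
    then have "y \<notin> S" using y e0(2) by blast
    then have "\<phi> y \<noteq> 0" using chart_mem_iff[OF ch \<open>y \<in> ball p \<delta>\<close>] by simp
    then show "y \<in> ?P \<union> ?N" using y by auto
  qed
  then show "\<exists>e'>0. e' \<le> e \<and> (\<exists>P N. ball p e' - A \<subseteq> P \<union> N \<and>
     (\<forall>a\<in>P. \<forall>b\<in>P. connected_component (ball p e - A) a b) \<and> (\<forall>a\<in>N. \<forall>b\<in>N. connected_component (ball p e - A) a b))"
    using P N f by (intro exI[of _ "f / 8"] conjI exI[of _ ?P] exI[of _ ?N]) auto
qed

lemma chart_sign:
  assumes ch: "chart S p \<phi> g \<delta>" and AS: "A \<subseteq> S" and e0: "0 < e0" "S \<inter> ball p e0 \<subseteq> A"
  shows "sign_on A (ball p (min e0 (\<delta> / 2))) (\<lambda>y. if 0 < \<phi> y then 1 else - 1)" (is "sign_on A ?B ?s")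
  unfolding sign_on_def
proof (intro conjI ballI allI impI)
  have \<delta>: "0 < \<delta>" using ch by (simp add: chart_def)
  show "?s x = 1 \<or> ?s x = - 1" for x by simp
  fix x assume x: "x \<in> ?B - A"
  then have x\<delta>: "x \<in> ball p \<delta>" "x \<in> ball p e0" using \<delta> by auto
  then have "x \<notin> S" using x e0(2) by blast
  then have nz: "\<phi> x \<noteq> 0" using chart_mem_iff[OF ch x\<delta>(1)] by simp
  obtain e1 where e1: "e1 > 0" "\<And>y. y \<in> ball p \<delta> \<Longrightarrow> dist y x < e1 \<Longrightarrow> dist (\<phi> y) (\<phi> x) < \<bar>\<phi> x\<bar>"
    using chart_continuous[OF ch] x\<delta>(1) nz unfolding continuous_on_iff by (metis zero_less_abs_iff)
  define e where "e = min e1 (\<delta> - dist p x)"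
  have "e > 0" using e1 x\<delta> by (simp add: e_def)
  moreover have "?s y = ?s x" if y: "y \<in> ball x e - A" for y
  proof -
    have "dist p y \<le> dist p x + dist x y" by (rule dist_triangle)
    then have "y \<in> ball p \<delta>" using y by (simp add: e_def)
    moreover have "dist y x < e1" using y by (simp add: e_def dist_commute)
    ultimately have "\<bar>\<phi> y - \<phi> x\<bar> < \<bar>\<phi> x\<bar>" using e1(2) by (simp add: dist_real_def)
    then show ?thesis by (auto split: if_splits)
  qed
  ultimately show "\<exists>e>0. \<forall>y\<in>ball x e - A. ?s y = ?s x" by blast
next
  fix q and e :: real assume q: "q \<in> ?B \<inter> A" and e: "e > 0"
  have \<delta>: "0 < \<delta>" using ch by (simp add: chart_def)
  have qS: "q \<in> S" "q \<in> ball p (\<delta> / 2)" using q AS by auto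
  define r where "r = min e (\<delta> / 2)"
  have r: "0 < r" "r \<le> \<delta> / 2" "r \<le> e" using e \<delta> by (auto simp: r_def)
  obtain u where u: "ball u (r / 8) \<subseteq> ball q r" "\<And>y. y \<in> ball u (r / 8) \<Longrightarrow> y \<in> ball p \<delta> \<and> 0 < \<phi> y"
    by (rule chart_cone[OF ch qS r(1,2)]) blast
  obtain w where w: "ball w (r / 8) \<subseteq> ball q r" "\<And>y. y \<in> ball w (r / 8) \<Longrightarrow> y \<in> ball p \<delta> \<and> \<phi> y < 0"
    by (rule chart_cone_negative[OF ch qS r(1,2)]) blast
  have c: "u \<in> ball u (r / 8)" "w \<in> ball w (r / 8)" using r by auto
  have "u \<in> ball q r" "w \<in> ball q r" using subsetD[OF u(1) c(1)] subsetD[OF w(1) c(2)] .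
  then have "u \<in> ball q e" "w \<in> ball q e" using r(3) by auto
  moreover have "u \<notin> A" "w \<notin> A"
    using u(2)[OF c(1)] w(2)[OF c(2)] chart_mem_iff[OF ch, of u] chart_mem_iff[OF ch, of w] AS by auto
  moreover have "?s u \<noteq> ?s w" using u(2)[OF c(1)] w(2)[OF c(2)] by auto
  ultimately show "\<exists>u\<in>ball q e - A. \<exists>w\<in>ball q e - A. ?s u \<noteq> ?s w" by blast
qed

lemma connected_component_frontier:
  assumes "connected_component (- frontier X) a b" "a \<in> X"
  shows "b \<in> X"
proof (rule ccontr)
  assume b: "b \<notin> X"
  obtain T where T: "connected T" "T \<subseteq> - frontier X" "a \<in> T" "b \<in> T"
    using assms(1) unfolding connected_component_def by (elim exE conjE)
  have "a \<in> T \<inter> X" "b \<in> T - X" using T(3,4) assms(2) b by simp_all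
  then have "T \<inter> frontier X \<noteq> {}" by (intro connected_Int_frontier[OF T(1)]) blast+
  then obtain z where "z \<in> T" "z \<in> frontier X" by blast
  with T(2) show False by auto
qed

text \<open>The part of the boundary with \<open>\<Omega>\<close> on both sides is open and closed in the boundary, so it has a
  global sign function; this is constant on the connected set \<open>\<Omega>\<close>.\<close>

lemma smooth_one_sided:
  fixes \<Omega> :: "(real^'n::finite) set"
  assumes dom: "bounded_domain \<Omega>" and sm: "smooth_hypersurface (frontier \<Omega>)"
    and p: "p \<in> frontier \<Omega>" and e: "0 < e"
  shows "\<exists>y\<in>ball p e - frontier \<Omega>. y \<notin> \<Omega>"
proof (rule ccontr)
  assume neg: "\<not> ?thesis"
  let ?S = "frontier \<Omega>"
  have con: "connected \<Omega>" and bd: "bounded \<Omega>" and op: "open \<Omega>" using dom by (auto simp: bounded_domain_def)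
  define A where "A = {q \<in> ?S. \<exists>e>0. ball q e - ?S \<subseteq> \<Omega>}"
  have AS: "A \<subseteq> ?S" by (auto simp: A_def)
  have pA: "p \<in> A" using neg p e by (auto simp: A_def)
  have A_open: "\<exists>e>0. ?S \<inter> ball q e \<subseteq> A" if "q \<in> A" for q
  proof -
    obtain e where e: "e > 0" "ball q e - ?S \<subseteq> \<Omega>" using \<open>q \<in> A\<close> unfolding A_def by blast
    have "?S \<inter> ball q e \<subseteq> A"
    proof
      fix z assume z: "z \<in> ?S \<inter> ball q e"
      have "ball z (e - dist q z) \<subseteq> ball q e"
      proof
        fix y assume "y \<in> ball z (e - dist q z)"
        then show "y \<in> ball q e" using dist_triangle[of q y z] by simp
      qed
      then have "ball z (e - dist q z) - ?S \<subseteq> \<Omega>" by (rule order_trans[OF Diff_mono[OF _ order_refl] e(2)])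
      moreover have "e - dist q z > 0" using z by simp
      ultimately have "\<exists>e>0. ball z e - ?S \<subseteq> \<Omega>" by (intro exI[of _ "e - dist q z"]) simp
      then show "z \<in> A" using z by (simp add: A_def)
    qed
    then show ?thesis using e(1) by blast
  qed
  \<comment> \<open>At a boundary point outside \<open>A\<close> some exterior point lies on one
    side of the chart. That side is joined off the boundary, hence exterior, and the cone at any
    nearby boundary point reaches into it; so nearby boundary points are outside \<open>A\<close>
    too.\<close>
  have comp_open: "\<exists>e>0. ball x e \<inter> A = {}" if x: "x \<notin> A" for x
  proof (cases "x \<in> ?S")
    case False
    then obtain e where "e > 0" "ball x e \<subseteq> - ?S"
      using open_contains_ball[of "- ?S"] frontier_closed by auto
    then show ?thesis using AS by blast
  next
    case True
    obtain \<phi> g \<delta> where ch: "chart ?S x \<phi> g \<delta>" using hypersurface_chart[OF sm True] .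
    have \<delta>: "0 < \<delta>" using ch by (simp add: chart_def)
    have "\<not> ball x (\<delta> / 8) - ?S \<subseteq> \<Omega>"
    proof
      assume sub: "ball x (\<delta> / 8) - ?S \<subseteq> \<Omega>"
      have "0 < \<delta> / 8" using \<delta> by simp
      then have "x \<in> A" using sub True unfolding A_def by blast
      then show False using x by simp
    qed
    then obtain y where y: "y \<in> ball x (\<delta> / 8)" "y \<notin> ?S" "y \<notin> \<Omega>" by blast
    have "dist x y < \<delta>" using y(1) \<delta> by simp
    then have "\<phi> y \<noteq> 0" using chart_mem_iff[OF ch, of y] y(2) by simp
    have main: "\<exists>e>0. ball x e \<inter> A = {}" if ch: "chart ?S x \<psi> h \<delta>" and pos: "0 < \<psi> y" for \<psi> h
    proof -
      have out: "z \<notin> \<Omega>" if z: "z \<in> ball x (\<delta> / 8)" "0 < \<psi> z" for z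
      proof
        assume "z \<in> \<Omega>"
        have "connected_component (ball x \<delta> - ?S) z y"
          by (rule chart_positive_connected[OF ch \<delta> order_refl z(1) y(1) z(2) pos])
        then have "connected_component (- ?S) z y" by (rule connected_component_of_subset) auto
        then show False using connected_component_frontier[OF _ \<open>z \<in> \<Omega>\<close>] y(3) by blast
      qed
      have "ball x (\<delta> / 16) \<inter> A = {}"
      proof (rule ccontr)
        assume "ball x (\<delta> / 16) \<inter> A \<noteq> {}"
        then obtain q where q: "q \<in> ball x (\<delta> / 16)" "q \<in> A" by blast
        obtain f where f: "f > 0" "ball q f - ?S \<subseteq> \<Omega>" using q(2) by (auto simp: A_def)
        define r where "r = min f (\<delta> / 16)"
        have r: "0 < r" "r \<le> \<delta> / 2" "r \<le> f" "r \<le> \<delta> / 16" using f \<delta> by (auto simp: r_def)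
        have "q \<in> ?S" "q \<in> ball x (\<delta> / 2)" using q AS \<delta> by auto
        then obtain u where u: "ball u (r / 8) \<subseteq> ball q r" "\<And>y. y \<in> ball u (r / 8) \<Longrightarrow> y \<in> ball x \<delta> \<and> 0 < \<psi> y"
          by (rule chart_cone[OF ch _ _ r(1,2)]) blast
        have c: "u \<in> ball u (r / 8)" using r by simp
        have uq: "dist q u < r" using u(1) c by (auto simp: subset_iff)
        have "u \<in> ball x (\<delta> / 8)" using dist_triangle[of x u q] q(1) uq r(4) by simp
        then have "u \<notin> \<Omega>" using out u(2)[OF c] by blast
        moreover have "u \<notin> ?S" using chart_mem_iff[OF ch, of u] u(2)[OF c] by auto
        moreover have "u \<in> ball q f" using uq r(3) by simp
        ultimately show False using f(2) by blast
      qed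
      then show ?thesis using \<delta> by (intro exI[of _ "\<delta> / 16"]) simp
    qed
    show ?thesis
    proof (cases "0 < \<phi> y")
      case True
      then show ?thesis by (rule main[OF ch])
    next
      case False
      then have "0 < - \<phi> y" using \<open>\<phi> y \<noteq> 0\<close> by simp
      then show ?thesis by (rule main[OF chart_uminus[OF ch]])
    qed
  qed
  have closedA: "closed A"
    unfolding closed_def open_contains_ball
  proof
    fix x assume "x \<in> - A"
    then have "x \<notin> A" by simp
    from comp_open[OF this] obtain e where "e > 0" "ball x e \<inter> A = {}" by blast
    then show "\<exists>e>0. ball x e \<subseteq> - A" by (intro exI[of _ e]) blast
  qed
  have local: "two_sided_at A q \<and> (\<exists>B s. open B \<and> q \<in> B \<and> sign_on A B s)" if q: "q \<in> A" for q
  proof -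
    obtain e0 where e0: "e0 > 0" "?S \<inter> ball q e0 \<subseteq> A" using A_open[OF q] by blast
    obtain \<phi> g \<delta> where ch: "chart ?S q \<phi> g \<delta>" using hypersurface_chart[OF sm, of q] q AS by blast
    have "0 < \<delta>" using ch by (simp add: chart_def)
    then have "q \<in> ball q (min e0 (\<delta> / 2))" using e0 by simp
    then show ?thesis
      using chart_two_sided[OF ch AS e0] chart_sign[OF ch AS e0] open_ball by blast
  qed
  obtain R' where R': "\<Omega> \<union> {p} \<subseteq> ball 0 R'"
    using bounded_subset_ballD[of "\<Omega> \<union> {p}" 0] bd by auto
  obtain \<sigma> where \<sigma>: "sign_on A (ball 0 R') \<sigma>"
    using global_sign[OF closedA] local by blast
  obtain f where f: "f > 0" "ball p f - ?S \<subseteq> \<Omega>" using pA by (auto simp: A_def)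
  obtain e0 where e0: "e0 > 0" "?S \<inter> ball p e0 \<subseteq> A" using A_open[OF pA] by blast
  \<comment> \<open>Near \<open>p\<close> both signs of \<sigma> occur, and at points of \<Omega>;
    but \<Omega> is connected and avoids \<open>A\<close>, so \<sigma> is constant on it.\<close>
  have "p \<in> ball 0 R' \<inter> A" "0 < min f e0" using R' pA f e0 by auto
  then obtain u w where uw: "u \<in> ball p (min f e0) - A" "w \<in> ball p (min f e0) - A" "\<sigma> u \<noteq> \<sigma> w"
    using \<sigma> unfolding sign_on_def by blast
  have "u \<notin> ?S" "w \<notin> ?S" using uw e0(2) by auto
  then have "u \<in> \<Omega>" "w \<in> \<Omega>" using uw f(2) by auto
  moreover have "\<Omega> \<inter> ?S = {}" using frontier_disjoint_eq[of \<Omega>] op by blast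
  then have "\<Omega> \<subseteq> ball 0 R' - A" using R' AS by auto
  ultimately show False using sign_on_connected[OF \<sigma> con] uw(3) by blast
qed

text \<open>One exterior point near \<open>p\<close> settles which side of the chart is exterior; at
  every nearby boundary point the cone on that side contains a ball of proportional radius.\<close>

lemma smooth_exterior_ball:
  fixes \<Omega> :: "(real^'n::finite) set"
  assumes dom: "bounded_domain \<Omega>" and sm: "smooth_hypersurface (frontier \<Omega>)" and p: "p \<in> frontier \<Omega>"
  shows "\<exists>e>0. \<forall>q\<in>frontier \<Omega> \<inter> ball p e. \<forall>r. 0 < r \<and> r \<le> e \<longrightarrow> (\<exists>u. ball u (r / 8) \<subseteq> ball q r - \<Omega>)"
proof -
  let ?S = "frontier \<Omega>"
  obtain \<phi> g \<delta> where ch: "chart ?S p \<phi> g \<delta>" using hypersurface_chart[OF sm p] .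
  have \<delta>: "0 < \<delta>" using ch by (simp add: chart_def)
  obtain y where y: "y \<in> ball p (\<delta> / 8)" "y \<notin> ?S" "y \<notin> \<Omega>"
    using smooth_one_sided[OF dom sm p, of "\<delta> / 8"] \<delta> by auto
  have "dist p y < \<delta>" using y(1) \<delta> by simp
  then have nz: "\<phi> y \<noteq> 0" using chart_mem_iff[OF ch, of y] y(2) by simp
  have main: "\<exists>e>0. \<forall>q\<in>?S \<inter> ball p e. \<forall>r. 0 < r \<and> r \<le> e \<longrightarrow> (\<exists>u. ball u (r / 8) \<subseteq> ball q r - \<Omega>)"
    if ch: "chart ?S p \<psi> h \<delta>" and pos: "0 < \<psi> y" for \<psi> h
  proof (intro exI[of _ "\<delta> / 16"] conjI ballI allI impI)
    show "0 < \<delta> / 16" using \<delta> by simp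
    fix q r assume q: "q \<in> ?S \<inter> ball p (\<delta> / 16)" and r: "0 < r \<and> r \<le> \<delta> / 16"
    have "q \<in> ?S" "q \<in> ball p (\<delta> / 2)" "0 < r" "r \<le> \<delta> / 2" using q r \<delta> by auto
    then obtain u where u: "ball u (r / 8) \<subseteq> ball q r" "\<And>y. y \<in> ball u (r / 8) \<Longrightarrow> y \<in> ball p \<delta> \<and> 0 < \<psi> y"
      by (rule chart_cone[OF ch]) blast
    have "z \<notin> \<Omega>" if z: "z \<in> ball u (r / 8)" for z
    proof
      assume "z \<in> \<Omega>"
      have "dist q z < r" using u(1) z by (auto simp: subset_iff)
      then have zb: "z \<in> ball p (\<delta> / 8)" using dist_triangle[of p z q] q r by simp
      have "connected_component (ball p \<delta> - ?S) z y"
        using u(2)[OF z] by (intro chart_positive_connected[OF ch \<delta> order_refl zb y(1) _ pos]) simp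
      then obtain T where T: "connected T" "T \<subseteq> ball p \<delta> - ?S" "z \<in> T" "y \<in> T"
        unfolding connected_component_def by blast
      have "T \<inter> ?S \<noteq> {}" by (rule connected_Int_frontier[OF T(1)]) (use T \<open>z \<in> \<Omega>\<close> y(3) in auto)
      then show False using T(2) by blast
    qed
    then show "\<exists>u. ball u (r / 8) \<subseteq> ball q r - \<Omega>" using u(1) by blast
  qed
  show ?thesis
  proof (cases "0 < \<phi> y")
    case True
    then show ?thesis by (rule main[OF ch])
  next
    case False
    then have "0 < - \<phi> y" using nz by simp
    then show ?thesis by (rule main[OF chart_uminus[OF ch]])
  qed
qed

text \<open>Compactness of the boundary makes the radii of \<open>smooth_exterior_ball\<close>
  uniform. An exterior ball of radius proportional to \<open>r\<close> has volume of order r^d,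
  which bounds the content of exponent d from below.\<close>

lemma thick_smooth:
  fixes \<Omega> :: "(real^'n::finite) set"
  assumes dom: "bounded_domain \<Omega>" and sm: "smooth_hypersurface (frontier \<Omega>)"
  shows "thick 0 \<Omega>"
proof -
  let ?S = "frontier \<Omega>"
  define d where "d = CARD('n)"
  have d: "0 < d" by (simp add: d_def)
  have cpt: "compact ?S" using dom by (simp add: bounded_domain_def compact_frontier_bounded)
  obtain e where e: "\<And>p. p \<in> ?S \<Longrightarrow> e p > 0"
    "\<And>p q r. p \<in> ?S \<Longrightarrow> q \<in> ?S \<Longrightarrow> q \<in> ball p (e p) \<Longrightarrow> 0 < r \<Longrightarrow> r \<le> e p \<Longrightarrow> \<exists>u. ball u (r / 8) \<subseteq> ball q r - \<Omega>"
  proof -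
    have "\<forall>p\<in>?S. \<exists>e>0. \<forall>q\<in>?S \<inter> ball p e. \<forall>r. 0 < r \<and> r \<le> e \<longrightarrow> (\<exists>u. ball u (r / 8) \<subseteq> ball q r - \<Omega>)"
      using smooth_exterior_ball[OF dom sm] by blast
    from bchoice[OF this] show ?thesis using that by blast
  qed
  obtain F where F: "F \<subseteq> ?S" "finite F" "?S \<subseteq> (\<Union>p\<in>F. ball p (e p))"
  proof -
    have "?S \<subseteq> (\<Union>p\<in>?S. ball p (e p))" using e(1) by force
    then show ?thesis using compactE_image[OF cpt, of ?S "\<lambda>p. ball p (e p)"] that by blast
  qed
  define m where "m = Min (insert 1 (e ` F))"
  have m: "0 < m" "m \<le> 1" "\<And>p. p \<in> F \<Longrightarrow> m \<le> e p"
    using F e(1) by (auto simp: m_def)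
  define C where "C = (m / 8 / real d) ^ d / 2 ^ d"
  have C: "0 < C" using m d by (simp add: C_def)
  have "thick_with 0 C \<Omega>"
    unfolding thick_with_def
  proof (intro conjI ballI allI impI)
    fix q and r :: real assume q: "q \<in> ?S" and r: "0 < r \<and> r < 1"
    obtain p where p: "p \<in> F" "q \<in> ball p (e p)" using F(3) q by blast
    \<comment> \<open>Multiplying by \<open>m\<close> instead of cutting off at \<open>m\<close>
      keeps the radius proportional to \<open>r\<close> for all r < 1.\<close>
    define r0 where "r0 = r * m"
    have r0: "0 < r0" "r0 \<le> e p" "r0 \<le> r"
    proof -
      show "0 < r0" using r m by (simp add: r0_def)
      have "r * m \<le> 1 * m" using r m by (intro mult_right_mono) auto
      then show "r0 \<le> e p" using m(3)[OF p(1)] by (simp add: r0_def)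
      show "r0 \<le> r" using r m by (simp add: r0_def mult_left_le)
    qed
    obtain u where u: "ball u (r0 / 8) \<subseteq> ball q r0 - \<Omega>"
      using e(2)[OF _ q p(2) r0(1,2)] p(1) F(1) by blast
    then have sub: "ball u (r0 / 8) \<subseteq> ball q r - \<Omega>" using r0(3) by (force simp: subset_iff)
    have "ennreal ((r0 / 8 / real d) ^ d) \<le> ennreal (2 ^ d) * hausdorff_content (real d) (ball q r - \<Omega>)"
      unfolding d_def by (rule hausdorff_content_ball_ge[OF sub]) (use r0 in simp)
    moreover have "ennreal ((r0 / 8 / real d) ^ d) = ennreal (2 ^ d) * ennreal (C * r powr real d)"
    proof -
      have "(r0 / 8 / real d) ^ d = 2 ^ d * (C * r powr real d)"
      proof -
        have "r0 / 8 / real d = r * (m / 8 / real d)" by (simp add: r0_def)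
        then have "(r0 / 8 / real d) ^ d = r ^ d * (m / 8 / real d) ^ d" by (simp only: power_mult_distrib)
        then show ?thesis using r d by (simp add: C_def powr_realpow)
      qed
      then show ?thesis using C by (simp add: ennreal_mult)
    qed
    ultimately have "ennreal (2 ^ d) * ennreal (C * r powr real d) \<le> ennreal (2 ^ d) * hausdorff_content (real d) (ball q r - \<Omega>)"
      by simp
    then have "ennreal (C * r powr real d) \<le> hausdorff_content (real d) (ball q r - \<Omega>)"
      by (subst (asm) ennreal_mult_le_mult_iff) auto
    then show "ennreal (C * r powr (real CARD('n) - 0)) \<le> hausdorff_content (real CARD('n) - 0) (ball q r - \<Omega>)"
      by (simp add: d_def)
  qed (use C in auto)
  then show ?thesis by (auto simp: thick_def)
qed

theorem corollary3:
  shows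
    "(CARD('n::finite) = 2 \<longrightarrow>
        (\<forall>\<Omega> :: (real^'n) set. bounded_domain \<Omega> \<longrightarrow> thick 2 \<Omega>) \<and>
        wos_converges_in TYPE('w) (\<lambda>\<Omega> :: (real^'n) set. True) 2 (\<lambda>\<epsilon>. (ln (1/\<epsilon>))^2))
     \<and>
     (CARD('n) = 2 \<longrightarrow>
        (\<forall>\<Omega> :: (real^'n) set. bounded_domain \<Omega> \<and> connected (- \<Omega>) \<longrightarrow> thick 1 \<Omega>) \<and>
        wos_converges_in TYPE('w) (\<lambda>\<Omega> :: (real^'n) set. connected (- \<Omega>)) 1 (\<lambda>\<epsilon>. ln (1/\<epsilon>)))
     \<and>
     (CARD('n) \<ge> 3 \<longrightarrow>
        (\<forall>\<Omega> :: (real^'n) set. bounded_domain \<Omega> \<longrightarrow> thick (real CARD('n)) \<Omega>) \<and>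
        wos_converges_in TYPE('w) (\<lambda>\<Omega> :: (real^'n) set. True) (real CARD('n))
          (\<lambda>\<epsilon>. (1/\<epsilon>) powr (2 - 4 / real CARD('n))))
     \<and>
     (CARD('n) = 3 \<longrightarrow>
        (\<forall>\<Omega> :: (real^'n) set. bounded_domain \<Omega> \<and> connected (- \<Omega>) \<longrightarrow> thick 2 \<Omega>) \<and>
        wos_converges_in TYPE('w) (\<lambda>\<Omega> :: (real^'n) set. connected (- \<Omega>)) 2
          (\<lambda>\<epsilon>. (ln (1/\<epsilon>))^2))
     \<and>
     (CARD('n) \<ge> 4 \<longrightarrow>
        (\<forall>\<Omega> :: (real^'n) set. bounded_domain \<Omega> \<and> connected (- \<Omega>) \<longrightarrow>
           thick (real CARD('n) - 1) \<Omega>) \<and>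
        wos_converges_in TYPE('w) (\<lambda>\<Omega> :: (real^'n) set. connected (- \<Omega>)) (real CARD('n) - 1)
          (\<lambda>\<epsilon>. (1/\<epsilon>) powr (2 - 4 / (real CARD('n) - 1))))
     \<and>
     (\<forall>\<Omega> :: (real^'n) set. bounded_domain \<Omega> \<and> smooth_hypersurface (frontier \<Omega>) \<longrightarrow> thick 0 \<Omega>)
     \<and>
     wos_converges_in TYPE('w) (\<lambda>\<Omega> :: (real^'n) set. smooth_hypersurface (frontier \<Omega>)) 0
       (\<lambda>\<epsilon>. ln (1/\<epsilon>))"
proof (intro conjI impI allI; (elim conjE)?)
  fix \<Omega> :: "(real^'n) set"
  { assume "CARD('n) = 2" "bounded_domain \<Omega>"
    then show "thick 2 \<Omega>" using thick_full[of \<Omega>] by simp }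
  { assume "CARD('n) = 2" "bounded_domain \<Omega>" "connected (- \<Omega>)"
    then show "thick 1 \<Omega>" using thick_connected[of \<Omega>] by simp }
  { assume "bounded_domain \<Omega>"
    then show "thick (real CARD('n)) \<Omega>" by (rule thick_full) }
  { assume "CARD('n) = 3" "bounded_domain \<Omega>" "connected (- \<Omega>)"
    then show "thick 2 \<Omega>" using thick_connected[of \<Omega>] by simp }
  { assume "bounded_domain \<Omega>" "connected (- \<Omega>)"
    then show "thick (real CARD('n) - 1) \<Omega>" by (rule thick_connected) }
  { assume "bounded_domain \<Omega>" "smooth_hypersurface (frontier \<Omega>)"
    then show "thick 0 \<Omega>" by (rule thick_smooth) }
next
  \<comment> \<open>From here on the rate is decided by comparing s with d - 2, where s is 0, 1 or d
    as the complement permits.\<close>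
  assume "CARD('n) = 2"
  then show "wos_converges_in TYPE('w) (\<lambda>\<Omega> :: (real^'n) set. True) 2 (\<lambda>\<epsilon>. (ln (1/\<epsilon>))^2)"
    by (intro wos_converges_log_squared[where s = 0] local_mass_point) (auto simp: bounded_domain_def)
next
  assume "CARD('n) = 2"
  then show "wos_converges_in TYPE('w) (\<lambda>\<Omega> :: (real^'n) set. connected (- \<Omega>)) 1 (\<lambda>\<epsilon>. ln (1/\<epsilon>))"
    by (intro wos_converges_log[where s = 1 and c = "\<lambda>_. 1"] local_mass_connected)
      (auto simp: bounded_domain_def)
next
  assume "CARD('n) \<ge> 3"
  then obtain j where j: "CARD('n) = 0 + 3 + j" using le_Suc_ex by fastforce
  have "wos_converges_in TYPE('w) (\<lambda>\<Omega> :: (real^'n) set. True) (real CARD('n))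
      (\<lambda>\<epsilon>. (1/\<epsilon>) powr (2 - 4 / real (j + 3)))"
    by (intro wos_converges_power[OF _ j] local_mass_point) (auto simp: bounded_domain_def)
  moreover have "real (j + 3) = real CARD('n)" using j by simp
  ultimately show "wos_converges_in TYPE('w) (\<lambda>\<Omega> :: (real^'n) set. True) (real CARD('n))
      (\<lambda>\<epsilon>. (1/\<epsilon>) powr (2 - 4 / real CARD('n)))"
    by (simp only:)
next
  assume "CARD('n) = 3"
  then show "wos_converges_in TYPE('w) (\<lambda>\<Omega> :: (real^'n) set. connected (- \<Omega>)) 2 (\<lambda>\<epsilon>. (ln (1/\<epsilon>))^2)"
    by (intro wos_converges_log_squared[where s = 1] local_mass_connected) (auto simp: bounded_domain_def)
next
  assume "CARD('n) \<ge> 4"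
  then obtain j where j: "CARD('n) = 1 + 3 + j" using le_Suc_ex by fastforce
  have "wos_converges_in TYPE('w) (\<lambda>\<Omega> :: (real^'n) set. connected (- \<Omega>)) (real CARD('n) - 1)
      (\<lambda>\<epsilon>. (1/\<epsilon>) powr (2 - 4 / real (j + 3)))"
    by (intro wos_converges_power[OF _ j] local_mass_connected) (auto simp: bounded_domain_def)
  moreover have "real (j + 3) = real CARD('n) - 1" using j by simp
  ultimately show "wos_converges_in TYPE('w) (\<lambda>\<Omega> :: (real^'n) set. connected (- \<Omega>)) (real CARD('n) - 1)
      (\<lambda>\<epsilon>. (1/\<epsilon>) powr (2 - 4 / (real CARD('n) - 1)))"
    by (simp only:)
next
  show "wos_converges_in TYPE('w) (\<lambda>\<Omega> :: (real^'n) set. smooth_hypersurface (frontier \<Omega>)) 0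
      (\<lambda>\<epsilon>. ln (1/\<epsilon>))"
    by (rule wos_converges_log[where s = "CARD('n)" and c = "\<lambda>C. C / (2 * real CARD('n)) ^ CARD('n)"])
      (rule local_mass_content, assumption, auto simp: Suc_leI)
qed

end
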